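(* Let $E$ be a complex elliptic curve, let $\Gamma=(\mathcal{V},\mathcal{E})$ be a chordal graph, and let $\mathcal{A}=\mathcal{A}(\Gamma,E)$ be the associated chordal abelian arrangement. Then the graded algebra $A(\mathcal{A})$ (defined in the context) is Koszul.
   Context: Graphs are finite and simple. A graph is chordal if every cycle with more than three vertices has a chord. The vertices of a chordal graph are ordered by a perfect elimination ordering: a total order such that every vertex $v$ is simplicial (its neighbors form a clique) in the graph obtained by deleting all vertices $v'>v$; such an order exists if and only if the graph is chordal. For an edge $e$, $h(e)$ is its larger and $t(e)$ its smaller vertex. Edges are ordered by $e<e'$ if $h(e)<h(e')$, or $h(e)=h(e')$ and $t(e)<t(e')$. The arrangement $\mathcal{A}(\Gamma,E)$ is $\{H_e\mid e\in\mathcal{E}\}$ where $H_e=\{x\in E^{\mathcal{V}}\mid x_{h(e)}=x_{t(e)}\}$. The algebra $A(\mathcal{A})$ is the exterior algebra on the $\mathbb{Q}$-vector space with basis $\{x_v,y_v,g_e\mid v\in\mathcal{V},e\in\mathcal{E}\}$ (all generators in degree 1) modulo the ideal generated by: (i) $\sum_j(-1)^jg_{e_1}\cdots\hat g_{e_j}\cdots g_{e_k}$ whenever $\{e_1<\dots<e_k\}$ is (the edge set of) a cycle; (ii) $(x_{h(e)}-x_{t(e)})g_e$ and $(y_{h(e)}-y_{t(e)})g_e$ for each $e\in\mathcal{E}$. (It also carries a differential, ignored here.) A connected graded $\mathbb{Q}$-algebra $A$ is Koszul if $\mathrm{Ext}_A^{i}(\mathbb{Q},\mathbb{Q})$ is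 concentrated in internal degree $i$ for all $i$. *)

theory Defs
  imports
    Complex_Main
    "HOL-Library.Poly_Mapping"
    "HOL-Algebra.QuotRing"
    "HOL-Algebra.Module"
    "HOL-Algebra.Elementary_Groups"
begin

section \<open>Chordal graphs and perfect elimination orderings\<close>

definition simple_graph :: "'v set \<Rightarrow> 'v set set \<Rightarrow> bool" where
  "simple_graph V Ed \<longleftrightarrow> finite V \<and> (\<forall>e\<in>Ed. e \<subseteq> V \<and> card e = 2)"

definition graph_cycle :: "'v set set \<Rightarrow> 'v list \<Rightarrow> bool" where
  "graph_cycle Ed vs \<longleftrightarrow> 3 \<le> length vs \<and> distinct vs \<and>
     (\<forall>i<length vs. {vs ! i, vs ! (Suc i mod length vs)} \<in> Ed)"

definition cycle_edges :: "'v list \<Rightarrow> 'v set set" where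
  "cycle_edges vs = {{vs ! i, vs ! (Suc i mod length vs)} | i. i < length vs}"

definition chordal :: "'v set set \<Rightarrow> bool" where
  "chordal Ed \<longleftrightarrow> (\<forall>vs. graph_cycle Ed vs \<and> length vs > 3 \<longrightarrow>
     (\<exists>e\<in>Ed. e \<subseteq> set vs \<and> e \<notin> cycle_edges vs))"

definition simplicial :: "'v set set \<Rightarrow> 'v \<Rightarrow> bool" where
  "simplicial Ed v \<longleftrightarrow>
     (\<forall>u w. {u, v} \<in> Ed \<and> {w, v} \<in> Ed \<and> u \<noteq> w \<longrightarrow> {u, w} \<in> Ed)"

text \<open>Orders on the vertex set are reflexive: \<open>(u, v) \<in> r\<close> means \<open>u \<le> v\<close>. The edge set
  \<open>{e \<in> Ed. e \<subseteq> {u \<in> V. (u, v) \<in> r}}\<close> is that of the graph with all vertices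
  above \<open>v\<close> deleted.\<close>

definition perfect_elimination_ordering :: "'v set \<Rightarrow> 'v set set \<Rightarrow> 'v rel \<Rightarrow> bool" where
  "perfect_elimination_ordering V Ed r \<longleftrightarrow> linear_order_on V r \<and>
     (\<forall>v\<in>V. simplicial {e \<in> Ed. e \<subseteq> {u \<in> V. (u, v) \<in> r}} v)"

definition edge_head :: "'v rel \<Rightarrow> 'v set \<Rightarrow> 'v" where
  "edge_head r e = (THE v. v \<in> e \<and> (\<forall>u\<in>e. (u, v) \<in> r))"

definition edge_tail :: "'v rel \<Rightarrow> 'v set \<Rightarrow> 'v" where
  "edge_tail r e = (THE v. v \<in> e \<and> (\<forall>u\<in>e. (v, u) \<in> r))"

definition edge_less :: "'v rel \<Rightarrow> 'v set \<Rightarrow> 'v set \<Rightarrow> bool" where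
  "edge_less r e e' \<longleftrightarrow>
     (edge_head r e, edge_head r e') \<in> r - Id \<or>
     edge_head r e = edge_head r e' \<and> (edge_tail r e, edge_tail r e') \<in> r - Id"


section \<open>Elliptic curves and graphic abelian arrangements\<close>

definition complex_add_group :: "complex monoid" where
  "complex_add_group = \<lparr>carrier = UNIV, mult = (+), one = 0\<rparr>"

text \<open>A complex elliptic curve, as the group of its points, is a complex torus of
  dimension one.\<close>

definition elliptic_curve :: "complex set monoid \<Rightarrow> bool" where
  "elliptic_curve E \<longleftrightarrow> (\<exists>w1 w2. w2 / w1 \<notin> \<real> \<and>
     E = complex_add_group Mod {of_int m * w1 + of_int n * w2 | m n. True})"

record 'v arrangement =
  verts :: "'v set"
  edges :: "'v set set"
  vorder :: "'v rel"
  curve :: "complex set monoid"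
  hyperplane :: "'v set \<Rightarrow> ('v \<Rightarrow> complex set) set"

definition abelian_arrangement ::
    "'v set \<Rightarrow> 'v set set \<Rightarrow> 'v rel \<Rightarrow> complex set monoid \<Rightarrow> 'v arrangement" where
  "abelian_arrangement V Ed r E =
     \<lparr>verts = V, edges = Ed, vorder = r, curve = E,
      hyperplane = (\<lambda>e\<in>Ed. {x \<in> V \<rightarrow>\<^sub>E carrier E. x (edge_head r e) = x (edge_tail r e)})\<rparr>"


section \<open>Graded algebras\<close>

text \<open>One record serves for graded rational algebras (scalars \<open>rat\<close>, degrees \<open>nat\<close>) and for
  graded left modules over them (scalars in the algebra, degrees \<open>int\<close>); for modules the
  fields \<open>mult\<close> and \<open>one\<close> are irrelevant.\<close>

record ('r, 'i, 'a) graded = "('r, 'a) module" +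
  grade :: "'i \<Rightarrow> 'a set"

type_synonym 'a graded_algebra = "(rat, nat, 'a) graded"

definition rat_algebra :: "'a graded_algebra \<Rightarrow> bool" where
  "rat_algebra A \<longleftrightarrow> ring A \<and>
     (\<forall>p q. \<forall>a\<in>carrier A. \<forall>b\<in>carrier A.
        q \<odot>\<^bsub>A\<^esub> a \<in> carrier A \<and>
        (p + q) \<odot>\<^bsub>A\<^esub> a = p \<odot>\<^bsub>A\<^esub> a \<oplus>\<^bsub>A\<^esub> q \<odot>\<^bsub>A\<^esub> a \<and>
        q \<odot>\<^bsub>A\<^esub> (a \<oplus>\<^bsub>A\<^esub> b) = q \<odot>\<^bsub>A\<^esub> a \<oplus>\<^bsub>A\<^esub> q \<odot>\<^bsub>A\<^esub> b \<and>
        (p * q) \<odot>\<^bsub>A\<^esub> a = p \<odot>\<^bsub>A\<^esub> (q \<odot>\<^bsub>A\<^esub> a) \<and>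
        1 \<odot>\<^bsub>A\<^esub> a = a \<and>
        (q \<odot>\<^bsub>A\<^esub> a) \<otimes>\<^bsub>A\<^esub> b = q \<odot>\<^bsub>A\<^esub> (a \<otimes>\<^bsub>A\<^esub> b) \<and>
        a \<otimes>\<^bsub>A\<^esub> (q \<odot>\<^bsub>A\<^esub> b) = q \<odot>\<^bsub>A\<^esub> (a \<otimes>\<^bsub>A\<^esub> b))"

definition graded_algebra :: "'a graded_algebra \<Rightarrow> bool" where
  "graded_algebra A \<longleftrightarrow> rat_algebra A \<and>
     (\<forall>n. grade A n \<subseteq> carrier A \<and> \<zero>\<^bsub>A\<^esub> \<in> grade A n \<and>
        (\<forall>a\<in>grade A n. \<forall>b\<in>grade A n. a \<oplus>\<^bsub>A\<^esub> b \<in> grade A n) \<and>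
        (\<forall>q. \<forall>a\<in>grade A n. q \<odot>\<^bsub>A\<^esub> a \<in> grade A n)) \<and>
     (\<forall>m n. \<forall>a\<in>grade A m. \<forall>b\<in>grade A n. a \<otimes>\<^bsub>A\<^esub> b \<in> grade A (m + n)) \<and>
     \<one>\<^bsub>A\<^esub> \<in> grade A 0 \<and>
     (\<forall>a\<in>carrier A. \<exists>!c. (\<forall>n. c n \<in> grade A n) \<and> finite {n. c n \<noteq> \<zero>\<^bsub>A\<^esub>} \<and>
        a = (\<Oplus>\<^bsub>A\<^esub>n\<in>{n. c n \<noteq> \<zero>\<^bsub>A\<^esub>}. c n))"

definition connected_graded_algebra :: "'a graded_algebra \<Rightarrow> bool" where
  "connected_graded_algebra A \<longleftrightarrow> graded_algebra A \<and> \<one>\<^bsub>A\<^esub> \<noteq> \<zero>\<^bsub>A\<^esub> \<and>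
     grade A 0 = {q \<odot>\<^bsub>A\<^esub> \<one>\<^bsub>A\<^esub> | q. True}"

text \<open>The quotient of a graded algebra by a (homogeneous) two-sided ideal.\<close>

definition quotient_algebra :: "'a graded_algebra \<Rightarrow> 'a set \<Rightarrow> 'a set graded_algebra" where
  "quotient_algebra A I =
     \<lparr>carrier = carrier (A Quot I), mult = mult (A Quot I), one = one (A Quot I),
      zero = zero (A Quot I), add = add (A Quot I),
      smult = (\<lambda>q X. \<Union>x\<in>X. I +>\<^bsub>A\<^esub> (q \<odot>\<^bsub>A\<^esub> x)),
      grade = (\<lambda>n. (\<lambda>a. I +>\<^bsub>A\<^esub> a) ` grade A n)\<rparr>"


section \<open>Tensor and exterior algebras\<close>

text \<open>Lists form the free monoid, so \<open>'g list \<Rightarrow>\<^sub>0 rat\<close> is its monoid algebra: the free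
  associative algebra on \<open>'g\<close>, i.e. the tensor algebra of the vector space with basis \<open>'g\<close>.\<close>

instantiation list :: (type) monoid_add
begin
definition zero_list_def: "0 = ([] :: 'a list)"
definition plus_list_def: "xs + ys = (xs @ ys :: 'a list)"
instance
  by standard (simp_all add: zero_list_def plus_list_def)
end

definition tensor_algebra :: "'g set \<Rightarrow> ('g list \<Rightarrow>\<^sub>0 rat) graded_algebra" where
  "tensor_algebra B =
     \<lparr>carrier = {p. Poly_Mapping.keys p \<subseteq> lists B}, mult = (*), one = 1,
      zero = 0, add = (+),
      smult = (\<lambda>q p. Poly_Mapping.single [] q * p),
      grade = (\<lambda>n. {p. Poly_Mapping.keys p \<subseteq> {w \<in> lists B. length w = n}})\<rparr>"

lemma ring_tensor_algebra: "ring (tensor_algebra B)"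
proof -
  have *: "Poly_Mapping.keys (x * y) \<subseteq> lists B"
    if "Poly_Mapping.keys x \<subseteq> lists B" "Poly_Mapping.keys y \<subseteq> lists B"
    for x y :: "'a list \<Rightarrow>\<^sub>0 rat"
    using keys_mult[of x y] that by (fastforce simp: plus_list_def)
  show ?thesis
  proof (rule ringI)
    show "abelian_group (tensor_algebra B)"
    proof (rule abelian_groupI)
      fix x y assume "x \<in> carrier (tensor_algebra B)" "y \<in> carrier (tensor_algebra B)"
      then show "x \<oplus>\<^bsub>tensor_algebra B\<^esub> y \<in> carrier (tensor_algebra B)"
        using Poly_Mapping.keys_add[of x y] by (auto simp: tensor_algebra_def)
    next
      fix x assume x: "x \<in> carrier (tensor_algebra B)"
      show "\<exists>y\<in>carrier (tensor_algebra B).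
        y \<oplus>\<^bsub>tensor_algebra B\<^esub> x = \<zero>\<^bsub>tensor_algebra B\<^esub>"
        by (rule bexI[of _ "- x"]) (use x in \<open>auto simp: tensor_algebra_def\<close>)
    qed (auto simp: tensor_algebra_def add_ac)
  next
    have one: "Poly_Mapping.keys (1 :: 'a list \<Rightarrow>\<^sub>0 rat) \<subseteq> lists B"
      by (simp add: zero_list_def flip: single_one)
    show "Group.monoid (tensor_algebra B)"
      by (rule monoidI)
        (simp_all only: tensor_algebra_def monoid.simps partial_object.simps mem_Collect_eq
          mult.assoc mult_1_left mult_1_right * one)
  qed (auto simp: tensor_algebra_def algebra_simps)
qed

text \<open>The exterior algebra of the vector space with basis \<open>B\<close>; the degree one part of the
  tensor algebra is that vector space.\<close>

definition exterior_algebra :: "'g set \<Rightarrow> ('g list \<Rightarrow>\<^sub>0 rat) set graded_algebra" where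
  "exterior_algebra B = quotient_algebra (tensor_algebra B)
     (Idl\<^bsub>tensor_algebra B\<^esub> {v * v | v. v \<in> grade (tensor_algebra B) 1})"

definition ext_gen :: "'g set \<Rightarrow> 'g \<Rightarrow> ('g list \<Rightarrow>\<^sub>0 rat) set" where
  "ext_gen B b =
     (Idl\<^bsub>tensor_algebra B\<^esub> {v * v | v. v \<in> grade (tensor_algebra B) 1})
       +>\<^bsub>tensor_algebra B\<^esub> Poly_Mapping.single [b] 1"


section \<open>The algebra of an arrangement\<close>

datatype 'v gen = GenX 'v | GenY 'v | GenG "'v set"

definition arr_gens :: "'v arrangement \<Rightarrow> 'v gen set" where
  "arr_gens \<A> = GenX ` verts \<A> \<union> GenY ` verts \<A> \<union> GenG ` edges \<A>"

abbreviation arr_ext :: "'v arrangement \<Rightarrow> ('v gen list \<Rightarrow>\<^sub>0 rat) set graded_algebra" where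
  "arr_ext \<A> \<equiv> exterior_algebra (arr_gens \<A>)"

definition gx :: "'v arrangement \<Rightarrow> 'v \<Rightarrow> ('v gen list \<Rightarrow>\<^sub>0 rat) set" where
  "gx \<A> v = ext_gen (arr_gens \<A>) (GenX v)"

definition gy :: "'v arrangement \<Rightarrow> 'v \<Rightarrow> ('v gen list \<Rightarrow>\<^sub>0 rat) set" where
  "gy \<A> v = ext_gen (arr_gens \<A>) (GenY v)"

definition gg :: "'v arrangement \<Rightarrow> 'v set \<Rightarrow> ('v gen list \<Rightarrow>\<^sub>0 rat) set" where
  "gg \<A> e = ext_gen (arr_gens \<A>) (GenG e)"

definition gg_prod :: "'v arrangement \<Rightarrow> 'v set list \<Rightarrow> ('v gen list \<Rightarrow>\<^sub>0 rat) set" where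
  "gg_prod \<A> es = foldr (\<lambda>e a. gg \<A> e \<otimes>\<^bsub>arr_ext \<A>\<^esub> a) es \<one>\<^bsub>arr_ext \<A>\<^esub>"

text \<open>In the list \<open>es\<close> of edges \<open>e\<^sub>1, \<dots>, e\<^sub>k\<close>, the list \<open>take (j - 1) es @ drop j es\<close>
  omits \<open>e\<^sub>j\<close>.\<close>

definition cycle_relations :: "'v arrangement \<Rightarrow> ('v gen list \<Rightarrow>\<^sub>0 rat) set set" where
  "cycle_relations \<A> =
     {(\<Oplus>\<^bsub>arr_ext \<A>\<^esub>j\<in>{1..length es}.
         (-1) ^ j \<odot>\<^bsub>arr_ext \<A>\<^esub> gg_prod \<A> (take (j - 1) es @ drop j es))
      | es. sorted_wrt (edge_less (vorder \<A>)) es \<and>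
            (\<exists>vs. graph_cycle (edges \<A>) vs \<and> set es = cycle_edges vs)}"

definition edge_relations :: "'v arrangement \<Rightarrow> ('v gen list \<Rightarrow>\<^sub>0 rat) set set" where
  "edge_relations \<A> =
     (\<Union>e\<in>edges \<A>. let h = edge_head (vorder \<A>) e; t = edge_tail (vorder \<A>) e in
       {(gx \<A> h \<ominus>\<^bsub>arr_ext \<A>\<^esub> gx \<A> t) \<otimes>\<^bsub>arr_ext \<A>\<^esub> gg \<A> e,
        (gy \<A> h \<ominus>\<^bsub>arr_ext \<A>\<^esub> gy \<A> t) \<otimes>\<^bsub>arr_ext \<A>\<^esub> gg \<A> e})"

definition arrangement_algebra ::
    "'v arrangement \<Rightarrow> ('v gen list \<Rightarrow>\<^sub>0 rat) set set graded_algebra" where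
  "arrangement_algebra \<A> = quotient_algebra (arr_ext \<A>)
     (Idl\<^bsub>arr_ext \<A>\<^esub> (cycle_relations \<A> \<union> edge_relations \<A>))"


section \<open>Graded modules, Ext and Koszul algebras\<close>

text \<open>Homomorphisms of graded left \<open>A\<close>-modules which lower the internal degree by \<open>j\<close>.\<close>

definition graded_hom :: "'a graded_algebra \<Rightarrow> ('a, int, 'm) graded \<Rightarrow>
    ('a, int, 'n) graded \<Rightarrow> int \<Rightarrow> ('m \<Rightarrow> 'n) set" where
  "graded_hom A M N j =
     {f \<in> carrier M \<rightarrow> carrier N.
        (\<forall>x\<in>carrier M. \<forall>y\<in>carrier M. f (x \<oplus>\<^bsub>M\<^esub> y) = f x \<oplus>\<^bsub>N\<^esub> f y) \<and>
        (\<forall>a\<in>carrier A. \<forall>x\<in>carrier M. f (a \<odot>\<^bsub>M\<^esub> x) = a \<odot>\<^bsub>N\<^esub> f x) \<and>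
        (\<forall>n. f ` grade M n \<subseteq> grade N (n - j))}"

definition hom_group :: "'a graded_algebra \<Rightarrow> ('a, int, 'm) graded \<Rightarrow>
    ('a, int, 'n) graded \<Rightarrow> int \<Rightarrow> ('m \<Rightarrow> 'n) monoid" where
  "hom_group A M N j =
     \<lparr>carrier = graded_hom A M N j \<inter> extensional (carrier M),
      mult = (\<lambda>f g. \<lambda>x\<in>carrier M. f x \<oplus>\<^bsub>N\<^esub> g x),
      one = (\<lambda>x\<in>carrier M. \<zero>\<^bsub>N\<^esub>)\<rparr>"

text \<open>For connected \<open>A\<close> the ideal below is the sum of the components of positive degree, and the
  augmentation is the projection onto the degree zero component.\<close>

definition augmentation :: "'a graded_algebra \<Rightarrow> 'a \<Rightarrow> rat" where
  "augmentation A a =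
     (THE q. a \<ominus>\<^bsub>A\<^esub> q \<odot>\<^bsub>A\<^esub> \<one>\<^bsub>A\<^esub> \<in> Idl\<^bsub>A\<^esub> (\<Union>n\<in>{0<..}. grade A n))"

definition trivial_module :: "'a graded_algebra \<Rightarrow> ('a, int, rat) graded" where
  "trivial_module A =
     \<lparr>carrier = UNIV, mult = (*), one = 1, zero = 0, add = (+),
      smult = (\<lambda>a q. augmentation A a * q),
      grade = (\<lambda>n. if n = 0 then UNIV else {0})\<rparr>"

text \<open>The graded free left module with basis \<open>B\<close>, the basis element \<open>b\<close> having degree
  \<open>dg b\<close>: finitely supported families of coefficients.\<close>

definition free_module :: "'a graded_algebra \<Rightarrow> 'b set \<Rightarrow> ('b \<Rightarrow> int) \<Rightarrow>
    ('a, int, 'b \<Rightarrow> 'a) graded" where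
  "free_module A B dg =
     (let C = {f. (\<forall>b\<in>B. f b \<in> carrier A) \<and> (\<forall>b. b \<notin> B \<longrightarrow> f b = \<zero>\<^bsub>A\<^esub>) \<and>
                  finite {b. f b \<noteq> \<zero>\<^bsub>A\<^esub>}} in
      \<lparr>carrier = C, mult = undefined, one = undefined,
       zero = (\<lambda>_. \<zero>\<^bsub>A\<^esub>), add = (\<lambda>f g b. f b \<oplus>\<^bsub>A\<^esub> g b),
       smult = (\<lambda>a f b. a \<otimes>\<^bsub>A\<^esub> f b),
       grade = (\<lambda>n. {f \<in> C. \<forall>b\<in>B.
         f b \<in> (if dg b \<le> n then grade A (nat (n - dg b)) else {\<zero>\<^bsub>A\<^esub>})})\<rparr>)"

text \<open>\<open>res_diff R i\<close> is the differential from the term in homological degree \<open>i + 1\<close> to that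
  in degree \<open>i\<close>.\<close>

record ('a, 'b) resolution =
  res_basis :: "nat \<Rightarrow> 'b set"
  res_deg :: "nat \<Rightarrow> 'b \<Rightarrow> int"
  res_diff :: "nat \<Rightarrow> ('b \<Rightarrow> 'a) \<Rightarrow> ('b \<Rightarrow> 'a)"
  res_aug :: "('b \<Rightarrow> 'a) \<Rightarrow> rat"

definition res_term :: "'a graded_algebra \<Rightarrow> ('a, 'b) resolution \<Rightarrow> nat \<Rightarrow>
    ('a, int, 'b \<Rightarrow> 'a) graded" where
  "res_term A R i = free_module A (res_basis R i) (res_deg R i)"

definition graded_free_resolution :: "'a graded_algebra \<Rightarrow> ('a, 'b) resolution \<Rightarrow> bool" where
  "graded_free_resolution A R \<longleftrightarrow>
     res_aug R \<in> graded_hom A (res_term A R 0) (trivial_module A) 0 \<and>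
     (\<forall>i. res_diff R i \<in> graded_hom A (res_term A R (Suc i)) (res_term A R i) 0) \<and>
     res_aug R ` carrier (res_term A R 0) = UNIV \<and>
     {x \<in> carrier (res_term A R 0). res_aug R x = 0} =
       res_diff R 0 ` carrier (res_term A R 1) \<and>
     (\<forall>i. {x \<in> carrier (res_term A R (Suc i)).
             res_diff R i x = \<zero>\<^bsub>res_term A R i\<^esub>} =
           res_diff R (Suc i) ` carrier (res_term A R (Suc (Suc i))))"

definition cocycles :: "'a graded_algebra \<Rightarrow> ('a, 'b) resolution \<Rightarrow> nat \<Rightarrow> int \<Rightarrow>
    (('b \<Rightarrow> 'a) \<Rightarrow> rat) set" where
  "cocycles A R i j =
     {f \<in> carrier (hom_group A (res_term A R i) (trivial_module A) j).
        \<forall>x\<in>carrier (res_term A R (Suc i)). f (res_diff R i x) = 0}"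

fun coboundaries :: "'a graded_algebra \<Rightarrow> ('a, 'b) resolution \<Rightarrow> nat \<Rightarrow> int \<Rightarrow>
    (('b \<Rightarrow> 'a) \<Rightarrow> rat) set" where
  "coboundaries A R 0 j = {\<one>\<^bsub>hom_group A (res_term A R 0) (trivial_module A) j\<^esub>}"
| "coboundaries A R (Suc i) j =
     (\<lambda>f. \<lambda>x\<in>carrier (res_term A R (Suc i)). f (res_diff R i x)) `
       carrier (hom_group A (res_term A R i) (trivial_module A) j)"

text \<open>The component of internal degree \<open>j\<close> of \<open>Ext\<^sup>i\<close> of the trivial module with itself, computed
  from the resolution \<open>R\<close>; the sign convention is that a cochain supported in degree \<open>j\<close> has
  internal degree \<open>j\<close>.\<close>

definition Ext :: "'a graded_algebra \<Rightarrow> ('a, 'b) resolution \<Rightarrow> nat \<Rightarrow> int \<Rightarrow>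
    (('b \<Rightarrow> 'a) \<Rightarrow> rat) set monoid" where
  "Ext A R i j =
     (hom_group A (res_term A R i) (trivial_module A) j)\<lparr>carrier := cocycles A R i j\<rparr>
       Mod coboundaries A R i j"

text \<open>\<open>Ext\<close> may be computed from any graded free resolution. The bases are taken inside
  \<open>'a list\<close>, which suffices for every connected graded algebra: its bar resolution has a basis
  consisting of lists of homogeneous elements. The existence clause is therefore always true; it
  makes it visible that the quantification over resolutions is not vacuous.\<close>

definition koszul :: "'a graded_algebra \<Rightarrow> bool" where
  "koszul A \<longleftrightarrow> connected_graded_algebra A \<and>
     (\<exists>R :: ('a, 'a list) resolution. graded_free_resolution A R) \<and>
     (\<forall>R :: ('a, 'a list) resolution. graded_free_resolution A R \<longrightarrow>
        (\<forall>i j. j \<noteq> int i \<longrightarrow> trivial_group (Ext A R i j)))"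

end

theory Submission
  imports Defs "HOL-Library.Function_Algebras" "HOL-Library.Multiset"
begin

text \<open>The algebra is Koszul because it has a Koszul filtration that is a single chain. List the generators
  vertex by vertex along the perfect elimination ordering, lowest vertex first, and for a vertex \<open>v\<close> take
  first the \<open>g\<^sub>e\<close> whose larger end is \<open>v\<close>, then \<open>x\<^sub>v\<close>, then \<open>y\<^sub>v\<close>. Let \<open>I\<^sub>k\<close> be the right ideal generated by the
  first \<open>k\<close> generators and let \<open>b\<close> be the next one. The colon ideal \<open>I\<^sub>k : b\<close> is again a member of the chain,
  so left multiplication by \<open>b\<close> gives an exact sequence
  \<open>0 \<rightarrow> A/I\<^sub>q(-1) \<rightarrow> A/I\<^sub>k \<rightarrow> A/I\<^sub>k\<^sub>+\<^sub>1 \<rightarrow> 0\<close>. Induction on the homological degree and on \<open>k\<close> then shows that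
  \<open>Tor\<^sub>i(A/I\<^sub>k, \<rat>)\<close> lives in internal degree \<open>i\<close> (\<open>homology_mod_ideal\<close>). The last quotient of the chain is
  \<open>\<rat>\<close> itself, and dualising turns the vanishing of \<open>Tor\<close> into that of \<open>Ext\<close> (\<open>cocycle_is_coboundary\<close>). The
  resulting criterion is \<open>koszul_chain.koszul\<close>.

  To compute the ideals one needs a basis of the algebra. If \<open>v\<close> is the largest vertex, then its smaller
  neighbours form a clique, and \<open>A\<close> is free as a right module over the algebra of the remaining graph with
  basis \<open>1, x\<^sub>v, y\<^sub>v, x\<^sub>v y\<^sub>v\<close> and the \<open>g\<^bsub>vu\<^esub>\<close> for the smaller neighbours \<open>u\<close>. That these products span
  follows by rewriting: \<open>x\<^sub>v\<close> and \<open>y\<^sub>v\<close> become \<open>x\<^sub>u\<close> and \<open>y\<^sub>u\<close> next to \<open>g\<^bsub>vu\<^esub>\<close>, and the triangle relation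
  gives \<open>g\<^bsub>vw\<^esub> g\<^bsub>vu\<^esub> = g\<^bsub>wu\<^esub> (g\<^bsub>vu\<^esub> - g\<^bsub>vw\<^esub>)\<close>, the edge \<open>wu\<close> existing because of the clique
  (\<open>letter_normal_form\<close>). That they are independent is seen by letting the generators act on the vector space
  with these products as a formal basis, by the operators that the rewriting rules dictate, and checking that
  these operators satisfy all relations (\<open>elimination_model_relations\<close>, \<open>kernel_annihilates\<close>).

  For the last check only triangles matter. A cycle through more than three vertices has a chord that joins
  the two neighbours of its largest vertex, and the relation of the cycle is a consequence of those of a
  triangle and of a shorter cycle (\<open>alt_sum_chord\<close>, \<open>alt_sum_cycle\<close>).

  In the monomial basis \<open>I\<^sub>k\<close> is spanned by the monomials whose letter of lowest level is among the first
  \<open>k\<close> generators, which reduces the colon ideals to a computation on one level (\<open>chain_steps\<close>).\<close>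

section \<open>Connected graded algebras and their augmentation\<close>

locale conn_graded =
  fixes A :: "'a graded_algebra" (structure)
  assumes cg: "connected_graded_algebra A"
begin

lemma ga: "graded_algebra A" and one_neq_zero: "\<one> \<noteq> \<zero>"
  and grade_0: "grade A 0 = {q \<odot> \<one> | q. True}"
  using cg by (auto simp: connected_graded_algebra_def)

lemma ra: "rat_algebra A"
  using ga by (simp add: graded_algebra_def)

lemma ring_A: "ring A"
  using ra by (simp add: rat_algebra_def)

end

sublocale conn_graded \<subseteq> ring A
  by (rule ring_A)

context conn_graded
begin

lemma smult_closed [simp]: "a \<in> carrier A \<Longrightarrow> q \<odot> a \<in> carrier A"
  and smult_l_distr: "a \<in> carrier A \<Longrightarrow> (p + q) \<odot> a = p \<odot> a \<oplus> q \<odot> a"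
  and smult_r_distr: "\<lbrakk>a \<in> carrier A; b \<in> carrier A\<rbrakk> \<Longrightarrow> q \<odot> (a \<oplus> b) = q \<odot> a \<oplus> q \<odot> b"
  and smult_assoc: "a \<in> carrier A \<Longrightarrow> (p * q) \<odot> a = p \<odot> (q \<odot> a)"
  and smult_one [simp]: "a \<in> carrier A \<Longrightarrow> 1 \<odot> a = a"
  and smult_mult_l: "\<lbrakk>a \<in> carrier A; b \<in> carrier A\<rbrakk> \<Longrightarrow> (q \<odot> a) \<otimes> b = q \<odot> (a \<otimes> b)"
  and smult_mult_r: "\<lbrakk>a \<in> carrier A; b \<in> carrier A\<rbrakk> \<Longrightarrow> a \<otimes> (q \<odot> b) = q \<odot> (a \<otimes> b)"
  using ra unfolding rat_algebra_def by blast+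

lemma grade_subset: "grade A n \<subseteq> carrier A"
  and grade_zero [simp]: "\<zero> \<in> grade A n"
  and grade_add [simp]: "\<lbrakk>a \<in> grade A n; b \<in> grade A n\<rbrakk> \<Longrightarrow> a \<oplus> b \<in> grade A n"
  and grade_smult [simp]: "a \<in> grade A n \<Longrightarrow> q \<odot> a \<in> grade A n"
  and grade_mult: "\<lbrakk>a \<in> grade A m; b \<in> grade A n\<rbrakk> \<Longrightarrow> a \<otimes> b \<in> grade A (m + n)"
  and grade_one [simp]: "\<one> \<in> grade A 0"
  using ga unfolding graded_algebra_def by blast+

lemma grade_carrier: "a \<in> grade A n \<Longrightarrow> a \<in> carrier A"
  using grade_subset by blast

lemma smult_zero_l [simp]: "a \<in> carrier A \<Longrightarrow> 0 \<odot> a = \<zero>"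
proof -
  assume a: "a \<in> carrier A"
  have "0 \<odot> a = 0 \<odot> a \<oplus> 0 \<odot> a" using smult_l_distr[OF a, of 0 0] by simp
  then show ?thesis using a by (metis add.r_cancel_one' smult_closed)
qed

lemma smult_uminus: "a \<in> carrier A \<Longrightarrow> (-1) \<odot> a = \<ominus> a"
proof -
  assume a: "a \<in> carrier A"
  have "(-1) \<odot> a \<oplus> a = \<zero>" using smult_l_distr[OF a, of "-1" 1] a by simp
  then show ?thesis using a by (metis add.inv_equality smult_closed)
qed

lemma smult_one_inj: "p \<odot> \<one> = q \<odot> \<one> \<Longrightarrow> p = q"
proof (rule ccontr)
  assume *: "p \<odot> \<one> = q \<odot> \<one>" "p \<noteq> q"
  have "(p - q) \<odot> \<one> \<oplus> q \<odot> \<one> = p \<odot> \<one>"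
    using smult_l_distr[of \<one> "p - q" q] by simp
  then have "(p - q) \<odot> \<one> = \<zero>"
    using * by (metis add.r_cancel_one' one_closed smult_closed a_comm)
  then have "(1 / (p - q)) \<odot> ((p - q) \<odot> \<one>) = (1 / (p - q)) \<odot> (0 \<odot> \<one>)" by simp
  then have "(1 / (p - q) * (p - q)) \<odot> \<one> = (1 / (p - q) * 0) \<odot> \<one>"
    by (simp only: smult_assoc[symmetric] one_closed)
  then show False using *(2) one_neq_zero by simp
qed

lemma grade_uminus [simp]: "a \<in> grade A n \<Longrightarrow> \<ominus> a \<in> grade A n"
  using grade_smult[of a n "-1"] by (simp add: smult_uminus grade_carrier)

definition components :: "'a \<Rightarrow> nat \<Rightarrow> 'a" where
  "components a = (THE c. (\<forall>n. c n \<in> grade A n) \<and> finite {n. c n \<noteq> \<zero>} \<and>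
        a = (\<Oplus>n\<in>{n. c n \<noteq> \<zero>}. c n))"

lemma components:
  assumes "a \<in> carrier A"
  shows "components a n \<in> grade A n" "finite {n. components a n \<noteq> \<zero>}"
    "a = (\<Oplus>n\<in>{n. components a n \<noteq> \<zero>}. components a n)"
proof -
  have "\<exists>!c. (\<forall>n. c n \<in> grade A n) \<and> finite {n. c n \<noteq> \<zero>} \<and>
        a = (\<Oplus>n\<in>{n. c n \<noteq> \<zero>}. c n)"
    using ga assms unfolding graded_algebra_def by blast
  from theI'[OF this] show "components a n \<in> grade A n" "finite {n. components a n \<noteq> \<zero>}"
    "a = (\<Oplus>n\<in>{n. components a n \<noteq> \<zero>}. components a n)"
    by (auto simp: components_def)
qed

lemma components_carrier [simp]: "a \<in> carrier A \<Longrightarrow> components a n \<in> carrier A"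
  by (rule grade_carrier[OF components(1)])

text \<open>Any finite index set outside of which the family vanishes will do: sums of homogeneous elements
  rarely come indexed by exactly the nonzero components.\<close>

lemma components_unique:
  assumes c: "\<And>n. c n \<in> grade A n" and S: "finite S" "\<And>n. n \<notin> S \<Longrightarrow> c n = \<zero>"
    and a: "a = (\<Oplus>n\<in>S. c n)"
  shows "components a = c"
proof -
  have cc: "c n \<in> carrier A" for n using c by (rule grade_carrier)
  have a_in: "a \<in> carrier A" unfolding a by (rule finsum_closed) (use cc in auto)
  have sub: "{n. c n \<noteq> \<zero>} \<subseteq> S" using S by auto
  have eq: "(\<Oplus>n\<in>{n. c n \<noteq> \<zero>}. c n) = (\<Oplus>n\<in>S. c n)"
    by (rule add.finprod_mono_neutral_cong_left) (use S sub cc in auto)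
  have "\<exists>!c. (\<forall>n. c n \<in> grade A n) \<and> finite {n. c n \<noteq> \<zero>} \<and>
        a = (\<Oplus>n\<in>{n. c n \<noteq> \<zero>}. c n)"
    using ga a_in unfolding graded_algebra_def by blast
  then show ?thesis unfolding components_def
    by (rule the1_equality) (use c eq a finite_subset[OF sub S(1)] in auto)
qed

lemma components_grade:
  assumes "a \<in> grade A n" shows "components a m = (if m = n then a else \<zero>)"
proof -
  have "components a = (\<lambda>m. if m = n then a else \<zero>)"
    by (rule components_unique[where S = "{n}"]) (use assms grade_carrier in \<open>auto simp: finsum_insert\<close>)
  then show ?thesis by simp
qed

lemma components_zero [simp]: "components \<zero> m = \<zero>"
  using components_grade[OF grade_zero] by simp

lemma components_add:
  assumes "a \<in> carrier A" "b \<in> carrier A"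
  shows "components (a \<oplus> b) n = components a n \<oplus> components b n"
proof -
  let ?S = "{n. components a n \<noteq> \<zero>} \<union> {n. components b n \<noteq> \<zero>}"
  have fin: "finite ?S" using components(2) assms by auto
  have ext: "x = (\<Oplus>n\<in>?S. components x n)" if "x \<in> {a, b}" for x
    by (subst (1) components(3)[of x], use that assms in blast,
        rule add.finprod_mono_neutral_cong_left)
      (use that fin assms in auto)
  have "components (a \<oplus> b) = (\<lambda>n. components a n \<oplus> components b n)"
  proof (rule components_unique[where S = ?S])
    have "a \<oplus> b = (\<Oplus>n\<in>?S. components a n) \<oplus> (\<Oplus>n\<in>?S. components b n)"
      using ext[of a] ext[of b] by simp
    also have "\<dots> = (\<Oplus>n\<in>?S. components a n \<oplus> components b n)"
      by (rule finsum_addf[symmetric]) (use assms in auto)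
    finally show "a \<oplus> b = (\<Oplus>n\<in>?S. components a n \<oplus> components b n)" .
  qed (use fin assms components(1) in auto)
  then show ?thesis by simp
qed

lemma graded_induct [consumes 1, case_names zero homogeneous add]:
  assumes a: "a \<in> carrier A" and 0: "P \<zero>" and hom: "\<And>n a. a \<in> grade A n \<Longrightarrow> P a"
    and add: "\<And>a b. \<lbrakk>a \<in> carrier A; b \<in> carrier A; P a; P b\<rbrakk> \<Longrightarrow> P (a \<oplus> b)"
  shows "P a"
proof -
  have "finite S \<Longrightarrow> P (\<Oplus>n\<in>S. components a n)" for S
  proof (induction S rule: finite_induct)
    case empty
    then show ?case using 0 by simp
  next
    case (insert n S)
    have c: "components a m \<in> carrier A" for m using components(1)[OF a] grade_carrier by blast
    have "(\<Oplus>n\<in>insert n S. components a n) = components a n \<oplus> (\<Oplus>n\<in>S. components a n)"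
      by (rule finsum_insert) (use insert c in auto)
    then show ?case
      using add[OF c finsum_closed hom insert.IH] components(1)[OF a] c by auto
  qed
  from this[OF components(2)[OF a]] components(3)[OF a] show ?thesis by simp
qed

text \<open>Shifting the index to the integers lets the grading of a free module be treated uniformly,
  whether or not the degree of a basis element exceeds the degree of the module element.\<close>

definition igrade :: "int \<Rightarrow> 'a set" where
  "igrade n = (if n \<ge> 0 then grade A (nat n) else {\<zero>})"

definition icomp :: "int \<Rightarrow> 'a \<Rightarrow> 'a" where
  "icomp n a = (if n \<ge> 0 then components a (nat n) else \<zero>)"

lemma igrade_zero [simp]: "\<zero> \<in> igrade n"
  by (simp add: igrade_def)

lemma igrade_add [simp]: "\<lbrakk>a \<in> igrade n; b \<in> igrade n\<rbrakk> \<Longrightarrow> a \<oplus> b \<in> igrade n"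
  by (auto simp: igrade_def split: if_splits)

lemma igrade_carrier: "a \<in> igrade n \<Longrightarrow> a \<in> carrier A"
  by (auto simp: igrade_def grade_carrier split: if_splits)

lemma igrade_of_nat [simp]: "igrade (int n) = grade A n"
  by (simp add: igrade_def)

lemma igrade_mult:
  assumes "a \<in> igrade m" "b \<in> igrade n" shows "a \<otimes> b \<in> igrade (m + n)"
proof (cases "m \<ge> 0 \<and> n \<ge> 0")
  case True
  then show ?thesis
    using assms grade_mult[of a "nat m" b "nat n"] by (auto simp: igrade_def nat_add_distrib)
next
  case False
  then have "a = \<zero> \<or> b = \<zero>" using assms by (auto simp: igrade_def split: if_splits)
  then show ?thesis using assms igrade_carrier by auto
qed

lemma icomp_in: "a \<in> carrier A \<Longrightarrow> icomp n a \<in> igrade n"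
  by (auto simp: icomp_def igrade_def components)

lemma icomp_zero [simp]: "icomp n \<zero> = \<zero>"
  by (simp add: icomp_def)

lemma icomp_igrade: "a \<in> igrade n \<Longrightarrow> icomp m a = (if m = n then a else \<zero>)"
  by (auto simp: icomp_def igrade_def components_grade split: if_splits)

lemma icomp_add:
  "\<lbrakk>a \<in> carrier A; b \<in> carrier A\<rbrakk> \<Longrightarrow> icomp n (a \<oplus> b) = icomp n a \<oplus> icomp n b"
  by (simp add: icomp_def components_add)

lemma icomp_finite: "a \<in> carrier A \<Longrightarrow> finite {n. icomp n a \<noteq> \<zero>}"
proof -
  assume a: "a \<in> carrier A"
  have "{n. icomp n a \<noteq> \<zero>} \<subseteq> int ` {n. components a n \<noteq> \<zero>}"
  proof
    fix n assume "n \<in> {n. icomp n a \<noteq> \<zero>}"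
    then have "n = int (nat n)" "components a (nat n) \<noteq> \<zero>"
      by (auto simp: icomp_def split: if_splits)
    then show "n \<in> int ` {n. components a n \<noteq> \<zero>}" by blast
  qed
  then show ?thesis using components(2)[OF a] finite_surj by blast
qed

lemma icomp_sum:
  assumes a: "a \<in> carrier A" and S: "finite S" "\<And>n. n \<notin> S \<Longrightarrow> icomp n a = \<zero>"
  shows "(\<Oplus>n\<in>S. icomp n a) = a"
proof -
  have c: "icomp n a \<in> carrier A" for n using icomp_in[OF a] igrade_carrier by blast
  have "a = (\<Oplus>n\<in>{n. components a n \<noteq> \<zero>}. components a n)" by (rule components(3)[OF a])
  also have "\<dots> = (\<Oplus>n\<in>{n. components a n \<noteq> \<zero>}. icomp (int n) a)"
    by (rule finsum_cong') (use a in \<open>auto simp: icomp_def\<close>)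
  also have "\<dots> = (\<Oplus>n\<in>int ` {n. components a n \<noteq> \<zero>}. icomp n a)"
    by (rule finsum_reindex[symmetric]) (use c in auto)
  also have "\<dots> = (\<Oplus>n\<in>S. icomp n a)"
  proof (rule add.finprod_mono_neutral_cong_left)
    show "int ` {n. components a n \<noteq> \<zero>} \<subseteq> S"
      using S(2) by (force simp: icomp_def)
    show "icomp i a = \<zero>" if "i \<in> S - int ` {n. components a n \<noteq> \<zero>}" for i
    proof (cases "i \<ge> 0")
      case True
      then show ?thesis using that by (force simp: icomp_def image_iff dest: spec[of _ "nat i"])
    qed (simp add: icomp_def)
  qed (use S c in auto)
  finally show ?thesis ..
qed

text \<open>Degrees are natural numbers, so the only way to reach degree zero is to multiply two components of
  degree zero.\<close>

lemma components_0_mult: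
  assumes a: "a \<in> carrier A" and b: "b \<in> carrier A"
  shows "components (a \<otimes> b) 0 = components a 0 \<otimes> components b 0"
  using a
proof (induction a rule: graded_induct)
  case zero
  then show ?case using b by simp
next
  case (homogeneous n a)
  show ?case using b
  proof (induction b rule: graded_induct)
    case zero
    then show ?case using homogeneous grade_carrier by auto
  next
    case h: (homogeneous m b)
    show ?case
      using components_grade[OF homogeneous] components_grade[OF h]
        components_grade[OF grade_mult[OF homogeneous h]] homogeneous h grade_carrier by auto
  next
    case (add c d)
    then have "components c 0 \<in> carrier A" "components d 0 \<in> carrier A" "components a 0 \<in> carrier A"
      "a \<in> carrier A"
      using components(1) grade_carrier homogeneous by blast+
    then show ?case using add by (simp add: r_distr components_add)
  qed
next
  case (add c d)
  then have "components c 0 \<in> carrier A" "components d 0 \<in> carrier A" "components b 0 \<in> carrier A"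
    using components(1) grade_carrier b by blast+
  then show ?case using add b by (simp add: l_distr components_add)
qed

definition aug_ideal :: "'a set" where
  "aug_ideal = Idl (\<Union>n\<in>{0<..}. grade A n)"

text \<open>The right-hand side is an ideal by multiplicativity of the component of degree zero, and each of its
  elements is the sum of its components of positive degree. This identifies the augmentation with the
  component of degree zero.\<close>

lemma aug_ideal: "aug_ideal = {a \<in> carrier A. components a 0 = \<zero>}"
proof
  have "ideal {a \<in> carrier A. components a 0 = \<zero>} A"
  proof (rule idealI[OF ring_A])
    show "subgroup {a \<in> carrier A. components a 0 = \<zero>} (add_monoid A)"
    proof
      fix x assume x: "x \<in> {a \<in> carrier A. components a 0 = \<zero>}"
      have "components (x \<oplus> \<ominus> x) 0 = components x 0 \<oplus> components (\<ominus> x) 0"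
        using x by (intro components_add) auto
      moreover have "components (\<ominus> x) 0 \<in> carrier A"
        using x by auto
      ultimately have "components (\<ominus> x) 0 = \<zero>" using x by (simp add: r_neg)
      then show "inv\<^bsub>add_monoid A\<^esub> x \<in> {a \<in> carrier A. components a 0 = \<zero>}"
        using x by (simp add: a_inv_def[symmetric])
    qed (auto simp: components_add)
    show "x \<otimes> a \<in> {a \<in> carrier A. components a 0 = \<zero>}"
      if "a \<in> {a \<in> carrier A. components a 0 = \<zero>}" "x \<in> carrier A" for a x
      using that by (auto simp: components_0_mult)
    show "a \<otimes> x \<in> {a \<in> carrier A. components a 0 = \<zero>}"
      if "a \<in> {a \<in> carrier A. components a 0 = \<zero>}" "x \<in> carrier A" for a x
      using that by (auto simp: components_0_mult)
  qed
  moreover have "(\<Union>n\<in>{0<..}. grade A n) \<subseteq> {a \<in> carrier A. components a 0 = \<zero>}"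
    by (auto simp: components_grade grade_carrier)
  ultimately show "aug_ideal \<subseteq> {a \<in> carrier A. components a 0 = \<zero>}"
    unfolding aug_ideal_def by (rule genideal_minimal)
  have sub: "(\<Union>n\<in>{0<..}. grade A n) \<subseteq> carrier A" using grade_carrier by auto
  interpret I: ideal aug_ideal A
    unfolding aug_ideal_def by (rule genideal_ideal[OF sub])
  show "{a \<in> carrier A. components a 0 = \<zero>} \<subseteq> aug_ideal"
  proof safe
    fix a assume a: "a \<in> carrier A" "components a 0 = \<zero>"
    have *: "finite S \<Longrightarrow> 0 \<notin> S \<Longrightarrow> (\<Oplus>n\<in>S. components a n) \<in> aug_ideal" for S
    proof (induction S rule: finite_induct)
      case empty
      then show ?case by simp
    next
      case (insert n S)
      have c: "components a m \<in> carrier A" for m using components(1)[OF a(1)] grade_carrier by blast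
      have "components a n \<in> aug_ideal"
        using genideal_self[OF sub] components(1)[OF a(1), of n] insert unfolding aug_ideal_def
        by (metis UN_I greaterThan_iff insertCI neq0_conv subsetD)
      then show ?case using insert c by (simp add: finsum_insert Pi_def)
    qed
    have "0 \<notin> {n. components a n \<noteq> \<zero>}" using a(2) by simp
    from *[OF components(2)[OF a(1)] this] show "a \<in> aug_ideal"
      using components(3)[OF a(1)] by simp
  qed
qed

lemma augmentation_eq:
  assumes a: "a \<in> carrier A" shows "augmentation A a \<odot> \<one> = components a 0"
proof -
  obtain q where q: "components a 0 = q \<odot> \<one>"
    using components(1)[OF a, of 0] by (auto simp: grade_0)
  have "a \<ominus> p \<odot> \<one> \<in> aug_ideal \<longleftrightarrow> p = q" for p
  proof -
    have g: "\<ominus> (p \<odot> \<one>) \<in> grade A 0" by simp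
    have "components (a \<ominus> p \<odot> \<one>) 0 = q \<odot> \<one> \<oplus> \<ominus> (p \<odot> \<one>)"
      using a components_grade[OF g] by (simp add: a_minus_def components_add q)
    moreover have "q \<odot> \<one> \<oplus> \<ominus> (p \<odot> \<one>) = \<zero> \<longleftrightarrow> q \<odot> \<one> = p \<odot> \<one>"
      by (metis a_minus_def minus_equality minus_minus one_closed r_neg smult_closed a_inv_closed)
    ultimately show ?thesis using a smult_one_inj by (auto simp: aug_ideal)
  qed
  then have "augmentation A a = q" unfolding augmentation_def aug_ideal_def by (intro the_equality) auto
  then show ?thesis by (simp add: q)
qed

lemma augmentation_eqI: "a \<in> carrier A \<Longrightarrow> components a 0 = q \<odot> \<one> \<Longrightarrow> augmentation A a = q"
  using augmentation_eq smult_one_inj by metis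

lemma aug_zero [simp]: "augmentation A \<zero> = 0"
  by (rule augmentation_eqI) auto

lemma aug_smult_one [simp]: "augmentation A (q \<odot> \<one>) = q"
  by (rule augmentation_eqI) (auto simp: components_grade[OF grade_smult[OF grade_one]])

lemma aug_add: "\<lbrakk>a \<in> carrier A; b \<in> carrier A\<rbrakk> \<Longrightarrow>
    augmentation A (a \<oplus> b) = augmentation A a + augmentation A b"
  by (rule augmentation_eqI) (auto simp: components_add smult_l_distr augmentation_eq)

lemma aug_mult:
  assumes a: "a \<in> carrier A" and b: "b \<in> carrier A"
  shows "augmentation A (a \<otimes> b) = augmentation A a * augmentation A b"
proof (rule augmentation_eqI)
  have "components (a \<otimes> b) 0 = (augmentation A a \<odot> \<one>) \<otimes> (augmentation A b \<odot> \<one>)"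
    using a b by (simp add: components_0_mult augmentation_eq)
  then show "components (a \<otimes> b) 0 = (augmentation A a * augmentation A b) \<odot> \<one>"
    by (simp add: smult_assoc smult_mult_l)
qed (use a b in simp)

lemma aug_grade: "a \<in> grade A n \<Longrightarrow> n \<noteq> 0 \<Longrightarrow> augmentation A a = 0"
  by (rule augmentation_eqI) (auto simp: components_grade grade_carrier)

lemma aug_igrade: "a \<in> igrade n \<Longrightarrow> n \<noteq> 0 \<Longrightarrow> augmentation A a = 0"
  using aug_grade[of a "nat n"] by (auto simp: igrade_def split: if_splits)

lemma aug_eq_0_grade_0:
  assumes a: "a \<in> grade A 0" and "augmentation A a = 0" shows "a = \<zero>"
  using augmentation_eq[OF grade_carrier[OF a]] components_grade[OF a, of 0] assms(2)
    smult_zero_l[OF one_closed] by simp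

end

section \<open>Graded free modules\<close>

context conn_graded
begin

definition fcar :: "'b set \<Rightarrow> ('b \<Rightarrow> 'a) set" where
  "fcar B = {f. (\<forall>b\<in>B. f b \<in> carrier A) \<and> (\<forall>b. b \<notin> B \<longrightarrow> f b = \<zero>) \<and> finite {b. f b \<noteq> \<zero>}}"

definition fgrade :: "'b set \<Rightarrow> ('b \<Rightarrow> int) \<Rightarrow> int \<Rightarrow> ('b \<Rightarrow> 'a) set" where
  "fgrade B dg n = {f \<in> fcar B. \<forall>b. f b \<in> igrade (n - dg b)}"

definition fzero :: "'b \<Rightarrow> 'a" where "fzero = (\<lambda>_. \<zero>)"

definition fadd :: "('b \<Rightarrow> 'a) \<Rightarrow> ('b \<Rightarrow> 'a) \<Rightarrow> 'b \<Rightarrow> 'a" where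
  "fadd f g = (\<lambda>b. f b \<oplus> g b)"

definition fsmult :: "'a \<Rightarrow> ('b \<Rightarrow> 'a) \<Rightarrow> 'b \<Rightarrow> 'a" where
  "fsmult a f = (\<lambda>b. a \<otimes> f b)"

lemma free_module_simps [simp]:
  "carrier (free_module A B dg) = fcar B"
  "\<zero>\<^bsub>free_module A B dg\<^esub> = fzero"
  "x \<oplus>\<^bsub>free_module A B dg\<^esub> y = fadd x y"
  "a \<odot>\<^bsub>free_module A B dg\<^esub> x = fsmult a x"
  by (simp_all add: free_module_def Let_def fcar_def fzero_def fadd_def fsmult_def)

lemma grade_free_module [simp]: "grade (free_module A B dg) n = fgrade B dg n"
proof -
  have "grade (free_module A B dg) n = {f \<in> fcar B. \<forall>b\<in>B. f b \<in> igrade (n - dg b)}"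
    by (simp add: free_module_def Let_def fcar_def[symmetric] igrade_def)
  also have "\<dots> = fgrade B dg n"
  proof -
    have "f b \<in> igrade (n - dg b)" if "f \<in> fcar B" "b \<notin> B" for f b
      using that by (simp add: fcar_def)
    then show ?thesis unfolding fgrade_def by blast
  qed
  finally show ?thesis .
qed

lemma fcar_carrier: "f \<in> fcar B \<Longrightarrow> f b \<in> carrier A"
  by (cases "b \<in> B") (auto simp: fcar_def)

lemma fcar_finite: "f \<in> fcar B \<Longrightarrow> finite {b. f b \<noteq> \<zero>}"
  and fcar_outside: "f \<in> fcar B \<Longrightarrow> b \<notin> B \<Longrightarrow> f b = \<zero>"
  by (simp_all add: fcar_def)

lemma fcarI:
  assumes "\<And>b. f b \<in> carrier A" "\<And>b. b \<notin> B \<Longrightarrow> f b = \<zero>" "{b. f b \<noteq> \<zero>} \<subseteq> S" "finite S"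
  shows "f \<in> fcar B"
  using assms finite_subset unfolding fcar_def by blast

lemma fzero_closed [simp]: "fzero \<in> fcar B"
  by (rule fcarI[where S = "{}"]) (auto simp: fzero_def)

lemma fadd_closed [simp]: "\<lbrakk>f \<in> fcar B; g \<in> fcar B\<rbrakk> \<Longrightarrow> fadd f g \<in> fcar B"
  by (rule fcarI[where S = "{b. f b \<noteq> \<zero>} \<union> {b. g b \<noteq> \<zero>}"])
    (auto simp: fadd_def fcar_carrier fcar_finite fcar_outside)

lemma fsmult_closed [simp]: "\<lbrakk>a \<in> carrier A; f \<in> fcar B\<rbrakk> \<Longrightarrow> fsmult a f \<in> fcar B"
  by (rule fcarI[where S = "{b. f b \<noteq> \<zero>}"])
    (auto simp: fsmult_def fcar_carrier fcar_finite fcar_outside)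

lemma fgrade_fcar: "f \<in> fgrade B dg n \<Longrightarrow> f \<in> fcar B"
  and fgrade_igrade: "f \<in> fgrade B dg n \<Longrightarrow> f b \<in> igrade (n - dg b)"
  by (simp_all add: fgrade_def)

lemma fgrade_zero [simp]: "fzero \<in> fgrade B dg n"
  by (simp add: fgrade_def, simp add: fzero_def)

lemma fgrade_add [simp]:
  "\<lbrakk>f \<in> fgrade B dg n; g \<in> fgrade B dg n\<rbrakk> \<Longrightarrow> fadd f g \<in> fgrade B dg n"
  by (simp add: fgrade_def, simp add: fadd_def)

lemma fgrade_smult:
  assumes a: "a \<in> igrade m" and f: "f \<in> fgrade B dg n"
  shows "fsmult a f \<in> fgrade B dg (m + n)"
proof -
  have "fsmult a f b \<in> igrade (m + n - dg b)" for b
    using igrade_mult[OF a fgrade_igrade[OF f]] by (simp add: fsmult_def add_diff_eq)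
  then show ?thesis using a f by (simp add: fgrade_def igrade_carrier)
qed

lemma fadd_fzero [simp]: "f \<in> fcar B \<Longrightarrow> fadd f fzero = f" "f \<in> fcar B \<Longrightarrow> fadd fzero f = f"
  by (auto simp: fadd_def fzero_def fcar_carrier)

lemma fsmult_fzero [simp]: "a \<in> carrier A \<Longrightarrow> fsmult a fzero = fzero"
  by (auto simp: fsmult_def fzero_def)

lemma fsmult_zero [simp]: "f \<in> fcar B \<Longrightarrow> fsmult \<zero> f = fzero"
  by (auto simp: fsmult_def fzero_def fcar_carrier)

definition fneg :: "('b \<Rightarrow> 'a) \<Rightarrow> 'b \<Rightarrow> 'a" where "fneg f = fsmult (\<ominus> \<one>) f"

lemma fneg_closed [simp]: "f \<in> fcar B \<Longrightarrow> fneg f \<in> fcar B"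
  by (simp add: fneg_def)

lemma fneg_apply: "f \<in> fcar B \<Longrightarrow> fneg f b = \<ominus> (f b)"
  by (simp add: fneg_def fsmult_def fcar_carrier l_minus)

lemma fgrade_neg [simp]: "f \<in> fgrade B dg n \<Longrightarrow> fneg f \<in> fgrade B dg n"
  unfolding fneg_def using fgrade_smult[of "\<ominus> \<one>" 0 f B dg n] by (simp add: igrade_def)

lemma fadd_fneg [simp]: "f \<in> fcar B \<Longrightarrow> fadd f (fneg f) = fzero"
  by (simp add: fun_eq_iff fadd_def fzero_def fneg_apply fcar_carrier r_neg)

lemma fadd_assoc: "\<lbrakk>f \<in> fcar B; g \<in> fcar B; h \<in> fcar B\<rbrakk> \<Longrightarrow> fadd (fadd f g) h = fadd f (fadd g h)"
  by (simp add: fun_eq_iff fadd_def fcar_carrier a_assoc)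

text \<open>The coefficient at \<open>b\<close> of the component of degree \<open>n\<close> has degree \<open>n - dg b\<close>.\<close>

definition fcomp :: "('b \<Rightarrow> int) \<Rightarrow> int \<Rightarrow> ('b \<Rightarrow> 'a) \<Rightarrow> 'b \<Rightarrow> 'a" where
  "fcomp dg n f = (\<lambda>b. icomp (n - dg b) (f b))"

lemma fcomp_fgrade: "f \<in> fcar B \<Longrightarrow> fcomp dg n f \<in> fgrade B dg n"
proof -
  assume f: "f \<in> fcar B"
  have "fcomp dg n f \<in> fcar B"
    by (rule fcarI[where S = "{b. f b \<noteq> \<zero>}"])
      (use f in \<open>auto simp: fcomp_def fcar_finite fcar_outside intro: igrade_carrier[OF icomp_in] fcar_carrier\<close>)
  then show ?thesis
    using f by (auto simp: fgrade_def) (simp add: fcomp_def icomp_in fcar_carrier)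
qed

lemma fcomp_closed [simp]: "f \<in> fcar B \<Longrightarrow> fcomp dg n f \<in> fcar B"
  by (rule fgrade_fcar[OF fcomp_fgrade])

lemma fcomp_of_fgrade:
  assumes f: "f \<in> fgrade B dg n" shows "fcomp dg m f = (if m = n then f else fzero)"
proof
  fix b
  show "fcomp dg m f b = (if m = n then f else fzero) b"
    using icomp_igrade[OF fgrade_igrade[OF f, of b], of "m - dg b"]
    by (auto simp: fcomp_def fzero_def)
qed

lemma fcomp_add:
  "\<lbrakk>f \<in> fcar B; g \<in> fcar B\<rbrakk> \<Longrightarrow> fcomp dg n (fadd f g) = fadd (fcomp dg n f) (fcomp dg n g)"
  by (simp add: fcomp_def fadd_def icomp_add fcar_carrier)

lemma fcomp_zero [simp]: "fcomp dg n fzero = fzero"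
  by (simp add: fcomp_def fzero_def)

lemma single_closed [simp]:
  "b \<in> B \<Longrightarrow> a \<in> carrier A \<Longrightarrow> (\<lambda>c. if c = b then a else \<zero>) \<in> fcar B"
  by (rule fcarI[where S = "{b}"]) auto

text \<open>The terms of a finitely supported function, taken one at a time.\<close>

lemma free_module_single_induct [consumes 1, case_names zero single add]:
  assumes f: "f \<in> fcar B" and 0: "P fzero"
    and single: "\<And>b a. \<lbrakk>b \<in> B; a \<in> carrier A\<rbrakk> \<Longrightarrow> P (\<lambda>c. if c = b then a else \<zero>)"
    and add: "\<And>f g. \<lbrakk>f \<in> fcar B; g \<in> fcar B; P f; P g\<rbrakk> \<Longrightarrow> P (fadd f g)"
  shows "P f"
proof -
  have "finite S \<Longrightarrow> \<forall>f\<in>fcar B. {b. f b \<noteq> \<zero>} \<subseteq> S \<longrightarrow> P f" for S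
  proof (induction S rule: finite_induct)
    case empty
    have "f = fzero" if "{b. f b \<noteq> \<zero>} \<subseteq> {}" for f :: "'b \<Rightarrow> 'a" using that by (auto simp: fzero_def)
    then show ?case using 0 by auto
  next
    case (insert b S)
    show ?case
    proof (intro ballI impI)
      fix f assume f: "f \<in> fcar B" "{b. f b \<noteq> \<zero>} \<subseteq> insert b S"
      let ?g = "\<lambda>c. if c = b then \<zero> else f c"
      have g: "?g \<in> fcar B"
        by (rule fcarI[where S = S]) (use f insert in \<open>auto simp: fcar_carrier fcar_outside\<close>)
      have "{c. ?g c \<noteq> \<zero>} \<subseteq> S" using f(2) by auto
      then have "P ?g" by (rule insert.IH[rule_format, OF g])
      show "P f"
      proof (cases "b \<in> B")
        case True
        let ?h = "\<lambda>c. if c = b then f b else \<zero>"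
        have h: "?h \<in> fcar B" using f True by (simp add: fcar_carrier)
        have "f = fadd ?g ?h" using f by (auto simp: fadd_def fcar_carrier)
        then show ?thesis
          using add[OF g h \<open>P ?g\<close> single[OF True fcar_carrier[OF f(1)]]] by simp
      next
        case False
        then have "?g = f" using f by (auto simp: fcar_outside)
        then show ?thesis using \<open>P ?g\<close> by simp
      qed
    qed
  qed
  then show ?thesis using f fcar_finite[OF f] by blast
qed

lemma free_module_induct [consumes 1, case_names zero homogeneous add]:
  assumes f: "f \<in> fcar B" and 0: "P fzero"
    and hom: "\<And>n f. f \<in> fgrade B dg n \<Longrightarrow> P f"
    and add: "\<And>f g. \<lbrakk>f \<in> fcar B; g \<in> fcar B; P f; P g\<rbrakk> \<Longrightarrow> P (fadd f g)"
  shows "P f"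
  using f
proof (induction f rule: free_module_single_induct)
  case (single b a)
  show ?case using single(2)
  proof (induction a rule: graded_induct)
    case zero
    then show ?case using 0 by (simp add: fzero_def)
  next
    case (homogeneous n a)
    have "(\<lambda>c. if c = b then a else \<zero>) \<in> fcar B"
      using single(1) homogeneous by (simp add: grade_carrier)
    then have "(\<lambda>c. if c = b then a else \<zero>) \<in> fgrade B dg (dg b + int n)"
      using homogeneous by (simp add: fgrade_def)
    then show ?case by (rule hom)
  next
    case (add a a')
    have "(\<lambda>c. if c = b then a \<oplus> a' else \<zero>) =
        fadd (\<lambda>c. if c = b then a else \<zero>) (\<lambda>c. if c = b then a' else \<zero>)"
      by (auto simp: fadd_def)
    then show ?case
      using add single(1) by (auto intro!: assms(4))
  qed
qed (use 0 add in auto)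

lemma graded_hom_free:
  assumes "f \<in> graded_hom A (free_module A B dg) (free_module A B' dg') j"
  shows "x \<in> fcar B \<Longrightarrow> f x \<in> fcar B'"
    "\<lbrakk>x \<in> fcar B; y \<in> fcar B\<rbrakk> \<Longrightarrow> f (fadd x y) = fadd (f x) (f y)"
    "\<lbrakk>a \<in> carrier A; x \<in> fcar B\<rbrakk> \<Longrightarrow> f (fsmult a x) = fsmult a (f x)"
    "x \<in> fgrade B dg n \<Longrightarrow> f x \<in> fgrade B' dg' (n - j)"
proof -
  have "f ` fgrade B dg n \<subseteq> fgrade B' dg' (n - j)"
    using assms by (simp add: graded_hom_def)
  then show "x \<in> fgrade B dg n \<Longrightarrow> f x \<in> fgrade B' dg' (n - j)" by blast
qed (use assms in \<open>auto simp: graded_hom_def\<close>)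

lemma trivial_module_simps [simp]:
  "carrier (trivial_module A) = UNIV" "\<zero>\<^bsub>trivial_module A\<^esub> = 0"
  "x \<oplus>\<^bsub>trivial_module A\<^esub> y = x + y" "a \<odot>\<^bsub>trivial_module A\<^esub> x = augmentation A a * x"
  "grade (trivial_module A) n = (if n = 0 then UNIV else {0})"
  by (simp_all add: trivial_module_def)

lemma graded_hom_trivial:
  assumes "f \<in> graded_hom A (free_module A B dg) (trivial_module A) j"
  shows "\<lbrakk>x \<in> fcar B; y \<in> fcar B\<rbrakk> \<Longrightarrow> f (fadd x y) = f x + f y"
    "\<lbrakk>a \<in> carrier A; x \<in> fcar B\<rbrakk> \<Longrightarrow> f (fsmult a x) = augmentation A a * f x"
    "x \<in> fgrade B dg n \<Longrightarrow> n \<noteq> j \<Longrightarrow> f x = 0"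
proof -
  have "f ` fgrade B dg n \<subseteq> (if n = j then UNIV else {0})"
    using assms by (simp add: graded_hom_def)
  then show "x \<in> fgrade B dg n \<Longrightarrow> n \<noteq> j \<Longrightarrow> f x = 0" by auto
qed (use assms in \<open>auto simp: graded_hom_def\<close>)

lemma graded_hom_free_zero:
  assumes "f \<in> graded_hom A (free_module A B dg) (free_module A B' dg') j"
  shows "f fzero = fzero"
proof -
  have "f (fsmult \<zero> fzero) = fsmult \<zero> (f fzero)"
    by (rule graded_hom_free(3)[OF assms]) auto
  then show ?thesis using graded_hom_free(1)[OF assms, of fzero] by simp
qed

lemma graded_hom_trivial_zero:
  assumes "f \<in> graded_hom A (free_module A B dg) (trivial_module A) j"
  shows "f fzero = 0"
  using graded_hom_trivial(1)[OF assms, of fzero fzero] by simp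

text \<open>A homogeneous map of degree zero commutes with passing to components, so a preimage of a homogeneous
  element may be replaced by its homogeneous component.\<close>

lemma graded_hom_fcomp:
  assumes f: "f \<in> graded_hom A (free_module A B dg) (free_module A B' dg') 0"
    and x: "x \<in> fcar B"
  shows "f (fcomp dg n x) = fcomp dg' n (f x)"
  using x
proof (induction x rule: free_module_induct[where dg = dg])
  case zero
  then show ?case by (simp add: graded_hom_free_zero[OF f])
next
  case (homogeneous m x)
  have "f x \<in> fgrade B' dg' m" using graded_hom_free(4)[OF f homogeneous] by simp
  then show ?case
    by (simp add: fcomp_of_fgrade[OF homogeneous] fcomp_of_fgrade graded_hom_free_zero[OF f])
next
  case (add x y)
  then show ?case
    by (simp add: fcomp_add graded_hom_free(2)[OF f] fcomp_add[OF graded_hom_free(1)[OF f] graded_hom_free(1)[OF f]])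
qed

end

section \<open>A graded free resolution by syzygies\<close>

text \<open>The basis of the next term of the resolution consists of elements of the previous one, that is, of
  finitely supported functions on lists. To have all bases in one type of lists, such a function is itself
  written as a list. The marker \<open>p\<close> announces a further entry of the current word and \<open>q\<close> ends the word, which
  makes the code uniquely decodable for \<open>p \<noteq> q\<close>.\<close>

fun flatten :: "'a \<Rightarrow> 'a \<Rightarrow> 'a list list \<Rightarrow> 'a list" where
  "flatten p q [] = []"
| "flatten p q ([] # xss) = q # flatten p q xss"
| "flatten p q ((x # xs) # xss) = p # x # flatten p q (xs # xss)"

lemma flatten_inject: "p \<noteq> q \<Longrightarrow> flatten p q xss = flatten p q yss \<Longrightarrow> xss = yss"
proof (induction p q xss arbitrary: yss rule: flatten.induct)
  case (1 p q)
  then show ?case by (cases "(p, q, yss)" rule: flatten.cases) auto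
next
  case (2 p q xss)
  then show ?case by (cases "(p, q, yss)" rule: flatten.cases) auto
next
  case (3 p q x xs xss)
  then show ?case by (cases "(p, q, yss)" rule: flatten.cases) auto
qed

text \<open>Each argument \<open>b\<close> outside the default value \<open>q\<close> contributes the word \<open>f b # b\<close>, so the list determines
  the graph of \<open>f\<close> on its support. The order in which the support is enumerated is irrelevant for
  injectivity.\<close>

definition encode :: "'a \<Rightarrow> 'a \<Rightarrow> ('a list \<Rightarrow> 'a) \<Rightarrow> 'a list" where
  "encode p q f = flatten p q (map (\<lambda>b. f b # b) (SOME bs. set bs = {b. f b \<noteq> q}))"

lemma inj_encode:
  assumes "p \<noteq> q" shows "inj_on (encode p q) {f. finite {b. f b \<noteq> q}}"
proof (rule inj_onI)
  fix f g :: "'a list \<Rightarrow> 'a"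
  define L where "L h = (SOME bs. set bs = {b :: 'a list. h b \<noteq> q})" for h :: "'a list \<Rightarrow> 'a"
  have L: "set (L h) = {b. h b \<noteq> q}" if "finite {b. h b \<noteq> q}" for h
    unfolding L_def by (rule someI_ex) (rule finite_list[OF that])
  assume fin: "f \<in> {f. finite {b. f b \<noteq> q}}" "g \<in> {f. finite {b. f b \<noteq> q}}"
    and "encode p q f = encode p q g"
  then have eq: "map (\<lambda>b. f b # b) (L f) = map (\<lambda>b. g b # b) (L g)"
    using flatten_inject[OF assms] by (simp add: encode_def L_def)
  have "map tl (map (\<lambda>b. f b # b) (L f)) = map tl (map (\<lambda>b. g b # b) (L g))"
    by (simp only: eq)
  then have LL: "L f = L g" by (simp add: comp_def)
  show "f = g"
  proof
    fix b show "f b = g b"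
    proof (cases "b \<in> set (L f)")
      case True
      then show ?thesis using eq by (simp add: LL)
    next
      case False
      moreover have "set (L f) = {b. f b \<noteq> q}" "set (L f) = {b. g b \<noteq> q}"
        using L[of f] L[of g] fin unfolding LL by blast+
      ultimately have "f b = q" "g b = q" by blast+
      then show ?thesis by simp
    qed
  qed
qed

context conn_graded
begin

text \<open>The linear map that sends the basis element \<open>b\<close> to \<open>U b\<close>.\<close>

definition lincomb :: "('c \<Rightarrow> 'b \<Rightarrow> 'a) \<Rightarrow> ('c \<Rightarrow> 'a) \<Rightarrow> 'b \<Rightarrow> 'a" where
  "lincomb U f = (\<lambda>c. \<Oplus>b\<in>{b. f b \<noteq> \<zero>}. f b \<otimes> U b c)"

context
  fixes U :: "'c \<Rightarrow> 'b \<Rightarrow> 'a" and C :: "'c set" and dc :: "'c \<Rightarrow> int"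
    and B :: "'b set" and dg :: "'b \<Rightarrow> int"
  assumes U: "\<And>b. b \<in> C \<Longrightarrow> U b \<in> fgrade B dg (dc b)"
begin

lemma U_term: "f \<in> fcar C \<Longrightarrow> b \<in> C \<Longrightarrow> f b \<otimes> U b c \<in> carrier A"
  by (rule m_closed[OF fcar_carrier fcar_carrier[OF fgrade_fcar[OF U]]])

lemma U_term_zero: "f \<in> fcar C \<Longrightarrow> f b = \<zero> \<Longrightarrow> b \<in> C \<Longrightarrow> f b \<otimes> U b c = \<zero>"
  using fcar_carrier[OF fgrade_fcar[OF U]] by auto

lemma lincomb_superset:
  assumes f: "f \<in> fcar C" and S: "finite S" "{b. f b \<noteq> \<zero>} \<subseteq> S" "S \<subseteq> C"
  shows "lincomb U f c = (\<Oplus>b\<in>S. f b \<otimes> U b c)"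
  unfolding lincomb_def
proof (rule add.finprod_mono_neutral_cong_left)
  show "f b \<otimes> U b c = \<zero>" if "b \<in> S - {b. f b \<noteq> \<zero>}" for b
    using that S by (intro U_term_zero[OF f]) auto
qed (use S U_term[OF f] in auto)

lemma support_subset: "f \<in> fcar C \<Longrightarrow> {b. f b \<noteq> \<zero>} \<subseteq> C"
proof
  fix b assume "f \<in> fcar C" "b \<in> {b. f b \<noteq> \<zero>}"
  then show "b \<in> C" using fcar_outside[of f C b] by (cases "b \<in> C") simp_all
qed

lemma lincomb_igrade:
  assumes "f \<in> fgrade C dc n" shows "lincomb U f c \<in> igrade (n - dg c)"
proof -
  have f: "f \<in> fcar C" by (rule fgrade_fcar[OF assms])
  have "finite S \<Longrightarrow> S \<subseteq> C \<Longrightarrow> (\<Oplus>b\<in>S. f b \<otimes> U b c) \<in> igrade (n - dg c)" for S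
  proof (induction S rule: finite_induct)
    case (insert b S)
    have "f b \<otimes> U b c \<in> igrade ((n - dc b) + (dc b - dg c))"
      by (rule igrade_mult[OF fgrade_igrade[OF assms] fgrade_igrade[OF U]]) (use insert in blast)
    moreover have "(n - dc b) + (dc b - dg c) = n - dg c" by simp
    ultimately have "f b \<otimes> U b c \<in> igrade (n - dg c)" by (simp only:)
    moreover have "(\<Oplus>b\<in>insert b S. f b \<otimes> U b c) = f b \<otimes> U b c \<oplus> (\<Oplus>b\<in>S. f b \<otimes> U b c)"
      by (rule finsum_insert) (use insert U_term[OF f] in blast)+
    moreover have "(\<Oplus>b\<in>S. f b \<otimes> U b c) \<in> igrade (n - dg c)"
      by (rule insert.IH) (use insert.prems in blast)
    ultimately show ?case by (simp only: igrade_add)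
  qed simp
  then show ?thesis using fcar_finite[OF f] support_subset[OF f] by (simp add: lincomb_def)
qed

lemma lincomb_closed: assumes f: "f \<in> fcar C" shows "lincomb U f \<in> fcar B"
proof (rule fcarI[where S = "\<Union>b\<in>{b. f b \<noteq> \<zero>}. {c. U b c \<noteq> \<zero>}"])
  show "lincomb U f c \<in> carrier A" for c
    unfolding lincomb_def by (rule finsum_closed) (use U_term[OF f] support_subset[OF f] in blast)
  have *: "lincomb U f c = \<zero>" if "\<And>b. f b \<noteq> \<zero> \<Longrightarrow> U b c = \<zero>" for c
  proof -
    have "lincomb U f c = (\<Oplus>b\<in>{b. f b \<noteq> \<zero>}. \<zero>)"
      unfolding lincomb_def by (rule finsum_cong') (use that f in \<open>auto simp: fcar_carrier\<close>)
    then show ?thesis by simp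
  qed
  show "lincomb U f c = \<zero>" if "c \<notin> B" for c
    using that support_subset[OF f] U fcar_outside[OF fgrade_fcar[OF U]] by (intro *) auto
  show "{c. lincomb U f c \<noteq> \<zero>} \<subseteq> (\<Union>b\<in>{b. f b \<noteq> \<zero>}. {c. U b c \<noteq> \<zero>})"
    using * by blast
  show "finite (\<Union>b\<in>{b. f b \<noteq> \<zero>}. {c. U b c \<noteq> \<zero>})"
    using fcar_finite[OF f] support_subset[OF f] fcar_finite[OF fgrade_fcar[OF U]] by auto
qed

lemma lincomb_hom: "lincomb U \<in> graded_hom A (free_module A C dc) (free_module A B dg) 0"
proof -
  have add: "lincomb U (fadd f g) = fadd (lincomb U f) (lincomb U g)"
    if f: "f \<in> fcar C" and g: "g \<in> fcar C" for f g
  proof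
    fix c
    let ?S = "{b. f b \<noteq> \<zero>} \<union> {b. g b \<noteq> \<zero>}"
    have S: "finite ?S" "?S \<subseteq> C" using f g fcar_finite support_subset by auto
    have "lincomb U (fadd f g) c = (\<Oplus>b\<in>?S. fadd f g b \<otimes> U b c)"
      by (rule lincomb_superset[OF fadd_closed[OF f g] S(1) _ S(2)]) (auto simp: fadd_def)
    also have "\<dots> = (\<Oplus>b\<in>?S. f b \<otimes> U b c \<oplus> g b \<otimes> U b c)"
      by (rule finsum_cong') (use f g S U fcar_carrier[OF fgrade_fcar[OF U]] in
          \<open>auto simp: fadd_def fcar_carrier l_distr subset_iff\<close>)
    also have "\<dots> = lincomb U f c \<oplus> lincomb U g c"
      using lincomb_superset[OF f S(1) _ S(2)] lincomb_superset[OF g S(1) _ S(2)]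
        U_term[OF f] U_term[OF g] S(2) by (simp add: finsum_addf Pi_def subset_iff)
    finally show "lincomb U (fadd f g) c = fadd (lincomb U f) (lincomb U g) c"
      by (simp add: fadd_def)
  qed
  have smult: "lincomb U (fsmult a f) = fsmult a (lincomb U f)"
    if f: "f \<in> fcar C" and a: "a \<in> carrier A" for f a
  proof
    fix c
    let ?S = "{b. f b \<noteq> \<zero>}"
    have S: "finite ?S" "?S \<subseteq> C" using f fcar_finite support_subset by auto
    have "lincomb U (fsmult a f) c = (\<Oplus>b\<in>?S. fsmult a f b \<otimes> U b c)"
      by (rule lincomb_superset[OF fsmult_closed[OF a f] S(1) _ S(2)]) (use a in \<open>auto simp: fsmult_def\<close>)
    also have "\<dots> = (\<Oplus>b\<in>?S. a \<otimes> (f b \<otimes> U b c))"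
      by (rule finsum_cong') (use f a S U fcar_carrier[OF fgrade_fcar[OF U]] in
          \<open>auto simp: fsmult_def fcar_carrier m_assoc subset_iff\<close>)
    also have "\<dots> = a \<otimes> (\<Oplus>b\<in>?S. f b \<otimes> U b c)"
      by (rule finsum_rdistr[symmetric]) (use S U_term[OF f] a in blast)+
    finally show "lincomb U (fsmult a f) c = fsmult a (lincomb U f) c"
      by (simp add: fsmult_def lincomb_def)
  qed
  have "lincomb U f \<in> fgrade B dg n" if "f \<in> fgrade C dc n" for f n
    using that lincomb_closed[OF fgrade_fcar[OF that]] lincomb_igrade[OF that] by (simp add: fgrade_def)
  then show ?thesis
    using add smult lincomb_closed by (auto simp: graded_hom_def)
qed

lemma lincomb_single:
  assumes b: "b \<in> C" and a: "a \<in> carrier A"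
  shows "lincomb U (\<lambda>c. if c = b then a else \<zero>) = fsmult a (U b)"
proof
  fix c
  have "lincomb U (\<lambda>c. if c = b then a else \<zero>) c =
      (\<Oplus>d\<in>{b}. (if d = b then a else \<zero>) \<otimes> U d c)"
    by (rule lincomb_superset) (use assms in auto)
  also have "\<dots> = a \<otimes> U b c"
    using a fcar_carrier[OF fgrade_fcar[OF U[OF b]]] by (simp add: finsum_insert)
  finally show "lincomb U (\<lambda>c. if c = b then a else \<zero>) c = fsmult a (U b) c"
    by (simp add: fsmult_def)
qed

end

definition enc :: "('a list \<Rightarrow> 'a) \<Rightarrow> 'a list" where
  "enc = encode \<one> \<zero>"

definition dec :: "'a list \<Rightarrow> 'a list \<Rightarrow> 'a" where
  "dec = inv_into {f. finite {b. f b \<noteq> \<zero>}} enc"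

lemma inj_enc: "inj_on enc {f. finite {b. f b \<noteq> \<zero>}}"
  unfolding enc_def by (rule inj_encode[OF one_neq_zero])

lemma dec_enc: "f \<in> fcar B \<Longrightarrow> dec (enc f) = f"
  unfolding dec_def by (rule inv_into_f_f[OF inj_enc]) (simp add: fcar_def)

lemma fgrade_unique: "u \<in> fgrade B dg n \<Longrightarrow> u \<in> fgrade B dg m \<Longrightarrow> u \<noteq> fzero \<Longrightarrow> n = m"
  using fcomp_of_fgrade by metis

text \<open>Killing a graded submodule of a free module, given by its membership predicate \<open>\<kappa>\<close>, by a free
  module on its nonzero homogeneous elements.\<close>

definition syz :: "'a list set \<Rightarrow> ('a list \<Rightarrow> int) \<Rightarrow> (('a list \<Rightarrow> 'a) \<Rightarrow> bool) \<Rightarrow> 'a list set" where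
  "syz B dg \<kappa> = enc ` {u. u \<noteq> fzero \<and> (\<exists>n. u \<in> fgrade B dg n) \<and> \<kappa> u}"

definition syz_deg :: "'a list set \<Rightarrow> ('a list \<Rightarrow> int) \<Rightarrow> 'a list \<Rightarrow> int" where
  "syz_deg B dg b = (THE n. dec b \<in> fgrade B dg n)"

lemma syz_dec:
  assumes "b \<in> syz B dg \<kappa>" shows "dec b \<in> fgrade B dg (syz_deg B dg b)" "\<kappa> (dec b)"
proof -
  obtain u n where u: "b = enc u" "u \<noteq> fzero" "u \<in> fgrade B dg n" "\<kappa> u"
    using assms by (auto simp: syz_def)
  then have d: "dec b = u" using dec_enc fgrade_fcar by blast
  have "syz_deg B dg b = n"
    unfolding syz_deg_def d by (rule the_equality) (use u fgrade_unique in blast)+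
  then show "dec b \<in> fgrade B dg (syz_deg B dg b)" "\<kappa> (dec b)" using u d by auto
qed

lemma syz_hom: "lincomb dec \<in>
    graded_hom A (free_module A (syz B dg \<kappa>) (syz_deg B dg)) (free_module A B dg) 0"
  by (rule lincomb_hom) (rule syz_dec(1))

lemma syz_single: "b \<in> syz B dg \<kappa> \<Longrightarrow> a \<in> carrier A \<Longrightarrow>
    lincomb dec (\<lambda>c. if c = b then a else \<zero>) = fsmult a (dec b)"
  by (rule lincomb_single) (rule syz_dec(1))

text \<open>An element all of whose components satisfy \<open>\<kappa>\<close> is the sum of its nonzero components, and each of
  these is the image of a basis element.\<close>

lemma syz_onto:
  assumes x: "x \<in> fcar B" and \<kappa>: "\<And>n. \<kappa> (fcomp dg n x)"
  shows "x \<in> lincomb dec ` fcar (syz B dg \<kappa>)"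
proof -
  define S where "S = {n. fcomp dg n x \<noteq> fzero}"
  have c: "fcomp dg n x \<in> fcar B" for n using x by simp
  have "S \<subseteq> (\<Union>b\<in>{b. x b \<noteq> \<zero>}. (\<lambda>n. n + dg b) ` {n. icomp n (x b) \<noteq> \<zero>})"
  proof
    fix n assume "n \<in> S"
    then obtain b where b: "icomp (n - dg b) (x b) \<noteq> \<zero>"
      by (auto simp: S_def fcomp_def fzero_def fun_eq_iff)
    then have "x b \<noteq> \<zero>" by auto
    moreover have "n = (n - dg b) + dg b" by simp
    ultimately show "n \<in> (\<Union>b\<in>{b. x b \<noteq> \<zero>}. (\<lambda>n. n + dg b) ` {n. icomp n (x b) \<noteq> \<zero>})"
      using b by blast
  qed
  then have S: "finite S"
    by (rule finite_subset) (use x in \<open>simp add: fcar_finite icomp_finite fcar_carrier\<close>)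
  let ?e = "\<lambda>n. enc (fcomp dg n x)"
  have inj: "inj_on ?e S"
  proof (rule inj_onI)
    fix n m assume nm: "n \<in> S" "m \<in> S" "?e n = ?e m"
    then have "fcomp dg n x = fcomp dg m x"
      using dec_enc[OF c[of n]] dec_enc[OF c[of m]] by metis
    then show "n = m"
      using fgrade_unique[OF fcomp_fgrade[OF x, of dg n], of m] fcomp_fgrade[OF x, of dg m] nm
      by (simp add: S_def)
  qed
  have sub: "?e ` S \<subseteq> syz B dg \<kappa>"
    unfolding syz_def S_def using fcomp_fgrade[OF x] \<kappa> by blast
  define f where "f b = (if b \<in> ?e ` S then \<one> else \<zero>)" for b
  have f: "f \<in> fcar (syz B dg \<kappa>)"
    by (rule fcarI[where S = "?e ` S"]) (use sub S in \<open>auto simp: f_def\<close>)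
  have f1: "f (?e n) = \<one>" if "n \<in> S" for n using that unfolding f_def by auto
  have "lincomb dec f c = x c" for c
  proof -
    have car: "fcomp dg n x c \<in> carrier A" for n by (rule fcar_carrier[OF c])
    have "lincomb dec f c = (\<Oplus>b\<in>?e ` S. f b \<otimes> dec b c)"
    proof (rule lincomb_superset[OF syz_dec(1) f _ _ sub])
      show "{b. f b \<noteq> \<zero>} \<subseteq> ?e ` S" unfolding f_def by auto
    qed (use S in auto)
    also have "\<dots> = (\<Oplus>n\<in>S. f (?e n) \<otimes> dec (?e n) c)"
    proof (rule finsum_reindex[OF _ inj], rule Pi_I)
      fix b assume "b \<in> ?e ` S"
      then show "f b \<otimes> dec b c \<in> carrier A" using f1 car by (elim imageE) (simp add: dec_enc[OF c])
    qed
    also have "\<dots> = (\<Oplus>n\<in>S. fcomp dg n x c)"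
      by (rule finsum_cong') (use car in \<open>simp_all add: f1 dec_enc[OF c]\<close>)
    also have "\<dots> = (\<Oplus>n\<in>(\<lambda>n. n - dg c) ` S. icomp n (x c))"
      by (subst finsum_reindex) (use car x in \<open>auto simp: fcomp_def inj_on_def\<close>)
    also have "\<dots> = x c"
    proof (rule icomp_sum)
      fix n assume n: "n \<notin> (\<lambda>n. n - dg c) ` S"
      have "n + dg c \<notin> S" using n by force
      then have "fcomp dg (n + dg c) x c = \<zero>" by (simp add: S_def fzero_def)
      then show "icomp n (x c) = \<zero>" by (simp add: fcomp_def)
    qed (use S x in \<open>auto simp: fcar_carrier\<close>)
    finally show ?thesis .
  qed
  then show ?thesis using f by (intro image_eqI[of _ _ f]) auto
qed

text \<open>The first step kills the kernel of the augmentation, every later one the kernel of the preceding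
  differential.\<close>

primrec stage :: "nat \<Rightarrow> 'a list set \<times> ('a list \<Rightarrow> int)" where
  "stage 0 = ({[]}, \<lambda>_. 0)"
| "stage (Suc i) = (let \<kappa> = (\<lambda>u. if i = 0 then augmentation A (u []) = 0 else lincomb dec u = fzero) in
     (syz (fst (stage i)) (snd (stage i)) \<kappa>, syz_deg (fst (stage i)) (snd (stage i))))"

definition syzygy_resolution :: "('a, 'a list) resolution" where
  "syzygy_resolution = \<lparr>res_basis = (\<lambda>i. fst (stage i)), res_deg = (\<lambda>i. snd (stage i)),
     res_diff = (\<lambda>i. lincomb dec), res_aug = (\<lambda>u. augmentation A (u []))\<rparr>"

lemma syz_in_kernel:
  assumes d: "d \<in> graded_hom A (free_module A B dg) (free_module A B' dg') 0"
    and \<kappa>: "\<And>u. \<kappa> u \<Longrightarrow> d u = fzero" and f: "f \<in> fcar (syz B dg \<kappa>)"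
  shows "d (lincomb dec f) = fzero"
  using f
proof (induction f rule: free_module_single_induct)
  case zero
  then show ?case by (simp add: graded_hom_free_zero[OF syz_hom] graded_hom_free_zero[OF d])
next
  case (single b a)
  then show ?case
    using fgrade_fcar[OF syz_dec(1)[OF single(1)]] \<kappa>[OF syz_dec(2)[OF single(1)]]
    by (simp add: syz_single graded_hom_free(3)[OF d])
next
  case (add f g)
  then show ?case
    by (simp add: graded_hom_free(2)[OF syz_hom] graded_hom_free(1)[OF syz_hom] graded_hom_free(2)[OF d])
qed

lemma aug_hom: "(\<lambda>u. augmentation A (u [])) \<in>
    graded_hom A (free_module A {[]} (\<lambda>_. 0)) (trivial_module A) 0"
proof -
  have "augmentation A (f []) = 0" if "f \<in> fgrade {[]} (\<lambda>_. 0) n" "n \<noteq> 0" for f :: "'c list \<Rightarrow> 'a" and n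
    using aug_igrade[of "f []" n] fgrade_igrade[OF that(1), of "[]"] that(2) by simp
  then show ?thesis
    by (auto simp: graded_hom_def, auto simp: fadd_def fsmult_def aug_add aug_mult fcar_carrier)
qed

lemma syz_in_aug_kernel:
  assumes \<kappa>: "\<And>u. \<kappa> u \<Longrightarrow> augmentation A (u []) = 0"
    and f: "f \<in> fcar (syz {[]} (\<lambda>_. 0) \<kappa>)"
  shows "augmentation A (lincomb dec f []) = 0"
  using f
proof (induction f rule: free_module_single_induct)
  case zero
  then show ?case by (simp add: graded_hom_free_zero[OF syz_hom]) (simp add: fzero_def)
next
  case (single b a)
  then show ?case
    using fcar_carrier[OF fgrade_fcar[OF syz_dec(1)[OF single(1)]]] \<kappa>[OF syz_dec(2)[OF single(1)]]
    by (simp add: syz_single) (simp add: fsmult_def aug_mult)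
next
  case (add f g)
  then have "lincomb dec f \<in> fcar {[]}" "lincomb dec g \<in> fcar {[]}"
    using graded_hom_free(1)[OF syz_hom] by blast+
  then show ?case using add
    by (simp add: graded_hom_free(2)[OF syz_hom]) (simp add: fadd_def aug_add fcar_carrier)
qed

text \<open>Exactness holds by construction: a graded submodule is generated by its homogeneous elements, all of
  which are hit by the next basis.\<close>

theorem graded_free_resolution_exists: "graded_free_resolution A syzygy_resolution"
proof -
  let ?R = syzygy_resolution
  have R [simp]: "res_basis ?R i = fst (stage i)" "res_deg ?R i = snd (stage i)"
      "res_diff ?R i = lincomb dec" "res_aug ?R = (\<lambda>u. augmentation A (u []))" for i
    by (simp_all add: syzygy_resolution_def)
  have hom: "lincomb dec \<in> graded_hom A (free_module A (fst (stage (Suc i))) (snd (stage (Suc i))))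
      (free_module A (fst (stage i)) (snd (stage i))) 0" for i
    by (simp add: Let_def syz_hom)
  show ?thesis
    unfolding graded_free_resolution_def res_term_def
  proof (intro conjI allI)
    show "res_aug ?R \<in> graded_hom A (free_module A (res_basis ?R 0) (res_deg ?R 0)) (trivial_module A) 0"
      using aug_hom by simp
    show "res_diff ?R i \<in> graded_hom A (free_module A (res_basis ?R (Suc i)) (res_deg ?R (Suc i)))
          (free_module A (res_basis ?R i) (res_deg ?R i)) 0" for i
      using hom[of i] by (simp only: R)
    show "res_aug ?R ` carrier (free_module A (res_basis ?R 0) (res_deg ?R 0)) = UNIV"
    proof -
      have "q \<in> (\<lambda>u. augmentation A (u [])) ` fcar {[]}" for q
        by (rule image_eqI[where x = "\<lambda>c. if c = [] then q \<odot> \<one> else \<zero>"]) auto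
      then show ?thesis by auto
    qed
    show "{x \<in> carrier (free_module A (res_basis ?R 0) (res_deg ?R 0)). res_aug ?R x = 0} =
       res_diff ?R 0 ` carrier (free_module A (res_basis ?R 1) (res_deg ?R 1))"
    proof -
      let ?k = "\<lambda>u. augmentation A (u []) = 0"
      have "x \<in> lincomb dec ` fcar (syz {[]} (\<lambda>_. 0) ?k)" if x: "x \<in> fcar {[]}" "?k x" for x
      proof (rule syz_onto[OF x(1)])
        fix n
        show "?k (fcomp (\<lambda>_. 0) n x)"
        proof (cases "n = 0")
          case True
          then show ?thesis
            using x aug_smult_one augmentation_eq[OF fcar_carrier[OF x(1)], of "[]"]
            by (simp add: fcomp_def icomp_def) (metis aug_zero one_closed smult_zero_l)
        next
          case False
          then show ?thesis
            using aug_igrade[OF icomp_in[OF fcar_carrier[OF x(1)]]] by (simp add: fcomp_def)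
        qed
      qed
      moreover have "lincomb dec f \<in> fcar {[]}" "?k (lincomb dec f)"
        if "f \<in> fcar (syz {[]} (\<lambda>_. 0) ?k)" for f
        using graded_hom_free(1)[OF syz_hom that] syz_in_aug_kernel[OF _ that] by auto
      ultimately show ?thesis by auto
    qed
    show "{x \<in> carrier (free_module A (res_basis ?R (Suc i)) (res_deg ?R (Suc i))).
            res_diff ?R i x = \<zero>\<^bsub>free_module A (res_basis ?R i) (res_deg ?R i)\<^esub>} =
       res_diff ?R (Suc i) ` carrier (free_module A (res_basis ?R (Suc (Suc i))) (res_deg ?R (Suc (Suc i))))"
      for i
    proof -
      let ?B = "fst (stage (Suc i))" and ?dg = "snd (stage (Suc i))"
      let ?k = "\<lambda>u. lincomb dec u = fzero"
      have *: "stage (Suc (Suc i)) = (syz ?B ?dg ?k, syz_deg ?B ?dg)"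
        by (subst stage.simps(2)) (simp only: Let_def nat.distinct if_False)
      have "x \<in> lincomb dec ` fcar (syz ?B ?dg ?k)" if x: "x \<in> fcar ?B" "?k x" for x
        by (rule syz_onto[OF x(1)]) (simp only: graded_hom_fcomp[OF hom x(1)] x(2) fcomp_zero)
      moreover have "lincomb dec f \<in> fcar ?B" "?k (lincomb dec f)"
        if f: "f \<in> fcar (syz ?B ?dg ?k)" for f
        using graded_hom_free(1)[OF syz_hom f] syz_in_kernel[OF hom _ f] by blast+
      ultimately show ?thesis
        unfolding R * fst_conv snd_conv free_module_simps by blast
    qed
  qed
qed

end

section \<open>Koszul chains\<close>

text \<open>The subspace \<open>U\<close> is a partial linear function in disguise: the coordinate \<open>None\<close> holds the value and the
  coordinates \<open>Some b\<close> the argument, and the last hypothesis says that the value is determined by the argument.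
  A linear right inverse of the projection to the arguments extends it to the whole space.\<close>

lemma functional_extension:
  fixes U :: "('b option \<Rightarrow> rat) set"
  assumes zero: "(\<lambda>_. 0) \<in> U" and add: "\<And>f g. f \<in> U \<Longrightarrow> g \<in> U \<Longrightarrow> (\<lambda>b. f b + g b) \<in> U"
    and smult: "\<And>q f. f \<in> U \<Longrightarrow> (\<lambda>b. q * f b) \<in> U"
    and inj: "\<And>f. f \<in> U \<Longrightarrow> (\<And>b. f (Some b) = 0) \<Longrightarrow> f None = 0"
  shows "\<exists>\<psi> :: ('b \<Rightarrow> rat) \<Rightarrow> rat. (\<forall>f g. \<psi> (\<lambda>b. f b + g b) = \<psi> f + \<psi> g) \<and>
    (\<forall>q f. \<psi> (\<lambda>b. q * f b) = q * \<psi> f) \<and> (\<forall>f\<in>U. \<psi> (\<lambda>b. f (Some b)) = f None)"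
proof -
  interpret vp: vector_space_pair "(\<lambda>q f b. q * f b) :: rat \<Rightarrow> ('b option \<Rightarrow> rat) \<Rightarrow> _"
    "(\<lambda>q f b. q * f b) :: rat \<Rightarrow> ('b \<Rightarrow> rat) \<Rightarrow> _"
    by unfold_locales (auto simp: fun_eq_iff algebra_simps)
  have lin: "Vector_Spaces.linear (\<lambda>q f b. q * f b) (\<lambda>q f b. q * f b)
      (\<lambda>(f :: 'b option \<Rightarrow> rat) b. f (Some b))"
    by unfold_locales (auto simp: fun_eq_iff algebra_simps)
  have sub: "vp.vs1.subspace U"
    using zero add smult by (auto simp: vp.vs1.subspace_def zero_fun_def plus_fun_def)
  obtain g where g: "range g \<subseteq> U"
      "Vector_Spaces.linear (\<lambda>q f b. q * f b) (\<lambda>q f b. q * f b) g"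
      "\<And>v. v \<in> (\<lambda>f b. f (Some b)) ` U \<Longrightarrow> (\<lambda>b. g v (Some b)) = v"
    using vp.linear_exists_right_inverse_on[OF lin sub] by blast
  interpret g: Vector_Spaces.linear "\<lambda>q f b. q * f b" "\<lambda>q f b. q * f b" g by (rule g(2))
  show ?thesis
  proof (intro exI[of _ "\<lambda>v. g v None"] conjI allI ballI)
    show "g (\<lambda>b. f b + h b) None = g f None + g h None" for f h
      using fun_cong[OF g.add[of f h], of None] by (simp only: plus_fun_def)
    show "g (\<lambda>b. q * f b) None = q * g f None" for q f
      using fun_cong[OF g.scale[of q f], of None] by simp
    fix f assume f: "f \<in> U"
    let ?v = "\<lambda>b. f (Some b)"
    have "g ?v \<in> U" using g(1) by (rule subsetD) (rule rangeI)
    then have "(\<lambda>b. f b + (-1) * g ?v b) \<in> U" by (rule add[OF f smult])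
    moreover have "?v \<in> (\<lambda>f b. f (Some b)) ` U"
      by (rule image_eqI[where x = f]) (simp_all add: f)
    then have "(\<lambda>b. g ?v (Some b)) = ?v" by (rule g(3))
    then have "g ?v (Some b) = f (Some b)" for b by (simp only: fun_eq_iff)
    ultimately have "f None + (-1) * g ?v None = 0"
      using inj[of "\<lambda>b. f b + (-1) * g ?v b"] by simp
    then show "g ?v None = f None" by simp
  qed
qed

text \<open>The sets \<open>I k n\<close> are the graded pieces of the right ideal generated by \<open>x 0, \<dots>, x (k - 1)\<close>; the last
  ideal is the augmentation ideal, and every colon ideal of successive members is again a member.\<close>

locale koszul_chain = conn_graded A for A :: "'a graded_algebra" (structure) +
  fixes x :: "nat \<Rightarrow> 'a" and N :: nat and I :: "nat \<Rightarrow> nat \<Rightarrow> 'a set"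
  assumes x_grade: "k < N \<Longrightarrow> x k \<in> grade A 1"
    and I_sub: "k \<le> N \<Longrightarrow> I k n \<subseteq> grade A n"
    and I_zero: "k \<le> N \<Longrightarrow> \<zero> \<in> I k n"
    and I_add: "\<lbrakk>k \<le> N; a \<in> I k n; b \<in> I k n\<rbrakk> \<Longrightarrow> a \<oplus> b \<in> I k n"
    and I_uminus: "\<lbrakk>k \<le> N; a \<in> I k n\<rbrakk> \<Longrightarrow> \<ominus> a \<in> I k n"
    and I_bot: "I 0 n = {\<zero>}"
    and I_top: "I N (Suc n) = grade A (Suc n)"
    and I_deg_0: "k \<le> N \<Longrightarrow> I k 0 = {\<zero>}"
    and I_Suc: "k < N \<Longrightarrow>
      I (Suc k) (Suc n) = {x k \<otimes> u \<oplus> c | u c. u \<in> grade A n \<and> c \<in> I k (Suc n)}"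
    and I_colon: "k < N \<Longrightarrow>
      \<exists>q\<le>N. \<forall>n. \<forall>u\<in>grade A n. x k \<otimes> u \<in> I k (Suc n) \<longleftrightarrow> u \<in> I q n"
begin

definition igr :: "nat \<Rightarrow> int \<Rightarrow> 'a set" where
  "igr k n = (if n \<ge> 0 then I k (nat n) else {\<zero>})"

lemma igr_igrade: "k \<le> N \<Longrightarrow> a \<in> igr k n \<Longrightarrow> a \<in> igrade n"
  using I_sub by (auto simp: igr_def igrade_def split: if_splits)

lemma igr_zero: "k \<le> N \<Longrightarrow> \<zero> \<in> igr k n"
  and igr_add: "k \<le> N \<Longrightarrow> a \<in> igr k n \<Longrightarrow> b \<in> igr k n \<Longrightarrow> a \<oplus> b \<in> igr k n"
  and igr_uminus: "k \<le> N \<Longrightarrow> a \<in> igr k n \<Longrightarrow> \<ominus> a \<in> igr k n"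
  using I_zero I_add I_uminus by (auto simp: igr_def split: if_splits)

lemma igr_nonpos: "k \<le> N \<Longrightarrow> n < 1 \<Longrightarrow> a \<in> igr k n \<Longrightarrow> a = \<zero>"
  using I_deg_0[of k] by (cases "n = 0") (simp_all add: igr_def)

lemma x_closed: "k < N \<Longrightarrow> x k \<in> carrier A"
  by (rule grade_carrier[OF x_grade])

lemma igr_mult_x:
  assumes k: "k < N" and u: "u \<in> igrade (n - 1)"
  shows "x k \<otimes> u \<in> igr (Suc k) n"
proof (cases "n \<ge> 1")
  case True
  then have n: "nat n = Suc (nat (n - 1))" by simp
  have "u \<in> grade A (nat (n - 1))" using u True by (simp add: igrade_def)
  moreover have "\<zero> \<in> I k (nat n)" using I_zero k by simp
  moreover have "x k \<otimes> u = x k \<otimes> u \<oplus> \<zero>"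
    using calculation(1) k by (simp add: x_closed grade_carrier)
  ultimately have "x k \<otimes> u \<in> I (Suc k) (nat n)" unfolding n I_Suc[OF k] by blast
  then show ?thesis using True by (simp add: igr_def)
next
  case False
  then have "u = \<zero>" using u by (simp add: igrade_def)
  then show ?thesis using k by (simp add: x_closed igr_zero)
qed

lemma igr_mono: assumes k: "k < N" and a: "a \<in> igr k n" shows "a \<in> igr (Suc k) n"
proof (cases "n \<ge> 1")
  case True
  then have n: "nat n = Suc (nat (n - 1))" by simp
  have "a \<in> I k (nat n)" using a True by (simp add: igr_def)
  moreover have "a = x k \<otimes> \<zero> \<oplus> a"
    using k igr_igrade[OF _ a] by (simp add: x_closed igrade_carrier)
  moreover have "\<zero> \<in> grade A (nat (n - 1))" by simp
  ultimately have "a \<in> I (Suc k) (nat n)" unfolding n I_Suc[OF k] by blast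
  then show ?thesis using True by (simp add: igr_def)
next
  case False
  then have "a = \<zero>" using igr_nonpos[OF _ _ a] k by simp
  then show ?thesis using k by (simp add: igr_zero)
qed

lemma igr_decomp:
  assumes k: "k < N" and a: "a \<in> igr (Suc k) n"
  obtains u c where "u \<in> igrade (n - 1)" "c \<in> igr k n" "a = x k \<otimes> u \<oplus> c" "a = \<zero> \<longrightarrow> u = \<zero> \<and> c = \<zero>"
proof (cases "n \<ge> 1 \<and> a \<noteq> \<zero>")
  case True
  then have "n \<ge> 1" by blast
  then have n: "nat n = Suc (nat (n - 1))" by simp
  have "a \<in> I (Suc k) (nat n)" using a True by (simp add: igr_def)
  then obtain u c where uc: "u \<in> grade A (nat (n - 1))" "c \<in> I k (nat n)" "a = x k \<otimes> u \<oplus> c"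
    unfolding n I_Suc[OF k] by blast
  show ?thesis
  proof (rule that[OF _ _ uc(3)])
    show "u \<in> igrade (n - 1)" "c \<in> igr k n" using uc True by (simp_all add: igr_def igrade_def)
  qed (use True in blast)
next
  case False
  then have "a = \<zero>" using igr_nonpos[OF _ _ a] k by (cases "n \<ge> 1") simp_all
  then show ?thesis using that[of \<zero> \<zero>] k by (simp add: x_closed igr_zero)
qed

lemma igr_colon:
  assumes k: "k < N"
  obtains q where "q \<le> N" "\<And>n u. u \<in> igrade n \<Longrightarrow> x k \<otimes> u \<in> igr k (n + 1) \<longleftrightarrow> u \<in> igr q n"
proof -
  obtain q where q: "q \<le> N" "\<And>n u. u \<in> grade A n \<Longrightarrow> x k \<otimes> u \<in> I k (Suc n) \<longleftrightarrow> u \<in> I q n"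
    using I_colon[OF k] by blast
  have "x k \<otimes> u \<in> igr k (n + 1) \<longleftrightarrow> u \<in> igr q n" if u: "u \<in> igrade n" for n u
  proof (cases "n \<ge> 0")
    case True
    then show ?thesis using q(2)[of u "nat n"] u by (simp add: igr_def igrade_def nat_add_distrib)
  next
    case False
    then have "u = \<zero>" using u by (simp add: igrade_def)
    then show ?thesis using k q(1) by (simp add: x_closed igr_zero)
  qed
  then show ?thesis using that q(1) by blast
qed

text \<open>The component of degree \<open>n\<close> of the submodule \<open>I\<^sub>k F\<close> of a free module \<open>F\<close>.\<close>

definition fideal :: "'b set \<Rightarrow> ('b \<Rightarrow> int) \<Rightarrow> nat \<Rightarrow> int \<Rightarrow> ('b \<Rightarrow> 'a) set" where
  "fideal B dg k n = {f \<in> fgrade B dg n. \<forall>b. f b \<in> igr k (n - dg b)}"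

lemma fideal_fgrade: "f \<in> fideal B dg k n \<Longrightarrow> f \<in> fgrade B dg n"
  and fideal_igr: "f \<in> fideal B dg k n \<Longrightarrow> f b \<in> igr k (n - dg b)"
  by (simp_all add: fideal_def)

lemma fideal_fcar: "f \<in> fideal B dg k n \<Longrightarrow> f \<in> fcar B"
  by (rule fgrade_fcar[OF fideal_fgrade])

lemma fideal_zero: "k \<le> N \<Longrightarrow> fzero \<in> fideal B dg k n"
  by (simp add: fideal_def, simp add: fzero_def igr_zero)

lemma fideal_add:
  "\<lbrakk>k \<le> N; f \<in> fideal B dg k n; g \<in> fideal B dg k n\<rbrakk> \<Longrightarrow> fadd f g \<in> fideal B dg k n"
  by (simp add: fideal_def, simp add: fadd_def igr_add)

lemma fideal_neg: "k \<le> N \<Longrightarrow> f \<in> fideal B dg k n \<Longrightarrow> fneg f \<in> fideal B dg k n"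
  using fneg_apply[OF fideal_fcar, of f B dg k n] fideal_igr[of f B dg k n]
  by (simp add: fideal_def igr_uminus)

lemma fideal_0: "f \<in> fideal B dg 0 n \<Longrightarrow> f = fzero"
proof
  fix b assume "f \<in> fideal B dg 0 n"
  from fideal_igr[OF this, of b] show "f b = fzero b"
    using I_bot by (auto simp: igr_def fzero_def split: if_splits)
qed

text \<open>The last ideal of the chain is the kernel of the augmentation.\<close>

lemma fideal_top: "fideal B dg N n = {f \<in> fgrade B dg n. \<forall>b. augmentation A (f b) = 0}"
proof -
  have "a \<in> igr N m \<longleftrightarrow> augmentation A a = 0" if a: "a \<in> igrade m" for a m
  proof (cases "m \<ge> 1")
    case True
    then have n: "nat m = Suc (nat (m - 1))" by simp
    show ?thesis
      using a True I_top[of "nat (m - 1)"] aug_igrade[OF a] n[symmetric] by (simp add: igr_def igrade_def)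
  next
    case False
    then consider "m = 0" | "m < 0" by linarith
    then show ?thesis
    proof cases
      case 1
      then have "a \<in> grade A 0" using a by (simp add: igrade_def)
      then show ?thesis using 1 I_deg_0[of N] aug_eq_0_grade_0[of a] by (auto simp: igr_def)
    next
      case 2
      then have "a = \<zero>" using a by (simp add: igrade_def)
      then show ?thesis by (simp add: igr_zero)
    qed
  qed
  then have "f b \<in> igr N (n - dg b) \<longleftrightarrow> augmentation A (f b) = 0" if "f \<in> fgrade B dg n" for f b
    using fgrade_igrade[OF that, of b] by (simp only:)
  then show ?thesis by (simp add: fideal_def cong: conj_cong)
qed

lemma fideal_mult_x:
  assumes "k < N" "u \<in> fgrade B dg (n - 1)" shows "fsmult (x k) u \<in> fideal B dg (Suc k) n"
proof -
  have "x k \<otimes> u b \<in> igr (Suc k) (n - dg b)" for b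
    using igr_mult_x[of k "u b" "n - dg b"] assms(1) fgrade_igrade[OF assms(2), of b]
    by (simp add: algebra_simps)
  moreover have "fsmult (x k) u \<in> fgrade B dg n"
    using fgrade_smult[of "x k" 1 u B dg "n - 1"] x_grade[OF assms(1)] assms(2) by (simp add: igrade_def)
  ultimately show ?thesis by (simp add: fideal_def) (simp add: fsmult_def)
qed

lemma fideal_mono: "k < N \<Longrightarrow> f \<in> fideal B dg k n \<Longrightarrow> f \<in> fideal B dg (Suc k) n"
  by (simp add: fideal_def igr_mono)

lemma fideal_decomp:
  assumes k: "k < N" and f: "f \<in> fideal B dg (Suc k) n"
  obtains u p where "u \<in> fgrade B dg (n - 1)" "p \<in> fideal B dg k n" "f = fadd (fsmult (x k) u) p"
proof -
  have "\<forall>b. \<exists>uc. fst uc \<in> igrade (n - dg b - 1) \<and> snd uc \<in> igr k (n - dg b) \<and>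
      f b = x k \<otimes> fst uc \<oplus> snd uc \<and> (f b = \<zero> \<longrightarrow> fst uc = \<zero> \<and> snd uc = \<zero>)"
    using igr_decomp[OF k fideal_igr[OF f]] by (metis fst_conv snd_conv)
  then obtain uc where uc: "\<And>b. fst (uc b) \<in> igrade (n - dg b - 1)"
      "\<And>b. snd (uc b) \<in> igr k (n - dg b)" "\<And>b. f b = x k \<otimes> fst (uc b) \<oplus> snd (uc b)"
      "\<And>b. f b = \<zero> \<Longrightarrow> fst (uc b) = \<zero>" "\<And>b. f b = \<zero> \<Longrightarrow> snd (uc b) = \<zero>"
    by metis
  have fc: "f \<in> fcar B" by (rule fideal_fcar[OF f])
  have car: "snd (uc b) \<in> igrade (n - dg b)" for b
    using igr_igrade[OF _ uc(2)] k by simp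
  have u: "(\<lambda>b. fst (uc b)) \<in> fcar B"
    by (rule fcarI[where S = "{b. f b \<noteq> \<zero>}"])
      (use uc(1,4) fcar_finite[OF fc] fcar_outside[OF fc] in \<open>auto intro: igrade_carrier\<close>)
  have p: "(\<lambda>b. snd (uc b)) \<in> fcar B"
    by (rule fcarI[where S = "{b. f b \<noteq> \<zero>}"])
      (use car uc(5) fcar_finite[OF fc] fcar_outside[OF fc] in \<open>auto intro: igrade_carrier\<close>)
  show ?thesis
  proof (rule that[of "\<lambda>b. fst (uc b)" "\<lambda>b. snd (uc b)"])
    show "(\<lambda>b. fst (uc b)) \<in> fgrade B dg (n - 1)"
      using u uc(1) by (simp add: fgrade_def algebra_simps)
    show "(\<lambda>b. snd (uc b)) \<in> fideal B dg k n"
      using p car uc(2) by (simp add: fideal_def fgrade_def)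
    show "f = fadd (fsmult (x k) (\<lambda>b. fst (uc b))) (\<lambda>b. snd (uc b))"
      using uc(3) by (simp add: fun_eq_iff fadd_def fsmult_def)
  qed
qed

text \<open>The bound \<open>q\<close> is chosen before the free module, so that one index serves all terms of a resolution.\<close>

lemma fideal_colon:
  assumes k: "k < N"
  obtains q where "q \<le> N" "\<And>B :: 'b set. \<And>dg n u. u \<in> fgrade B dg n \<Longrightarrow>
    fsmult (x k) u \<in> fideal B dg k (n + 1) \<longleftrightarrow> u \<in> fideal B dg q n"
proof -
  obtain q where q: "q \<le> N" "\<And>n u. u \<in> igrade n \<Longrightarrow> x k \<otimes> u \<in> igr k (n + 1) \<longleftrightarrow> u \<in> igr q n"
    using igr_colon[OF k] by blast
  have "fsmult (x k) u \<in> fideal B dg k (n + 1) \<longleftrightarrow> u \<in> fideal B dg q n"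
    if u: "u \<in> fgrade B dg n" for B :: "'b set" and dg n u
  proof -
    have "fsmult (x k) u \<in> fgrade B dg (n + 1)"
      using fideal_fgrade[OF fideal_mult_x[OF k, of u B dg "n + 1"]] u by simp
    moreover have "x k \<otimes> u b \<in> igr k (n + 1 - dg b) \<longleftrightarrow> u b \<in> igr q (n - dg b)" for b
      using q(2)[OF fgrade_igrade[OF u], of b] by (simp add: algebra_simps)
    ultimately show ?thesis using u by (simp add: fideal_def) (simp add: fsmult_def)
  qed
  then show ?thesis using that q(1) by blast
qed

text \<open>Homomorphisms are linear from the left and \<open>I\<^sub>k\<close> is a right ideal: if \<open>f\<close> has coefficients in the ideal,
  then so has the combination \<open>\<Sum>\<^sub>b f b \<cdot> d b\<close>.\<close>

lemma hom_fideal: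
  assumes d: "d \<in> graded_hom A (free_module A B dg) (free_module A B' dg') 0"
  shows "k \<le> N \<Longrightarrow> f \<in> fideal B dg k n \<Longrightarrow> d f \<in> fideal B' dg' k n"
proof (induction k arbitrary: f)
  case 0
  then show ?case using fideal_0[OF 0(2)] graded_hom_free_zero[OF d] fideal_zero[of 0] by simp
next
  case (Suc k)
  then have k: "k < N" by simp
  obtain u p where u: "u \<in> fgrade B dg (n - 1)" and p: "p \<in> fideal B dg k n"
      and f: "f = fadd (fsmult (x k) u) p"
    using fideal_decomp[OF k Suc.prems(2)] by blast
  have uc: "u \<in> fcar B" and pc: "p \<in> fcar B" using u p fgrade_fcar fideal_fcar by blast+
  have "d u \<in> fgrade B' dg' (n - 1)" using graded_hom_free(4)[OF d u] by simp
  then have "fsmult (x k) (d u) \<in> fideal B' dg' (Suc k) n" by (rule fideal_mult_x[OF k])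
  moreover have "d p \<in> fideal B' dg' (Suc k) n" by (rule fideal_mono[OF k Suc.IH[OF _ p]]) (use k in simp)
  moreover have "d f = fadd (fsmult (x k) (d u)) (d p)"
    using uc pc k by (simp add: f graded_hom_free(2,3)[OF d] x_closed)
  ultimately show ?case using fideal_add Suc.prems(1) by simp
qed

text \<open>Coefficients in \<open>I\<^sub>k\<close> have positive degree and are killed by the augmentation.\<close>

lemma hom_trivial_fideal:
  assumes d: "d \<in> graded_hom A (free_module A B dg) (trivial_module A) j"
  shows "k \<le> N \<Longrightarrow> f \<in> fideal B dg k n \<Longrightarrow> d f = 0"
proof (induction k arbitrary: f)
  case 0
  then show ?case using fideal_0[OF 0(2)] graded_hom_trivial_zero[OF d] by simp
next
  case (Suc k)
  then have k: "k < N" by simp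
  obtain u p where u: "u \<in> fgrade B dg (n - 1)" and p: "p \<in> fideal B dg k n"
      and f: "f = fadd (fsmult (x k) u) p"
    using fideal_decomp[OF k Suc.prems(2)] by blast
  have uc: "u \<in> fcar B" and pc: "p \<in> fcar B" using u p fgrade_fcar fideal_fcar by blast+
  have "d f = augmentation A (x k) * d u + d p"
    using uc pc k by (simp add: f graded_hom_trivial(1,2)[OF d] x_closed)
  then show ?case using Suc.IH[OF _ p] k aug_grade[OF x_grade[OF k]] by simp
qed

context
  fixes R :: "('a, 'b) resolution"
  assumes R: "graded_free_resolution A R"
begin

abbreviation "Bs \<equiv> res_basis R"
abbreviation "ds \<equiv> res_deg R"
abbreviation "d \<equiv> res_diff R"

lemma d_hom: "d i \<in> graded_hom A (free_module A (Bs (Suc i)) (ds (Suc i))) (free_module A (Bs i) (ds i)) 0"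
  using R by (simp add: graded_free_resolution_def res_term_def)

lemmas d_fcar = graded_hom_free(1)[OF d_hom]
  and d_add = graded_hom_free(2)[OF d_hom]
  and d_smult = graded_hom_free(3)[OF d_hom]
  and d_zero = graded_hom_free_zero[OF d_hom]

lemma d_fgrade: "f \<in> fgrade (Bs (Suc i)) (ds (Suc i)) n \<Longrightarrow> d i f \<in> fgrade (Bs i) (ds i) n"
  using graded_hom_free(4)[OF d_hom] by force

lemma d_neg: "f \<in> fcar (Bs (Suc i)) \<Longrightarrow> d i (fneg f) = fneg (d i f)"
  by (simp add: fneg_def d_smult)

lemma exact: "{y \<in> fcar (Bs (Suc i)). d i y = fzero} = d (Suc i) ` fcar (Bs (Suc (Suc i)))"
  using R by (simp add: graded_free_resolution_def res_term_def)

lemma d_d: assumes "f \<in> fcar (Bs (Suc (Suc i)))" shows "d i (d (Suc i) f) = fzero"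
proof -
  have "d (Suc i) f \<in> d (Suc i) ` fcar (Bs (Suc (Suc i)))" using assms by (rule imageI)
  then show ?thesis unfolding exact[symmetric] by simp
qed

lemma exact_homogeneous:
  assumes f: "f \<in> fgrade (Bs (Suc i)) (ds (Suc i)) n" and 0: "d i f = fzero"
  obtains w where "w \<in> fgrade (Bs (Suc (Suc i))) (ds (Suc (Suc i))) n" "f = d (Suc i) w"
proof -
  have "f \<in> d (Suc i) ` fcar (Bs (Suc (Suc i)))"
    using f 0 unfolding exact[symmetric] by (simp add: fgrade_fcar)
  then obtain w where w: "w \<in> fcar (Bs (Suc (Suc i)))" "f = d (Suc i) w" by blast
  have "d (Suc i) (fcomp (ds (Suc (Suc i))) n w) = f"
    using graded_hom_fcomp[OF d_hom w(1)] fcomp_of_fgrade[OF f] w(2) by simp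
  then show ?thesis using that fcomp_fgrade[OF w(1)] by metis
qed

lemma exact_homogeneous_0:
  assumes f: "f \<in> fgrade (Bs 0) (ds 0) n" and n: "n \<noteq> 0"
  obtains w where "w \<in> fgrade (Bs 1) (ds 1) n" "f = d 0 w"
proof -
  have "res_aug R \<in> graded_hom A (free_module A (Bs 0) (ds 0)) (trivial_module A) 0"
    using R by (simp add: graded_free_resolution_def res_term_def)
  from graded_hom_trivial(3)[OF this f n] have "res_aug R f = 0" .
  then have "f \<in> d 0 ` fcar (Bs 1)"
    using R f by (auto simp: graded_free_resolution_def res_term_def fgrade_fcar)
  then obtain w where w: "w \<in> fcar (Bs (Suc 0))" "f = d 0 w" by auto
  have "d 0 (fcomp (ds (Suc 0)) n w) = f"
    using graded_hom_fcomp[OF d_hom w(1)] fcomp_of_fgrade[OF f] w(2) by simp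
  then show ?thesis using that fcomp_fgrade[OF w(1)] by (metis One_nat_def)
qed

text \<open>This is the vanishing of \<open>Tor\<^sub>i(A/I\<^sub>k, \<rat>)\<close> in internal degree \<open>j \<noteq> i\<close>, phrased for cycles modulo
  \<open>I\<^sub>k\<close>. The long exact sequence of \<open>0 \<rightarrow> A/I\<^sub>q(-1) \<rightarrow> A/I\<^sub>k \<rightarrow> A/I\<^sub>k\<^sub>+\<^sub>1 \<rightarrow> 0\<close> is replaced by chasing elements:
  write \<open>d f = x\<^sub>k u + p\<close> with \<open>p\<close> in \<open>I\<^sub>k F\<close>. Then \<open>u\<close> is a cycle modulo the colon ideal, so by induction on \<open>i\<close> it
  equals some \<open>d w\<close> modulo that ideal, and \<open>f - x\<^sub>k w\<close> is a cycle modulo \<open>I\<^sub>k\<close>, to which the induction on \<open>k\<close>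
  applies. Both \<open>j\<close> and \<open>i\<close> drop by one in the first step, so they stay different.\<close>

lemma homology_mod_ideal:
  "\<lbrakk>k \<le> N; j \<noteq> int i; f \<in> fgrade (Bs i) (ds i) j;
    \<And>i'. i = Suc i' \<Longrightarrow> d i' f \<in> fideal (Bs i') (ds i') k j\<rbrakk> \<Longrightarrow>
    \<exists>w\<in>fgrade (Bs (Suc i)) (ds (Suc i)) j. \<exists>p\<in>fideal (Bs i) (ds i) k j. f = fadd (d i w) p"
proof (induction i arbitrary: k j f)
  case 0
  obtain w where w: "w \<in> fgrade (Bs 1) (ds 1) j" "f = d 0 w"
    using exact_homogeneous_0[OF 0(3)] 0(2) by auto
  have "d 0 w = fadd (d 0 w) fzero" using d_fcar[of w 0] w fgrade_fcar by force
  then show ?case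
    using w fideal_zero[OF 0(1)] by (intro bexI[of _ w] bexI[of _ fzero]) simp_all
next
  case (Suc i)
  note outer = Suc.IH
  have "\<And>f. k \<le> N \<Longrightarrow> f \<in> fgrade (Bs (Suc i)) (ds (Suc i)) j \<Longrightarrow> d i f \<in> fideal (Bs i) (ds i) k j \<Longrightarrow>
    \<exists>w\<in>fgrade (Bs (Suc (Suc i))) (ds (Suc (Suc i))) j. \<exists>p\<in>fideal (Bs (Suc i)) (ds (Suc i)) k j.
      f = fadd (d (Suc i) w) p"
  proof (induction k)
    case 0
    obtain w where w: "w \<in> fgrade (Bs (Suc (Suc i))) (ds (Suc (Suc i))) j" "f = d (Suc i) w"
      using exact_homogeneous[OF 0(2) fideal_0[OF 0(3)]] by blast
    have "d (Suc i) w = fadd (d (Suc i) w) fzero" using d_fcar[OF fgrade_fcar[OF w(1)]] by simp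
    then show ?case
      using w fideal_zero[OF 0(1)] by (intro bexI[of _ w] bexI[of _ fzero]) simp_all
  next
    case (Suc k)
    then have k: "k < N" "k \<le> N" by simp_all
    have fc: "f \<in> fcar (Bs (Suc i))" by (rule fgrade_fcar[OF Suc.prems(2)])
    obtain u p where u: "u \<in> fgrade (Bs i) (ds i) (j - 1)" and p: "p \<in> fideal (Bs i) (ds i) k j"
        and df: "d i f = fadd (fsmult (x k) u) p"
      using fideal_decomp[OF k(1) Suc.prems(3)] by blast
    have uc: "u \<in> fcar (Bs i)" and pc: "p \<in> fcar (Bs i)" using u p fgrade_fcar fideal_fcar by blast+
    have xk: "x k \<in> carrier A" by (rule x_closed[OF k(1)])
    obtain q where q: "q \<le> N" "\<And>B :: 'b set. \<And>dg n u. u \<in> fgrade B dg n \<Longrightarrow>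
        fsmult (x k) u \<in> fideal B dg k (n + 1) \<longleftrightarrow> u \<in> fideal B dg q n"
      using fideal_colon[OF k(1), where 'b = 'b] by blast
    \<comment> \<open>From \<open>d (d f) = 0\<close>: multiplication by \<open>x k\<close> sends \<open>d u\<close> to \<open>- d p\<close>, hence into the smaller ideal,
      so \<open>d u\<close> lies in the colon ideal.\<close>
    have "d i' u \<in> fideal (Bs i') (ds i') q (j - 1)" if i': "i = Suc i'" for i'
    proof -
      note u' = u[unfolded i'] and uc' = uc[unfolded i'] and pc' = pc[unfolded i'] and p' = p[unfolded i']
      have du: "d i' u \<in> fcar (Bs i')" and dp: "d i' p \<in> fcar (Bs i')" by (rule d_fcar uc' pc')+
      have "fzero = d i' (d i f)" using d_d fc by (simp add: i')
      also have "\<dots> = fadd (fsmult (x k) (d i' u)) (d i' p)"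
        unfolding df using uc' pc' xk by (simp add: d_add d_smult)
      finally have eq: "fadd (fsmult (x k) (d i' u)) (d i' p) = fzero" ..
      have "fsmult (x k) (d i' u) = fneg (d i' p)"
      proof -
        have "fsmult (x k) (d i' u) = fadd (fsmult (x k) (d i' u)) (fadd (d i' p) (fneg (d i' p)))"
          using dp fadd_fzero(1)[OF fsmult_closed[OF xk du]] by simp
        also have "\<dots> = fadd (fadd (fsmult (x k) (d i' u)) (d i' p)) (fneg (d i' p))"
          using du dp xk by (intro fadd_assoc[symmetric, of _ "Bs i'"]) auto
        finally show ?thesis using fadd_fzero(2)[OF fneg_closed[OF dp]] by (simp add: eq)
      qed
      then have "fsmult (x k) (d i' u) \<in> fideal (Bs i') (ds i') k j"
        using fideal_neg[OF k(2) hom_fideal[OF d_hom k(2) p']] by simp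
      then show ?thesis using q(2)[OF d_fgrade[OF u']] by simp
    qed
    then obtain w p' where w: "w \<in> fgrade (Bs (Suc i)) (ds (Suc i)) (j - 1)"
        and p': "p' \<in> fideal (Bs i) (ds i) q (j - 1)" and u_eq: "u = fadd (d i w) p'"
      using outer[of q "j - 1" u] q(1) Suc(4) u \<open>j \<noteq> int (Suc i)\<close> by auto
    have wc: "w \<in> fcar (Bs (Suc i))" and p'c: "p' \<in> fcar (Bs i)"
      using w p' fgrade_fcar fideal_fcar by blast+
    have xp': "fsmult (x k) p' \<in> fideal (Bs i) (ds i) k j"
      using q(2)[OF fideal_fgrade[OF p']] p' by simp
    \<comment> \<open>The multiple of \<open>d w\<close> in \<open>d f\<close> cancels, leaving \<open>x\<^sub>k p' + p\<close>, which lies in the smaller ideal.\<close>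
    define g where "g = fadd f (fneg (fsmult (x k) w))"
    have xw: "fsmult (x k) w \<in> fideal (Bs (Suc i)) (ds (Suc i)) (Suc k) j"
      by (rule fideal_mult_x[OF k(1) w])
    have xwc: "fsmult (x k) w \<in> fcar (Bs (Suc i))" by (rule fideal_fcar[OF xw])
    have g: "g \<in> fgrade (Bs (Suc i)) (ds (Suc i)) j"
      unfolding g_def using Suc.prems(2) fideal_fgrade[OF xw] by simp
    have dwc: "d i w \<in> fcar (Bs i)" by (rule d_fcar[OF wc])
    have "d i g = fadd (fadd (fadd (fsmult (x k) (d i w)) (fsmult (x k) p')) p) (fneg (fsmult (x k) (d i w)))"
    proof -
      have "fsmult (x k) u = fadd (fsmult (x k) (d i w)) (fsmult (x k) p')"
        using dwc p'c xk by (auto simp: u_eq fun_eq_iff fsmult_def fadd_def r_distr fcar_carrier)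
      then show ?thesis unfolding g_def using fc xwc wc xk by (simp add: d_add d_neg d_smult df)
    qed
    also have "\<dots> = fadd (fsmult (x k) p') p"
    proof
      fix b
      have c: "d i w b \<in> carrier A" "p' b \<in> carrier A" "p b \<in> carrier A"
        using dwc p'c pc by (auto intro: fcar_carrier)
      then show "fadd (fadd (fadd (fsmult (x k) (d i w)) (fsmult (x k) p')) p) (fneg (fsmult (x k) (d i w))) b =
          fadd (fsmult (x k) p') p b"
        using xk dwc fneg_apply[of "fsmult (x k) (d i w)" "Bs i" b]
        by (simp add: fadd_def) (simp add: fsmult_def a_ac r_neg r_neg2 r_neg1)
    qed
    also have "\<dots> \<in> fideal (Bs i) (ds i) k j" by (rule fideal_add[OF k(2) xp' p])
    finally obtain w2 p2 where w2: "w2 \<in> fgrade (Bs (Suc (Suc i))) (ds (Suc (Suc i))) j"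
        and p2: "p2 \<in> fideal (Bs (Suc i)) (ds (Suc i)) k j" and g_eq: "g = fadd (d (Suc i) w2) p2"
      using Suc.IH[OF k(2) g] by blast
    have "f = fadd g (fsmult (x k) w)"
    proof
      fix b
      have "f b \<in> carrier A" "fsmult (x k) w b \<in> carrier A"
        using fc xwc by (auto intro: fcar_carrier)
      then show "f b = fadd g (fsmult (x k) w) b"
        unfolding g_def by (simp add: fadd_def fneg_apply[OF xwc] a_assoc l_neg)
    qed
    also have "\<dots> = fadd (d (Suc i) w2) (fadd p2 (fsmult (x k) w))"
      unfolding g_eq
      by (rule fadd_assoc[OF d_fcar[OF fgrade_fcar[OF w2]] fideal_fcar[OF p2] xwc])
    finally show ?case
      using w2 fideal_add[OF Suc.prems(1) fideal_mono[OF k(1) p2] xw] by blast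
  qed
  then show ?case using Suc.prems by blast
qed

text \<open>An element whose boundary has coefficients in the augmentation ideal is a cycle of \<open>\<rat> \<otimes> F\<close>. It is
  therefore a boundary up to an element of the augmentation ideal, and a cocycle kills both parts.\<close>

lemma cocycle_vanishes:
  assumes f: "f \<in> graded_hom A (free_module A (Bs i) (ds i)) (trivial_module A) j"
    and cocycle: "\<And>w. w \<in> fcar (Bs (Suc i)) \<Longrightarrow> f (d i w) = 0" and j: "j \<noteq> int i"
    and y: "y \<in> fgrade (Bs i) (ds i) j" "\<And>i'. i = Suc i' \<Longrightarrow> d i' y \<in> fideal (Bs i') (ds i') N j"
  shows "f y = 0"
proof -
  obtain w p where w: "w \<in> fgrade (Bs (Suc i)) (ds (Suc i)) j" and p: "p \<in> fideal (Bs i) (ds i) N j"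
      and "y = fadd (d i w) p"
    using homology_mod_ideal[OF _ j y] by blast
  then have "f y = f (d i w) + f p"
    using graded_hom_trivial(1)[OF f] d_fcar[OF fgrade_fcar[OF w]] fideal_fcar[OF p] by simp
  then show ?thesis using cocycle[OF fgrade_fcar[OF w]] hom_trivial_fideal[OF f _ p] by simp
qed

text \<open>The value \<open>f y\<close> depends only on the augmented coefficients of \<open>d y\<close>, because \<open>f\<close> vanishes where these
  vanish. Extending this dependence to all families of rational numbers gives the cochain \<open>g\<close>.\<close>

lemma cocycle_is_coboundary:
  assumes f: "f \<in> graded_hom A (free_module A (Bs (Suc i)) (ds (Suc i))) (trivial_module A) j"
    and cocycle: "\<And>w. w \<in> fcar (Bs (Suc (Suc i))) \<Longrightarrow> f (d (Suc i) w) = 0" and j: "j \<noteq> int (Suc i)"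
  obtains g where "g \<in> graded_hom A (free_module A (Bs i) (ds i)) (trivial_module A) j"
    "\<And>y. y \<in> fcar (Bs (Suc i)) \<Longrightarrow> f y = g (d i y)"
proof -
  let ?Z = "fgrade (Bs (Suc i)) (ds (Suc i)) j"
  \<comment> \<open>Value and argument of the partial functional, for elements of internal degree \<open>j\<close>.\<close>
  define \<rho> where "\<rho> y = case_option (f y) (\<lambda>b. augmentation A (d i y b))" for y
  have Zc: "y \<in> fcar (Bs (Suc i))" if "y \<in> ?Z" for y by (rule fgrade_fcar[OF that])
  have dc: "d i y b \<in> carrier A" if "y \<in> ?Z" for y b by (rule fcar_carrier[OF d_fcar[OF Zc[OF that]]])
  have "\<exists>\<psi> :: ('b \<Rightarrow> rat) \<Rightarrow> rat. (\<forall>f g. \<psi> (\<lambda>b. f b + g b) = \<psi> f + \<psi> g) \<and>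
    (\<forall>q f. \<psi> (\<lambda>b. q * f b) = q * \<psi> f) \<and> (\<forall>F\<in>\<rho> ` ?Z. \<psi> (\<lambda>b. F (Some b)) = F None)"
  proof (rule functional_extension[of "\<rho> ` ?Z"])
    have "\<rho> fzero = (\<lambda>_. 0)"
      by (auto simp: \<rho>_def fun_eq_iff d_zero graded_hom_trivial_zero[OF f] split: option.splits)
        (simp add: fzero_def)
    then show "(\<lambda>_. 0) \<in> \<rho> ` ?Z" using fgrade_zero by (metis imageI)
  next
    fix F G assume "F \<in> \<rho> ` ?Z" "G \<in> \<rho> ` ?Z"
    then obtain y z where yz: "F = \<rho> y" "G = \<rho> z" "y \<in> ?Z" "z \<in> ?Z" by blast
    then have "\<rho> (fadd y z) = (\<lambda>b. F b + G b)"
      using Zc[OF yz(3)] Zc[OF yz(4)] dc[OF yz(3)] dc[OF yz(4)]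
      by (auto simp: \<rho>_def fun_eq_iff d_add graded_hom_trivial(1)[OF f] split: option.splits)
        (simp add: fadd_def aug_add)
    then show "(\<lambda>b. F b + G b) \<in> \<rho> ` ?Z" using yz fgrade_add by (metis imageI)
  next
    fix q F assume "F \<in> \<rho> ` ?Z"
    then obtain y where y: "F = \<rho> y" "y \<in> ?Z" by blast
    then have "\<rho> (fsmult (q \<odot> \<one>) y) = (\<lambda>b. q * F b)"
      using Zc[OF y(2)] dc[OF y(2)]
      by (auto simp: \<rho>_def fun_eq_iff d_smult graded_hom_trivial(2)[OF f] split: option.splits)
        (simp add: fsmult_def aug_mult)
    moreover have "fsmult (q \<odot> \<one>) y \<in> ?Z"
      using fgrade_smult[of "q \<odot> \<one>" 0 y _ _ j] y by (simp add: igrade_def)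
    ultimately show "(\<lambda>b. q * F b) \<in> \<rho> ` ?Z" by (metis imageI)
  next
    fix F assume F: "F \<in> \<rho> ` ?Z" and 0: "\<And>b. F (Some b) = 0"
    then obtain y where y: "F = \<rho> y" "y \<in> ?Z" by blast
    have "d i y \<in> fideal (Bs i) (ds i) N j"
      using d_fgrade[OF y(2)] 0 y(1) by (simp add: fideal_top \<rho>_def)
    then have "f y = 0" by (intro cocycle_vanishes[OF f cocycle j y(2)]) auto
    then show "F None = 0" using y(1) by (simp add: \<rho>_def)
  qed
  then obtain \<psi> :: "('b \<Rightarrow> rat) \<Rightarrow> rat" where
    *: "(\<forall>f g. \<psi> (\<lambda>b. f b + g b) = \<psi> f + \<psi> g) \<and>
    (\<forall>q f. \<psi> (\<lambda>b. q * f b) = q * \<psi> f) \<and> (\<forall>F\<in>\<rho> ` ?Z. \<psi> (\<lambda>b. F (Some b)) = F None)" ..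
  then have \<psi>_add: "\<psi> (\<lambda>b. f b + g b) = \<psi> f + \<psi> g" and \<psi>_smult: "\<psi> (\<lambda>b. q * f b) = q * \<psi> f" for f g q
    by blast+
  have \<psi>: "\<psi> (\<lambda>b. F (Some b)) = F None" if "F \<in> \<rho> ` ?Z" for F
    using * that by blast
  have \<psi>_zero: "\<psi> (\<lambda>_. 0) = 0" using \<psi>_smult[of 0 "\<lambda>_. 0"] by simp
  \<comment> \<open>A cochain of degree \<open>j\<close> sees only the basis elements of degree \<open>j\<close>.\<close>
  define g where "g z = \<psi> (\<lambda>b. if ds i b = j then augmentation A (z b) else 0)" for z
  have g: "g \<in> graded_hom A (free_module A (Bs i) (ds i)) (trivial_module A) j"
  proof -
    have "g (fadd y z) = g y + g z" if "y \<in> fcar (Bs i)" "z \<in> fcar (Bs i)" for y z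
    proof -
      have "(\<lambda>b. if ds i b = j then augmentation A (fadd y z b) else 0) =
          (\<lambda>b. (if ds i b = j then augmentation A (y b) else 0) + (if ds i b = j then augmentation A (z b) else 0))"
        using fcar_carrier[OF that(1)] fcar_carrier[OF that(2)] by (auto simp: fun_eq_iff fadd_def aug_add)
      then show ?thesis by (simp add: g_def \<psi>_add)
    qed
    moreover have "g (fsmult a y) = augmentation A a * g y" if "a \<in> carrier A" "y \<in> fcar (Bs i)" for a y
    proof -
      have "(\<lambda>b. if ds i b = j then augmentation A (fsmult a y b) else 0) =
          (\<lambda>b. augmentation A a * (if ds i b = j then augmentation A (y b) else 0))"
        using fcar_carrier[OF that(2)] that(1) by (auto simp: fun_eq_iff fsmult_def aug_mult)
      then show ?thesis by (simp add: g_def \<psi>_smult)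
    qed
    moreover have "g y = 0" if y: "y \<in> fgrade (Bs i) (ds i) n" and n: "n \<noteq> j" for y n
    proof -
      have "(\<lambda>b. if ds i b = j then augmentation A (y b) else 0) = (\<lambda>_. 0)"
        using aug_igrade[OF fgrade_igrade[OF y]] n by (auto simp: fun_eq_iff)
      then show ?thesis by (simp add: g_def \<psi>_zero)
    qed
    ultimately show ?thesis by (auto simp: graded_hom_def)
  qed
  moreover have "f y = g (d i y)" if "y \<in> fcar (Bs (Suc i))" for y
    using that
  proof (induction y rule: free_module_induct[where dg = "ds (Suc i)"])
    case zero
    then show ?case by (simp add: d_zero graded_hom_trivial_zero[OF f] graded_hom_trivial_zero[OF g])
  next
    case (homogeneous n y)
    show ?case
    proof (cases "n = j")
      case True
      then have y: "y \<in> ?Z" using homogeneous by simp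
      have "augmentation A (d i y b) = 0" if "ds i b \<noteq> j" for b
        using aug_igrade[OF fgrade_igrade[OF d_fgrade[OF y]]] that by simp
      then have "(\<lambda>b. if ds i b = j then augmentation A (d i y b) else 0) = (\<lambda>b. \<rho> y (Some b))"
        by (auto simp: \<rho>_def fun_eq_iff)
      then have "g (d i y) = \<rho> y None" using \<psi>[of "\<rho> y"] y by (simp add: g_def)
      then show ?thesis by (simp add: \<rho>_def)
    next
      case False
      then show ?thesis
        using graded_hom_trivial(3)[OF f homogeneous] graded_hom_trivial(3)[OF g d_fgrade[OF homogeneous]]
        by simp
    qed
  next
    case (add y z)
    then show ?case
      by (simp add: d_add d_fcar graded_hom_trivial(1)[OF f] graded_hom_trivial(1)[OF g])
  qed
  ultimately show ?thesis using that by blast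
qed

abbreviation "cochains i j \<equiv> hom_group A (res_term A R i) (trivial_module A) j"

lemma cochains_carrier: "f \<in> carrier (cochains i j) \<longleftrightarrow>
    f \<in> graded_hom A (free_module A (Bs i) (ds i)) (trivial_module A) j \<and> f \<in> extensional (fcar (Bs i))"
  by (simp add: hom_group_def res_term_def)

lemma graded_hom_trivialI:
  assumes "\<And>x y. x \<in> fcar B \<Longrightarrow> y \<in> fcar B \<Longrightarrow> f (fadd x y) = f x + f y"
    and "\<And>a x. a \<in> carrier A \<Longrightarrow> x \<in> fcar B \<Longrightarrow> f (fsmult a x) = augmentation A a * f x"
    and "\<And>x n. x \<in> fgrade B dg n \<Longrightarrow> n \<noteq> j \<Longrightarrow> f x = 0"
  shows "f \<in> graded_hom A (free_module A B dg) (trivial_module A) j"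
proof -
  have "f ` fgrade B dg n \<subseteq> (if n = j then UNIV else {0})" for n
    using assms(3)[of _ n] by (cases "n = j") auto
  then show ?thesis using assms(1,2) by (simp add: graded_hom_def)
qed

lemma graded_hom_trivial_restrict:
  assumes f: "f \<in> graded_hom A (free_module A B dg) (trivial_module A) j"
  shows "(\<lambda>y\<in>fcar B. f y) \<in> graded_hom A (free_module A B dg) (trivial_module A) j"
  by (rule graded_hom_trivialI)
    (simp_all add: fgrade_fcar graded_hom_trivial(1,2)[OF f] graded_hom_trivial(3)[OF f])

lemma coboundaries_eq_cocycles:
  assumes j: "j \<noteq> int i" shows "coboundaries A R i j = cocycles A R i j"
proof
  have restrict: "(\<lambda>y\<in>fcar (Bs i). f y) \<in> carrier (cochains i j)"
    if "f \<in> graded_hom A (free_module A (Bs i) (ds i)) (trivial_module A) j" for i f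
    using graded_hom_trivial_restrict[OF that] by (simp add: cochains_carrier)
  show "coboundaries A R i j \<subseteq> cocycles A R i j"
  proof (cases i)
    case 0
    have "(\<lambda>y\<in>fcar (Bs 0). 0) \<in> carrier (cochains 0 j)"
      by (rule restrict) (auto simp: graded_hom_def)
    then show ?thesis using d_fcar[of _ 0] by (auto simp: 0 cocycles_def hom_group_def res_term_def)
  next
    case (Suc i')
    show ?thesis
    proof
      fix h assume "h \<in> coboundaries A R i j"
      then obtain f where h: "h = (\<lambda>y\<in>fcar (Bs i). f (d i' y))" and "f \<in> carrier (cochains i' j)"
        by (auto simp: Suc res_term_def)
      then have f: "f \<in> graded_hom A (free_module A (Bs i') (ds i')) (trivial_module A) j"
        by (simp add: cochains_carrier)
      have "(\<lambda>y. f (d i' y)) \<in> graded_hom A (free_module A (Bs i) (ds i)) (trivial_module A) j"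
        by (rule graded_hom_trivialI)
          (simp_all add: Suc d_add d_smult d_fcar graded_hom_trivial(1,2)[OF f]
            graded_hom_trivial(3)[OF f d_fgrade])
      then have "h \<in> carrier (cochains i j)" unfolding h by (rule restrict)
      then show "h \<in> cocycles A R i j"
        using d_fcar by (auto simp: cocycles_def res_term_def h Suc d_d graded_hom_trivial_zero[OF f])
    qed
  qed
  show "cocycles A R i j \<subseteq> coboundaries A R i j"
  proof
    fix f assume "f \<in> cocycles A R i j"
    then have f: "f \<in> graded_hom A (free_module A (Bs i) (ds i)) (trivial_module A) j"
        "f \<in> extensional (fcar (Bs i))" and c: "\<And>w. w \<in> fcar (Bs (Suc i)) \<Longrightarrow> f (d i w) = 0"
      unfolding cocycles_def mem_Collect_eq cochains_carrier by (auto simp: res_term_def)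
    show "f \<in> coboundaries A R i j"
    proof (cases i)
      case 0
      have "f y = 0" if "y \<in> fcar (Bs 0)" for y
        using that
      proof (induction y rule: free_module_induct[where dg = "ds 0"])
        case zero
        then show ?case by (rule graded_hom_trivial_zero[OF f(1)[unfolded 0]])
      next
        case (homogeneous n y)
        then show ?case
          using cocycle_vanishes[OF f(1) c j] graded_hom_trivial(3)[OF f(1)] by (cases "n = j") (auto simp: 0)
      next
        case (add y z)
        then show ?case by (simp add: graded_hom_trivial(1)[OF f(1)[unfolded 0]])
      qed
      then have "f = (\<lambda>y\<in>fcar (Bs 0). 0)" using f(2) by (auto simp: 0 extensional_def fun_eq_iff)
      then show ?thesis by (simp add: 0 hom_group_def res_term_def)
    next
      case (Suc i')
      obtain g where g: "g \<in> graded_hom A (free_module A (Bs i') (ds i')) (trivial_module A) j"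
          "\<And>y. y \<in> fcar (Bs i) \<Longrightarrow> f y = g (d i' y)"
        using cocycle_is_coboundary[OF f(1)[unfolded Suc] c[unfolded Suc] j[unfolded Suc]]
        unfolding Suc by blast
      have "f = (\<lambda>y\<in>fcar (Bs (Suc i')). (\<lambda>z\<in>fcar (Bs i'). g z) (d i' y))"
        using f(2) g(2) d_fcar by (auto simp: Suc extensional_def fun_eq_iff)
      then show ?thesis
        unfolding Suc coboundaries.simps res_term_def free_module_simps
        by (rule image_eqI[where x = "\<lambda>z\<in>fcar (Bs i'). g z"])
          (use restrict[OF g(1)] in \<open>simp_all add: res_term_def\<close>)
    qed
  qed
qed

lemma cocycles_group: "group ((cochains i j)\<lparr>carrier := cocycles A R i j\<rparr>)"
proof -
  have eq: "f \<in> cocycles A R i j \<longleftrightarrow>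
      f \<in> graded_hom A (free_module A (Bs i) (ds i)) (trivial_module A) j \<and>
      f \<in> extensional (fcar (Bs i)) \<and> (\<forall>w\<in>fcar (Bs (Suc i)). f (d i w) = 0)" for f
    by (auto simp: cocycles_def cochains_carrier) (auto simp: res_term_def)
  have restrict: "(\<lambda>y\<in>fcar (Bs i). f y) \<in> cocycles A R i j"
    if "f \<in> graded_hom A (free_module A (Bs i) (ds i)) (trivial_module A) j"
      "\<forall>w\<in>fcar (Bs (Suc i)). f (d i w) = 0" for f
    using graded_hom_trivial_restrict[OF that(1)] that(2) by (simp add: eq d_fcar)
  have add: "(\<lambda>y\<in>fcar (Bs i). f y + g y) \<in> cocycles A R i j"
    if "f \<in> cocycles A R i j" "g \<in> cocycles A R i j" for f g
  proof (rule restrict)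
    have f: "f \<in> graded_hom A (free_module A (Bs i) (ds i)) (trivial_module A) j"
      and g: "g \<in> graded_hom A (free_module A (Bs i) (ds i)) (trivial_module A) j"
      using that by (simp_all add: eq)
    show "(\<lambda>y. f y + g y) \<in> graded_hom A (free_module A (Bs i) (ds i)) (trivial_module A) j"
      by (rule graded_hom_trivialI)
        (simp_all add: graded_hom_trivial[OF f] graded_hom_trivial[OF g] distrib_left)
  qed (use that in \<open>auto simp: eq\<close>)
  have neg: "(\<lambda>y\<in>fcar (Bs i). - f y) \<in> cocycles A R i j"
    if "f \<in> cocycles A R i j" for f
  proof (rule restrict)
    have f: "f \<in> graded_hom A (free_module A (Bs i) (ds i)) (trivial_module A) j"
      using that by (simp_all add: eq)
    show "(\<lambda>y. - f y) \<in> graded_hom A (free_module A (Bs i) (ds i)) (trivial_module A) j"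
      by (rule graded_hom_trivialI) (simp_all add: graded_hom_trivial[OF f])
  qed (use that in \<open>auto simp: eq\<close>)
  have zero: "(\<lambda>y\<in>fcar (Bs i). 0) \<in> cocycles A R i j"
    by (rule restrict) (auto simp: graded_hom_def)
  show ?thesis
  proof (rule groupI)
    fix f assume "f \<in> carrier ((cochains i j)\<lparr>carrier := cocycles A R i j\<rparr>)"
    then have f: "f \<in> cocycles A R i j" by simp
    then show "\<one>\<^bsub>(cochains i j)\<lparr>carrier := cocycles A R i j\<rparr>\<^esub> \<otimes>\<^bsub>(cochains i j)\<lparr>carrier := cocycles A R i j\<rparr>\<^esub> f = f"
      by (auto simp: eq hom_group_def res_term_def extensional_def fun_eq_iff)
    show "\<exists>g\<in>carrier ((cochains i j)\<lparr>carrier := cocycles A R i j\<rparr>).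
        g \<otimes>\<^bsub>(cochains i j)\<lparr>carrier := cocycles A R i j\<rparr>\<^esub> f = \<one>\<^bsub>(cochains i j)\<lparr>carrier := cocycles A R i j\<rparr>\<^esub>"
      by (rule bexI[of _ "\<lambda>y\<in>fcar (Bs i). - f y"])
        (use neg[OF f] in \<open>auto simp: hom_group_def res_term_def fun_eq_iff\<close>)
  qed (use add zero in \<open>auto simp: hom_group_def res_term_def fun_eq_iff\<close>)
qed

lemma Ext_trivial: assumes "j \<noteq> int i" shows "trivial_group (Ext A R i j)"
proof -
  let ?Z = "(cochains i j)\<lparr>carrier := cocycles A R i j\<rparr>"
  interpret Z: group ?Z by (rule cocycles_group)
  have "Ext A R i j = ?Z Mod carrier ?Z"
    by (simp add: Ext_def coboundaries_eq_cocycles[OF assms])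
  moreover have "group (?Z Mod carrier ?Z)" by (rule normal.factorgroup_is_group[OF Z.normal_self])
  moreover have "carrier (?Z Mod carrier ?Z) = {carrier ?Z}"
  proof -
    have "rcosets\<^bsub>?Z\<^esub> carrier ?Z = {carrier ?Z}"
      using Z.coset_join2[OF _ Z.subgroup_self] Z.one_closed by (force simp: RCOSETS_def)
    then show ?thesis by (simp add: FactGroup_def)
  qed
  ultimately show ?thesis by (simp add: trivial_group_def)
qed

end

theorem koszul: "koszul A"
  using cg graded_free_resolution_exists Ext_trivial by (auto simp: koszul_def)

end

section \<open>Alternating products along cycles\<close>

text \<open>The sum of all products with one factor left out, signs alternating and starting with plus. The
  recursion is that of a boundary map.\<close>

primrec alt_sum :: "('e \<Rightarrow> 'a::ring_1) \<Rightarrow> 'e list \<Rightarrow> 'a" where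
  "alt_sum g [] = 0"
| "alt_sum g (e # es) = prod_list (map g es) - g e * alt_sum g es"

lemma alt_sum_expand:
  "alt_sum g es = (\<Sum>j<length es. (-1) ^ j * prod_list (map g (take j es @ drop (Suc j) es)))"
proof (induction es)
  case (Cons e es)
  have "(\<Sum>j<length (e # es). (-1) ^ j * prod_list (map g (take j (e # es) @ drop (Suc j) (e # es)))) =
      prod_list (map g es) + (\<Sum>j<length es. (-1) ^ Suc j * (g e * prod_list (map g (take j es @ drop (Suc j) es))))"
    by (simp only: list.size add_0_right add_Suc_right sum.lessThan_Suc_shift) simp
  also have "(\<Sum>j<length es. (-1) ^ Suc j * (g e * prod_list (map g (take j es @ drop (Suc j) es)))) =
      - (g e * alt_sum g es)"
  proof -
    have "(-1) ^ j * (g e * y) = g e * ((-1) ^ j * y)" for j y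
      by (cases "even j") auto
    then show ?thesis
      by (simp add: Cons.IH sum_distrib_left sum_negf)
  qed
  finally show ?case by simp
qed simp

text \<open>An exterior algebra seen from above: computations take place in a ring, modulo an ideal that contains
  the squares and anticommutators of the distinguished elements.\<close>

locale anticommuting =
  fixes K :: "'a::ring_1 set" and Ed :: "'e set" and g :: "'e \<Rightarrow> 'a"
  assumes K_zero: "0 \<in> K" and K_add: "\<lbrakk>a \<in> K; b \<in> K\<rbrakk> \<Longrightarrow> a + b \<in> K"
    and K_left: "a \<in> K \<Longrightarrow> c * a \<in> K" and K_right: "a \<in> K \<Longrightarrow> a * c \<in> K"
    and square: "e \<in> Ed \<Longrightarrow> g e * g e \<in> K"
    and anticommute: "\<lbrakk>e \<in> Ed; f \<in> Ed\<rbrakk> \<Longrightarrow> g e * g f + g f * g e \<in> K"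
begin

lemma K_uminus: "a \<in> K \<Longrightarrow> - a \<in> K"
  using K_left[of a "-1"] by simp

definition equiv_mod (infix "\<approx>" 50) where "a \<approx> b \<longleftrightarrow> a - b \<in> K"

lemma cong_refl [simp]: "a \<approx> a"
  by (simp add: equiv_mod_def K_zero)

lemma cong_sym: "a \<approx> b \<Longrightarrow> b \<approx> a"
  using K_uminus[of "a - b"] by (simp add: equiv_mod_def)

lemma cong_trans [trans]: "a \<approx> b \<Longrightarrow> b \<approx> c \<Longrightarrow> a \<approx> c"
  using K_add[of "a - b" "b - c"] by (simp add: equiv_mod_def)

lemma cong_add: "a \<approx> b \<Longrightarrow> c \<approx> d \<Longrightarrow> a + c \<approx> b + d"
  using K_add[of "a - b" "c - d"] by (simp add: equiv_mod_def algebra_simps)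

lemma cong_uminus: "a \<approx> b \<Longrightarrow> - a \<approx> - b"
  using K_uminus[of "a - b"] by (simp add: equiv_mod_def)

lemma cong_diff: "a \<approx> b \<Longrightarrow> c \<approx> d \<Longrightarrow> a - c \<approx> b - d"
  using cong_add[of a b "- c" "- d"] cong_uminus by simp

lemma cong_sum: "(\<And>i. i \<in> S \<Longrightarrow> f i \<approx> h i) \<Longrightarrow> (\<Sum>i\<in>S. f i) \<approx> (\<Sum>i\<in>S. h i)"
  by (induction S rule: infinite_finite_induct) (auto intro: cong_add)

lemma cong_left: "a \<approx> b \<Longrightarrow> c * a \<approx> c * b"
  using K_left[of "a - b" c] by (simp add: equiv_mod_def algebra_simps)

lemma cong_right: "a \<approx> b \<Longrightarrow> a * c \<approx> b * c"
  using K_right[of "a - b" c] by (simp add: equiv_mod_def algebra_simps)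

lemma zero_iff: "a \<approx> 0 \<longleftrightarrow> a \<in> K"
  by (simp add: equiv_mod_def)

lemma swap: "e \<in> Ed \<Longrightarrow> f \<in> Ed \<Longrightarrow> g e * g f \<approx> - (g f * g e)"
  using anticommute by (simp add: equiv_mod_def)

lemma swap_left: "e \<in> Ed \<Longrightarrow> f \<in> Ed \<Longrightarrow> g e * (g f * c) \<approx> - (g f * (g e * c))"
  using cong_right[OF swap, of e f c] by (simp add: mult.assoc)

lemma square_left: "e \<in> Ed \<Longrightarrow> g e * (g e * c) \<approx> 0"
  using K_right[OF square, of e c] by (simp add: equiv_mod_def mult.assoc)

definition diff_prod :: "'e \<Rightarrow> 'e list \<Rightarrow> 'a" where
  "diff_prod e es = prod_list (map (\<lambda>f. g f - g e) es)"

text \<open>The alternating sum factors because it is the boundary of a product: subtracting \<open>g e\<close> from every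
  other factor changes nothing in the presence of the factor \<open>g e\<close>.\<close>

lemma alt_sum_factor:
  assumes "e \<in> Ed" "set es \<subseteq> Ed" shows "alt_sum g (e # es) \<approx> diff_prod e es"
  using assms(2)
proof (induction es)
  case (Cons f es)
  let ?P = "prod_list (map g es)" and ?B = "alt_sum g es"
  have "diff_prod e (f # es) = (g f - g e) * diff_prod e es" by (simp add: diff_prod_def)
  also have "\<dots> \<approx> (g f - g e) * (?P - g e * ?B)"
    using cong_left[OF cong_sym[OF Cons.IH]] Cons.prems by simp
  also have "\<dots> = g f * ?P - g e * ?P - g f * (g e * ?B) + g e * (g e * ?B)"
    by (simp add: algebra_simps)
  also have "\<dots> \<approx> g f * ?P - g e * ?P - - (g e * (g f * ?B)) + 0"
    using assms Cons.prems by (intro cong_add cong_diff cong_refl swap_left square_left) auto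
  also have "\<dots> = alt_sum g (e # f # es)" by (simp add: algebra_simps)
  finally show ?case by (rule cong_sym)
qed (simp add: diff_prod_def)

lemma sign_commute: "(-1) ^ n * (a * c) = a * ((-1) ^ n * c)" for a c :: 'a
  by (cases "even n") auto

lemma prod_list_move:
  assumes "e \<in> Ed" "set xs \<subseteq> Ed"
  shows "prod_list (map g (xs @ e # ys)) \<approx> (-1) ^ length xs * (g e * prod_list (map g (xs @ ys)))"
  using assms(2)
proof (induction xs)
  case (Cons f xs)
  let ?Q = "prod_list (map g (xs @ ys))"
  have "prod_list (map g ((f # xs) @ e # ys)) = g f * prod_list (map g (xs @ e # ys))" by simp
  also have "\<dots> \<approx> g f * ((-1) ^ length xs * (g e * ?Q))"
    using Cons by (intro cong_left) auto
  also have "\<dots> = (-1) ^ length xs * (g f * (g e * ?Q))" by (simp only: sign_commute[of _ "g f"])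
  also have "\<dots> \<approx> (-1) ^ length xs * - (g e * (g f * ?Q))"
    using Cons.prems assms(1) by (intro cong_left swap_left) auto
  finally show ?case by simp
qed simp

lemma alt_sum_move:
  assumes "e \<in> Ed" "set xs \<subseteq> Ed"
  shows "alt_sum g (xs @ e # ys) \<approx> (-1) ^ length xs * alt_sum g (e # xs @ ys)"
  using assms(2)
proof (induction xs)
  case (Cons f xs)
  let ?Q = "prod_list (map g (xs @ ys))" and ?B = "alt_sum g (xs @ ys)" and ?s = "(-1) ^ length xs :: 'a"
  have "alt_sum g ((f # xs) @ e # ys) = prod_list (map g (xs @ e # ys)) - g f * alt_sum g (xs @ e # ys)"
    by simp
  also have "\<dots> \<approx> ?s * (g e * ?Q) - g f * (?s * (?Q - g e * ?B))"
    using Cons prod_list_move[OF assms(1), of xs ys] by (intro cong_diff cong_left) auto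
  also have "\<dots> = ?s * (g e * ?Q) - ?s * (g f * (?Q - g e * ?B))"
    by (simp only: sign_commute[of _ "g f"])
  also have "\<dots> = ?s * (g e * ?Q - g f * ?Q + g f * (g e * ?B))"
    by (simp add: algebra_simps)
  also have "\<dots> \<approx> ?s * (g e * ?Q - g f * ?Q + - (g e * (g f * ?B)))"
    using Cons.prems assms(1) by (intro cong_left cong_add swap_left cong_refl) auto
  also have "\<dots> = (-1) ^ length (f # xs) * alt_sum g (e # (f # xs) @ ys)"
    by (simp add: algebra_simps)
  finally show ?case .
qed simp

text \<open>Both expressions change by the sign of the permutation; one sign \<open>n\<close> must serve for the two in order
  to carry the induction.\<close>

lemma alt_sum_permute:
  "mset es = mset fs \<Longrightarrow> set es \<subseteq> Ed \<Longrightarrow>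
    \<exists>n. alt_sum g fs \<approx> (-1) ^ n * alt_sum g es \<and>
        prod_list (map g fs) \<approx> (-1) ^ n * prod_list (map g es)"
proof (induction es arbitrary: fs)
  case Nil
  then have "fs = []" by simp
  then show ?case by (intro exI[of _ 0]) simp
next
  case (Cons e es)
  have "e \<in> set fs" using Cons.prems(1) by (metis list.set_intros(1) set_mset_mset)
  then obtain xs ys where fs: "fs = xs @ e # ys" by (metis split_list)
  have m: "mset es = mset (xs @ ys)" using Cons.prems(1) by (simp add: fs)
  then have sub: "set (xs @ ys) \<subseteq> Ed" using Cons.prems(2) by (metis set_mset_mset set_subset_Cons subset_trans)
  obtain n where n: "alt_sum g (xs @ ys) \<approx> (-1) ^ n * alt_sum g es"
      "prod_list (map g (xs @ ys)) \<approx> (-1) ^ n * prod_list (map g es)"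
    using Cons.IH[OF m] Cons.prems(2) by auto
  have "alt_sum g fs \<approx> (-1) ^ length xs * alt_sum g (e # xs @ ys)"
    unfolding fs using Cons.prems(2) sub by (intro alt_sum_move) auto
  also have "\<dots> = (-1) ^ length xs * (prod_list (map g (xs @ ys)) - g e * alt_sum g (xs @ ys))"
    by simp
  also have "\<dots> \<approx> (-1) ^ length xs * ((-1) ^ n * prod_list (map g es) - g e * ((-1) ^ n * alt_sum g es))"
    by (intro cong_left cong_diff n)
  also have "\<dots> = (-1) ^ length xs * ((-1) ^ n * prod_list (map g es) - (-1) ^ n * (g e * alt_sum g es))"
    by (simp only: sign_commute[of n "g e"])
  also have "\<dots> = (-1) ^ (length xs + n) * alt_sum g (e # es)"
    by (simp add: power_add mult.assoc right_diff_distrib)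
  finally have a: "alt_sum g fs \<approx> (-1) ^ (length xs + n) * alt_sum g (e # es)" .
  have "prod_list (map g fs) \<approx> (-1) ^ length xs * (g e * prod_list (map g (xs @ ys)))"
    using prod_list_move[of e xs ys] Cons.prems(2) sub unfolding fs by auto
  also have "\<dots> \<approx> (-1) ^ length xs * (g e * ((-1) ^ n * prod_list (map g es)))"
    by (intro cong_left n)
  also have "\<dots> = (-1) ^ length xs * ((-1) ^ n * (g e * prod_list (map g es)))"
    by (simp only: sign_commute[of n "g e"])
  also have "\<dots> = (-1) ^ (length xs + n) * prod_list (map g (e # es))"
    by (simp add: power_add mult.assoc)
  finally show ?case using a by blast
qed

lemma alt_sum_mset:
  assumes "mset es = mset fs" "set es \<subseteq> Ed" "alt_sum g es \<in> K" shows "alt_sum g fs \<in> K"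
proof -
  obtain n where "alt_sum g fs \<approx> (-1) ^ n * alt_sum g es"
    using alt_sum_permute[OF assms(1,2)] by blast
  moreover have "(-1) ^ n * alt_sum g es \<approx> 0" using K_left[OF assms(3)] by (simp add: zero_iff)
  ultimately show ?thesis using cong_trans zero_iff by blast
qed

text \<open>In the presence of the factor \<open>g f - g e\<close> the elements \<open>g e\<close> and \<open>g c\<close> act alike, so the first can be
  exchanged for the second in all remaining factors.\<close>

lemma diff_prod_replace:
  assumes "e \<in> Ed" "f \<in> Ed" "c \<in> Ed" "set es \<subseteq> Ed"
    and tri: "(g f - g e) * g c \<approx> (g f - g e) * g e"
  shows "(g f - g e) * diff_prod e es \<approx> (g f - g e) * diff_prod c es"
  using assms(4)
proof (induction es)
  case (Cons a es)
  have anti: "(g f - g e) * ((g a - g h) * y) \<approx> - ((g a - g h) * ((g f - g e) * y))"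
    if "h \<in> Ed" for h y
  proof -
    have "(g f - g e) * ((g a - g h) * y) =
        g f * (g a * y) - g f * (g h * y) - (g e * (g a * y) - g e * (g h * y))"
      by (simp add: algebra_simps)
    also have "\<dots> \<approx> - (g a * (g f * y)) - - (g h * (g f * y)) - (- (g a * (g e * y)) - - (g h * (g e * y)))"
      using assms(1,2) that Cons.prems by (intro cong_diff swap_left) auto
    also have "\<dots> = - ((g a - g h) * ((g f - g e) * y))" by (simp add: algebra_simps)
    finally show ?thesis .
  qed
  have "(g f - g e) * diff_prod e (a # es) = (g f - g e) * g a * diff_prod e es - (g f - g e) * g e * diff_prod e es"
    by (simp add: diff_prod_def algebra_simps)
  also have "\<dots> \<approx> (g f - g e) * g a * diff_prod e es - (g f - g e) * g c * diff_prod e es"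
    by (intro cong_diff cong_refl cong_right cong_sym[OF tri])
  also have "\<dots> = (g f - g e) * ((g a - g c) * diff_prod e es)" by (simp add: algebra_simps)
  also have "\<dots> \<approx> - ((g a - g c) * ((g f - g e) * diff_prod e es))" by (rule anti[OF assms(3)])
  also have "\<dots> \<approx> - ((g a - g c) * ((g f - g e) * diff_prod c es))"
    using Cons by (intro cong_uminus[OF cong_left]) auto
  also have "\<dots> \<approx> (g f - g e) * ((g a - g c) * diff_prod c es)" by (rule cong_sym[OF anti[OF assms(3)]])
  also have "\<dots> = (g f - g e) * diff_prod c (a # es)" by (simp add: diff_prod_def)
  finally show ?case .
qed (simp add: diff_prod_def)

text \<open>Factoring the three sums at \<open>e\<close>, \<open>e\<close> and \<open>c\<close>, the triangle says that \<open>(g f - g e) (g c - g e)\<close> vanishes, and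
  this allows the sum of the long cycle to be rewritten as \<open>g f - g e\<close> times that of the short one.\<close>

lemma alt_sum_chord:
  assumes "e \<in> Ed" "f \<in> Ed" "c \<in> Ed" "set es \<subseteq> Ed"
    and tri: "alt_sum g [e, f, c] \<in> K" and cyc: "alt_sum g (c # es) \<in> K"
  shows "alt_sum g (e # f # es) \<in> K"
proof -
  have "alt_sum g [e, f, c] \<approx> (g f - g e) * (g c - g e)"
    using alt_sum_factor[of e "[f, c]"] assms by (simp add: diff_prod_def)
  then have "(g f - g e) * (g c - g e) \<approx> 0" using tri zero_iff cong_trans cong_sym by blast
  then have r: "(g f - g e) * g c \<approx> (g f - g e) * g e"
    by (simp add: equiv_mod_def algebra_simps)
  have "alt_sum g (e # f # es) \<approx> (g f - g e) * diff_prod e es"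
    using alt_sum_factor[of e "f # es"] assms by (simp add: diff_prod_def)
  also have "\<dots> \<approx> (g f - g e) * diff_prod c es" by (rule diff_prod_replace[OF assms(1-4) r])
  also have "\<dots> \<approx> (g f - g e) * alt_sum g (c # es)"
    using assms by (intro cong_left[OF cong_sym[OF alt_sum_factor]]) auto
  also have "\<dots> \<approx> 0" using K_left[OF cyc] by (simp add: zero_iff)
  finally show ?thesis by (simp add: zero_iff)
qed

end

fun path_edges :: "'v list \<Rightarrow> 'v set list" where
  "path_edges (u # w # vs) = {u, w} # path_edges (w # vs)"
| "path_edges _ = []"

text \<open>The edges of a cycle in cyclic order, which induction along a cycle needs and the set of its edges
  does not provide.\<close>

definition cycle_edge_list :: "'v list \<Rightarrow> 'v set list" where
  "cycle_edge_list vs = map (\<lambda>i. {vs ! i, vs ! (Suc i mod length vs)}) [0..<length vs]"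

lemma set_cycle_edge_list: "set (cycle_edge_list vs) = cycle_edges vs"
  by (auto simp: cycle_edge_list_def cycle_edges_def)

lemma path_edges_nth: "path_edges vs = map (\<lambda>i. {vs ! i, vs ! Suc i}) [0..<length vs - 1]"
proof (induction vs rule: path_edges.induct)
  case (1 u w vs)
  have "[0..<length (u # w # vs) - 1] = 0 # map Suc [0..<length (w # vs) - 1]"
    by (simp add: upt_conv_Cons map_Suc_upt del: upt_Suc)
  then show ?case using 1 by (simp add: comp_def)
qed auto

lemma cycle_edge_list_path:
  "vs \<noteq> [] \<Longrightarrow> cycle_edge_list vs = path_edges vs @ [{last vs, hd vs}]"
proof -
  assume vs: "vs \<noteq> []"
  then obtain n where n: "length vs = Suc n" by (cases vs) auto
  have "cycle_edge_list vs = map (\<lambda>i. {vs ! i, vs ! Suc i}) [0..<n] @ [{vs ! n, vs ! 0}]"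
    by (simp add: cycle_edge_list_def n)
  then show ?thesis using vs by (simp add: path_edges_nth n last_conv_nth hd_conv_nth)
qed

lemma path_edges_Cons: "us \<noteq> [] \<Longrightarrow> path_edges (v # us) = {v, hd us} # path_edges us"
  by (cases us) auto

lemma graph_cycle_iff:
  "graph_cycle Ed vs \<longleftrightarrow> 3 \<le> length vs \<and> distinct vs \<and> set (cycle_edge_list vs) \<subseteq> Ed"
  by (auto simp: graph_cycle_def cycle_edge_list_def)

lemma cycle_edge_list_rotate1: "cycle_edge_list (rotate1 vs) = rotate1 (cycle_edge_list vs)"
proof (cases vs)
  case (Cons v us)
  show ?thesis
  proof (cases "us = []")
    case False
    have "path_edges (us @ [v]) = path_edges us @ [{last us, v}]"
      using False by (induction us rule: path_edges.induct) auto
    then show ?thesis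
      using Cons False by (simp add: cycle_edge_list_path path_edges_Cons)
  qed (simp add: Cons cycle_edge_list_path)
qed (simp add: cycle_edge_list_def)

lemma cycle_edge_list_rotate: "cycle_edge_list (rotate n vs) = rotate n (cycle_edge_list vs)"
  by (induction n) (simp_all add: cycle_edge_list_rotate1)

lemma mset_rotate_list: "mset (rotate n vs) = mset vs"
  by (metis rotate_drop_take mset_append add.commute append_take_drop_id)

lemma distinct_cycle_edge_list:
  assumes "distinct vs" "3 \<le> length vs" shows "distinct (cycle_edge_list vs)"
proof -
  have "i = j" if ij: "i < length vs" "j < length vs"
    "{vs ! i, vs ! (Suc i mod length vs)} = {vs ! j, vs ! (Suc j mod length vs)}" for i j
  proof (rule ccontr)
    assume "i \<noteq> j"
    have l: "Suc i mod length vs < length vs" "Suc j mod length vs < length vs"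
      using ij by (auto intro!: mod_less_divisor)
    have "vs ! i \<noteq> vs ! j" using \<open>i \<noteq> j\<close> nth_eq_iff_index_eq[OF assms(1) ij(1,2)] by blast
    then have "vs ! i = vs ! (Suc j mod length vs)" "vs ! (Suc i mod length vs) = vs ! j"
      using ij(3) unfolding doubleton_eq_iff by blast+
    then have i: "i = Suc j mod length vs" and j: "Suc i mod length vs = j"
      using nth_eq_iff_index_eq[OF assms(1) ij(1) l(2)] nth_eq_iff_index_eq[OF assms(1) l(1) ij(2)] by blast+
    show False
    proof (cases "Suc i = length vs")
      case True
      then have "j = 0" using j by simp
      then show False using i True assms(2) by simp
    next
      case False
      then have "j = Suc i" using j ij by simp
      then show False using i ij assms(2) by (cases "Suc j = length vs") auto
    qed
  qed
  then show ?thesis by (auto simp: cycle_edge_list_def distinct_map intro!: inj_onI)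
qed

text \<open>A perfect elimination ordering as a list with the largest vertex first, so that removing the head
  removes the largest vertex.\<close>

fun elimination_list :: "'v set set \<Rightarrow> 'v list \<Rightarrow> bool" where
  "elimination_list Ed [] = True"
| "elimination_list Ed (v # vs) \<longleftrightarrow> v \<notin> set vs \<and> elimination_list Ed vs \<and>
     (\<forall>u\<in>set vs. \<forall>w\<in>set vs. {u, v} \<in> Ed \<and> {w, v} \<in> Ed \<and> u \<noteq> w \<longrightarrow> {u, w} \<in> Ed)"

lemma elimination_list_first:
  assumes "elimination_list Ed vs" "X \<subseteq> set vs" "X \<noteq> {}"
  obtains v where "v \<in> X"
    "\<And>u w. \<lbrakk>u \<in> X - {v}; w \<in> X - {v}; {u, v} \<in> Ed; {w, v} \<in> Ed; u \<noteq> w\<rbrakk> \<Longrightarrow> {u, w} \<in> Ed"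
  using assms
proof (induction vs arbitrary: thesis)
  case (Cons v vs)
  show ?case
  proof (cases "v \<in> X")
    case True
    show ?thesis
    proof (rule Cons.prems(1)[OF True])
      fix u w assume "u \<in> X - {v}" "w \<in> X - {v}" "{u, v} \<in> Ed" "{w, v} \<in> Ed" "u \<noteq> w"
      moreover from this have "u \<in> set vs" "w \<in> set vs" using Cons.prems(3) by auto
      ultimately show "{u, w} \<in> Ed" using Cons.prems(2) by simp
    qed
  next
    case False
    then show ?thesis using Cons.IH[OF Cons.prems(1)] Cons.prems by auto
  qed
qed simp

locale anticommuting_edges = anticommuting K Ed g
  for K :: "'a::ring_1 set" and Ed :: "'v set set" and g :: "'v set \<Rightarrow> 'a"
begin

text \<open>The neighbours in the cycle of its largest vertex \<open>v\<close> are adjacent. If the cycle is longer than a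
  triangle, this edge is a chord that cuts off a triangle at \<open>v\<close>, and the rest is a shorter cycle.\<close>

lemma alt_sum_cycle:
  assumes vs: "elimination_list Ed vs"
    and tri: "\<And>u w v. \<lbrakk>{u, v} \<in> Ed; {w, v} \<in> Ed; {u, w} \<in> Ed; distinct [u, w, v]; {u, v, w} \<subseteq> set vs\<rbrakk> \<Longrightarrow>
      alt_sum g [{v, u}, {w, v}, {w, u}] \<in> K"
  shows "graph_cycle Ed cs \<Longrightarrow> set cs \<subseteq> set vs \<Longrightarrow> alt_sum g (cycle_edge_list cs) \<in> K"
proof (induction "length cs" arbitrary: cs rule: less_induct)
  case less
  have cs: "3 \<le> length cs" "distinct cs" "set (cycle_edge_list cs) \<subseteq> Ed"
    using less.prems(1) by (simp_all add: graph_cycle_iff)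
  obtain v where v: "v \<in> set cs"
    "\<And>u w. \<lbrakk>u \<in> set cs - {v}; w \<in> set cs - {v}; {u, v} \<in> Ed; {w, v} \<in> Ed; u \<noteq> w\<rbrakk> \<Longrightarrow> {u, w} \<in> Ed"
    using elimination_list_first[OF vs less.prems(2)] cs(1) by (metis list.size(3) not_numeral_le_zero set_empty)
  obtain xs ys where xs: "cs = xs @ v # ys" using v(1) by (metis split_list)
  define us where "us = ys @ xs"
  have rot: "rotate (length xs) cs = v # us" by (simp add: xs us_def rotate_append)
  have us: "2 \<le> length us" "v \<notin> set us" "distinct us" "set us \<subseteq> set cs" "us \<noteq> []"
    using cs by (auto simp: xs us_def)
  let ?u = "hd us" and ?w = "last us"
  have uw: "?u \<in> set us" "?w \<in> set us" using us(5) by simp_all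
  have u_ne_w: "?u \<noteq> ?w"
    using us(1,3) by (cases us) (auto split: if_splits)
  have edges: "cycle_edge_list (v # us) = {v, ?u} # path_edges us @ [{?w, v}]"
    using us(5) by (simp add: cycle_edge_list_path path_edges_Cons)
  have sub: "set (cycle_edge_list (v # us)) \<subseteq> Ed"
    using cs(3) by (simp add: rot[symmetric] cycle_edge_list_rotate)
  then have e: "{v, ?u} \<in> Ed" "{?w, v} \<in> Ed" and p: "set (path_edges us) \<subseteq> Ed" by (auto simp: edges)
  have "?u \<in> set cs - {v}" "?w \<in> set cs - {v}" using uw us(2,4) by auto
  then have c: "{?w, ?u} \<in> Ed"
    using v(2)[of ?w ?u] e u_ne_w by (auto simp: insert_commute)
  \<comment> \<open>The triangle cut off at \<open>v\<close>.\<close>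
  have tr: "alt_sum g [{v, ?u}, {?w, v}, {?w, ?u}] \<in> K"
  proof (rule tri)
    show "{?u, v, ?w} \<subseteq> set vs" using uw us(4) v(1) less.prems(2) by blast
    show "distinct [?u, ?w, v]" using u_ne_w uw us(2) by auto
  qed (use e c in \<open>auto simp: insert_commute\<close>)
  have "alt_sum g ({v, ?u} # {?w, v} # path_edges us) \<in> K"
  proof (cases "length us = 2")
    case True
    then obtain a b where "us = [a, b]" by (auto simp: numeral_2_eq_2 length_Suc_conv)
    then show ?thesis using tr by (simp add: insert_commute)
  next
    case False
    have cyc: "cycle_edge_list us = path_edges us @ [{?w, ?u}]" by (rule cycle_edge_list_path[OF us(5)])
    then have "graph_cycle Ed us" using us p c False by (auto simp: graph_cycle_iff)
    then have "alt_sum g (cycle_edge_list us) \<in> K"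
      using less.hyps[of us] us less.prems(2) by (simp add: xs us_def)
    then have "alt_sum g ({?w, ?u} # path_edges us) \<in> K"
      by (rule alt_sum_mset[rotated 2]) (use p c in \<open>auto simp: cyc\<close>)
    then show ?thesis using alt_sum_chord[OF e c p tr] by blast
  qed
  then have "alt_sum g (cycle_edge_list (v # us)) \<in> K"
    by (rule alt_sum_mset[rotated 2]) (use e p in \<open>auto simp: edges\<close>)
  then show ?case
    by (rule alt_sum_mset[rotated 2]) (use sub in \<open>simp_all add: rot[symmetric] cycle_edge_list_rotate mset_rotate_list\<close>)
qed

lemma alt_sum_cycle_edges:
  assumes "elimination_list Ed vs"
    and "\<And>u w v. \<lbrakk>{u, v} \<in> Ed; {w, v} \<in> Ed; {u, w} \<in> Ed; distinct [u, w, v]; {u, v, w} \<subseteq> set vs\<rbrakk> \<Longrightarrow>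
      alt_sum g [{v, u}, {w, v}, {w, u}] \<in> K"
    and cs: "graph_cycle Ed cs" "set cs \<subseteq> set vs" and es: "distinct es" "set es = cycle_edges cs"
  shows "alt_sum g es \<in> K"
proof -
  have c: "3 \<le> length cs" "distinct cs" "set (cycle_edge_list cs) \<subseteq> Ed"
    using cs by (simp_all add: graph_cycle_iff)
  show ?thesis
  proof (rule alt_sum_mset)
    show "alt_sum g (cycle_edge_list cs) \<in> K" by (rule alt_sum_cycle[OF assms(1-2) cs]) auto
    show "mset (cycle_edge_list cs) = mset es"
      using es distinct_cycle_edge_list[OF c(2,1)]
      by (simp add: set_cycle_edge_list flip: set_eq_iff_mset_eq_distinct)
  qed (use c in auto)
qed

end

section \<open>Operators for an additional vertex\<close>

text \<open>The part of a monomial that involves one vertex \<open>v\<close>: nothing, \<open>x\<^sub>v\<close>, \<open>y\<^sub>v\<close>, \<open>x\<^sub>v y\<^sub>v\<close>, or the edge generator to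
  a smaller neighbour.\<close>

datatype 'v state = One | SX | SY | SXY | SG 'v

text \<open>A family \<open>F\<close> of elements of a module over the algebra of the smaller graph stands for
  \<open>F One + x\<^sub>v F SX + y\<^sub>v F SY + x\<^sub>v y\<^sub>v F SXY + \<Sum>\<^sub>u g\<^bsub>vu\<^esub> F (SG u)\<close>. The four operators are left multiplication by
  \<open>x\<^sub>v\<close>, by \<open>y\<^sub>v\<close>, by \<open>g\<^bsub>vw\<^esub>\<close> and by a generator \<open>b\<close> of the smaller graph, brought back into this form by means of the
  relations. Thus \<open>x\<^sub>v g\<^bsub>vu\<^esub> = - g\<^bsub>vu\<^esub> x\<^sub>u\<close> explains the last line of \<open>xop\<close>; in \<open>gop\<close> one uses \<open>g\<^bsub>vw\<^esub> x\<^sub>v = g\<^bsub>vw\<^esub> x\<^sub>w\<close> and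
  \<open>g\<^bsub>vw\<^esub> g\<^bsub>vu\<^esub> = g\<^bsub>vw\<^esub> g\<^bsub>wu\<^esub> - g\<^bsub>vu\<^esub> g\<^bsub>wu\<^esub>\<close>; and \<open>lop\<close> moves \<open>b\<close> past the basis element with the sign of its degree.
  The parameters \<open>X u\<close>, \<open>Y u\<close> and \<open>c u w\<close> are the actions of \<open>x\<^sub>u\<close>, \<open>y\<^sub>u\<close> and \<open>g\<^bsub>uw\<^esub>\<close> on the smaller module, and \<open>N\<close> is the
  set of smaller neighbours of \<open>v\<close>.\<close>

definition xop :: "('v \<Rightarrow> 'm \<Rightarrow> 'm) \<Rightarrow> 'v set \<Rightarrow> ('v state \<Rightarrow> 'm) \<Rightarrow> 'v state \<Rightarrow> 'm::ab_group_add" where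
  "xop X N F = (\<lambda>s. case s of One \<Rightarrow> 0 | SX \<Rightarrow> F One | SY \<Rightarrow> 0 | SXY \<Rightarrow> F SY
     | SG u \<Rightarrow> if u \<in> N then - X u (F (SG u)) else 0)"

definition yop :: "('v \<Rightarrow> 'm \<Rightarrow> 'm) \<Rightarrow> 'v set \<Rightarrow> ('v state \<Rightarrow> 'm) \<Rightarrow> 'v state \<Rightarrow> 'm::ab_group_add" where
  "yop Y N F = (\<lambda>s. case s of One \<Rightarrow> 0 | SX \<Rightarrow> 0 | SY \<Rightarrow> F One | SXY \<Rightarrow> - F SX
     | SG u \<Rightarrow> if u \<in> N then - Y u (F (SG u)) else 0)"

definition gop :: "('v \<Rightarrow> 'm \<Rightarrow> 'm) \<Rightarrow> ('v \<Rightarrow> 'm \<Rightarrow> 'm) \<Rightarrow> ('v \<Rightarrow> 'v \<Rightarrow> 'm \<Rightarrow> 'm) \<Rightarrow> 'v set \<Rightarrow> 'v \<Rightarrow>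
    ('v state \<Rightarrow> 'm) \<Rightarrow> 'v state \<Rightarrow> 'm::ab_group_add" where
  "gop X Y c N w F = (\<lambda>s. case s of
     SG u \<Rightarrow> if u \<notin> N then 0 else if u = w then
         F One + X w (F SX) + Y w (F SY) + X w (Y w (F SXY)) + (\<Sum>t\<in>N - {w}. c w t (F (SG t)))
       else - c w u (F (SG u))
   | _ \<Rightarrow> 0)"

definition lop :: "('m \<Rightarrow> 'm) \<Rightarrow> ('v state \<Rightarrow> 'm) \<Rightarrow> 'v state \<Rightarrow> 'm::ab_group_add" where
  "lop b F = (\<lambda>s. case s of One \<Rightarrow> b (F One) | SX \<Rightarrow> - b (F SX) | SY \<Rightarrow> - b (F SY)
     | SXY \<Rightarrow> b (F SXY) | SG u \<Rightarrow> - b (F (SG u)))"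

lemmas ext_ops_defs = xop_def yop_def gop_def lop_def

text \<open>The relations of the smaller graph that are used when a vertex with neighbourhood \<open>N\<close> is added. Any two
  distinct elements of \<open>N\<close> have an operator \<open>c\<close>, which is the clique condition.\<close>

locale extension_data =
  fixes Ops :: "('m::ab_group_add \<Rightarrow> 'm) set" and N :: "'v set"
    and X Y :: "'v \<Rightarrow> 'm \<Rightarrow> 'm" and c :: "'v \<Rightarrow> 'v \<Rightarrow> 'm \<Rightarrow> 'm"
  assumes fin: "finite N"
    and additive: "\<And>f m m'. f \<in> Ops \<Longrightarrow> f (m + m') = f m + f m'"
    and anti: "\<And>f g m. \<lbrakk>f \<in> Ops; g \<in> Ops\<rbrakk> \<Longrightarrow> f (g m) = - g (f m)"
    and square: "\<And>f m. f \<in> Ops \<Longrightarrow> f (f m) = 0"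
    and X_Ops: "\<And>u. u \<in> N \<Longrightarrow> X u \<in> Ops" and Y_Ops: "\<And>u. u \<in> N \<Longrightarrow> Y u \<in> Ops"
    and c_Ops: "\<And>u w. \<lbrakk>u \<in> N; w \<in> N; u \<noteq> w\<rbrakk> \<Longrightarrow> c u w \<in> Ops"
    and c_sym: "\<And>u w. c u w = c w u"
    and X_c: "\<And>u w m. \<lbrakk>u \<in> N; w \<in> N; u \<noteq> w\<rbrakk> \<Longrightarrow> X u (c u w m) = X w (c u w m)"
    and Y_c: "\<And>u w m. \<lbrakk>u \<in> N; w \<in> N; u \<noteq> w\<rbrakk> \<Longrightarrow> Y u (c u w m) = Y w (c u w m)"
    and triangle: "\<And>u w t m. \<lbrakk>u \<in> N; w \<in> N; t \<in> N; u \<noteq> w; w \<noteq> t; t \<noteq> u\<rbrakk> \<Longrightarrow>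
      c u w (c w t m) + c w t (c t u m) + c t u (c u w m) = 0"
begin

lemma op_zero: "f \<in> Ops \<Longrightarrow> f 0 = 0"
  using additive[of f 0 0] by simp

lemma op_uminus: "f \<in> Ops \<Longrightarrow> f (- m) = - f m"
  using additive[of f m "- m"] op_zero[of f] minus_unique[of "f m" "f (- m)"] by simp

lemma c_Ops': "\<lbrakk>u \<in> N; w \<in> N; w \<noteq> u\<rbrakk> \<Longrightarrow> c u w \<in> Ops"
  using c_Ops by blast

lemma op_diff: "f \<in> Ops \<Longrightarrow> f (m - m') = f m - f m'"
  using additive[of f m "- m'"] op_uminus by simp

lemma op_sum: "f \<in> Ops \<Longrightarrow> f (\<Sum>i\<in>S. m i) = (\<Sum>i\<in>S. f (m i))"
  by (induction S rule: infinite_finite_induct) (auto simp: op_zero additive)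

lemmas op_simps = op_zero op_uminus op_diff additive op_sum square

lemma state_ext: "\<lbrakk>F One = G One; F SX = G SX; F SY = G SY; F SXY = G SXY; \<And>u. F (SG u) = G (SG u)\<rbrakk>
    \<Longrightarrow> F = G"
  by (rule ext) (metis state.exhaust)

lemma lop_lop: "b \<in> Ops \<Longrightarrow> b' \<in> Ops \<Longrightarrow> lop b (lop b' F) = - lop b' (lop b F)"
  by (rule state_ext) (simp_all add: lop_def op_simps anti[of b b'])

lemma lop_square: "b \<in> Ops \<Longrightarrow> lop b (lop b F) = 0"
  by (rule state_ext) (simp_all add: lop_def op_simps)

lemma xop_square: "xop X N (xop X N F) = 0"
  by (rule state_ext) (simp_all add: xop_def op_simps X_Ops)

lemma yop_square: "yop Y N (yop Y N F) = 0"
  by (rule state_ext) (simp_all add: yop_def op_simps Y_Ops)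

lemma xop_yop: "xop X N (yop Y N F) = - yop Y N (xop X N F)"
  by (rule state_ext) (simp_all add: xop_def yop_def op_simps X_Ops Y_Ops anti[OF X_Ops Y_Ops])

lemma lop_xop: "b \<in> Ops \<Longrightarrow> lop b (xop X N F) = - xop X N (lop b F)"
  by (rule state_ext) (simp_all add: xop_def lop_def op_simps X_Ops anti[OF _ X_Ops])

lemma lop_yop: "b \<in> Ops \<Longrightarrow> lop b (yop Y N F) = - yop Y N (lop b F)"
  by (rule state_ext) (simp_all add: yop_def lop_def op_simps Y_Ops anti[OF _ Y_Ops])

lemma lop_gop:
  assumes b: "b \<in> Ops" and w: "w \<in> N"
  shows "lop b (gop X Y c N w F) = - gop X Y c N w (lop b F)"
proof (rule state_ext)
  fix u
  have s: "(\<Sum>t\<in>N - {w}. c w t (- b (F (SG t)))) = (\<Sum>t\<in>N - {w}. b (c w t (F (SG t))))"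
    by (rule sum.cong) (use w in \<open>auto simp: anti[OF c_Ops' b] op_uminus c_Ops'\<close>)
  have xy: "X w (Y w (b m)) = b (X w (Y w m))" for m
    using b w by (simp add: anti[OF Y_Ops b] anti[OF X_Ops b] op_simps X_Ops)
  show "lop b (gop X Y c N w F) (SG u) = (- gop X Y c N w (lop b F)) (SG u)"
    using b w by (auto simp: lop_def gop_def op_simps X_Ops Y_Ops c_Ops s xy sum_negf
        anti[OF X_Ops b] anti[OF Y_Ops b] anti[OF c_Ops b])
qed (simp_all add: lop_def gop_def op_simps b)

lemma X_c_commute: "\<lbrakk>w \<in> N; t \<in> N; w \<noteq> t\<rbrakk> \<Longrightarrow> c w t (X t m) = - X w (c w t m)"
  using anti[OF c_Ops X_Ops, of w t t m] X_c[of w t m] by simp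

lemma Y_c_commute: "\<lbrakk>w \<in> N; t \<in> N; w \<noteq> t\<rbrakk> \<Longrightarrow> c w t (Y t m) = - Y w (c w t m)"
  using anti[OF c_Ops Y_Ops, of w t t m] Y_c[of w t m] by simp

lemma xop_gop: assumes w: "w \<in> N" shows "xop X N (gop X Y c N w F) = - gop X Y c N w (xop X N F)"
proof (rule state_ext)
  fix u
  have s: "(\<Sum>t\<in>N - {w}. c w t (- X t (F (SG t)))) =
      (\<Sum>t\<in>N - {w}. X w (c w t (F (SG t))))"
    by (rule sum.cong) (use w in \<open>auto simp: op_simps c_Ops' X_c_commute\<close>)
  show "xop X N (gop X Y c N w F) (SG u) = (- gop X Y c N w (xop X N F)) (SG u)"
  proof (cases "u = w")
    case True
    then show ?thesis using w by (simp add: xop_def gop_def s op_simps X_Ops Y_Ops c_Ops)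
  next
    case False
    then show ?thesis
      using w X_c_commute[of w u "F (SG u)"] X_c[of w u "F (SG u)"]
      by (simp add: xop_def gop_def op_simps X_Ops c_Ops)
  qed
qed (simp_all add: xop_def gop_def)

lemma yop_gop: assumes w: "w \<in> N" shows "yop Y N (gop X Y c N w F) = - gop X Y c N w (yop Y N F)"
proof (rule state_ext)
  fix u
  have s: "(\<Sum>t\<in>N - {w}. c w t (- Y t (F (SG t)))) =
      (\<Sum>t\<in>N - {w}. Y w (c w t (F (SG t))))"
    by (rule sum.cong) (use w in \<open>auto simp: op_simps c_Ops' Y_c_commute\<close>)
  have yx: "Y w (X w m) = - X w (Y w m)" for m by (rule anti) (use w X_Ops Y_Ops in auto)
  show "yop Y N (gop X Y c N w F) (SG u) = (- gop X Y c N w (yop Y N F)) (SG u)"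
  proof (cases "u = w")
    case True
    then show ?thesis using w by (simp add: yop_def gop_def s yx op_simps X_Ops Y_Ops c_Ops)
  next
    case False
    then show ?thesis
      using w Y_c_commute[of w u "F (SG u)"] Y_c[of w u "F (SG u)"]
      by (simp add: yop_def gop_def op_simps Y_Ops c_Ops)
  qed
qed (simp_all add: yop_def gop_def)

text \<open>The relation \<open>(x\<^sub>v - x\<^sub>w) g\<^bsub>vw\<^esub> = 0\<close>.\<close>

lemma xop_gop_edge: assumes w: "w \<in> N" shows "xop X N (gop X Y c N w F) = lop (X w) (gop X Y c N w F)"
proof (rule state_ext)
  fix u
  show "xop X N (gop X Y c N w F) (SG u) = lop (X w) (gop X Y c N w F) (SG u)"
    using w X_c[of w u "F (SG u)"]
    by (simp add: xop_def lop_def gop_def op_zero op_uminus X_Ops)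
qed (simp_all add: xop_def gop_def lop_def op_zero X_Ops w)

lemma yop_gop_edge: assumes w: "w \<in> N" shows "yop Y N (gop X Y c N w F) = lop (Y w) (gop X Y c N w F)"
proof (rule state_ext)
  fix u
  show "yop Y N (gop X Y c N w F) (SG u) = lop (Y w) (gop X Y c N w F) (SG u)"
    using w Y_c[of w u "F (SG u)"]
    by (simp add: yop_def lop_def gop_def op_zero op_uminus Y_Ops)
qed (simp_all add: yop_def gop_def lop_def op_zero Y_Ops w)

lemma gop_square: assumes w: "w \<in> N" shows "gop X Y c N w (gop X Y c N w F) = 0"
proof (rule state_ext)
  fix u
  have s: "(\<Sum>t\<in>N - {w}. c w t (gop X Y c N w F (SG t))) = 0"
    by (rule sum.neutral) (use w in \<open>auto simp: gop_def op_simps c_Ops'\<close>)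
  show "gop X Y c N w (gop X Y c N w F) (SG u) = 0 (SG u)"
  proof (cases "u = w")
    case True
    have "gop X Y c N w F One = 0" "gop X Y c N w F SX = 0" "gop X Y c N w F SY = 0" "gop X Y c N w F SXY = 0"
      by (simp_all add: gop_def)
    then show ?thesis using True w s
      by (subst gop_def) (simp add: op_zero X_Ops Y_Ops)
  next
    case False
    then show ?thesis using w by (simp add: gop_def op_simps c_Ops)
  qed
qed (simp_all add: gop_def)

text \<open>The triangle relation \<open>g\<^bsub>vw\<^esub> g\<^bsub>vt\<^esub> = g\<^bsub>wt\<^esub> (g\<^bsub>vt\<^esub> - g\<^bsub>vw\<^esub>)\<close> for the new operators. On the coefficients of \<open>1\<close>,
  \<open>x\<^sub>v\<close>, \<open>y\<^sub>v\<close>, \<open>x\<^sub>v y\<^sub>v\<close> it holds because \<open>g\<^bsub>wt\<^esub>\<close> equalises the actions of \<open>w\<close> and \<open>t\<close>; on those of the \<open>g\<^bsub>vs\<^esub>\<close> it is the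
  triangle relation of \<open>w\<close>, \<open>t\<close> and \<open>s\<close> in the smaller graph.\<close>

lemma gop_gop: 
  assumes w: "w \<in> N" and t: "t \<in> N" and wt: "w \<noteq> t"
  shows "gop X Y c N w (gop X Y c N t F) =
    lop (c w t) (gop X Y c N t F) - lop (c w t) (gop X Y c N w F)"
proof (rule state_ext)
  fix u
  let ?L = "\<lambda>w. F One + X w (F SX) + Y w (F SY) + X w (Y w (F SXY))"
  let ?S = "\<lambda>w. \<Sum>s\<in>N - {w}. c w s (F (SG s))"
  let ?N = "N - {w} - {t}"
  note Ops = X_Ops Y_Ops c_Ops
  have cwt: "c w t \<in> Ops" using c_Ops w t wt by blast
  \<comment> \<open>Here \<open>?L w\<close> is the result of substituting \<open>w\<close> for the new vertex, and \<open>c w t\<close> makes \<open>w\<close> and \<open>t\<close> equal.\<close>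
  have L: "c w t (?L t) = c w t (?L w)"
  proof -
    have x: "c w t (X t m) = c w t (X w m)" for m
      using X_c_commute[of w t m] anti[OF cwt X_Ops[OF w]] w t wt by simp
    have y: "c w t (Y t m) = c w t (Y w m)" for m
      using Y_c_commute[of w t m] anti[OF cwt Y_Ops[OF w]] w t wt by simp
    have xy: "c w t (X t (Y t m)) = c w t (X w (Y w m))" for m
    proof -
      have "c w t (X t (Y t m)) = - X w (c w t (Y t m))" using X_c_commute[of w t "Y t m"] w t wt by simp
      also have "\<dots> = - X w (c w t (Y w m))" by (simp add: y)
      also have "\<dots> = c w t (X w (Y w m))" using anti[OF cwt X_Ops[OF w], of "Y w m"] by simp
      finally show ?thesis .
    qed
    have "c w t (X w (Y t m)) = c w t (X w (Y w m))" for m using x[of "Y t m"] xy[of m] by simp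
    then show ?thesis by (simp add: additive[OF cwt] x y)
  qed
  \<comment> \<open>The triangle relations of \<open>w\<close>, \<open>t\<close> and a third neighbour, summed over the latter.\<close>
  have S: "c w t (?S t) - (\<Sum>s\<in>?N. c w s (c t s (F (SG s)))) = c w t (?S w)"
  proof -
    have St: "c w t (?S t) = (\<Sum>s\<in>?N. c w t (c t s (F (SG s))))"
    proof -
      have "N - {t} = insert w ?N" using w wt by auto
      then have "?S t = c t w (F (SG w)) + (\<Sum>s\<in>?N. c t s (F (SG s)))" using fin by simp
      then show ?thesis using square[OF cwt] by (simp add: additive[OF cwt] op_sum[OF cwt] c_sym[of t w])
    qed
    have Sw: "c w t (?S w) = (\<Sum>s\<in>?N. c w t (c w s (F (SG s))))"
    proof -
      have "?S w = c w t (F (SG t)) + (\<Sum>s\<in>?N. c w s (F (SG s)))"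
        by (rule sum.remove) (use fin t wt in auto)
      then show ?thesis using square[OF cwt] by (simp add: additive[OF cwt] op_sum[OF cwt])
    qed
    have "c w t (c t s m) - c w s (c t s m) = c w t (c w s m)" if "s \<in> ?N" for s m
    proof -
      have s: "s \<in> N" "s \<noteq> w" "s \<noteq> t" using that by auto
      have "c w t (c t s m) + c t s (c s w m) + c s w (c w t m) = 0"
        using triangle[of w t s m] s w t wt by auto
      moreover have "c t s (c s w m) = - c w s (c t s m)"
        using anti[OF c_Ops c_Ops, of t s s w m] s w t by (simp add: c_sym[of s w])
      moreover have "c s w (c w t m) = - c w t (c w s m)"
        using anti[OF c_Ops cwt, of s w m] s w t by (simp add: c_sym[of s w])
      ultimately show ?thesis by (simp add: algebra_simps)
    qed
    then show ?thesis unfolding St Sw sum_subtractf[symmetric] by (intro sum.cong) auto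
  qed
  show "gop X Y c N w (gop X Y c N t F) (SG u) =
    (lop (c w t) (gop X Y c N t F) - lop (c w t) (gop X Y c N w F)) (SG u)"
  proof -
    consider "u = w" | "u = t" | "u \<notin> N" | "u \<in> N" "u \<noteq> w" "u \<noteq> t" by blast
    then show ?thesis
    proof cases
      case 1
      have "(\<Sum>s\<in>N - {w}. c w s (gop X Y c N t F (SG s))) =
          c w t (?L t + ?S t) + (\<Sum>s\<in>?N. - c w s (c t s (F (SG s))))"
      proof -
        have "(\<Sum>s\<in>?N. c w s (gop X Y c N t F (SG s))) = (\<Sum>s\<in>?N. - c w s (c t s (F (SG s))))"
          by (rule sum.cong) (use w in \<open>auto simp: gop_def op_uminus c_Ops\<close>)
        moreover have "gop X Y c N t F (SG t) = ?L t + ?S t" using t by (simp add: gop_def)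
        moreover have "(\<Sum>s\<in>N - {w}. c w s (gop X Y c N t F (SG s))) =
            c w t (gop X Y c N t F (SG t)) + (\<Sum>s\<in>?N. c w s (gop X Y c N t F (SG s)))"
          by (rule sum.remove) (use fin t wt in auto)
        ultimately show ?thesis by simp
      qed
      moreover have "gop X Y c N w (gop X Y c N t F) (SG w) = (\<Sum>s\<in>N - {w}. c w s (gop X Y c N t F (SG s)))"
      proof -
        have "gop X Y c N t F One = 0" "gop X Y c N t F SX = 0" "gop X Y c N t F SY = 0"
          "gop X Y c N t F SXY = 0" by (simp_all add: gop_def)
        then show ?thesis using w by (subst gop_def) (simp add: op_zero X_Ops Y_Ops)
      qed
      ultimately have "gop X Y c N w (gop X Y c N t F) (SG w) =
          c w t (?L t) + (c w t (?S t) - (\<Sum>s\<in>?N. c w s (c t s (F (SG s)))))"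
        by (simp add: additive[OF cwt] sum_negf)
      also have "\<dots> = c w t (?L w + ?S w)" by (simp only: L S additive[OF cwt, of "?L w" "?S w"])
      also have "\<dots> = (lop (c w t) (gop X Y c N t F) - lop (c w t) (gop X Y c N w F)) (SG w)"
      proof -
        have "gop X Y c N w F (SG w) = ?L w + ?S w" using w by (simp add: gop_def)
        moreover have "gop X Y c N t F (SG w) = - c w t (F (SG w))"
          using w wt by (simp add: gop_def c_sym[of t w])
        ultimately show ?thesis by (simp add: lop_def op_uminus[OF cwt] square[OF cwt])
      qed
      finally show ?thesis using 1 by simp
    next
      case 2
      have "gop X Y c N t F (SG t) = ?L t + ?S t" "gop X Y c N w F (SG t) = - c w t (F (SG t))"
        using t wt by (simp_all add: gop_def)
      moreover have "gop X Y c N w (gop X Y c N t F) (SG t) = - c w t (gop X Y c N t F (SG t))"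
        using t wt by (subst gop_def) simp
      ultimately show ?thesis using 2 by (simp add: lop_def op_uminus[OF cwt] square[OF cwt])
    next
      case 3
      then show ?thesis by (simp add: gop_def lop_def op_zero[OF cwt])
    next
      case 4
      have "c w u (c t u m) + c w t (c w u m) = c w t (c t u m)" for m
      proof -
        have "c w t (c t u m) + c t u (c u w m) + c u w (c w t m) = 0"
          using triangle[of w t u m] 4 w t wt by auto
        moreover have "c t u (c u w m) = - c w u (c t u m)"
          using anti[OF c_Ops c_Ops, of t u u w m] 4 w t by (simp add: c_sym[of u w])
        moreover have "c u w (c w t m) = - c w t (c w u m)"
          using anti[OF c_Ops cwt, of u w m] 4 w t by (simp add: c_sym[of u w])
        ultimately show ?thesis by (simp add: algebra_simps)
      qed
      then have "c w u (c t u (F (SG u))) = c w t (c t u (F (SG u))) - c w t (c w u (F (SG u)))"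
        by (simp add: eq_diff_eq)
      then show ?thesis
        using 4 w by (simp add: gop_def lop_def op_uminus cwt c_Ops)
    qed
  qed
qed (simp_all add: gop_def lop_def op_zero c_Ops w t wt)

lemma gop_gop_anti:
  assumes "w \<in> N" "t \<in> N"
  shows "gop X Y c N w (gop X Y c N t F) = - gop X Y c N t (gop X Y c N w F)"
proof (cases "w = t")
  case True
  then show ?thesis using gop_square[OF assms(2)] by simp
next
  case False
  then show ?thesis using gop_gop[OF assms, of F] gop_gop[OF assms(2,1), of F] by (simp add: c_sym[of t w])
qed

lemma lop_sum3:
  assumes "\<And>m. f (g m) + f' (g' m) + f'' (g'' m) = 0"
    "f \<in> Ops" "f' \<in> Ops" "f'' \<in> Ops" "g \<in> Ops" "g' \<in> Ops" "g'' \<in> Ops"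
  shows "lop f (lop g F) + lop f' (lop g' F) + lop f'' (lop g'' F) = 0"
  by (rule state_ext) (use assms in \<open>simp_all add: lop_def op_uminus\<close>)

end

section \<open>The model space and its operators\<close>

text \<open>Basis elements are lists of states, one for each vertex in the order of the elimination list. All
  functions on lists are admitted, also those with values at lists that do not represent a monomial.\<close>

type_synonym 'v model = "'v state list \<Rightarrow> rat"

text \<open>The coefficients with respect to the first vertex, themselves elements of the model of the remaining
  vertices.\<close>

definition parts :: "'v model \<Rightarrow> 'v state \<Rightarrow> 'v model" where
  "parts F = (\<lambda>s l. F (s # l))"

definition assemble :: "('v state \<Rightarrow> 'v model) \<Rightarrow> 'v model" where
  "assemble P = (\<lambda>l. case l of [] \<Rightarrow> 0 | s # l \<Rightarrow> P s l)"

lemma assemble_simps [simp]: "assemble P [] = 0" "assemble P (s # l) = P s l"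
  by (simp_all add: assemble_def)

lemma parts_assemble [simp]: "parts (assemble P) = P"
  by (simp add: parts_def assemble_def)

lemma assemble_arith: "assemble (P + Q) = assemble P + assemble Q" "assemble (- P) = - assemble P"
  "assemble 0 = 0" "assemble (P - Q) = assemble P - assemble Q"
  by (auto simp: fun_eq_iff assemble_def split: list.splits)

lemma parts_add: "parts (F + G) = parts F + parts G"
  by (auto simp: fun_eq_iff parts_def)

definition const :: "rat \<Rightarrow> 'v model" where "const q = (\<lambda>_. q)"

definition nbrs :: "'v set set \<Rightarrow> 'v \<Rightarrow> 'v list \<Rightarrow> 'v set" where
  "nbrs Ed v vs = {u \<in> set vs. {v, u} \<in> Ed}"

definition other :: "'v \<Rightarrow> 'v set \<Rightarrow> 'v" where
  "other v e = (THE w. e = {v, w})"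

lemma other_eq [simp]: "other v {v, w} = w" "other v {w, v} = w"
  unfolding other_def by (rule the_equality; auto simp: doubleton_eq_iff)+

definition extend_act :: "('v gen \<Rightarrow> 'v model \<Rightarrow> 'v model) \<Rightarrow> 'v \<Rightarrow> 'v set \<Rightarrow> 'v gen \<Rightarrow>
    ('v state \<Rightarrow> 'v model) \<Rightarrow> 'v state \<Rightarrow> 'v model" where
  "extend_act \<rho> v N a =
    (if a = GenX v then xop (\<lambda>u. \<rho> (GenX u)) N
     else if a = GenY v then yop (\<lambda>u. \<rho> (GenY u)) N
     else case a of
       GenG e \<Rightarrow> if v \<in> e then
           gop (\<lambda>u. \<rho> (GenX u)) (\<lambda>u. \<rho> (GenY u)) (\<lambda>u w. \<rho> (GenG {u, w})) N (other v e)
         else lop (\<rho> a)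
     | _ \<Rightarrow> lop (\<rho> a))"

text \<open>Left multiplication by a generator, constructed one vertex at a time.\<close>

primrec act :: "'v set set \<Rightarrow> 'v list \<Rightarrow> 'v gen \<Rightarrow> 'v model \<Rightarrow> 'v model" where
  "act Ed [] = (\<lambda>a F. 0)"
| "act Ed (v # vs) = (\<lambda>a F. assemble (extend_act (act Ed vs) v (nbrs Ed v vs) a (parts F)))"

lemma finite_nbrs [simp]: "finite (nbrs Ed v vs)"
  by (simp add: nbrs_def)

lemma ext_op_add:
  assumes "\<And>a F G. \<rho> a (F + G) = \<rho> a F + \<rho> a G"
  shows "extend_act \<rho> v N a (P + Q) = extend_act \<rho> v N a P + extend_act \<rho> v N a Q"
  by (auto simp: extend_act_def ext_ops_defs assms sum.distrib fun_eq_iff split: state.splits gen.splits)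

lemma ext_op_scale:
  assumes "\<And>a F. \<rho> a (const q * F) = const q * \<rho> a F"
  shows "extend_act \<rho> v N a (\<lambda>s. const q * P s) = (\<lambda>s. const q * extend_act \<rho> v N a P s)"
proof
  fix s
  show "extend_act \<rho> v N a (\<lambda>s. const q * P s) s = const q * extend_act \<rho> v N a P s"
    by (cases s; cases a)
      (simp_all add: extend_act_def ext_ops_defs assms distrib_left sum_distrib_left)
qed

lemma act_add: "act Ed vs a (F + G) = act Ed vs a F + act Ed vs a G"
proof (induction vs arbitrary: a F G)
  case (Cons v vs)
  show ?case
    by (simp only: act.simps parts_add ext_op_add[where \<rho> = "act Ed vs", OF Cons.IH] assemble_arith)
qed simp

lemma act_scale: "act Ed vs a (const q * F) = const q * act Ed vs a F"
proof (induction vs arbitrary: a F)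
  case (Cons v vs)
  have "parts (const q * F) = (\<lambda>s. const q * parts F s)"
    by (auto simp: parts_def fun_eq_iff const_def)
  moreover have "assemble (\<lambda>s. const q * P s) = const q * assemble P" for P :: "'a state \<Rightarrow> 'a model"
    by (auto simp: fun_eq_iff const_def assemble_def split: list.splits)
  ultimately show ?case
    by (simp only: act.simps ext_op_scale[where \<rho> = "act Ed vs", OF Cons.IH])
qed simp

definition gens :: "'v set set \<Rightarrow> 'v list \<Rightarrow> 'v gen set" where
  "gens Ed vs = GenX ` set vs \<union> GenY ` set vs \<union> GenG ` {e \<in> Ed. e \<subseteq> set vs}"

lemma gens_Cons_cases [consumes 3, case_names X Y G lower]:
  assumes "a \<in> gens Ed (v # vs)" and "\<forall>e\<in>Ed. card e = 2" and v: "v \<notin> set vs"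
  obtains "a = GenX v" | "a = GenY v" | w where "a = GenG {v, w}" "w \<in> nbrs Ed v vs" | "a \<in> gens Ed vs"
proof (cases a)
  case (GenG e)
  then have e: "e \<in> Ed" "e \<subseteq> insert v (set vs)" using assms(1) by (auto simp: gens_def)
  show ?thesis
  proof (cases "v \<in> e")
    case True
    then obtain w where "e = {v, w}" "w \<noteq> v"
      using assms(2) e(1) by (metis card_2_iff doubleton_eq_iff insertE singletonD)
    then show ?thesis using that(3)[of w] e GenG by (auto simp: nbrs_def)
  next
    case False
    then show ?thesis using that(4) e GenG by (auto simp: gens_def)
  qed
qed (use assms(1) that in \<open>auto simp: gens_def\<close>)

lemma extend_act_simps:
  assumes "v \<notin> set vs"
  shows "extend_act \<rho> v N (GenX v) = xop (\<lambda>u. \<rho> (GenX u)) N"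
    "extend_act \<rho> v N (GenY v) = yop (\<lambda>u. \<rho> (GenY u)) N"
    "extend_act \<rho> v N (GenG {v, w}) =
       gop (\<lambda>u. \<rho> (GenX u)) (\<lambda>u. \<rho> (GenY u)) (\<lambda>u w. \<rho> (GenG {u, w})) N w"
    "extend_act \<rho> v N (GenG {w, v}) =
       gop (\<lambda>u. \<rho> (GenX u)) (\<lambda>u. \<rho> (GenY u)) (\<lambda>u w. \<rho> (GenG {u, w})) N w"
    "a \<in> gens Ed vs \<Longrightarrow> extend_act \<rho> v N a = lop (\<rho> a)"
  using assms by (auto simp: extend_act_def gens_def split: gen.splits)

text \<open>All relations among generators of degree two. Cycle relations are required for triangles only.\<close>

locale model_relations =
  fixes Ed :: "'v set set" and vs :: "'v list"
  assumes act_anti: "\<lbrakk>a \<in> gens Ed vs; b \<in> gens Ed vs\<rbrakk> \<Longrightarrow>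
      act Ed vs a (act Ed vs b F) = - act Ed vs b (act Ed vs a F)"
    and act_square: "a \<in> gens Ed vs \<Longrightarrow> act Ed vs a (act Ed vs a F) = 0"
    and act_X_edge: "\<lbrakk>u \<in> set vs; w \<in> set vs; {u, w} \<in> Ed\<rbrakk> \<Longrightarrow>
      act Ed vs (GenX u) (act Ed vs (GenG {u, w}) F) = act Ed vs (GenX w) (act Ed vs (GenG {u, w}) F)"
    and act_Y_edge: "\<lbrakk>u \<in> set vs; w \<in> set vs; {u, w} \<in> Ed\<rbrakk> \<Longrightarrow>
      act Ed vs (GenY u) (act Ed vs (GenG {u, w}) F) = act Ed vs (GenY w) (act Ed vs (GenG {u, w}) F)"
    and act_triangle:
      "\<lbrakk>u \<in> set vs; w \<in> set vs; t \<in> set vs; u \<noteq> w; w \<noteq> t; t \<noteq> u; {u, w} \<in> Ed; {w, t} \<in> Ed; {t, u} \<in> Ed\<rbrakk> \<Longrightarrow>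
      act Ed vs (GenG {u, w}) (act Ed vs (GenG {w, t}) F) + act Ed vs (GenG {w, t}) (act Ed vs (GenG {t, u}) F)
        + act Ed vs (GenG {t, u}) (act Ed vs (GenG {u, w}) F) = 0"

lemma extension_data_act:
  assumes rel: "model_relations Ed vs" and elim: "elimination_list Ed (v # vs)"
  shows "extension_data (act Ed vs ` gens Ed vs) (nbrs Ed v vs) (\<lambda>u. act Ed vs (GenX u))
    (\<lambda>u. act Ed vs (GenY u)) (\<lambda>u w. act Ed vs (GenG {u, w}))"
proof
  let ?N = "nbrs Ed v vs"
  have edge: "{u, w} \<in> Ed" if "u \<in> ?N" "w \<in> ?N" "u \<noteq> w" for u w
    using that elim by (auto simp: nbrs_def insert_commute)
  show "finite ?N" by simp
  show "f (m + m') = f m + f m'" if "f \<in> act Ed vs ` gens Ed vs" for f m m'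
    using that by (auto simp: act_add)
  show "f (g m) = - g (f m)" if "f \<in> act Ed vs ` gens Ed vs" "g \<in> act Ed vs ` gens Ed vs" for f g m
  proof -
    from that(1) obtain a where a: "f = act Ed vs a" "a \<in> gens Ed vs" by (rule imageE)
    from that(2) obtain b where b: "g = act Ed vs b" "b \<in> gens Ed vs" by (rule imageE)
    show ?thesis unfolding a(1) b(1) by (rule model_relations.act_anti[OF rel a(2) b(2)])
  qed
  show "f (f m) = 0" if "f \<in> act Ed vs ` gens Ed vs" for f m
    using that by (elim imageE) (simp only: model_relations.act_square[OF rel])
  show "act Ed vs (GenX u) \<in> act Ed vs ` gens Ed vs" "act Ed vs (GenY u) \<in> act Ed vs ` gens Ed vs"
    if "u \<in> ?N" for u using that by (auto simp: gens_def nbrs_def)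
  show "act Ed vs (GenG {u, w}) \<in> act Ed vs ` gens Ed vs" if "u \<in> ?N" "w \<in> ?N" "u \<noteq> w" for u w
    using that edge[OF that] by (auto simp: gens_def nbrs_def)
  show "act Ed vs (GenG {u, w}) = act Ed vs (GenG {w, u})" for u w by (simp add: insert_commute)
  show "act Ed vs (GenX u) (act Ed vs (GenG {u, w}) m) = act Ed vs (GenX w) (act Ed vs (GenG {u, w}) m)"
    "act Ed vs (GenY u) (act Ed vs (GenG {u, w}) m) = act Ed vs (GenY w) (act Ed vs (GenG {u, w}) m)"
    if "u \<in> ?N" "w \<in> ?N" "u \<noteq> w" for u w m
    using that edge[OF that] by (intro model_relations.act_X_edge[OF rel] model_relations.act_Y_edge[OF rel]; simp add: nbrs_def)+
  show "act Ed vs (GenG {u, w}) (act Ed vs (GenG {w, t}) m) + act Ed vs (GenG {w, t}) (act Ed vs (GenG {t, u}) m)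
        + act Ed vs (GenG {t, u}) (act Ed vs (GenG {u, w}) m) = 0"
    if "u \<in> ?N" "w \<in> ?N" "t \<in> ?N" "u \<noteq> w" "w \<noteq> t" "t \<noteq> u" for u w t m
    using that edge[of u w] edge[of w t] edge[of t u]
    by (intro model_relations.act_triangle[OF rel]) (auto simp: nbrs_def)
qed

text \<open>Every relation of the enlarged graph either involves the new vertex, and then it is one of the
  identities for the four kinds of operators, or it is inherited from the smaller graph.\<close>

theorem elimination_model_relations:
  assumes card: "\<forall>e\<in>Ed. card e = 2"
  shows "elimination_list Ed vs \<Longrightarrow> model_relations Ed vs"
proof (induction vs)
  case Nil
  show ?case by unfold_locales (simp_all add: gens_def)
next
  case (Cons v vs)
  have v: "v \<notin> set vs" and elim: "elimination_list Ed vs" using Cons.prems by auto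
  have rel: "model_relations Ed vs" by (rule Cons.IH[OF elim])
  let ?N = "nbrs Ed v vs" and ?\<rho> = "act Ed vs"
  let ?X = "\<lambda>u. ?\<rho> (GenX u)" and ?Y = "\<lambda>u. ?\<rho> (GenY u)" and ?c = "\<lambda>u w. ?\<rho> (GenG {u, w})"
  interpret E: extension_data "?\<rho> ` gens Ed vs" ?N ?X ?Y ?c
    by (rule extension_data_act[OF rel Cons.prems])
  let ?E = "extend_act ?\<rho> v ?N"
  note cases = gens_Cons_cases[OF _ card v, consumes 1, case_names X Y G lower]
  note E_simps = extend_act_simps(1-4)[OF v] extend_act_simps(5)[OF v, where Ed = Ed]
  have anti: "?E a (?E b P) = - ?E b (?E a P)"
    if a: "a \<in> gens Ed (v # vs)" and b: "b \<in> gens Ed (v # vs)" for a b P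
    using a
  proof (cases rule: cases)
    case X
    show ?thesis using b
      by (cases rule: cases) (simp_all add: X E_simps E.xop_square E.xop_yop E.lop_xop E.xop_gop)
  next
    case Y
    show ?thesis using b
      by (cases rule: cases) (simp_all add: Y E_simps E.yop_square E.xop_yop E.lop_yop E.yop_gop)
  next
    case (G w)
    show ?thesis using b
      by (cases rule: cases)
        (use G(2) E.gop_gop_anti[OF G(2)] in \<open>simp_all add: G(1) E_simps E.lop_gop E.xop_gop E.yop_gop\<close>)
  next
    case lower
    show ?thesis using b
      by (cases rule: cases)
        (use lower in \<open>simp_all add: E_simps E.lop_xop E.lop_yop E.lop_gop E.lop_lop[of "?\<rho> a"]\<close>)
  qed
  have square: "?E a (?E a P) = 0" if "a \<in> gens Ed (v # vs)" for a P
    using that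
    by (cases rule: cases) (simp_all add: E_simps E.xop_square E.yop_square E.gop_square E.lop_square)
  have gens: "GenX u \<in> gens Ed vs" "GenY u \<in> gens Ed vs" if "u \<in> set vs" for u
    using that by (simp_all add: gens_def)
  have gG: "GenG {u, w} \<in> gens Ed vs" if "u \<in> set vs" "w \<in> set vs" "{u, w} \<in> Ed" for u w
    using that by (simp add: gens_def)
  have ne: "u \<noteq> w" if "{u, w} \<in> Ed" for u w using card that by fastforce
  have lops: "lop (?\<rho> a) (lop (?\<rho> b) P) = lop (?\<rho> a') (lop (?\<rho> b) P)"
    if "\<And>F. ?\<rho> a (?\<rho> b F) = ?\<rho> a' (?\<rho> b F)" "a \<in> gens Ed vs" "a' \<in> gens Ed vs" for a a' b P
    by (rule E.state_ext) (use that in \<open>simp_all add: lop_def E.op_uminus\<close>)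
  have top: "?E (GenX v) (?E (GenG {v, w}) P) = ?E (GenX w) (?E (GenG {v, w}) P) \<and>
      ?E (GenY v) (?E (GenG {v, w}) P) = ?E (GenY w) (?E (GenG {v, w}) P)"
    if "w \<in> set vs" "{v, w} \<in> Ed" for w P
    using that E.xop_gop_edge[of w P] E.yop_gop_edge[of w P] gens[of w] by (simp add: E_simps nbrs_def)
  have edge: "?E (GenX u) (?E (GenG {u, w}) P) = ?E (GenX w) (?E (GenG {u, w}) P) \<and>
      ?E (GenY u) (?E (GenG {u, w}) P) = ?E (GenY w) (?E (GenG {u, w}) P)"
    if uw: "u \<in> set (v # vs)" "w \<in> set (v # vs)" "{u, w} \<in> Ed" for u w P
  proof -
    consider "u = v" "w \<in> set vs" | "w = v" "u \<in> set vs" | "u \<in> set vs" "w \<in> set vs"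
      using uw ne by auto
    then show ?thesis
    proof cases
      case 1
      then show ?thesis using top uw by simp
    next
      case 2
      then show ?thesis using top[of u P] uw by (simp add: insert_commute)
    next
      case 3
      have "lop (?X u) (lop (?c u w) P) = lop (?X w) (lop (?c u w) P)"
        "lop (?Y u) (lop (?c u w) P) = lop (?Y w) (lop (?c u w) P)"
        by (rule lops; use 3 uw gens in \<open>auto intro: model_relations.act_X_edge[OF rel] model_relations.act_Y_edge[OF rel]\<close>)+
      then show ?thesis using 3 uw by (simp add: E_simps gens gG)
    qed
  qed
  have tri_top: "?E (GenG {v, w}) (?E (GenG {w, t}) P) + ?E (GenG {w, t}) (?E (GenG {t, v}) P)
        + ?E (GenG {t, v}) (?E (GenG {v, w}) P) = 0"
    if wt: "w \<in> set vs" "t \<in> set vs" "w \<noteq> t" "{v, w} \<in> Ed" "{w, t} \<in> Ed" "{t, v} \<in> Ed" for w t P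
  proof -
    have N: "w \<in> ?N" "t \<in> ?N" using wt by (auto simp: nbrs_def insert_commute)
    have "gop ?X ?Y ?c ?N t (gop ?X ?Y ?c ?N w P) =
        lop (?c w t) (gop ?X ?Y ?c ?N w P) - lop (?c w t) (gop ?X ?Y ?c ?N t P)"
      using E.gop_gop[OF N(2,1), of P] wt by (simp add: insert_commute)
    moreover have "lop (?c w t) (gop ?X ?Y ?c ?N w P) = - gop ?X ?Y ?c ?N w (lop (?c w t) P)"
      using gG[OF wt(1,2,5)] N by (intro E.lop_gop) auto
    ultimately show ?thesis
      using gG[OF wt(1,2,5)] by (simp add: E_simps)
  qed
  have tri: "?E (GenG {u, w}) (?E (GenG {w, t}) P) + ?E (GenG {w, t}) (?E (GenG {t, u}) P)
        + ?E (GenG {t, u}) (?E (GenG {u, w}) P) = 0"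
    if uwt: "u \<in> set (v # vs)" "w \<in> set (v # vs)" "t \<in> set (v # vs)" "u \<noteq> w" "w \<noteq> t" "t \<noteq> u"
      "{u, w} \<in> Ed" "{w, t} \<in> Ed" "{t, u} \<in> Ed" for u w t P
  proof -
    consider "u = v" "w \<in> set vs" "t \<in> set vs" | "w = v" "u \<in> set vs" "t \<in> set vs"
      | "t = v" "u \<in> set vs" "w \<in> set vs" | "u \<in> set vs" "w \<in> set vs" "t \<in> set vs"
      using uwt by auto
    then show ?thesis
    proof cases
      case 1
      then show ?thesis using tri_top[of w t P] uwt by simp
    next
      case 2
      then show ?thesis using tri_top[of t u P] uwt by (simp add: add_ac)
    next
      case 3
      then show ?thesis using tri_top[of u w P] uwt by (simp add: add_ac)
    next
      case 4
      have "lop (?c u w) (lop (?c w t) P) + lop (?c w t) (lop (?c t u) P) + lop (?c t u) (lop (?c u w) P) = 0"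
        by (rule E.lop_sum3) (use 4 uwt gG model_relations.act_triangle[OF rel] in auto)
      then show ?thesis using 4 uwt by (simp add: E_simps gG)
    qed
  qed
  show ?case
  proof
    fix a b F assume "a \<in> gens Ed (v # vs)" "b \<in> gens Ed (v # vs)"
    from anti[OF this] show "act Ed (v # vs) a (act Ed (v # vs) b F) = - act Ed (v # vs) b (act Ed (v # vs) a F)"
      by (simp only: act.simps parts_assemble assemble_arith(2))
  next
    fix a F assume "a \<in> gens Ed (v # vs)"
    from square[OF this] show "act Ed (v # vs) a (act Ed (v # vs) a F) = 0"
      by (simp only: act.simps parts_assemble assemble_arith(3))
  next
    fix u w F assume uw: "u \<in> set (v # vs)" "w \<in> set (v # vs)" "{u, w} \<in> Ed"
    show "act Ed (v # vs) (GenX u) (act Ed (v # vs) (GenG {u, w}) F) =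
        act Ed (v # vs) (GenX w) (act Ed (v # vs) (GenG {u, w}) F)"
      unfolding act.simps parts_assemble by (rule arg_cong[OF conjunct1[OF edge[OF uw]]])
    show "act Ed (v # vs) (GenY u) (act Ed (v # vs) (GenG {u, w}) F) =
        act Ed (v # vs) (GenY w) (act Ed (v # vs) (GenG {u, w}) F)"
      unfolding act.simps parts_assemble by (rule arg_cong[OF conjunct2[OF edge[OF uw]]])
  next
    fix u w t F
    assume uwt: "u \<in> set (v # vs)" "w \<in> set (v # vs)" "t \<in> set (v # vs)" "u \<noteq> w" "w \<noteq> t" "t \<noteq> u"
      "{u, w} \<in> Ed" "{w, t} \<in> Ed" "{t, u} \<in> Ed"
    show "act Ed (v # vs) (GenG {u, w}) (act Ed (v # vs) (GenG {w, t}) F) +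
        act Ed (v # vs) (GenG {w, t}) (act Ed (v # vs) (GenG {t, u}) F) +
        act Ed (v # vs) (GenG {t, u}) (act Ed (v # vs) (GenG {u, w}) F) = 0"
      unfolding act.simps parts_assemble assemble_arith(1)[symmetric] tri[OF uwt] by (rule assemble_arith(3))
  qed
qed

section \<open>Degree and filtration of the model\<close>

lemma sum_fun_app: "(\<Sum>i\<in>S. f i) x = (\<Sum>i\<in>S. f i x)" for f :: "'i \<Rightarrow> 'b \<Rightarrow> 'c::comm_monoid_add"
  by (induction S rule: infinite_finite_induct) auto

fun state_deg :: "'v state \<Rightarrow> int" where
  "state_deg One = 0" | "state_deg SXY = 2" | "state_deg _ = 1"

definition states_deg :: "'v state list \<Rightarrow> int" where
  "states_deg l = sum_list (map state_deg l)"

text \<open>Edge states must point to an actual neighbour; the other lists do not represent monomials.\<close>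

primrec valid :: "'v set set \<Rightarrow> 'v list \<Rightarrow> 'v state list \<Rightarrow> bool" where
  "valid Ed [] l \<longleftrightarrow> l = []"
| "valid Ed (v # vs) l \<longleftrightarrow> (\<exists>s l'. l = s # l' \<and> valid Ed vs l' \<and> (\<forall>u. s = SG u \<longrightarrow> u \<in> nbrs Ed v vs))"

text \<open>The generator of a level that decides which member of the chain contains the state. For \<open>SXY\<close> it is
  \<open>x\<^sub>v\<close>, the earlier of its two letters.\<close>

fun state_gen :: "'v \<Rightarrow> 'v state \<Rightarrow> 'v gen option" where
  "state_gen v One = None"
| "state_gen v SX = Some (GenX v)"
| "state_gen v SY = Some (GenY v)"
| "state_gen v SXY = Some (GenX v)"
| "state_gen v (SG u) = Some (GenG {v, u})"

text \<open>The letter of a monomial at its lowest level: deeper positions in the list take precedence.\<close>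

fun low :: "'v list \<Rightarrow> 'v state list \<Rightarrow> 'v gen option" where
  "low (v # vs) (s # l) = (case low vs l of Some a \<Rightarrow> Some a | None \<Rightarrow> state_gen v s)"
| "low _ _ = None"

definition homog :: "'v set set \<Rightarrow> 'v list \<Rightarrow> int \<Rightarrow> 'v model set" where
  "homog Ed vs n = {F. \<forall>l. F l \<noteq> 0 \<longrightarrow> valid Ed vs l \<and> states_deg l = n}"

text \<open>If \<open>P\<close> is an initial segment of the generators, the homogeneous elements of this set are those of the
  right ideal generated by \<open>P\<close>.\<close>

definition filt :: "'v list \<Rightarrow> 'v gen set \<Rightarrow> 'v model set" where
  "filt vs P = {F. \<forall>l. F l \<noteq> 0 \<longrightarrow> low vs l \<in> Some ` P}"

lemma state_deg_nonneg: "0 \<le> state_deg s"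
  by (cases s) auto

lemma states_deg_simps [simp]: "states_deg [] = 0" "states_deg (s # l) = state_deg s + states_deg l"
  by (simp_all add: states_deg_def)

lemma states_deg_nonneg: "0 \<le> states_deg l"
  by (induction l) (auto simp: state_deg_nonneg)

lemma homog_zero [simp]: "0 \<in> homog Ed vs n" and filt_zero [simp]: "0 \<in> filt vs P"
  by (simp_all add: homog_def filt_def)

lemma homogI: "(\<And>l. F l \<noteq> 0 \<Longrightarrow> valid Ed vs l \<and> states_deg l = n) \<Longrightarrow> F \<in> homog Ed vs n"
  and homogD: "F \<in> homog Ed vs n \<Longrightarrow> F l \<noteq> 0 \<Longrightarrow> valid Ed vs l \<and> states_deg l = n"
  by (simp_all add: homog_def)

lemma homog_add: "F \<in> homog Ed vs n \<Longrightarrow> G \<in> homog Ed vs n \<Longrightarrow> F + G \<in> homog Ed vs n"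
  by (rule homogI) (metis add.right_neutral homogD plus_fun_apply)

lemma homog_uminus_iff: "- F \<in> homog Ed vs n \<longleftrightarrow> F \<in> homog Ed vs n"
  by (simp add: homog_def)

lemma homog_uminus: "F \<in> homog Ed vs n \<Longrightarrow> - F \<in> homog Ed vs n"
  by (simp add: homog_uminus_iff)

lemma homog_diff: "F \<in> homog Ed vs n \<Longrightarrow> G \<in> homog Ed vs n \<Longrightarrow> F - G \<in> homog Ed vs n"
  using homog_add[of F Ed vs n "- G"] homog_uminus[of G] by simp

lemma homog_sum: "(\<And>i. i \<in> S \<Longrightarrow> F i \<in> homog Ed vs n) \<Longrightarrow> (\<Sum>i\<in>S. F i) \<in> homog Ed vs n"
  by (induction S rule: infinite_finite_induct) (auto simp: homog_add)

lemma filt_add: "F \<in> filt vs P \<Longrightarrow> G \<in> filt vs P \<Longrightarrow> F + G \<in> filt vs P"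
  unfolding filt_def mem_Collect_eq by (metis add.right_neutral plus_fun_apply)

lemma filt_uminus_iff: "- F \<in> filt vs P \<longleftrightarrow> F \<in> filt vs P"
  by (simp add: filt_def)

lemma homog_Cons: "F \<in> homog Ed (v # vs) n \<longleftrightarrow> F [] = 0 \<and>
    (\<forall>s. parts F s \<in> homog Ed vs (n - state_deg s)) \<and> (\<forall>u. u \<notin> nbrs Ed v vs \<longrightarrow> parts F (SG u) = 0)"
  (is "?l \<longleftrightarrow> ?r")
proof
  assume F: ?l
  have "F [] = 0" using F by (auto simp: homog_def)
  moreover have "parts F s \<in> homog Ed vs (n - state_deg s)" for s
    using F by (force simp: homog_def parts_def)
  moreover have "parts F (SG u) = 0" if "u \<notin> nbrs Ed v vs" for u
  proof
    fix l show "parts F (SG u) l = 0 l" using F that by (force simp: homog_def parts_def)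
  qed
  ultimately show ?r by blast
next
  assume F: ?r
  show ?l unfolding homog_def mem_Collect_eq
  proof (intro allI impI)
    fix l assume l: "F l \<noteq> 0"
    then obtain s l' where sl: "l = s # l'" using F by (cases l) auto
    then have "parts F s l' \<noteq> 0" using l by (simp add: parts_def)
    moreover from this have "u \<in> nbrs Ed v vs" if "s = SG u" for u
      using F that by (metis zero_fun_apply)
    ultimately show "valid Ed (v # vs) l \<and> states_deg l = n"
      using F unfolding sl homog_def by force
  qed
qed

lemma assemble_homog: "\<lbrakk>\<And>s. P s \<in> homog Ed vs (n - state_deg s);
    \<And>u. u \<notin> nbrs Ed v vs \<Longrightarrow> P (SG u) = 0\<rbrakk> \<Longrightarrow> assemble P \<in> homog Ed (v # vs) n"
  by (simp add: homog_Cons)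

text \<open>Each summand of the four operators raises the total degree by one; in \<open>gop\<close> a letter of the new vertex may
  turn into one of a lower level.\<close>

lemma act_homog:
  assumes card: "\<forall>e\<in>Ed. card e = 2"
  shows "elimination_list Ed vs \<Longrightarrow> a \<in> gens Ed vs \<Longrightarrow> F \<in> homog Ed vs n \<Longrightarrow>
    act Ed vs a F \<in> homog Ed vs (n + 1)"
proof (induction vs arbitrary: a F n)
  case Nil
  then show ?case by (simp add: homog_def)
next
  case (Cons v vs)
  have v: "v \<notin> set vs" and elim: "elimination_list Ed vs" using Cons.prems by auto
  let ?N = "nbrs Ed v vs"
  have F: "parts F s \<in> homog Ed vs (n - state_deg s)" "u \<notin> ?N \<Longrightarrow> parts F (SG u) = 0" for s u
    using Cons.prems(3) by (simp_all add: homog_Cons)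
  have F': "parts F One \<in> homog Ed vs n" "parts F SX \<in> homog Ed vs (n - 1)"
    "parts F SY \<in> homog Ed vs (n - 1)" "parts F SXY \<in> homog Ed vs (n - 2)"
    "parts F (SG u) \<in> homog Ed vs (n - 1)" for u
    using F(1)[of One] F(1)[of SX] F(1)[of SY] F(1)[of SXY] F(1)[of "SG u"] by simp_all
  note IH = Cons.IH[OF elim]
  have IH': "act Ed vs b G \<in> homog Ed vs m" if "b \<in> gens Ed vs" "G \<in> homog Ed vs (m - 1)" for b G m
    using IH[OF that] by simp
  have gX: "GenX u \<in> gens Ed vs" "GenY u \<in> gens Ed vs" if "u \<in> ?N" for u
    using that by (simp_all add: gens_def nbrs_def)
  have gG: "GenG {u, w} \<in> gens Ed vs" if "u \<in> ?N" "w \<in> ?N" "u \<noteq> w" for u w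
    using that Cons.prems(1) by (auto simp: gens_def nbrs_def insert_commute)
  show ?case
    unfolding act.simps
  proof (rule assemble_homog)
    note E_simps = extend_act_simps(1-4)[OF v] extend_act_simps(5)[OF v, where Ed = Ed]
    show "extend_act (act Ed vs) v ?N a (parts F) s \<in> homog Ed vs (n + 1 - state_deg s)" for s
      using Cons.prems(2) card v
    proof (cases rule: gens_Cons_cases)
      case X
      show ?thesis
        unfolding X E_simps(1)
        by (cases s) (auto simp: xop_def F' homog_uminus_iff gX intro!: IH')
    next
      case Y
      show ?thesis
        unfolding Y E_simps(2)
        by (cases s) (auto simp: yop_def F' homog_uminus_iff gX intro!: IH')
    next
      case (G w)
      show ?thesis
      proof (cases s)
        case (SG u)
        have XY: "act Ed vs (GenX w) (act Ed vs (GenY w) (parts F SXY)) \<in> homog Ed vs n"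
          by (intro IH' gX G(2)) (use F'(4) in \<open>simp add: algebra_simps\<close>)
        show ?thesis
        proof (cases "u = w")
          case True
          have "act Ed vs (GenG {w, t}) (parts F (SG t)) \<in> homog Ed vs n" if "t \<in> ?N - {w}" for t
            using that G(2) by (intro IH' gG) (auto simp: F')
          then show ?thesis
            using True XY G gX[OF G(2)]
            by (auto simp: SG E_simps gop_def F' intro!: homog_add homog_sum IH' gG)
        next
          case False
          show ?thesis
          proof (cases "u \<in> ?N")
            case True
            have "act Ed vs (GenG {w, u}) (parts F (SG u)) \<in> homog Ed vs n"
              using True G(2) False by (intro IH' gG) (auto simp: F')
            then show ?thesis using False True by (simp add: SG G E_simps gop_def homog_uminus_iff)
          qed (simp add: SG G E_simps gop_def)
        qed
      qed (simp_all add: G E_simps gop_def)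
    next
      case lower
      have "act Ed vs a (parts F s) \<in> homog Ed vs (n + 1 - state_deg s)"
        by (rule IH'[OF lower]) (use F(1)[of s] in \<open>simp add: algebra_simps\<close>)
      then show ?thesis
        unfolding extend_act_simps(5)[OF v lower]
        by (cases s; simp add: lop_def homog_uminus_iff)
    qed
    show "extend_act (act Ed vs) v ?N a (parts F) (SG u) = 0" if u: "u \<notin> ?N" for u
    proof -
      have z: "act Ed vs b 0 = 0" for b
        using act_add[of Ed vs b 0 0] by simp
      show ?thesis using Cons.prems(2) card v
        by (cases rule: gens_Cons_cases)
          (use u F(2)[OF u] in \<open>simp_all add: E_simps xop_def yop_def gop_def lop_def z\<close>)
    qed
  qed
qed

text \<open>The empty monomial.\<close>

abbreviation triv :: "'v list \<Rightarrow> 'v state list" where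
  "triv vs \<equiv> replicate (length vs) One"

definition vac :: "'v list \<Rightarrow> 'v model" where
  "vac vs = (\<lambda>l. if l = triv vs then 1 else 0)"

lemma states_deg_triv: "states_deg (replicate n One) = 0"
  by (induction n) auto

lemma valid_triv: "valid Ed vs (triv vs)"
  by (induction vs) auto

lemma vac_homog: "vac vs \<in> homog Ed vs 0"
  by (auto simp: vac_def homog_def states_deg_triv valid_triv)

lemma parts_vac: "parts (vac (v # vs)) = (\<lambda>s. if s = One then vac vs else 0)"
  by (auto simp: parts_def vac_def fun_eq_iff)

lemma low_triv: "low vs (triv vs) = None"
  by (induction vs) auto

lemma low_None: "valid Ed vs l \<Longrightarrow> low vs l = None \<Longrightarrow> l = triv vs"
proof (induction vs arbitrary: l)
  case (Cons v vs)
  then obtain s l' where l: "l = s # l'" "valid Ed vs l'" by auto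
  then have "low vs l' = None" "state_gen v s = None" using Cons.prems(2) by (auto split: option.splits)
  then show ?case using Cons.IH[OF l(2)] l(1) by (cases s) auto
qed auto

lemma low_gens: "valid Ed vs l \<Longrightarrow> low vs l = Some a \<Longrightarrow> a \<in> gens Ed vs"
proof (induction vs arbitrary: l)
  case (Cons v vs)
  then obtain s l' where l: "l = s # l'" "valid Ed vs l'" "\<And>u. s = SG u \<Longrightarrow> u \<in> nbrs Ed v vs" by auto
  have sub: "gens Ed vs \<subseteq> gens Ed (v # vs)" by (auto simp: gens_def)
  show ?case
  proof (cases "low vs l'")
    case None
    then show ?thesis using Cons.prems(2) l
      by (cases s) (auto simp: gens_def nbrs_def)
  next
    case (Some b)
    then show ?thesis using Cons.prems(2) Cons.IH[OF l(2)] l(1) sub by auto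
  qed
qed auto

lemma act_triv: "act Ed vs a F (triv vs) = 0"
proof (induction vs arbitrary: a F)
  case (Cons v vs)
  show ?case
    by (cases a) (auto simp: extend_act_def ext_ops_defs Cons.IH)
qed simp

text \<open>The order of the generators along which the chain of ideals is formed.\<close>

fun gen_list :: "'v set set \<Rightarrow> 'v list \<Rightarrow> 'v gen list" where
  "gen_list Ed [] = []"
| "gen_list Ed (v # vs) = gen_list Ed vs @
     map (\<lambda>u. GenG {v, u}) (filter (\<lambda>u. {v, u} \<in> Ed) vs) @ [GenX v, GenY v]"

lemma set_gen_list:
  assumes "\<forall>e\<in>Ed. card e = 2"
  shows "elimination_list Ed vs \<Longrightarrow> set (gen_list Ed vs) = gens Ed vs"
proof (induction vs)
  case (Cons v vs)
  then have IH: "set (gen_list Ed vs) = gens Ed vs" and v: "v \<notin> set vs" by auto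
  have "gens Ed (v # vs) = gens Ed vs \<union> (\<lambda>u. GenG {v, u}) ` nbrs Ed v vs \<union> {GenX v, GenY v}"
  proof (intro equalityI subsetI)
    fix a assume "a \<in> gens Ed (v # vs)"
    then show "a \<in> gens Ed vs \<union> (\<lambda>u. GenG {v, u}) ` nbrs Ed v vs \<union> {GenX v, GenY v}"
      using assms v by (cases rule: gens_Cons_cases) auto
  qed (auto simp: gens_def nbrs_def)
  then show ?case using IH by (auto simp: nbrs_def)
qed (use assms in \<open>auto simp: gens_def\<close>)

definition chain :: "'v set set \<Rightarrow> 'v list \<Rightarrow> nat \<Rightarrow> 'v gen set" where
  "chain Ed vs k = set (take k (gen_list Ed vs))"

text \<open>Generators of lower levels are compared with the deeper entries only, so membership can be tested on
  the coefficients.\<close>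

lemma filt_lower:
  assumes P: "P \<subseteq> gens Ed vs" and v: "v \<notin> set vs"
  shows "F \<in> filt (v # vs) P \<longleftrightarrow> F [] = 0 \<and> (\<forall>s. parts F s \<in> filt vs P)"
proof -
  have s: "state_gen v s \<notin> Some ` P" for s
    using P v by (cases s) (auto simp: gens_def)
  have low: "low (v # vs) (s # l) \<in> Some ` P \<longleftrightarrow> low vs l \<in> Some ` P" for s l
    using s by (cases "low vs l") auto
  have all: "(\<forall>l. Q l) \<longleftrightarrow> Q [] \<and> (\<forall>s l. Q (s # l))" for Q :: "'a state list \<Rightarrow> bool"
    by (metis list.exhaust)
  show ?thesis
    unfolding filt_def mem_Collect_eq by (subst all) (auto simp only: low, auto simp: parts_def)
qed

text \<open>If \<open>P\<close> contains all generators of the lower levels, then only the monomials in the letters of \<open>v\<close> alone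
  can fail to lie in the ideal.\<close>

lemma filt_level:
  assumes F: "F \<in> homog Ed (v # vs) n" and P: "P = gens Ed vs \<union> P'"
    and P': "\<And>s. state_gen v s \<in> Some ` gens Ed vs \<longrightarrow> False"
  shows "F \<in> filt (v # vs) P \<longleftrightarrow> (\<forall>s. state_gen v s \<notin> Some ` P' \<longrightarrow> parts F s (triv vs) = 0)"
proof
  assume "F \<in> filt (v # vs) P"
  then show "\<forall>s. state_gen v s \<notin> Some ` P' \<longrightarrow> parts F s (triv vs) = 0"
    using P P' by (fastforce simp: filt_def parts_def low_triv)
next
  assume r: "\<forall>s. state_gen v s \<notin> Some ` P' \<longrightarrow> parts F s (triv vs) = 0"
  show "F \<in> filt (v # vs) P" unfolding filt_def mem_Collect_eq
  proof (intro allI impI)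
    fix l assume l: "F l \<noteq> 0"
    then have "valid Ed (v # vs) l" using F by (simp add: homog_def)
    then obtain s l' where sl: "l = s # l'" "valid Ed vs l'" by auto
    show "low (v # vs) l \<in> Some ` P"
    proof (cases "low vs l'")
      case None
      then have "l' = triv vs" using low_None sl(2) by blast
      then have "parts F s (triv vs) \<noteq> 0" using l sl(1) by (simp add: parts_def)
      then show ?thesis using r None P sl(1) by auto
    next
      case (Some a)
      then show ?thesis using low_gens[OF sl(2) Some] sl(1) P by auto
    qed
  qed
qed

lemma homog_scaled_vac:
  assumes "F \<in> homog Ed vs n" shows "const (F (triv vs)) * vac vs \<in> homog Ed vs n"
  using assms by (auto simp: homog_def const_def vac_def states_deg_triv valid_triv)

text \<open>The conditions on a generator \<open>a\<close> that are needed in a Koszul chain, in terms of the model: multiples of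
  \<open>a\<close> lie in the next ideal, modulo the present ideal they are all of it, and the colon ideal belongs to
  the chain.\<close>

definition chain_step :: "'v set set \<Rightarrow> 'v list \<Rightarrow> nat \<Rightarrow> 'v gen \<Rightarrow> bool" where
  "chain_step Ed vs k a \<longleftrightarrow>
    (\<forall>n. \<forall>U\<in>homog Ed vs n. act Ed vs a U \<in> filt vs (chain Ed vs (Suc k))) \<and>
    (\<forall>n. \<forall>F\<in>homog Ed vs (n + 1) \<inter> filt vs (chain Ed vs (Suc k)).
       \<exists>U\<in>homog Ed vs n. F - act Ed vs a U \<in> filt vs (chain Ed vs k)) \<and>
    (\<exists>q\<le>length (gen_list Ed vs). \<forall>n. \<forall>U\<in>homog Ed vs n.
       act Ed vs a U \<in> filt vs (chain Ed vs k) \<longleftrightarrow> U \<in> filt vs (chain Ed vs q))"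

lemma chain_subset:
  assumes "\<forall>e\<in>Ed. card e = 2" "elimination_list Ed vs" shows "chain Ed vs k \<subseteq> gens Ed vs"
  unfolding chain_def set_gen_list[OF assms, symmetric] by (rule set_take_subset)

lemma chain_Cons_lower: "k \<le> length (gen_list Ed vs) \<Longrightarrow> chain Ed (v # vs) k = chain Ed vs k"
  by (simp add: chain_def)

text \<open>A generator of a lower level acts on the coefficients separately, up to signs, and these do not
  affect membership. All three conditions are inherited with the same index of the colon ideal.\<close>

lemma chain_step_lower:
  assumes card: "\<forall>e\<in>Ed. card e = 2" and elim: "elimination_list Ed (v # vs)"
    and k: "k < length (gen_list Ed vs)" and a: "a \<in> gens Ed vs" and step: "chain_step Ed vs k a"
  shows "chain_step Ed (v # vs) k a"
proof -
  have v: "v \<notin> set vs" and elim': "elimination_list Ed vs" using elim by auto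
  \<comment> \<open>The sign from moving a letter past the state \<open>s\<close>.\<close>
  define sg where "sg s = (case s of One \<Rightarrow> (1::rat) | SXY \<Rightarrow> 1 | _ \<Rightarrow> - 1)" for s :: "'a state"
  have sg: "sg s * sg s = 1" "sg s = 1 \<or> sg s = - 1" for s by (auto simp: sg_def split: state.splits)
  have const_sg: "const (sg s) * F = F \<or> const (sg s) * F = - F" for s and F :: "'a model"
    using sg(2)[of s] by (auto simp: const_def fun_eq_iff)
  have filt_sg: "const (sg s) * F \<in> filt vs P \<longleftrightarrow> F \<in> filt vs P" for s F P
    using const_sg[of s F] filt_uminus_iff by metis
  have act: "parts (act Ed (v # vs) a F) s = const (sg s) * act Ed vs a (parts F s)" for F s
    unfolding act.simps parts_assemble extend_act_simps(5)[OF v a]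
    by (cases s) (auto simp: lop_def sg_def const_def fun_eq_iff)
  have nil: "act Ed (v # vs) a F [] = 0" for F by simp
  note lower = filt_lower[OF chain_subset[OF card elim'] v]
  have ch: "chain Ed (v # vs) j = chain Ed vs j" if "j \<le> length (gen_list Ed vs)" for j
    by (rule chain_Cons_lower[OF that])
  have parts: "parts F s \<in> homog Ed vs (n - state_deg s)" if "F \<in> homog Ed (v # vs) n" for F n s
    using that by (simp add: homog_Cons)
  show ?thesis
    unfolding chain_step_def
  proof (intro conjI allI ballI)
    fix n U assume U: "U \<in> homog Ed (v # vs) n"
    have "act Ed vs a (parts U s) \<in> filt vs (chain Ed vs (Suc k))" for s
      using step parts[OF U, of s] unfolding chain_step_def by blast
    then show "act Ed (v # vs) a U \<in> filt (v # vs) (chain Ed (v # vs) (Suc k))"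
      using k by (simp add: ch lower act filt_sg nil del: act.simps)
  next
    fix n F assume F: "F \<in> homog Ed (v # vs) (n + 1) \<inter> filt (v # vs) (chain Ed (v # vs) (Suc k))"
    have "\<exists>U\<in>homog Ed vs (n - state_deg s). parts F s - act Ed vs a U \<in> filt vs (chain Ed vs k) \<and>
        (parts F s = 0 \<longrightarrow> U = 0)" for s
    proof (cases "parts F s = 0")
      case True
      have "act Ed vs a 0 = 0" using act_add[of Ed vs a 0 0] by simp
      then show ?thesis using True by (intro bexI[of _ 0]) auto
    next
      case False
      have "parts F s \<in> homog Ed vs ((n - state_deg s) + 1) \<inter> filt vs (chain Ed vs (Suc k))"
        using F parts[of F "n + 1" s] k by (simp add: ch lower algebra_simps)
      then show ?thesis using step False unfolding chain_step_def by blast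
    qed
    then obtain U where U: "\<And>s. U s \<in> homog Ed vs (n - state_deg s)"
        "\<And>s. parts F s - act Ed vs a (U s) \<in> filt vs (chain Ed vs k)" "\<And>s. parts F s = 0 \<Longrightarrow> U s = 0"
      by metis
    define U' where "U' = assemble (\<lambda>s. const (sg s) * U s)"
    have "U' \<in> homog Ed (v # vs) n"
      unfolding U'_def
    proof (rule assemble_homog)
      show "const (sg s) * U s \<in> homog Ed vs (n - state_deg s)" for s
        using const_sg[of s "U s"] U(1)[of s] homog_uminus by metis
      show "const (sg (SG u)) * U (SG u) = 0" if "u \<notin> nbrs Ed v vs" for u
        using U(3)[of "SG u"] F that by (simp add: homog_Cons)
    qed
    moreover have "F - act Ed (v # vs) a U' \<in> filt (v # vs) (chain Ed (v # vs) k)"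
    proof -
      have "parts (act Ed (v # vs) a U') s = act Ed vs a (U s)" for s
      proof -
        have "parts (act Ed (v # vs) a U') s = const (sg s) * (const (sg s) * act Ed vs a (U s))"
          unfolding act by (simp add: U'_def act_scale)
        then show ?thesis using sg(1)[of s] by (auto simp: const_def fun_eq_iff mult.assoc[symmetric])
      qed
      moreover have "parts (G - H) s = parts G s - parts H s" for G H :: "'a model" and s
        by (simp add: parts_def fun_eq_iff)
      ultimately show ?thesis using U(2) F k by (simp add: ch lower homog_Cons del: act.simps) simp
    qed
    ultimately show "\<exists>U\<in>homog Ed (v # vs) n. F - act Ed (v # vs) a U \<in> filt (v # vs) (chain Ed (v # vs) k)"
      by blast
  next
    obtain q where q: "q \<le> length (gen_list Ed vs)" "\<And>n U. U \<in> homog Ed vs n \<Longrightarrow>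
       act Ed vs a U \<in> filt vs (chain Ed vs k) \<longleftrightarrow> U \<in> filt vs (chain Ed vs q)"
      using step unfolding chain_step_def by blast
    have "act Ed (v # vs) a U \<in> filt (v # vs) (chain Ed (v # vs) k) \<longleftrightarrow>
        U \<in> filt (v # vs) (chain Ed (v # vs) q)" if U: "U \<in> homog Ed (v # vs) n" for n U
    proof -
      have "U [] = 0" using U by (simp add: homog_Cons)
      then show ?thesis
        using q(2)[OF parts[OF U]] q(1) k by (simp add: ch lower act filt_sg del: act.simps) simp
    qed
    then show "\<exists>q\<le>length (gen_list Ed (v # vs)). \<forall>n. \<forall>U\<in>homog Ed (v # vs) n.
       act Ed (v # vs) a U \<in> filt (v # vs) (chain Ed (v # vs) k) \<longleftrightarrow> U \<in> filt (v # vs) (chain Ed (v # vs) q)"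
      using q(1) by (intro exI[of _ q]) auto
  qed
qed

text \<open>Modulo the generators of lower levels only the values at the states \<open>s\<close> of \<open>v\<close> remain, and the products
  are \<open>g\<^bsub>vw\<^esub> \<cdot> 1 = g\<^bsub>vw\<^esub>\<close>, \<open>x\<^sub>v \<cdot> 1 = x\<^sub>v\<close>, \<open>x\<^sub>v \<cdot> y\<^sub>v = x\<^sub>v y\<^sub>v\<close>, \<open>y\<^sub>v \<cdot> 1 = y\<^sub>v\<close>, \<open>y\<^sub>v \<cdot> x\<^sub>v = - x\<^sub>v y\<^sub>v\<close>, all others being zero.
  Hence the colon ideal of \<open>x\<^sub>v\<close> is generated by \<open>x\<^sub>v\<close> and everything before it, and those of \<open>g\<^bsub>vw\<^esub>\<close> and \<open>y\<^sub>v\<close> are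
  the augmentation ideal. Taking \<open>x\<^sub>v\<close> before \<open>y\<^sub>v\<close> puts \<open>y\<^sub>v \<cdot> x\<^sub>v\<close> into the ideal that precedes \<open>y\<^sub>v\<close>.\<close>

lemma chain_step_top:
  assumes card: "\<forall>e\<in>Ed. card e = 2" and elim: "elimination_list Ed (v # vs)"
    and k: "length (gen_list Ed vs) \<le> k" "k < length (gen_list Ed (v # vs))"
  shows "chain_step Ed (v # vs) k (gen_list Ed (v # vs) ! k)"
proof -
  have v: "v \<notin> set vs" and elim': "elimination_list Ed vs" using elim by auto
  define a where "a = gen_list Ed (v # vs) ! k"
  define gs where "gs = map (\<lambda>u. GenG {v, u}) (filter (\<lambda>u. {v, u} \<in> Ed) vs) @ [GenX v, GenY v]"
  define i where "i = k - length (gen_list Ed vs)"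
  have i: "i < length gs" and k_eq: "k = length (gen_list Ed vs) + i"
    using k by (auto simp: i_def gs_def)
  have a_eq: "a = gs ! i" unfolding a_def k_eq by (simp add: gs_def nth_append)
  have ch: "chain Ed (v # vs) (length (gen_list Ed vs) + j) = gens Ed vs \<union> set (take j gs)" for j
    by (simp add: chain_def gs_def set_gen_list[OF card elim'])
  have len: "length (gen_list Ed (v # vs)) = length (gen_list Ed vs) + length gs" by (simp add: gs_def)
  have ns: "state_gen v s \<in> Some ` gens Ed vs \<longrightarrow> False" for s
    using v by (cases s) (auto simp: gens_def)
  note level = filt_level[OF _ ch ns]
  have dist: "distinct gs"
  proof -
    have "distinct vs" using elim by (induction vs arbitrary: v) auto
    then show ?thesis using v by (auto simp: gs_def distinct_map inj_on_def doubleton_eq_iff)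
  qed
  have a_in: "a \<in> gens Ed (v # vs)"
    using set_gen_list[OF card elim] k(2) unfolding a_def by (metis nth_mem)
  let ?N = "nbrs Ed v vs"
  have gs_cases: "a = GenX v \<and> set (take i gs) = (\<lambda>u. GenG {v, u}) ` ?N \<or>
      a = GenY v \<and> set (take i gs) = (\<lambda>u. GenG {v, u}) ` ?N \<union> {GenX v} \<or>
      (\<exists>w\<in>?N. a = GenG {v, w} \<and> set (take i gs) \<subseteq> (\<lambda>u. GenG {v, u}) ` ?N)"
  proof -
    let ?ws = "filter (\<lambda>u. {v, u} \<in> Ed) vs"
    have N: "set ?ws = ?N" by (auto simp: nbrs_def)
    consider "i < length ?ws" | "i = length ?ws" | "i = Suc (length ?ws)"
      using i by (fastforce simp: gs_def)
    then show ?thesis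
    proof cases
      case 1
      have "a = GenG {v, ?ws ! i}" using 1 by (simp add: a_eq gs_def nth_append)
      moreover have "?ws ! i \<in> ?N" using 1 N nth_mem by blast
      moreover have "set (take i gs) \<subseteq> (\<lambda>u. GenG {v, u}) ` ?N"
      proof -
        have "take i gs = map (\<lambda>u. GenG {v, u}) (take i ?ws)" using 1 by (simp add: gs_def take_map)
        then show ?thesis unfolding N[symmetric] using set_take_subset[of i ?ws] by auto
      qed
      ultimately show ?thesis by blast
    next
      case 2
      then show ?thesis using N by (simp add: a_eq gs_def nth_append)
    next
      case 3
      then show ?thesis using N by (simp add: a_eq gs_def nth_append)
    qed
  qed
  have take_Suc: "set (take (Suc i) gs) = insert a (set (take i gs))"
    using i by (simp add: take_Suc_conv_app_nth a_eq)
  have a_new: "a \<notin> set (take i gs)"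
    using dist i by (auto simp: a_eq in_set_conv_nth nth_eq_iff_index_eq)
  have all: "set (take (length gs) gs) = (\<lambda>u. GenG {v, u}) ` ?N \<union> {GenX v, GenY v}"
    by (auto simp: gs_def nbrs_def)
  let ?t = "triv vs"
  have E_simps: "extend_act (act Ed vs) v ?N (GenX v) = xop (\<lambda>u. act Ed vs (GenX u)) ?N"
    "extend_act (act Ed vs) v ?N (GenY v) = yop (\<lambda>u. act Ed vs (GenY u)) ?N"
    "extend_act (act Ed vs) v ?N (GenG {v, w}) = gop (\<lambda>u. act Ed vs (GenX u)) (\<lambda>u. act Ed vs (GenY u))
       (\<lambda>u w. act Ed vs (GenG {u, w})) ?N w" for w
    by (rule extend_act_simps[OF v])+
  \<comment> \<open>Only the values at \<open>triv vs\<close> matter on the level of \<open>v\<close>, and there the lower operators vanish.\<close>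
  have X: "parts (act Ed (v # vs) (GenX v) U) s ?t =
      (case s of SX \<Rightarrow> parts U One ?t | SXY \<Rightarrow> parts U SY ?t | _ \<Rightarrow> 0)" for U s
    by (cases s) (simp_all add: E_simps xop_def act_triv)
  have Y: "parts (act Ed (v # vs) (GenY v) U) s ?t =
      (case s of SY \<Rightarrow> parts U One ?t | SXY \<Rightarrow> - parts U SX ?t | _ \<Rightarrow> 0)" for U s
    by (cases s) (simp_all add: E_simps yop_def act_triv)
  have G: "parts (act Ed (v # vs) (GenG {v, w}) U) s ?t = (if s = SG w then parts U One ?t else 0)"
    if "w \<in> ?N" for U s w
    using that by (cases s) (simp_all add: E_simps gop_def act_triv sum_fun_app)
  have st: "(\<forall>s. Q s) \<longleftrightarrow> Q One \<and> Q SX \<and> Q SY \<and> Q SXY \<and> (\<forall>u. Q (SG u))" for Q :: "'a state \<Rightarrow> bool"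
    by (metis state.exhaust)
  have hom_act: "act Ed (v # vs) a U \<in> homog Ed (v # vs) (n + 1)" if "U \<in> homog Ed (v # vs) n" for U n
    by (rule act_homog[OF card elim a_in that])
  have pd: "parts (G - H) s l = parts G s l - parts H s l" for G H :: "'a model" and s l
    by (simp add: parts_def)
  have edge_inj: "{v, u} = {v, w} \<longleftrightarrow> u = w" for u w by (auto simp: doubleton_eq_iff)
  have im: "GenG {v, u} \<in> (\<lambda>u. GenG {v, u}) ` S \<longleftrightarrow> u \<in> S" for u S by (auto simp: edge_inj)
  have some: "Some x \<in> Some ` S \<longleftrightarrow> x \<in> S" for x and S :: "'a gen set" by auto
  have out: "parts U (SG u) ?t = 0" if "U \<in> homog Ed (v # vs) n" "u \<notin> ?N" for U u n
    using that by (simp add: homog_Cons)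
  have Suc_k: "Suc k = length (gen_list Ed vs) + Suc i" by (simp add: k_eq)
  have scaled: "const (parts F s ?t) * vac vs \<in> homog Ed vs m"
    if "F \<in> homog Ed (v # vs) n" "m = n - state_deg s" for F s m n
    using that homog_scaled_vac[of "parts F s" Ed vs m] by (simp add: homog_Cons)
  have pick: "F - act Ed (v # vs) a (assemble P) \<in> filt (v # vs) (chain Ed (v # vs) k)"
    if "F \<in> homog Ed (v # vs) (n + 1)" "assemble P \<in> homog Ed (v # vs) n"
      "\<And>s. state_gen v s \<notin> Some ` set (take i gs) \<Longrightarrow>
        parts F s ?t = parts (act Ed (v # vs) a (assemble P)) s ?t" for F P n
    unfolding k_eq using that by (subst level[OF homog_diff[OF that(1) hom_act[OF that(2)]]]) (auto simp: pd)
  show ?thesis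
    unfolding chain_step_def a_def[symmetric]
  proof (intro conjI allI ballI)
    fix n U assume U: "U \<in> homog Ed (v # vs) n"
    show "act Ed (v # vs) a U \<in> filt (v # vs) (chain Ed (v # vs) (Suc k))"
      unfolding Suc_k by (subst level[OF hom_act[OF U]]; use gs_cases in \<open>elim disjE bexE conjE\<close>)
        (auto simp: take_Suc X Y G st im some simp del: act.simps)
  next
    fix n F assume F: "F \<in> homog Ed (v # vs) (n + 1) \<inter> filt (v # vs) (chain Ed (v # vs) (Suc k))"
    then have Fh: "F \<in> homog Ed (v # vs) (n + 1)" by blast
    have F0: "\<And>s. state_gen v s \<notin> Some ` set (take (Suc i) gs) \<Longrightarrow> parts F s ?t = 0"
      using F level[OF Fh, of "Suc i"] unfolding Suc_k by blast
    show "\<exists>U\<in>homog Ed (v # vs) n. F - act Ed (v # vs) a U \<in> filt (v # vs) (chain Ed (v # vs) k)"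
      using gs_cases
    proof (elim disjE bexE conjE)
      assume a: "a = GenX v" and t: "set (take i gs) = (\<lambda>u. GenG {v, u}) ` ?N"
      let ?P = "\<lambda>s. case s of One \<Rightarrow> const (parts F SX ?t) * vac vs | SY \<Rightarrow> const (parts F SXY ?t) * vac vs | _ \<Rightarrow> 0"
      have P: "assemble ?P \<in> homog Ed (v # vs) n"
        by (rule assemble_homog) (auto split: state.splits intro!: scaled[OF Fh])
      have "F - act Ed (v # vs) a (assemble ?P) \<in> filt (v # vs) (chain Ed (v # vs) k)"
      proof (rule pick[OF Fh P])
        fix s assume s: "state_gen v s \<notin> Some ` set (take i gs)"
        show "parts F s ?t = parts (act Ed (v # vs) a (assemble ?P)) s ?t"
          using s F0[of s] out[OF Fh]
          by (cases s) (auto simp: a X take_Suc t im some const_def vac_def simp del: act.simps)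
      qed
      then show ?thesis using P by blast
    next
      assume a: "a = GenY v" and t: "set (take i gs) = (\<lambda>u. GenG {v, u}) ` ?N \<union> {GenX v}"
      let ?P = "\<lambda>s. case s of One \<Rightarrow> const (parts F SY ?t) * vac vs | _ \<Rightarrow> 0"
      have P: "assemble ?P \<in> homog Ed (v # vs) n"
        by (rule assemble_homog) (auto split: state.splits intro!: scaled[OF Fh])
      have "F - act Ed (v # vs) a (assemble ?P) \<in> filt (v # vs) (chain Ed (v # vs) k)"
      proof (rule pick[OF Fh P])
        fix s assume s: "state_gen v s \<notin> Some ` set (take i gs)"
        show "parts F s ?t = parts (act Ed (v # vs) a (assemble ?P)) s ?t"
          using s F0[of s] out[OF Fh]
          by (cases s) (auto simp: a Y take_Suc t im some const_def vac_def simp del: act.simps)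
      qed
      then show ?thesis using P by blast
    next
      fix w assume w: "w \<in> ?N" and a: "a = GenG {v, w}"
        and t: "set (take i gs) \<subseteq> (\<lambda>u. GenG {v, u}) ` ?N"
      let ?P = "\<lambda>s. case s of One \<Rightarrow> const (parts F (SG w) ?t) * vac vs | _ \<Rightarrow> 0"
      have P: "assemble ?P \<in> homog Ed (v # vs) n"
        by (rule assemble_homog) (auto split: state.splits intro!: scaled[OF Fh])
      have "F - act Ed (v # vs) a (assemble ?P) \<in> filt (v # vs) (chain Ed (v # vs) k)"
      proof (rule pick[OF Fh P])
        fix s assume s: "state_gen v s \<notin> Some ` set (take i gs)"
        show "parts F s ?t = parts (act Ed (v # vs) a (assemble ?P)) s ?t"
          using s F0[of s] t
          by (cases s) (auto simp: a G[OF w] take_Suc const_def vac_def edge_inj some simp del: act.simps)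
      qed
      then show ?thesis using P by blast
    qed
  next
    \<comment> \<open>The colon ideal: \<open>Suc i\<close> adds \<open>x\<^sub>v\<close> itself, \<open>length gs\<close> gives the augmentation ideal.\<close>
    have q: "\<exists>j\<le>length gs. \<forall>n. \<forall>U\<in>homog Ed (v # vs) n.
        (\<forall>s. state_gen v s \<notin> Some ` set (take i gs) \<longrightarrow> parts (act Ed (v # vs) a U) s ?t = 0) \<longleftrightarrow>
        (\<forall>s. state_gen v s \<notin> Some ` set (take j gs) \<longrightarrow> parts U s ?t = 0)"
      using gs_cases
    proof (elim disjE bexE conjE)
      assume a: "a = GenX v" and t: "set (take i gs) = (\<lambda>u. GenG {v, u}) ` ?N"
      show ?thesis
        by (rule exI[of _ "Suc i"]) (use i out in \<open>auto simp: st take_Suc a t X im some simp del: act.simps\<close>)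
    next
      assume a: "a = GenY v" and t: "set (take i gs) = (\<lambda>u. GenG {v, u}) ` ?N \<union> {GenX v}"
      show ?thesis
        by (rule exI[of _ "length gs"]) (use out in \<open>auto simp: st all a t Y im some simp del: act.simps take_all_iff take_all\<close>)
    next
      fix w assume w: "w \<in> ?N" and a: "a = GenG {v, w}"
        and t: "set (take i gs) \<subseteq> (\<lambda>u. GenG {v, u}) ` ?N"
      have "GenX v \<notin> set (take i gs)" "GenY v \<notin> set (take i gs)" using t by auto
      then show ?thesis
        using a_new by (intro exI[of _ "length gs"])
          (use out in \<open>auto simp: st all a G[OF w] im some edge_inj image_iff simp del: act.simps take_all_iff take_all\<close>)
    qed
    then obtain j where j: "j \<le> length gs" "\<And>n U. U \<in> homog Ed (v # vs) n \<Longrightarrow>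
        (\<forall>s. state_gen v s \<notin> Some ` set (take i gs) \<longrightarrow> parts (act Ed (v # vs) a U) s ?t = 0) \<longleftrightarrow>
        (\<forall>s. state_gen v s \<notin> Some ` set (take j gs) \<longrightarrow> parts U s ?t = 0)" by blast
    show "\<exists>q\<le>length (gen_list Ed (v # vs)). \<forall>n. \<forall>U\<in>homog Ed (v # vs) n.
       act Ed (v # vs) a U \<in> filt (v # vs) (chain Ed (v # vs) k) \<longleftrightarrow> U \<in> filt (v # vs) (chain Ed (v # vs) q)"
    proof (intro exI[of _ "length (gen_list Ed vs) + j"] conjI allI ballI)
      fix n U assume U: "U \<in> homog Ed (v # vs) n"
      show "act Ed (v # vs) a U \<in> filt (v # vs) (chain Ed (v # vs) k) \<longleftrightarrow>
          U \<in> filt (v # vs) (chain Ed (v # vs) (length (gen_list Ed vs) + j))"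
        unfolding k_eq level[OF hom_act[OF U]] level[OF U] by (rule j(2)[OF U])
    qed (use j len in simp)
  qed
qed

theorem chain_steps:
  assumes card: "\<forall>e\<in>Ed. card e = 2"
  shows "elimination_list Ed vs \<Longrightarrow> k < length (gen_list Ed vs) \<Longrightarrow> chain_step Ed vs k (gen_list Ed vs ! k)"
proof (induction vs)
  case (Cons v vs)
  show ?case
  proof (cases "k < length (gen_list Ed vs)")
    case True
    have elim: "elimination_list Ed vs" using Cons.prems by simp
    have "gen_list Ed (v # vs) ! k = gen_list Ed vs ! k" using True by (simp add: nth_append)
    moreover have "gen_list Ed vs ! k \<in> gens Ed vs" using True set_gen_list[OF card elim] nth_mem by blast
    ultimately show ?thesis
      using chain_step_lower[OF card Cons.prems(1) True _ Cons.IH[OF elim True]] by simp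
  next
    case False
    then show ?thesis using chain_step_top[OF card Cons.prems(1) _ Cons.prems(2)] by simp
  qed
qed simp

lemma filt_bot: "F \<in> filt vs (chain Ed vs 0) \<longleftrightarrow> F = 0"
  by (auto simp: filt_def chain_def fun_eq_iff)

lemma filt_top:
  assumes card: "\<forall>e\<in>Ed. card e = 2" and elim: "elimination_list Ed vs"
    and F: "F \<in> homog Ed vs n" and n: "n \<noteq> 0"
  shows "F \<in> filt vs (chain Ed vs (length (gen_list Ed vs)))"
  unfolding filt_def mem_Collect_eq
proof (intro allI impI)
  fix l assume "F l \<noteq> 0"
  then have l: "valid Ed vs l" "states_deg l = n" using F by (auto simp: homog_def)
  show "low vs l \<in> Some ` chain Ed vs (length (gen_list Ed vs))"
  proof (cases "low vs l")
    case None
    then show ?thesis using low_None[OF l(1)] l(2) n states_deg_triv by auto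
  next
    case (Some a)
    then show ?thesis using low_gens[OF l(1)] by (simp add: chain_def set_gen_list[OF card elim])
  qed
qed

text \<open>A monomial of degree zero has no letters at all.\<close>

lemma filt_deg_0:
  assumes "F \<in> homog Ed vs 0" "F \<in> filt vs P" shows "F = 0"
proof
  fix l
  show "F l = 0 l"
  proof (rule ccontr)
    assume "F l \<noteq> 0 l"
    then have l: "valid Ed vs l" "states_deg l = 0" "low vs l \<in> Some ` P" using assms by (auto simp: homog_def filt_def)
    have "valid Ed vs l \<Longrightarrow> states_deg l = 0 \<Longrightarrow> low vs l = None"
    proof (induction vs arbitrary: l)
      case (Cons v vs)
      then obtain s l' where sl: "l = s # l'" "valid Ed vs l'" by auto
      then have "state_deg s = 0" "states_deg l' = 0"
        using Cons.prems(2) state_deg_nonneg[of s] states_deg_nonneg[of l'] by auto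
      moreover from this have "s = One" by (cases s) auto
      ultimately show ?case using Cons.IH[OF sl(2)] sl(1) by simp
    qed simp
    then show False using l by auto
  qed
qed

section \<open>Quotients of rational algebras and the tensor algebra\<close>

text \<open>Surjective homomorphisms of rational algebras for which the grading of the target is the image of the
  grading of the source, as it is for quotients.\<close>

definition algebra_epi :: "'a graded_algebra \<Rightarrow> 'b graded_algebra \<Rightarrow> ('a \<Rightarrow> 'b) \<Rightarrow> bool" where
  "algebra_epi R S h \<longleftrightarrow> carrier S = h ` carrier R \<and>
     (\<forall>x\<in>carrier R. \<forall>y\<in>carrier R. h (x \<otimes>\<^bsub>R\<^esub> y) = h x \<otimes>\<^bsub>S\<^esub> h y \<and> h (x \<oplus>\<^bsub>R\<^esub> y) = h x \<oplus>\<^bsub>S\<^esub> h y) \<and>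
     h \<one>\<^bsub>R\<^esub> = \<one>\<^bsub>S\<^esub> \<and> h \<zero>\<^bsub>R\<^esub> = \<zero>\<^bsub>S\<^esub> \<and>
     (\<forall>q. \<forall>x\<in>carrier R. h (q \<odot>\<^bsub>R\<^esub> x) = q \<odot>\<^bsub>S\<^esub> h x) \<and> (\<forall>n. grade S n = h ` grade R n)"

lemma algebra_epiD:
  assumes "algebra_epi R S h"
  shows "carrier S = h ` carrier R"
    "\<lbrakk>x \<in> carrier R; y \<in> carrier R\<rbrakk> \<Longrightarrow> h (x \<otimes>\<^bsub>R\<^esub> y) = h x \<otimes>\<^bsub>S\<^esub> h y"
    "\<lbrakk>x \<in> carrier R; y \<in> carrier R\<rbrakk> \<Longrightarrow> h (x \<oplus>\<^bsub>R\<^esub> y) = h x \<oplus>\<^bsub>S\<^esub> h y"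
    "h \<one>\<^bsub>R\<^esub> = \<one>\<^bsub>S\<^esub>" "h \<zero>\<^bsub>R\<^esub> = \<zero>\<^bsub>S\<^esub>"
    "x \<in> carrier R \<Longrightarrow> h (q \<odot>\<^bsub>R\<^esub> x) = q \<odot>\<^bsub>S\<^esub> h x" "grade S n = h ` grade R n"
    "x \<in> carrier R \<Longrightarrow> h x \<in> carrier S"
  using assms by (simp_all add: algebra_epi_def)

lemma algebra_epi_comp:
  assumes h: "algebra_epi R S h" and k: "algebra_epi S T k" shows "algebra_epi R T (\<lambda>x. k (h x))"
proof -
  note h' = algebra_epiD[OF h] and k' = algebra_epiD[OF k]
  show ?thesis unfolding algebra_epi_def
    by (simp add: h'(2-6,8) k'(2-6)) (simp add: h'(1,7) k'(1,7) image_image)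
qed

lemma rat_algebraD:
  assumes "rat_algebra R"
  shows "ring R" "a \<in> carrier R \<Longrightarrow> q \<odot>\<^bsub>R\<^esub> a \<in> carrier R"
    "a \<in> carrier R \<Longrightarrow> (p + q) \<odot>\<^bsub>R\<^esub> a = p \<odot>\<^bsub>R\<^esub> a \<oplus>\<^bsub>R\<^esub> q \<odot>\<^bsub>R\<^esub> a"
    "\<lbrakk>a \<in> carrier R; b \<in> carrier R\<rbrakk> \<Longrightarrow> q \<odot>\<^bsub>R\<^esub> (a \<oplus>\<^bsub>R\<^esub> b) = q \<odot>\<^bsub>R\<^esub> a \<oplus>\<^bsub>R\<^esub> q \<odot>\<^bsub>R\<^esub> b"
    "a \<in> carrier R \<Longrightarrow> (p * q) \<odot>\<^bsub>R\<^esub> a = p \<odot>\<^bsub>R\<^esub> (q \<odot>\<^bsub>R\<^esub> a)"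
    "a \<in> carrier R \<Longrightarrow> 1 \<odot>\<^bsub>R\<^esub> a = a"
    "\<lbrakk>a \<in> carrier R; b \<in> carrier R\<rbrakk> \<Longrightarrow> (q \<odot>\<^bsub>R\<^esub> a) \<otimes>\<^bsub>R\<^esub> b = q \<odot>\<^bsub>R\<^esub> (a \<otimes>\<^bsub>R\<^esub> b)"
    "\<lbrakk>a \<in> carrier R; b \<in> carrier R\<rbrakk> \<Longrightarrow> a \<otimes>\<^bsub>R\<^esub> (q \<odot>\<^bsub>R\<^esub> b) = q \<odot>\<^bsub>R\<^esub> (a \<otimes>\<^bsub>R\<^esub> b)"
  using assms unfolding rat_algebra_def by blast+

lemma algebra_epi_rat_algebra:
  assumes R: "rat_algebra R" and h: "algebra_epi R S h" shows "rat_algebra S"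
proof -
  note h' = algebra_epiD[OF h] and R' = rat_algebraD[OF R]
  interpret R: ring R by (rule R'(1))
  note hom = h'(2)[symmetric] h'(3)[symmetric] h'(4)[symmetric] h'(5)[symmetric] h'(6)[symmetric]
  have ex: "\<exists>a\<in>carrier R. x = h a" if "x \<in> carrier S" for x using that by (auto simp: h'(1))
  have "ring S"
  proof (rule ringI)
    show "abelian_group S"
    proof (rule abelian_groupI)
      fix x assume "x \<in> carrier S"
      then obtain a where a: "a \<in> carrier R" "x = h a" using ex by blast
      show "\<exists>y\<in>carrier S. y \<oplus>\<^bsub>S\<^esub> x = \<zero>\<^bsub>S\<^esub>"
        by (rule bexI[of _ "h (\<ominus>\<^bsub>R\<^esub> a)"]) (use a in \<open>simp_all add: hom h'(8) R.l_neg del: h'(5)\<close>)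
      show "\<zero>\<^bsub>S\<^esub> \<oplus>\<^bsub>S\<^esub> x = x" using a by (simp add: hom)
    next
      fix x y z assume "x \<in> carrier S" "y \<in> carrier S" "z \<in> carrier S"
      then obtain a b c where abc: "a \<in> carrier R" "x = h a" "b \<in> carrier R" "y = h b" "c \<in> carrier R" "z = h c"
        using ex by meson
      then show "x \<oplus>\<^bsub>S\<^esub> y \<oplus>\<^bsub>S\<^esub> z = x \<oplus>\<^bsub>S\<^esub> (y \<oplus>\<^bsub>S\<^esub> z)" by (simp add: hom R.a_assoc)
    next
      fix x y assume "x \<in> carrier S" "y \<in> carrier S"
      then obtain a b where ab: "a \<in> carrier R" "x = h a" "b \<in> carrier R" "y = h b"
        using ex by meson
      then show "x \<oplus>\<^bsub>S\<^esub> y \<in> carrier S" by (simp add: hom h'(8))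
      show "x \<oplus>\<^bsub>S\<^esub> y = y \<oplus>\<^bsub>S\<^esub> x" using ab by (simp add: hom R.a_comm)
    qed (simp add: hom h'(8))
  next
    show "Group.monoid S"
    proof (rule monoidI)
      fix x y z assume "x \<in> carrier S" "y \<in> carrier S" "z \<in> carrier S"
      then obtain a b c where abc: "a \<in> carrier R" "x = h a" "b \<in> carrier R" "y = h b" "c \<in> carrier R" "z = h c"
        using ex by meson
      then show "x \<otimes>\<^bsub>S\<^esub> y \<otimes>\<^bsub>S\<^esub> z = x \<otimes>\<^bsub>S\<^esub> (y \<otimes>\<^bsub>S\<^esub> z)" by (simp add: hom R.m_assoc)
    next
      fix x y assume "x \<in> carrier S" "y \<in> carrier S"
      then obtain a b where ab: "a \<in> carrier R" "x = h a" "b \<in> carrier R" "y = h b"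
        using ex by meson
      then show "x \<otimes>\<^bsub>S\<^esub> y \<in> carrier S" by (simp add: hom h'(8))
    next
      fix x assume "x \<in> carrier S"
      then obtain a where a: "a \<in> carrier R" "x = h a" using ex by blast
      show "\<one>\<^bsub>S\<^esub> \<otimes>\<^bsub>S\<^esub> x = x" "x \<otimes>\<^bsub>S\<^esub> \<one>\<^bsub>S\<^esub> = x" using a by (simp_all add: hom)
    qed (simp add: hom h'(8))
  next
    fix x y z assume "x \<in> carrier S" "y \<in> carrier S" "z \<in> carrier S"
    then obtain a b c where abc: "a \<in> carrier R" "x = h a" "b \<in> carrier R" "y = h b" "c \<in> carrier R" "z = h c"
      using ex by meson
    then show "(x \<oplus>\<^bsub>S\<^esub> y) \<otimes>\<^bsub>S\<^esub> z = x \<otimes>\<^bsub>S\<^esub> z \<oplus>\<^bsub>S\<^esub> y \<otimes>\<^bsub>S\<^esub> z"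
      "z \<otimes>\<^bsub>S\<^esub> (x \<oplus>\<^bsub>S\<^esub> y) = z \<otimes>\<^bsub>S\<^esub> x \<oplus>\<^bsub>S\<^esub> z \<otimes>\<^bsub>S\<^esub> y"
      by (simp_all add: hom R.l_distr R.r_distr)
  qed
  moreover have "q \<odot>\<^bsub>S\<^esub> x \<in> carrier S \<and> (p + q) \<odot>\<^bsub>S\<^esub> x = p \<odot>\<^bsub>S\<^esub> x \<oplus>\<^bsub>S\<^esub> q \<odot>\<^bsub>S\<^esub> x \<and>
      q \<odot>\<^bsub>S\<^esub> (x \<oplus>\<^bsub>S\<^esub> y) = q \<odot>\<^bsub>S\<^esub> x \<oplus>\<^bsub>S\<^esub> q \<odot>\<^bsub>S\<^esub> y \<and> (p * q) \<odot>\<^bsub>S\<^esub> x = p \<odot>\<^bsub>S\<^esub> (q \<odot>\<^bsub>S\<^esub> x) \<and>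
      1 \<odot>\<^bsub>S\<^esub> x = x \<and> (q \<odot>\<^bsub>S\<^esub> x) \<otimes>\<^bsub>S\<^esub> y = q \<odot>\<^bsub>S\<^esub> (x \<otimes>\<^bsub>S\<^esub> y) \<and> x \<otimes>\<^bsub>S\<^esub> (q \<odot>\<^bsub>S\<^esub> y) = q \<odot>\<^bsub>S\<^esub> (x \<otimes>\<^bsub>S\<^esub> y)"
    if xy: "x \<in> carrier S" "y \<in> carrier S" for p q x y
  proof -
    obtain a b where ab: "a \<in> carrier R" "x = h a" "b \<in> carrier R" "y = h b"
      using ex xy by meson
    then show ?thesis
      by (simp add: hom R'(2) h'(8)) (simp add: R'(3-8))
  qed
  ultimately show ?thesis unfolding rat_algebra_def by blast
qed

lemma (in ideal) a_rcos_eq_iff: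
  "\<lbrakk>x \<in> carrier R; y \<in> carrier R\<rbrakk> \<Longrightarrow> I +>\<^bsub>R\<^esub> x = I +>\<^bsub>R\<^esub> y \<longleftrightarrow> x \<ominus>\<^bsub>R\<^esub> y \<in> I"
  using quotient_eq_iff_same_a_r_cos[OF is_ideal] by blast

lemma algebra_epi_quotient:
  assumes R: "rat_algebra R" and I: "ideal I R"
  shows "algebra_epi R (quotient_algebra R I) (\<lambda>x. I +>\<^bsub>R\<^esub> x)"
proof -
  interpret R: ring R by (rule rat_algebraD(1)[OF R])
  interpret I: ideal I R by (rule I)
  note hom = I.rcos_ring_hom
  note R' = rat_algebraD[OF R]
  have smult: "(\<Union>x\<in>I +>\<^bsub>R\<^esub> a. I +>\<^bsub>R\<^esub> (q \<odot>\<^bsub>R\<^esub> x)) = I +>\<^bsub>R\<^esub> (q \<odot>\<^bsub>R\<^esub> a)" if a: "a \<in> carrier R" for q a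
  proof -
    have "I +>\<^bsub>R\<^esub> (q \<odot>\<^bsub>R\<^esub> x) = I +>\<^bsub>R\<^esub> (q \<odot>\<^bsub>R\<^esub> a)" if x: "x \<in> I +>\<^bsub>R\<^esub> a" for x
    proof -
      have xc: "x \<in> carrier R" using x a I.a_subset R.a_r_coset_subset_G by blast
      obtain i where i: "i \<in> I" "x = i \<oplus>\<^bsub>R\<^esub> a" using x by (auto simp: a_r_coset_def')
      have ic: "i \<in> carrier R" using i(1) by (rule I.Icarr)
      have "(q \<odot>\<^bsub>R\<^esub> \<one>\<^bsub>R\<^esub>) \<otimes>\<^bsub>R\<^esub> i \<in> I" by (rule I.I_l_closed[OF i(1)]) (simp add: R'(2))
      then have qi: "q \<odot>\<^bsub>R\<^esub> i \<in> I" using ic by (simp add: R'(7))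
      have "q \<odot>\<^bsub>R\<^esub> x \<ominus>\<^bsub>R\<^esub> q \<odot>\<^bsub>R\<^esub> a = q \<odot>\<^bsub>R\<^esub> i"
        using a ic by (simp add: i(2) R' a_minus_def R.a_assoc R.r_neg)
      then show ?thesis using qi a xc by (simp add: I.a_rcos_eq_iff R')
    qed
    moreover have "a \<in> I +>\<^bsub>R\<^esub> a" using a by (rule I.a_rcos_self)
    ultimately show ?thesis by blast
  qed
  have carr: "carrier (R Quot I) = (\<lambda>x. I +>\<^bsub>R\<^esub> x) ` carrier R"
    by (auto simp: FactRing_def A_RCOSETS_def')
  have zero: "I +>\<^bsub>R\<^esub> \<zero>\<^bsub>R\<^esub> = \<zero>\<^bsub>R Quot I\<^esub>"
    using R.a_rcos_zero[OF I I.zero_closed] by (simp add: FactRing_def)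
  show ?thesis
    unfolding algebra_epi_def
  proof (intro conjI allI ballI)
    fix x y assume "x \<in> carrier R" "y \<in> carrier R"
    then show "I +>\<^bsub>R\<^esub> (x \<otimes>\<^bsub>R\<^esub> y) = (I +>\<^bsub>R\<^esub> x) \<otimes>\<^bsub>quotient_algebra R I\<^esub> (I +>\<^bsub>R\<^esub> y)"
      "I +>\<^bsub>R\<^esub> (x \<oplus>\<^bsub>R\<^esub> y) = (I +>\<^bsub>R\<^esub> x) \<oplus>\<^bsub>quotient_algebra R I\<^esub> (I +>\<^bsub>R\<^esub> y)"
      using ring_hom_mult[OF hom] ring_hom_add[OF hom] by (simp_all add: quotient_algebra_def)
  next
    show "I +>\<^bsub>R\<^esub> \<one>\<^bsub>R\<^esub> = \<one>\<^bsub>quotient_algebra R I\<^esub>" "I +>\<^bsub>R\<^esub> \<zero>\<^bsub>R\<^esub> = \<zero>\<^bsub>quotient_algebra R I\<^esub>"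
      using ring_hom_one[OF hom] zero by (simp_all add: quotient_algebra_def)
  next
    fix q x assume "x \<in> carrier R"
    then show "I +>\<^bsub>R\<^esub> (q \<odot>\<^bsub>R\<^esub> x) = q \<odot>\<^bsub>quotient_algebra R I\<^esub> (I +>\<^bsub>R\<^esub> x)"
      by (simp add: quotient_algebra_def smult)
  qed (simp_all add: quotient_algebra_def carr)
qed

text \<open>An element that dies in the second quotient lies in the preimage of the ideal generated by \<open>S\<close>, and the
  image of \<open>K\<close> is an ideal that contains \<open>S\<close>.\<close>

lemma quotient_quotient_kernel:
  assumes R: "rat_algebra R" and I: "ideal I R" and S: "S \<subseteq> carrier (quotient_algebra R I)"
    and K: "ideal K R" "I \<subseteq> K" "\<And>x. \<lbrakk>x \<in> carrier R; I +>\<^bsub>R\<^esub> x \<in> S\<rbrakk> \<Longrightarrow> x \<in> K"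
    and x: "x \<in> carrier R"
      "(Idl\<^bsub>quotient_algebra R I\<^esub> S) +>\<^bsub>quotient_algebra R I\<^esub> (I +>\<^bsub>R\<^esub> x) =
        \<zero>\<^bsub>quotient_algebra (quotient_algebra R I) (Idl\<^bsub>quotient_algebra R I\<^esub> S)\<^esub>"
  shows "x \<in> K"
proof -
  let ?Q = "quotient_algebra R I" and ?h = "\<lambda>x. I +>\<^bsub>R\<^esub> x"
  have h: "algebra_epi R ?Q ?h" by (rule algebra_epi_quotient[OF R I])
  note h' = algebra_epiD[OF h]
  have Q: "rat_algebra ?Q" by (rule algebra_epi_rat_algebra[OF R h])
  interpret R: ring R by (rule rat_algebraD(1)[OF R])
  interpret I: ideal I R by (rule I)
  interpret K: ideal K R by (rule K(1))
  interpret Q: ring ?Q by (rule rat_algebraD(1)[OF Q])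
  have Kc: "a \<in> carrier R" if "a \<in> K" for a using that by (rule K.Icarr)
  have "ideal (?h ` K) ?Q"
  proof (rule idealI[OF Q.ring_axioms])
    show "subgroup (?h ` K) (add_monoid ?Q)"
    proof
      show "?h ` K \<subseteq> carrier (add_monoid ?Q)" using Kc h'(8) by auto
      show "\<one>\<^bsub>add_monoid ?Q\<^esub> \<in> ?h ` K" using h'(5) K.zero_closed by (metis imageI monoid.select_convs(2))
      show "x \<otimes>\<^bsub>add_monoid ?Q\<^esub> y \<in> ?h ` K" if "x \<in> ?h ` K" "y \<in> ?h ` K" for x y
        using that h'(3)[OF Kc Kc] K.a_closed by (auto simp: image_iff)
      fix y assume "y \<in> ?h ` K"
      then obtain a where a: "a \<in> K" "y = ?h a" by blast
      have "?h (\<ominus>\<^bsub>R\<^esub> a) \<oplus>\<^bsub>?Q\<^esub> y = \<zero>\<^bsub>?Q\<^esub>"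
        using Kc[OF a(1)] h'(3)[of "\<ominus>\<^bsub>R\<^esub> a" a] h'(5) a(2) by (simp add: R.l_neg)
      then have "\<ominus>\<^bsub>?Q\<^esub> y = ?h (\<ominus>\<^bsub>R\<^esub> a)"
        using Kc[OF a(1)] h'(8) a(2) by (intro Q.minus_equality) auto
      then show "inv\<^bsub>add_monoid ?Q\<^esub> y \<in> ?h ` K"
        using a(1) K.a_inv_closed by (auto simp: a_inv_def[symmetric])
    qed
    show "y \<otimes>\<^bsub>?Q\<^esub> a \<in> ?h ` K" "a \<otimes>\<^bsub>?Q\<^esub> y \<in> ?h ` K" if ay: "a \<in> ?h ` K" "y \<in> carrier ?Q" for a y
    proof -
      obtain k where k: "k \<in> K" "a = ?h k" using ay(1) by blast
      obtain z where z: "z \<in> carrier R" "y = ?h z" using ay(2) unfolding h'(1) by blast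
      show "y \<otimes>\<^bsub>?Q\<^esub> a \<in> ?h ` K" "a \<otimes>\<^bsub>?Q\<^esub> y \<in> ?h ` K"
        unfolding k z using k z Kc K.I_l_closed K.I_r_closed
        by (auto simp: h'(2)[symmetric])
    qed
  qed
  moreover have "S \<subseteq> ?h ` K"
  proof
    fix s assume s: "s \<in> S"
    then obtain z where "z \<in> carrier R" "s = ?h z" using S unfolding h'(1) by blast
    then show "s \<in> ?h ` K" using K(3) s by blast
  qed
  ultimately have sub: "Idl\<^bsub>?Q\<^esub> S \<subseteq> ?h ` K" by (rule Q.genideal_minimal)
  interpret J: ideal "Idl\<^bsub>?Q\<^esub> S" ?Q by (rule Q.genideal_ideal[OF S])
  have "?h x \<in> (Idl\<^bsub>?Q\<^esub> S) +>\<^bsub>?Q\<^esub> ?h x" by (rule J.a_rcos_self) (rule h'(8)[OF x(1)])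
  then have "?h x \<in> Idl\<^bsub>?Q\<^esub> S" unfolding x(2) by (simp add: quotient_algebra_def FactRing_def)
  then obtain k where k: "k \<in> K" "?h x = ?h k" using sub by blast
  then have "x \<ominus>\<^bsub>R\<^esub> k \<in> K" using I.a_rcos_eq_iff[OF x(1) Kc] K(2) by blast
  then have "(x \<ominus>\<^bsub>R\<^esub> k) \<oplus>\<^bsub>R\<^esub> k \<in> K" using k(1) by (rule K.a_closed)
  moreover have "(x \<ominus>\<^bsub>R\<^esub> k) \<oplus>\<^bsub>R\<^esub> k = x" using x(1) Kc[OF k(1)] by (simp add: a_minus_def R.a_assoc R.l_neg)
  ultimately show ?thesis by simp
qed

lemma tensor_simps [simp]:
  "carrier (tensor_algebra B) = {p. Poly_Mapping.keys p \<subseteq> lists B}"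
  "p \<otimes>\<^bsub>tensor_algebra B\<^esub> q = p * q" "\<one>\<^bsub>tensor_algebra B\<^esub> = 1" "\<zero>\<^bsub>tensor_algebra B\<^esub> = 0"
  "p \<oplus>\<^bsub>tensor_algebra B\<^esub> q = p + q" "c \<odot>\<^bsub>tensor_algebra B\<^esub> q = Poly_Mapping.single [] c * q"
  "grade (tensor_algebra B) n = {p. Poly_Mapping.keys p \<subseteq> {w \<in> lists B. length w = n}}"
  by (simp_all add: tensor_algebra_def)

lemma poly_mapping_single_induct [case_names zero single add]:
  fixes P :: "('k \<Rightarrow>\<^sub>0 'b::comm_monoid_add) \<Rightarrow> bool"
  assumes "P 0" "\<And>k v. k \<in> Poly_Mapping.keys p \<Longrightarrow> P (Poly_Mapping.single k v)" "\<And>p q. P p \<Longrightarrow> P q \<Longrightarrow> P (p + q)"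
  shows "P p"
proof -
  have "P (\<Sum>k\<in>S. Poly_Mapping.single k (Poly_Mapping.lookup p k))" if "S \<subseteq> Poly_Mapping.keys p" "finite S" for S
    using that(2,1) by (induction S rule: finite_induct) (use assms in auto)
  moreover have "(\<Sum>k\<in>Poly_Mapping.keys p. Poly_Mapping.single k (Poly_Mapping.lookup p k)) = p"
    by (rule poly_mapping_eqI) (auto simp: lookup_sum lookup_single when_def in_keys_iff)
  ultimately show ?thesis by (metis finite_keys order_refl)
qed

text \<open>Scalars are multiples of the empty word and hence central.\<close>

lemma single_Nil_commute: "Poly_Mapping.single [] c * p = p * Poly_Mapping.single [] c" for p :: "'g list \<Rightarrow>\<^sub>0 rat"
proof (induction p rule: poly_mapping_single_induct)
  case (single k v)
  then show ?case by (simp add: mult_single plus_list_def mult.commute)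
next
  case (add p q)
  then show ?case by (simp add: algebra_simps)
qed simp

lemma rat_algebra_tensor: "rat_algebra (tensor_algebra B)"
proof -
  interpret T: ring "tensor_algebra B" by (rule ring_tensor_algebra)
  have s: "Poly_Mapping.keys (Poly_Mapping.single [] c) \<subseteq> lists B" for c :: rat by auto
  have m: "Poly_Mapping.keys (p * q) \<subseteq> lists B"
    if "Poly_Mapping.keys p \<subseteq> lists B" "Poly_Mapping.keys q \<subseteq> lists B" for p q :: "'a list \<Rightarrow>\<^sub>0 rat"
    using T.m_closed[of p q] that by simp
  have one: "Poly_Mapping.single [] 1 = (1 :: 'a list \<Rightarrow>\<^sub>0 rat)"
    by (simp add: zero_list_def flip: single_one)
  have mul: "Poly_Mapping.single [] (p * q) = Poly_Mapping.single [] p * (Poly_Mapping.single [] q :: 'a list \<Rightarrow>\<^sub>0 rat)"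
    for p q by (simp add: mult_single plus_list_def)
  show ?thesis
    unfolding rat_algebra_def
  proof (intro conjI allI ballI ring_tensor_algebra)
    fix p q a b assume a: "a \<in> carrier (tensor_algebra B)" and b: "b \<in> carrier (tensor_algebra B)"
    show "q \<odot>\<^bsub>tensor_algebra B\<^esub> a \<in> carrier (tensor_algebra B)" using m[OF s] a by simp
    show "a \<otimes>\<^bsub>tensor_algebra B\<^esub> (q \<odot>\<^bsub>tensor_algebra B\<^esub> b) = q \<odot>\<^bsub>tensor_algebra B\<^esub> (a \<otimes>\<^bsub>tensor_algebra B\<^esub> b)"
      using single_Nil_commute[of q a] by (simp add: mult.assoc[symmetric])
  qed (simp_all add: single_add algebra_simps one mul)
qed

section \<open>Action of the tensor algebra and normal forms\<close>

abbreviation letter :: "'g \<Rightarrow> 'g list \<Rightarrow>\<^sub>0 rat" where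
  "letter b \<equiv> Poly_Mapping.single [b] 1"

abbreviation scalar :: "rat \<Rightarrow> 'g list \<Rightarrow>\<^sub>0 rat" where
  "scalar c \<equiv> Poly_Mapping.single [] c"

lemma letter_times_single: "letter b * Poly_Mapping.single w c = Poly_Mapping.single (b # w) c"
  by (simp add: mult_single plus_list_def)

lemma scalar_times_single: "scalar d * Poly_Mapping.single w c = Poly_Mapping.single w (d * c)"
  by (simp add: mult_single plus_list_def)

lemma scalar_1: "scalar 1 = 1"
  by (simp add: zero_list_def flip: single_one)

definition act_word :: "'v set set \<Rightarrow> 'v list \<Rightarrow> 'v gen list \<Rightarrow> 'v model \<Rightarrow> 'v model" where
  "act_word Ed vs w F = foldr (act Ed vs) w F"

text \<open>The action of the free algebra on the model that extends the action of the generators.\<close>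

definition tact :: "'v set set \<Rightarrow> 'v list \<Rightarrow> ('v gen list \<Rightarrow>\<^sub>0 rat) \<Rightarrow> 'v model \<Rightarrow> 'v model" where
  "tact Ed vs p F = (\<Sum>w\<in>Poly_Mapping.keys p. const (Poly_Mapping.lookup p w) * act_word Ed vs w F)"

lemma additive_act: "additive (act Ed vs a)"
  by (rule additive.intro) (rule act_add)

lemmas act_zero = additive.zero[OF additive_act] and act_sum = additive.sum[OF additive_act]

lemma act_word_add: "act_word Ed vs w (F + G) = act_word Ed vs w F + act_word Ed vs w G"
  by (induction w) (simp_all only: act_word_def foldr.simps id_apply o_apply act_add)

lemma act_word_scale: "act_word Ed vs w (const q * F) = const q * act_word Ed vs w F"
  by (induction w) (simp_all only: act_word_def foldr.simps id_apply o_apply act_scale)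

lemma const_simps: "const 0 = 0" "const 1 = 1" "const (p + q) = const p + const q" "const (p * q) = const p * const q"
  by (auto simp: const_def fun_eq_iff)

lemma tact_superset:
  "finite S \<Longrightarrow> Poly_Mapping.keys p \<subseteq> S \<Longrightarrow>
    tact Ed vs p F = (\<Sum>w\<in>S. const (Poly_Mapping.lookup p w) * act_word Ed vs w F)"
  unfolding tact_def by (rule sum.mono_neutral_left) (auto simp: in_keys_iff const_simps)

lemma tact_add: "tact Ed vs (p + q) F = tact Ed vs p F + tact Ed vs q F"
proof -
  let ?S = "Poly_Mapping.keys p \<union> Poly_Mapping.keys q"
  have "tact Ed vs (p + q) F = (\<Sum>w\<in>?S. const (Poly_Mapping.lookup (p + q) w) * act_word Ed vs w F)"
    by (rule tact_superset) (simp_all add: Poly_Mapping.keys_add)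
  also have "\<dots> = tact Ed vs p F + tact Ed vs q F"
    using tact_superset[of ?S p Ed vs F] tact_superset[of ?S q Ed vs F]
    by (simp add: lookup_add const_simps distrib_right sum.distrib)
  finally show ?thesis .
qed

lemma tact_zero [simp]: "tact Ed vs 0 F = 0"
  by (simp add: tact_def)

lemma tact_uminus: "tact Ed vs (- p) F = - tact Ed vs p F"
  using tact_add[of Ed vs p "- p" F] by (simp add: eq_neg_iff_add_eq_0 add.commute)

lemma tact_diff: "tact Ed vs (p - q) F = tact Ed vs p F - tact Ed vs q F"
  using tact_add[of Ed vs p "- q" F] by (simp add: tact_uminus)

lemma tact_sum: "tact Ed vs (\<Sum>i\<in>S. p i) F = (\<Sum>i\<in>S. tact Ed vs (p i) F)"
  by (induction S rule: infinite_finite_induct) (auto simp: tact_add)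

lemma tact_single: "tact Ed vs (Poly_Mapping.single w c) F = const c * act_word Ed vs w F"
  by (cases "c = 0") (simp_all add: tact_def const_simps)

lemma tact_letter [simp]: "tact Ed vs (letter b) F = act Ed vs b F"
  by (simp add: tact_single act_word_def const_simps)

lemma tact_scalar: "tact Ed vs (scalar c) F = const c * F"
  by (simp add: tact_single act_word_def)

lemma tact_add_right: "tact Ed vs p (F + G) = tact Ed vs p F + tact Ed vs p G"
  by (simp add: tact_def act_word_add distrib_left sum.distrib)

lemma tact_zero_right [simp]: "tact Ed vs p 0 = 0"
  using tact_add_right[of Ed vs p 0 0] by simp

lemma tact_mult: "tact Ed vs (p * q) F = tact Ed vs p (tact Ed vs q F)"
proof (induction p rule: poly_mapping_single_induct)
  case (single w c)
  show ?case
  proof (induction q rule: poly_mapping_single_induct)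
    case (single w' c')
    have "act_word Ed vs (w @ w') F = act_word Ed vs w (act_word Ed vs w' F)"
      by (simp add: act_word_def)
    then show ?case
      by (simp only: mult_single plus_list_def tact_single act_word_scale const_simps mult.assoc)
  next
    case (add p q)
    then show ?case by (simp only: distrib_left tact_add tact_add_right)
  qed (simp only: mult_zero_right tact_zero tact_zero_right)
next
  case (add p q)
  then show ?case by (simp only: distrib_right tact_add)
qed (simp only: mult_zero_left tact_zero)

text \<open>An ideal of the free algebra on all letters. It contains the defining relations, so everything that is
  zero in the quotient acts as zero.\<close>

definition annihilator :: "'v set set \<Rightarrow> 'v list \<Rightarrow> ('v gen list \<Rightarrow>\<^sub>0 rat) set" where
  "annihilator Ed vs = {p. \<forall>F. tact Ed vs p F = 0}"

lemma annihilator_ideal: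
  "0 \<in> annihilator Ed vs" "\<lbrakk>p \<in> annihilator Ed vs; q \<in> annihilator Ed vs\<rbrakk> \<Longrightarrow> p + q \<in> annihilator Ed vs"
  "p \<in> annihilator Ed vs \<Longrightarrow> c * p \<in> annihilator Ed vs" "p \<in> annihilator Ed vs \<Longrightarrow> p * c \<in> annihilator Ed vs"
  by (simp_all add: annihilator_def tact_add tact_mult)

lemma self_uminus: "F = - F \<Longrightarrow> F = 0" for F :: "'b \<Rightarrow> rat"
proof
  fix l assume "F = - F"
  then have "F l = - F l" by (metis uminus_apply)
  then show "F l = 0 l" by simp
qed

context model_relations
begin

text \<open>Generators anticommute and square to zero, so the square of a linear combination equals its own
  negative.\<close>

lemma degree_one_square_annihilator:
  assumes p: "Poly_Mapping.keys p \<subseteq> {w \<in> lists (gens Ed vs). length w = 1}"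
  shows "p * p \<in> annihilator Ed vs"
proof -
  let ?B = "{b. [b] \<in> Poly_Mapping.keys p}" and ?c = "\<lambda>b. const (Poly_Mapping.lookup p [b])"
  have keys: "Poly_Mapping.keys p = (\<lambda>b. [b]) ` ?B" using p by (force simp: length_Suc_conv)
  have B: "?B \<subseteq> gens Ed vs" using p by auto
  have t: "tact Ed vs p F = (\<Sum>b\<in>?B. ?c b * act Ed vs b F)" for F
    unfolding tact_def by (subst keys, subst sum.reindex) (auto simp: inj_on_def act_word_def)
  have "tact Ed vs p (tact Ed vs p F) = 0" for F
  proof (rule self_uminus)
    have eq: "tact Ed vs p (tact Ed vs p F) = (\<Sum>b\<in>?B. \<Sum>b'\<in>?B. ?c b * (?c b' * act Ed vs b (act Ed vs b' F)))"
      unfolding t by (simp add: act_sum act_scale sum_distrib_left)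
    also have "\<dots> = (\<Sum>b\<in>?B. \<Sum>b'\<in>?B. - (?c b' * (?c b * act Ed vs b' (act Ed vs b F))))"
    proof (intro sum.cong refl)
      fix b b' assume "b \<in> ?B" "b' \<in> ?B"
      then have "act Ed vs b (act Ed vs b' F) = - act Ed vs b' (act Ed vs b F)"
        using B by (intro act_anti) auto
      then show "?c b * (?c b' * act Ed vs b (act Ed vs b' F)) = - (?c b' * (?c b * act Ed vs b' (act Ed vs b F)))"
        by (simp add: mult.left_commute)
    qed
    also have "\<dots> = - (\<Sum>b\<in>?B. \<Sum>b'\<in>?B. ?c b' * (?c b * act Ed vs b' (act Ed vs b F)))"
      by (simp only: sum_negf)
    also have "\<dots> = - (\<Sum>b'\<in>?B. \<Sum>b\<in>?B. ?c b' * (?c b * act Ed vs b' (act Ed vs b F)))"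
      by (subst sum.swap) simp
    also have "\<dots> = - tact Ed vs p (tact Ed vs p F)" by (simp only: eq)
    finally show "tact Ed vs p (tact Ed vs p F) = - tact Ed vs p (tact Ed vs p F)" .
  qed
  then show ?thesis by (simp add: annihilator_def tact_mult)
qed

lemma annihilator_edges:
  "\<lbrakk>u \<in> set vs; w \<in> set vs; {u, w} \<in> Ed\<rbrakk> \<Longrightarrow>
     (letter (GenX u) - letter (GenX w)) * letter (GenG {u, w}) \<in> annihilator Ed vs"
  "\<lbrakk>u \<in> set vs; w \<in> set vs; {u, w} \<in> Ed\<rbrakk> \<Longrightarrow>
     (letter (GenY u) - letter (GenY w)) * letter (GenG {u, w}) \<in> annihilator Ed vs"
  using act_X_edge[of u w] act_Y_edge[of u w] by (simp_all add: annihilator_def tact_mult tact_diff)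

end

lemma annihilator_anticommuting:
  assumes "model_relations Ed vs" "\<forall>e\<in>Ed. e \<subseteq> set vs"
  shows "anticommuting_edges (annihilator Ed vs) Ed (\<lambda>e. letter (GenG e))"
proof
  interpret model_relations Ed vs by (rule assms(1))
  have g: "GenG e \<in> gens Ed vs" if "e \<in> Ed" for e using that assms(2) by (simp add: gens_def)
  show "letter (GenG e) * letter (GenG e) \<in> annihilator Ed vs" if "e \<in> Ed" for e
    using act_square[OF g[OF that]] by (simp add: annihilator_def tact_mult)
  show "letter (GenG e) * letter (GenG f) + letter (GenG f) * letter (GenG e) \<in> annihilator Ed vs"
    if "e \<in> Ed" "f \<in> Ed" for e f
    using act_anti[OF g[OF that(1)] g[OF that(2)]] by (simp add: annihilator_def tact_mult tact_add)
qed (auto intro: annihilator_ideal)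

text \<open>The annihilator contains the triangle relations, hence those of all cycles.\<close>

lemma annihilator_cycles:
  assumes card: "\<forall>e\<in>Ed. card e = 2" and Ed: "\<forall>e\<in>Ed. e \<subseteq> set vs" and elim: "elimination_list Ed vs"
    and cs: "graph_cycle Ed cs" "set cs \<subseteq> set vs" "distinct es" "set es = cycle_edges cs"
  shows "alt_sum (\<lambda>e. letter (GenG e)) es \<in> annihilator Ed vs"
proof -
  have rel: "model_relations Ed vs" by (rule elimination_model_relations[OF card elim])
  interpret anticommuting_edges "annihilator Ed vs" Ed "\<lambda>e. letter (GenG e)"
    by (rule annihilator_anticommuting[OF rel Ed])
  show ?thesis
  proof (rule alt_sum_cycle_edges[OF elim _ cs])
    fix u w v
    assume e: "{u, v} \<in> Ed" "{w, v} \<in> Ed" "{u, w} \<in> Ed" and d: "distinct [u, w, v]" "{u, v, w} \<subseteq> set vs"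
    have g: "GenG {u, v} \<in> gens Ed vs" "GenG {w, v} \<in> gens Ed vs" "GenG {w, u} \<in> gens Ed vs"
      using e d by (auto simp: gens_def insert_commute)
    have "act Ed vs (GenG {u, v}) (act Ed vs (GenG {v, w}) F) + act Ed vs (GenG {v, w}) (act Ed vs (GenG {w, u}) F)
        + act Ed vs (GenG {w, u}) (act Ed vs (GenG {u, v}) F) = 0" for F
      using e d by (intro model_relations.act_triangle[OF rel]) (auto simp: insert_commute)
    moreover have "act Ed vs (GenG {w, u}) (act Ed vs (GenG {u, v}) F) =
        - act Ed vs (GenG {u, v}) (act Ed vs (GenG {w, u}) F)" for F
      by (rule model_relations.act_anti[OF rel g(3,1)])
    ultimately show "alt_sum (\<lambda>e. letter (GenG e)) [{v, u}, {w, v}, {w, u}] \<in> annihilator Ed vs"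
      by (simp add: annihilator_def tact_mult tact_add tact_diff insert_commute algebra_simps)
  qed
qed

text \<open>The polynomial in normally ordered monomials that an element of the model stands for.\<close>

primrec normal_form :: "'v set set \<Rightarrow> 'v list \<Rightarrow> 'v model \<Rightarrow> 'v gen list \<Rightarrow>\<^sub>0 rat" where
  "normal_form Ed [] F = scalar (F [])"
| "normal_form Ed (v # vs) F = normal_form Ed vs (parts F One)
     + letter (GenX v) * normal_form Ed vs (parts F SX) + letter (GenY v) * normal_form Ed vs (parts F SY)
     + letter (GenX v) * (letter (GenY v) * normal_form Ed vs (parts F SXY))
     + (\<Sum>u\<in>nbrs Ed v vs. letter (GenG {v, u}) * normal_form Ed vs (parts F (SG u)))"

lemma normal_form_add: "normal_form Ed vs (F + G) = normal_form Ed vs F + normal_form Ed vs G"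
  by (induction vs arbitrary: F G)
    (simp_all add: single_add parts_add distrib_left sum.distrib algebra_simps)

lemma additive_normal_form: "additive (normal_form Ed vs)"
  by (rule additive.intro) (rule normal_form_add)

lemmas normal_form_zero = additive.zero[OF additive_normal_form]
  and normal_form_uminus = additive.minus[OF additive_normal_form]
  and normal_form_sum = additive.sum[OF additive_normal_form]

lemma parts_scale: "parts (const q * F) s = const q * parts F s"
  by (auto simp: parts_def fun_eq_iff const_def)

lemma normal_form_scale: "normal_form Ed vs (const q * F) = scalar q * normal_form Ed vs F"
proof (induction vs arbitrary: F)
  case Nil
  then show ?case by (simp add: scalar_times_single const_def)
next
  case (Cons v vs)
  have "letter a * (scalar q * p) = scalar q * (letter a * p)" for a and p :: "'a gen list \<Rightarrow>\<^sub>0 rat"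
    by (metis mult.assoc single_Nil_commute)
  then show ?case
    by (simp only: normal_form.simps parts_scale Cons.IH distrib_left sum_distrib_left)
qed

lemma normal_form_vac: "normal_form Ed vs (vac vs) = 1"
proof (induction vs)
  case Nil
  then show ?case by (simp add: vac_def scalar_1)
next
  case (Cons v vs)
  then show ?case by (simp add: parts_vac normal_form_zero)
qed

definition words :: "'g set \<Rightarrow> int \<Rightarrow> 'g list set" where
  "words B n = {w \<in> lists B. int (length w) = n}"

lemma keys_letter_mult:
  "b \<in> B \<Longrightarrow> Poly_Mapping.keys p \<subseteq> words B (n - 1) \<Longrightarrow> Poly_Mapping.keys (letter b * p) \<subseteq> words B n"
  for p :: "'g list \<Rightarrow>\<^sub>0 rat"
  using keys_mult[of "letter b" p] by (force simp: words_def plus_list_def)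

lemma keys_add_subset: "Poly_Mapping.keys p \<subseteq> S \<Longrightarrow> Poly_Mapping.keys q \<subseteq> S \<Longrightarrow> Poly_Mapping.keys (p + q) \<subseteq> S"
  using Poly_Mapping.keys_add[of p q] by blast

lemma keys_sum_subset: "(\<And>i. i \<in> I \<Longrightarrow> Poly_Mapping.keys (p i) \<subseteq> S) \<Longrightarrow> Poly_Mapping.keys (\<Sum>i\<in>I. p i) \<subseteq> S"
  by (induction I rule: infinite_finite_induct) (simp_all add: keys_add_subset)

lemma words_mono: "B \<subseteq> B' \<Longrightarrow> words B n \<subseteq> words B' n"
  by (auto simp: words_def)

lemma gens_mono: "gens Ed vs \<subseteq> gens Ed (v # vs)"
  by (auto simp: gens_def)

lemma gens_top: "GenX v \<in> gens Ed (v # vs)" "GenY v \<in> gens Ed (v # vs)"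
  "u \<in> nbrs Ed v vs \<Longrightarrow> GenG {v, u} \<in> gens Ed (v # vs)"
  by (auto simp: gens_def nbrs_def)

lemma normal_form_words: "F \<in> homog Ed vs n \<Longrightarrow> Poly_Mapping.keys (normal_form Ed vs F) \<subseteq> words (gens Ed vs) n"
proof (induction vs arbitrary: F n)
  case Nil
  then show ?case by (auto simp: homog_def words_def)
next
  case (Cons v vs)
  let ?W = "words (gens Ed (v # vs))"
  have IH: "Poly_Mapping.keys (normal_form Ed vs (parts F s)) \<subseteq> ?W (n - state_deg s)" for s
    using Cons words_mono[OF gens_mono] by (fastforce simp: homog_Cons)
  show ?case
    unfolding normal_form.simps
    by (intro keys_add_subset keys_sum_subset keys_letter_mult gens_top)
      (use IH[of One] IH[of SX] IH[of SY] IH[of SXY] IH[of "SG _"] in auto)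
qed

lemma tact_homog:
  assumes card: "\<forall>e\<in>Ed. card e = 2" and elim: "elimination_list Ed vs"
    and F: "F \<in> homog Ed vs m"
  shows "Poly_Mapping.keys p \<subseteq> words (gens Ed vs) n \<Longrightarrow> tact Ed vs p F \<in> homog Ed vs (n + m)"
proof -
  have word: "act_word Ed vs w F \<in> homog Ed vs (int (length w) + m)" if "w \<in> lists (gens Ed vs)" for w
    using that
  proof (induction w)
    case (Cons b w)
    then show ?case
      using act_homog[OF card elim, of b "act_word Ed vs w F" "int (length w) + m"]
      by (simp add: act_word_def add_ac)
  qed (simp add: act_word_def F)
  have scale: "const c * G \<in> homog Ed vs k" if "G \<in> homog Ed vs k" for c G k
    using that by (auto simp: homog_def const_def)
  assume "Poly_Mapping.keys p \<subseteq> words (gens Ed vs) n"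
  then show ?thesis unfolding tact_def
    by (intro homog_sum scale) (use word in \<open>force simp: words_def\<close>)
qed

text \<open>The embedding of the model of the smaller graph as the coefficient of \<open>1\<close>.\<close>

definition bottom :: "'v model \<Rightarrow> 'v model" where
  "bottom H = assemble (\<lambda>s. if s = One then H else 0)"

lemma act_bottom:
  assumes "v \<notin> set vs" "a \<in> gens Ed vs"
  shows "act Ed (v # vs) a (bottom H) = bottom (act Ed vs a H)"
  unfolding bottom_def act.simps parts_assemble extend_act_simps(5)[OF assms]
  by (rule arg_cong[of _ _ assemble]) (auto simp: lop_def act_zero split: state.splits)

lemma bottom_linear: "bottom (F + G) = bottom F + bottom G" "bottom (const q * F) = const q * bottom F" "bottom 0 = 0"
  by (auto simp: bottom_def assemble_def fun_eq_iff const_def split: list.splits)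

text \<open>The generators of the smaller graph act on the constants of the level of \<open>v\<close> as they do without \<open>v\<close>,
  which lets the reconstruction from normal forms proceed by induction.\<close>

lemma tact_bottom:
  assumes v: "v \<notin> set vs" and p: "Poly_Mapping.keys p \<subseteq> words (gens Ed vs) n"
  shows "tact Ed (v # vs) p (bottom H) = bottom (tact Ed vs p H)"
proof -
  have word: "act_word Ed (v # vs) w (bottom H) = bottom (act_word Ed vs w H)" if "w \<in> lists (gens Ed vs)" for w
    using that by (induction w) (simp_all add: act_word_def act_bottom[OF v] del: act.simps)
  have "additive (bottom :: 'a model \<Rightarrow> 'a model)" by (rule additive.intro) (rule bottom_linear)
  note sum = additive.sum[OF this]
  show ?thesis
    unfolding tact_def sum bottom_linear
  proof (rule sum.cong[OF refl])
    fix w assume "w \<in> Poly_Mapping.keys p"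
    then have "w \<in> lists (gens Ed vs)" using p by (auto simp: words_def)
    then show "const (Poly_Mapping.lookup p w) * act_word Ed (v # vs) w (bottom H) =
        const (Poly_Mapping.lookup p w) * bottom (act_word Ed vs w H)"
      by (simp only: word)
  qed
qed

text \<open>Building up a normally ordered monomial from the right never triggers a rewriting step. This makes
  normally ordered monomials independent modulo the annihilator.\<close>

theorem tact_normal_form:
  "elimination_list Ed vs \<Longrightarrow> F \<in> homog Ed vs n \<Longrightarrow> tact Ed vs (normal_form Ed vs F) (vac vs) = F"
proof (induction vs arbitrary: F n)
  case Nil
  then show ?case by (auto simp: tact_scalar const_def vac_def fun_eq_iff homog_def)
next
  case (Cons v vs)
  have v: "v \<notin> set vs" and elim: "elimination_list Ed vs" using Cons.prems(1) by auto
  have F: "F [] = 0" "\<And>s. parts F s \<in> homog Ed vs (n - state_deg s)"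
    "\<And>u. u \<notin> nbrs Ed v vs \<Longrightarrow> parts F (SG u) = 0"
    using Cons.prems(2) by (simp_all add: homog_Cons)
  have vac: "vac (v # vs) = bottom (vac vs)"
  proof
    fix l show "vac (v # vs) l = bottom (vac vs) l"
      by (cases l) (auto simp: vac_def bottom_def)
  qed
  have b: "tact Ed (v # vs) (normal_form Ed vs (parts F s)) (vac (v # vs)) = bottom (parts F s)" for s
    using tact_bottom[OF v normal_form_words[OF F(2)]] Cons.IH[OF elim F(2)] unfolding vac by metis
  have E_simps: "extend_act (act Ed vs) v N (GenX v) = xop (\<lambda>u. act Ed vs (GenX u)) N"
    "extend_act (act Ed vs) v N (GenY v) = yop (\<lambda>u. act Ed vs (GenY u)) N"
    "extend_act (act Ed vs) v N (GenG {v, w}) = gop (\<lambda>u. act Ed vs (GenX u)) (\<lambda>u. act Ed vs (GenY u))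
       (\<lambda>u w. act Ed vs (GenG {u, w})) N w" for N w
    by (rule extend_act_simps[OF v])+
  have X: "parts (act Ed (v # vs) (GenX v) (bottom H)) s = (if s = SX then H else 0)" for H s
    unfolding act.simps parts_assemble E_simps bottom_def by (cases s) (auto simp: xop_def act_zero)
  have Y: "parts (act Ed (v # vs) (GenY v) (bottom H)) s = (if s = SY then H else 0)" for H s
    unfolding act.simps parts_assemble E_simps bottom_def by (cases s) (auto simp: yop_def act_zero)
  have XY: "parts (act Ed (v # vs) (GenX v) (act Ed (v # vs) (GenY v) (bottom H))) s = (if s = SXY then H else 0)" for H s
    unfolding act.simps parts_assemble E_simps bottom_def by (cases s) (auto simp: xop_def yop_def act_zero)
  have G: "parts (act Ed (v # vs) (GenG {v, w}) (bottom H)) s = (if s = SG w then H else 0)"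
    if "w \<in> nbrs Ed v vs" for H s w
    using that unfolding act.simps parts_assemble E_simps bottom_def by (cases s) (auto simp: gop_def act_zero)
  have B: "parts (bottom H) s = (if s = One then H else 0)" for H :: "'a model" and s by (simp add: bottom_def)
  have psum: "parts (\<Sum>i\<in>S. H i) s = (\<Sum>i\<in>S. parts (H i) s)" for S s and H :: "'a \<Rightarrow> 'a model"
    by (auto simp: parts_def fun_eq_iff sum_fun_app)
  have padd: "parts (H + H') s = parts H s + parts H' s" for H H' :: "'a model" and s
    by (simp add: parts_add)
  let ?R = "tact Ed (v # vs) (normal_form Ed (v # vs) F) (vac (v # vs))"
  have R: "?R = bottom (parts F One) + act Ed (v # vs) (GenX v) (bottom (parts F SX))
      + act Ed (v # vs) (GenY v) (bottom (parts F SY))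
      + act Ed (v # vs) (GenX v) (act Ed (v # vs) (GenY v) (bottom (parts F SXY)))
      + (\<Sum>u\<in>nbrs Ed v vs. act Ed (v # vs) (GenG {v, u}) (bottom (parts F (SG u))))"
    by (simp only: normal_form.simps tact_add tact_mult tact_sum tact_letter b)
  have "parts ?R s = parts F s" for s
  proof -
    have "(\<Sum>u\<in>nbrs Ed v vs. if s = SG u then parts F (SG u) else 0) =
        (case s of SG u \<Rightarrow> parts F (SG u) | _ \<Rightarrow> 0)"
      using F(3) by (cases s) auto
    then show ?thesis
      unfolding R padd psum B X Y XY by (cases s) (simp_all add: G cong: sum.cong del: act.simps)
  qed
  moreover have "?R [] = 0" unfolding R by (simp add: sum_fun_app bottom_def)
  ultimately have "?R l = F l" for l using F(1) by (cases l) (auto simp: parts_def fun_eq_iff)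
  then show ?case by (rule ext)
qed

section \<open>Multiplication of normal forms modulo the relations\<close>

lemma gens_subset: "set vs \<subseteq> set us \<Longrightarrow> gens Ed vs \<subseteq> gens Ed us"
  unfolding gens_def by blast

text \<open>Any ideal that contains the quadratic relations; in the application it is the kernel of the projection
  to the arrangement algebra, enlarged to all polynomials.\<close>

locale relations_ideal = anticommuting K "gens Ed us" letter
  for K :: "('v gen list \<Rightarrow>\<^sub>0 rat) set" and Ed :: "'v set set" and us :: "'v list" +
  assumes X_rel: "\<lbrakk>u \<in> set us; w \<in> set us; {u, w} \<in> Ed\<rbrakk> \<Longrightarrow>
      (letter (GenX u) - letter (GenX w)) * letter (GenG {u, w}) \<in> K"
    and Y_rel: "\<lbrakk>u \<in> set us; w \<in> set us; {u, w} \<in> Ed\<rbrakk> \<Longrightarrow>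
      (letter (GenY u) - letter (GenY w)) * letter (GenG {u, w}) \<in> K"
    and triangle_rel: "\<lbrakk>u \<in> set us; w \<in> set us; t \<in> set us; distinct [u, w, t];
        {u, w} \<in> Ed; {w, t} \<in> Ed; {t, u} \<in> Ed\<rbrakk> \<Longrightarrow>
      letter (GenG {u, w}) * letter (GenG {w, t}) + letter (GenG {w, t}) * letter (GenG {t, u})
        + letter (GenG {t, u}) * letter (GenG {u, w}) \<in> K"
begin

lemma past: "\<lbrakk>a \<in> gens Ed us; b \<in> gens Ed us; letter a * p \<approx> q\<rbrakk> \<Longrightarrow>
    letter a * (letter b * p) \<approx> letter b * - q"
proof -
  assume a: "a \<in> gens Ed us" "b \<in> gens Ed us" "letter a * p \<approx> q"
  have "letter a * (letter b * p) \<approx> - (letter b * (letter a * p))" by (rule swap_left[OF a(1,2)])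
  also have "\<dots> \<approx> - (letter b * q)" by (rule cong_uminus[OF cong_left[OF a(3)]])
  finally show ?thesis by simp
qed

text \<open>Next to the edge generator of \<open>v\<close> and \<open>u\<close> a letter of \<open>v\<close> may be replaced by that of \<open>u\<close>, whose effect on
  normal forms of the smaller graph is known.\<close>

lemma transfer_edge:
  assumes g: "GenG {v, u} \<in> gens Ed us" and a: "a \<in> gens Ed us" and b: "b \<in> gens Ed us"
    and rel: "(letter a - letter b) * letter (GenG {v, u}) \<in> K" and p: "letter b * p \<approx> q"
  shows "letter a * (letter (GenG {v, u}) * p) \<approx> letter (GenG {v, u}) * - q"
    "letter (GenG {v, u}) * (letter a * p) \<approx> letter (GenG {v, u}) * q"
proof -
  have "(letter a - letter b) * letter (GenG {v, u}) \<approx> 0" using rel by (simp add: zero_iff)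
  from cong_right[OF this, of p]
  have "letter a * (letter (GenG {v, u}) * p) \<approx> letter b * (letter (GenG {v, u}) * p)"
    by (simp add: equiv_mod_def algebra_simps)
  also have "\<dots> \<approx> letter (GenG {v, u}) * - q" by (rule past[OF b g p])
  finally show *: "letter a * (letter (GenG {v, u}) * p) \<approx> letter (GenG {v, u}) * - q" .
  have "letter (GenG {v, u}) * (letter a * p) \<approx> - (letter a * (letter (GenG {v, u}) * p))"
    by (rule swap_left[OF g a])
  also have "\<dots> \<approx> - (letter (GenG {v, u}) * - q)" by (rule cong_uminus[OF *])
  finally show "letter (GenG {v, u}) * (letter a * p) \<approx> letter (GenG {v, u}) * q" by simp
qed

text \<open>The operators of the model were read off from the rewriting rules, and this verifies the rules: each
  summand of the normal form is rewritten by means of the relations, with the induction hypothesis for the letters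
  of smaller vertices that appear. Here \<open>us\<close> is the full list and \<open>vs\<close> runs through its final segments.\<close>

theorem letter_normal_form:
  assumes card: "\<forall>e\<in>Ed. card e = 2"
  shows "elimination_list Ed vs \<Longrightarrow> set vs \<subseteq> set us \<Longrightarrow> a \<in> gens Ed vs \<Longrightarrow>
    letter a * normal_form Ed vs F \<approx> normal_form Ed vs (act Ed vs a F)"
proof (induction vs arbitrary: a F)
  case Nil
  then show ?case using card by (auto simp: gens_def)
next
  case (Cons v vs)
  have v: "v \<notin> set vs" "v \<in> set us" and elim: "elimination_list Ed vs" and sub: "set vs \<subseteq> set us"
    using Cons.prems by auto
  note IH = Cons.IH[OF elim sub]
  let ?N = "nbrs Ed v vs" and ?nf = "normal_form Ed vs"
  have gsub: "gens Ed (v # vs) \<subseteq> gens Ed us" "gens Ed vs \<subseteq> gens Ed us"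
    using Cons.prems(2) by (auto intro!: gens_subset)
  have X: "GenX v \<in> gens Ed us" "GenY v \<in> gens Ed us" 
    by (rule subsetD[OF gsub(1) gens_top(1)], rule subsetD[OF gsub(1) gens_top(2)])
  have N: "u \<in> set vs" "u \<in> set us" "{v, u} \<in> Ed" "u \<noteq> v" "GenG {v, u} \<in> gens Ed us"
    "GenX u \<in> gens Ed vs" "GenY u \<in> gens Ed vs" "GenX u \<in> gens Ed us" "GenY u \<in> gens Ed us" if "u \<in> ?N" for u
  proof -
    show u: "u \<in> set vs" "{v, u} \<in> Ed" using that by (simp_all add: nbrs_def)
    show u': "u \<in> set us" using u(1) sub by (rule subsetD[rotated])
    show "u \<noteq> v" using u(1) v(1) by blast
    show "GenG {v, u} \<in> gens Ed us" by (rule subsetD[OF gsub(1) gens_top(3)[OF that]])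
    show "GenX u \<in> gens Ed vs" "GenY u \<in> gens Ed vs" "GenX u \<in> gens Ed us" "GenY u \<in> gens Ed us"
      using u(1) u' by (simp_all add: gens_def)
  qed
  define f where "f s = ?nf (parts F s)" for s
  have nF: "normal_form Ed (v # vs) F = f One + letter (GenX v) * f SX + letter (GenY v) * f SY
     + letter (GenX v) * (letter (GenY v) * f SXY) + (\<Sum>u\<in>?N. letter (GenG {v, u}) * f (SG u))"
    by (simp add: f_def)
  have E_simps: "extend_act (act Ed vs) v N (GenX v) = xop (\<lambda>u. act Ed vs (GenX u)) N"
    "extend_act (act Ed vs) v N (GenY v) = yop (\<lambda>u. act Ed vs (GenY u)) N"
    "extend_act (act Ed vs) v N (GenG {v, w}) = gop (\<lambda>u. act Ed vs (GenX u)) (\<lambda>u. act Ed vs (GenY u))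
       (\<lambda>u w. act Ed vs (GenG {u, w})) N w" for N w
    by (rule extend_act_simps[OF v(1)])+
  have nact: "normal_form Ed (v # vs) (act Ed (v # vs) a F) =
      ?nf (P One) + letter (GenX v) * ?nf (P SX) + letter (GenY v) * ?nf (P SY)
     + letter (GenX v) * (letter (GenY v) * ?nf (P SXY)) + (\<Sum>u\<in>?N. letter (GenG {v, u}) * ?nf (P (SG u)))"
    if "extend_act (act Ed vs) v ?N a (parts F) = P" for P
    by (simp only: normal_form.simps act.simps parts_assemble that)
  have expand: "letter a * normal_form Ed (v # vs) F = letter a * f One + letter a * (letter (GenX v) * f SX)
     + letter a * (letter (GenY v) * f SY) + letter a * (letter (GenX v) * (letter (GenY v) * f SXY))
     + (\<Sum>u\<in>?N. letter a * (letter (GenG {v, u}) * f (SG u)))"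
    unfolding nF by (simp only: distrib_left sum_distrib_left)
  have xf: "letter b * f s \<approx> ?nf (act Ed vs b (parts F s))" if "b \<in> gens Ed vs" for b s
    unfolding f_def by (rule IH[OF that])
  from Cons.prems(3) card v(1) show ?case
  proof (cases rule: gens_Cons_cases)
    case lower
    have a: "a \<in> gens Ed us" using lower gsub by blast
    note xf = xf[OF lower]
    have "letter a * (letter (GenX v) * (letter (GenY v) * f SXY)) \<approx>
        letter (GenX v) * - (letter (GenY v) * - ?nf (act Ed vs a (parts F SXY)))"
      by (intro past a X xf)
    then have "letter a * normal_form Ed (v # vs) F \<approx> ?nf (act Ed vs a (parts F One))
        + letter (GenX v) * - ?nf (act Ed vs a (parts F SX)) + letter (GenY v) * - ?nf (act Ed vs a (parts F SY))
        + letter (GenX v) * - (letter (GenY v) * - ?nf (act Ed vs a (parts F SXY)))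
        + (\<Sum>u\<in>?N. letter (GenG {v, u}) * - ?nf (act Ed vs a (parts F (SG u))))"
      unfolding expand by (intro cong_add cong_sum past a X N xf)
    also have "\<dots> = normal_form Ed (v # vs) (act Ed (v # vs) a F)"
      unfolding nact[OF refl] extend_act_simps(5)[OF v(1) lower]
      by (simp add: lop_def normal_form_uminus del: normal_form.simps)
    finally show ?thesis .
  next
    case a: X
    have "letter a * normal_form Ed (v # vs) F \<approx> letter (GenX v) * f One + 0
        + letter (GenX v) * (letter (GenY v) * f SY) + 0
        + (\<Sum>u\<in>?N. letter (GenG {v, u}) * - ?nf (act Ed vs (GenX u) (parts F (SG u))))"
      unfolding expand unfolding a
      by (intro cong_add cong_sum square_left X cong_refl transfer_edge(1)[OF _ _ _ X_rel xf] N v)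
    also have "\<dots> = normal_form Ed (v # vs) (act Ed (v # vs) a F)"
    proof -
      have "(\<Sum>u\<in>?N. letter (GenG {v, u}) * - ?nf (act Ed vs (GenX u) (parts F (SG u)))) =
          (\<Sum>u\<in>?N. letter (GenG {v, u}) * ?nf (xop (\<lambda>u. act Ed vs (GenX u)) ?N (parts F) (SG u)))"
        by (rule sum.cong) (simp_all add: xop_def normal_form_uminus)
      then show ?thesis
        unfolding nact[OF refl] unfolding a E_simps
        by (simp add: xop_def f_def normal_form_zero del: normal_form.simps)
    qed
    finally show ?thesis .
  next
    case a: Y
    have yxy: "letter (GenY v) * (letter (GenX v) * (letter (GenY v) * f SXY)) \<approx> letter (GenX v) * - 0"
      by (intro past X square_left)
    have "letter a * normal_form Ed (v # vs) F \<approx> letter (GenY v) * f One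
        + letter (GenX v) * - (letter (GenY v) * f SX) + 0 + letter (GenX v) * - 0
        + (\<Sum>u\<in>?N. letter (GenG {v, u}) * - ?nf (act Ed vs (GenY u) (parts F (SG u))))"
      unfolding expand unfolding a
      by (intro cong_add cong_sum square_left X cong_refl transfer_edge(1)[OF _ _ _ Y_rel xf] N v past yxy)
    also have "\<dots> = normal_form Ed (v # vs) (act Ed (v # vs) a F)"
    proof -
      have "(\<Sum>u\<in>?N. letter (GenG {v, u}) * - ?nf (act Ed vs (GenY u) (parts F (SG u)))) =
          (\<Sum>u\<in>?N. letter (GenG {v, u}) * ?nf (yop (\<lambda>u. act Ed vs (GenY u)) ?N (parts F) (SG u)))"
        by (rule sum.cong) (simp_all add: yop_def normal_form_uminus)
      then show ?thesis
        unfolding nact[OF refl] unfolding a E_simps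
        by (simp add: yop_def f_def normal_form_zero normal_form_uminus del: normal_form.simps)
    qed
    finally show ?thesis .
  next
    case (G w)
    note a = G(1) and w = G(2)
    let ?g = "\<lambda>u. letter (GenG {v, u}) :: 'v gen list \<Rightarrow>\<^sub>0 rat"
    let ?x = "act Ed vs (GenX w)" and ?y = "act Ed vs (GenY w)" and ?c = "\<lambda>u. act Ed vs (GenG {w, u})"
    have gx: "?g w * (letter (GenX v) * p) \<approx> ?g w * q" if "letter (GenX w) * p \<approx> q" for p q
      by (rule transfer_edge(2)[OF N(5)[OF w] X(1) N(8)[OF w] X_rel[OF v(2) N(2,3)[OF w]] that])
    have gy: "?g w * (letter (GenY v) * p) \<approx> ?g w * q" if "letter (GenY w) * p \<approx> q" for p q
      by (rule transfer_edge(2)[OF N(5)[OF w] X(2) N(9)[OF w] Y_rel[OF v(2) N(2,3)[OF w]] that])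
    have gxy: "?g w * (letter (GenX v) * (letter (GenY v) * f SXY)) \<approx> ?g w * ?nf (?x (?y (parts F SXY)))"
    proof -
      have "?g w * (letter (GenX v) * (letter (GenY v) * f SXY)) \<approx>
          ?g w * - (letter (GenY v) * (letter (GenX v) * f SXY))"
        by (intro cong_left swap_left X)
      also have "\<dots> = - (?g w * (letter (GenY v) * (letter (GenX v) * f SXY)))" by simp
      also have "\<dots> \<approx> - (?g w * (letter (GenX v) * - ?nf (?y (parts F SXY))))"
        by (intro cong_uminus gy past X N(9)[OF w] xf N(7)[OF w])
      also have "\<dots> = ?g w * (letter (GenX v) * ?nf (?y (parts F SXY)))" by simp
      also have "\<dots> \<approx> ?g w * ?nf (?x (?y (parts F SXY)))"
        by (intro gx IH N(6)[OF w])
      finally show ?thesis .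
    qed
    \<comment> \<open>The edge between \<open>w\<close> and \<open>u\<close> exists as both are smaller neighbours of \<open>v\<close>.\<close>
    have gg: "?g w * (?g u * f (SG u)) \<approx> ?g w * ?nf (?c u (parts F (SG u))) - ?g u * ?nf (?c u (parts F (SG u)))"
      if u: "u \<in> ?N - {w}" for u
    proof -
      have u': "u \<in> ?N" "u \<noteq> w" using u by auto
      have wu: "{w, u} \<in> Ed" using Cons.prems(1) N[OF w] N[OF u'(1)] u'(2) by (auto simp: insert_commute)
      have k: "GenG {w, u} \<in> gens Ed vs" using wu N(1)[OF w] N(1)[OF u'(1)] by (simp add: gens_def)
      then have k': "GenG {w, u} \<in> gens Ed us" using gsub by blast
      let ?k = "letter (GenG {w, u}) :: 'v gen list \<Rightarrow>\<^sub>0 rat" and ?d = "?nf (?c u (parts F (SG u)))"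
      have "?g w * ?g u + ?g u * ?k + ?k * ?g w \<in> K"
        using triangle_rel[of w v u] wu v(2) N[OF w] N[OF u'(1)] u'(2) by (auto simp: insert_commute)
      then have "(?g w * ?g u + ?g u * ?k + ?k * ?g w) * f (SG u) \<approx> 0"
        using K_right by (simp add: zero_iff)
      then have "?g w * (?g u * f (SG u)) \<approx> - (?g u * (?k * f (SG u))) - ?k * (?g w * f (SG u))"
        by (simp add: equiv_mod_def algebra_simps)
      also have "\<dots> \<approx> - (?g u * ?d) - ?g w * - ?d"
        by (intro cong_diff cong_uminus cong_left past k' N(5)[OF w] xf[OF k])
      also have "\<dots> = ?g w * ?d - ?g u * ?d" by simp
      finally show ?thesis .
    qed
    have gsum: "(\<Sum>u\<in>?N. ?g w * (?g u * f (SG u))) \<approx>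
        0 + (\<Sum>u\<in>?N - {w}. ?g w * ?nf (?c u (parts F (SG u))) - ?g u * ?nf (?c u (parts F (SG u))))"
    proof -
      have "(\<Sum>u\<in>?N. ?g w * (?g u * f (SG u))) =
          ?g w * (?g w * f (SG w)) + (\<Sum>u\<in>?N - {w}. ?g w * (?g u * f (SG u)))"
        by (rule sum.remove) (use w in auto)
      also have "\<dots> \<approx> 0 + (\<Sum>u\<in>?N - {w}. ?g w * ?nf (?c u (parts F (SG u))) - ?g u * ?nf (?c u (parts F (SG u))))"
        by (intro cong_add cong_sum square_left N(5)[OF w] gg)
      finally show ?thesis .
    qed
    have "letter a * normal_form Ed (v # vs) F \<approx> ?g w * f One + ?g w * ?nf (?x (parts F SX))
        + ?g w * ?nf (?y (parts F SY)) + ?g w * ?nf (?x (?y (parts F SXY)))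
        + (0 + (\<Sum>u\<in>?N - {w}. ?g w * ?nf (?c u (parts F (SG u))) - ?g u * ?nf (?c u (parts F (SG u)))))"
      unfolding expand unfolding a
      by (intro cong_add cong_refl gx gy gxy gsum xf N(6,7)[OF w])
    also have "\<dots> = normal_form Ed (v # vs) (act Ed (v # vs) a F)"
    proof -
      let ?P = "gop (\<lambda>u. act Ed vs (GenX u)) (\<lambda>u. act Ed vs (GenY u)) (\<lambda>u w. act Ed vs (GenG {u, w})) ?N w (parts F)"
      have "(\<Sum>u\<in>?N. ?g u * ?nf (?P (SG u))) = ?g w * ?nf (?P (SG w)) + (\<Sum>u\<in>?N - {w}. ?g u * ?nf (?P (SG u)))"
        by (rule sum.remove) (use w in auto)
      also have "?nf (?P (SG w)) = f One + ?nf (?x (parts F SX)) + ?nf (?y (parts F SY)) + ?nf (?x (?y (parts F SXY)))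
          + (\<Sum>u\<in>?N - {w}. ?nf (?c u (parts F (SG u))))"
      proof -
        have "?P (SG w) = parts F One + ?x (parts F SX) + ?y (parts F SY) + ?x (?y (parts F SXY))
            + (\<Sum>u\<in>?N - {w}. ?c u (parts F (SG u)))" using w by (simp add: gop_def)
        then show ?thesis by (simp only: f_def normal_form_add normal_form_sum)
      qed
      also have "(\<Sum>u\<in>?N - {w}. ?g u * ?nf (?P (SG u))) = (\<Sum>u\<in>?N - {w}. - (?g u * ?nf (?c u (parts F (SG u)))))"
      proof (rule sum.cong[OF refl])
        fix u assume "u \<in> ?N - {w}"
        then have "?P (SG u) = - ?c u (parts F (SG u))" by (simp add: gop_def)
        then show "?g u * ?nf (?P (SG u)) = - (?g u * ?nf (?c u (parts F (SG u))))"
          by (simp only: normal_form_uminus mult_minus_right)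
      qed
      finally have "(\<Sum>u\<in>?N. ?g u * ?nf (?P (SG u))) = ?g w * f One + ?g w * ?nf (?x (parts F SX))
          + ?g w * ?nf (?y (parts F SY)) + ?g w * ?nf (?x (?y (parts F SXY)))
          + (0 + (\<Sum>u\<in>?N - {w}. ?g w * ?nf (?c u (parts F (SG u))) - ?g u * ?nf (?c u (parts F (SG u)))))"
        by (simp add: distrib_left sum_distrib_left sum_subtractf sum_negf)
      moreover have "?P One = 0" "?P SX = 0" "?P SY = 0" "?P SXY = 0" by (simp_all add: gop_def)
      ultimately show ?thesis
        unfolding nact[OF refl] unfolding a E_simps
        by (simp only: normal_form_zero mult_zero_right add_0_left add_0_right)
    qed
    finally show ?thesis .
  qed
qed

text \<open>Normally ordered monomials span the quotient: every word is congruent to the normal form of what it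
  produces from the empty monomial.\<close>

theorem normal_form_tact:
  assumes card: "\<forall>e\<in>Ed. card e = 2" and elim: "elimination_list Ed us"
    and p: "Poly_Mapping.keys p \<subseteq> lists (gens Ed us)"
  shows "normal_form Ed us (tact Ed us p (vac us)) \<approx> p"
proof (induction p rule: poly_mapping_single_induct)
  case zero
  then show ?case by (simp only: tact_zero normal_form_zero cong_refl)
next
  case (single w c)
  then have "w \<in> lists (gens Ed us)" by (rule subsetD[OF p])
  then show ?case
  proof (induction w)
    case Nil
    have "normal_form Ed us (tact Ed us (scalar c) (vac us)) = scalar c"
      by (simp only: tact_scalar normal_form_scale normal_form_vac mult_1_right)
    then show ?case by simp
  next
    case (Cons b w)
    have eq: "Poly_Mapping.single (b # w) c = letter b * Poly_Mapping.single w c"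
      by (simp only: letter_times_single)
    have "normal_form Ed us (tact Ed us (Poly_Mapping.single (b # w) c) (vac us)) =
        normal_form Ed us (act Ed us b (tact Ed us (Poly_Mapping.single w c) (vac us)))"
      by (simp only: eq tact_mult tact_letter)
    also have "\<dots> \<approx> letter b * normal_form Ed us (tact Ed us (Poly_Mapping.single w c) (vac us))"
      by (rule cong_sym[OF letter_normal_form[OF card elim]]) (use Cons in auto)
    also have "\<dots> \<approx> letter b * Poly_Mapping.single w c" using Cons by (intro cong_left) auto
    finally show ?case by (simp only: letter_times_single)
  qed
next
  case (add p q)
  show ?case unfolding tact_add normal_form_add by (rule cong_add[OF add])
qed

end

section \<open>The arrangement algebra of a graph\<close>

text \<open>List the vertices by repeatedly removing the largest one.\<close>

lemma perfect_elimination_list: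
  assumes fin: "finite V" and peo: "perfect_elimination_ordering V Ed r"
    and sub: "\<forall>e\<in>Ed. e \<subseteq> V"
  obtains vs where "set vs = V" "elimination_list Ed vs"
proof -
  have lin: "linear_order_on V r" using peo by (simp add: perfect_elimination_ordering_def)
  have refl: "(u, u) \<in> r" if "u \<in> V" for u
    using lin that by (auto simp: linear_order_on_def partial_order_on_def preorder_on_def refl_on_def)
  have trans: "(u, t) \<in> r" if "(u, w) \<in> r" "(w, t) \<in> r" for u w t
    using lin that by (auto simp: linear_order_on_def partial_order_on_def preorder_on_def dest: transD)
  have total: "(u, w) \<in> r \<or> (w, u) \<in> r" if "u \<in> V" "w \<in> V" for u w
    using lin that refl by (cases "u = w") (auto simp: linear_order_on_def total_on_def)
  have ex_max: "\<exists>m\<in>W. \<forall>u\<in>W. (u, m) \<in> r" if "finite W" "W \<noteq> {}" "W \<subseteq> V" for W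
    using that
  proof (induction W rule: finite_ne_induct)
    case (singleton x)
    then show ?case using refl by auto
  next
    case (insert x F)
    then obtain m where m: "m \<in> F" "\<forall>u\<in>F. (u, m) \<in> r" by auto
    show ?case
    proof (cases "(x, m) \<in> r")
      case True
      then show ?thesis using m by auto
    next
      case False
      then have "(m, x) \<in> r" using total[of m x] m(1) insert.prems by auto
      then show ?thesis using m refl insert.prems trans by (intro bexI[of _ x]) blast+
    qed
  qed
  have "\<exists>vs. set vs = W \<and> elimination_list Ed vs" if "finite W" "W \<subseteq> V" for W
    using that
  proof (induction "card W" arbitrary: W)
    case 0
    then show ?case by (intro exI[of _ "[]"]) auto
  next
    case (Suc n)
    then have "W \<noteq> {}" by auto
    then obtain m where m: "m \<in> W" "\<forall>u\<in>W. (u, m) \<in> r" using ex_max Suc.prems by blast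
    have "n = card (W - {m})" using Suc.hyps(2) Suc.prems(1) m(1) by simp
    then have "\<exists>vs. set vs = W - {m} \<and> elimination_list Ed vs" using Suc.prems by (intro Suc.hyps(1)) auto
    then obtain vs where vs: "set vs = W - {m}" "elimination_list Ed vs" by blast
    have "simplicial {e \<in> Ed. e \<subseteq> {u \<in> V. (u, m) \<in> r}} m"
      using peo m(1) Suc.prems by (auto simp: perfect_elimination_ordering_def)
    then have "\<forall>u\<in>set vs. \<forall>w\<in>set vs. {u, m} \<in> Ed \<and> {w, m} \<in> Ed \<and> u \<noteq> w \<longrightarrow> {u, w} \<in> Ed"
      using m Suc.prems vs(1) unfolding simplicial_def by (simp add: subset_iff)
    then have "elimination_list Ed (m # vs)" using vs by auto
    then show ?case using vs(1) m(1) by (intro exI[of _ "m # vs"]) auto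
  qed
  then show ?thesis using that fin by blast
qed

text \<open>The two orders of the vertices have separate uses: the list \<open>vs\<close> drives the induction, while \<open>r\<close>
  determines the heads of edges and the order of the edges in the cycle relations.\<close>

locale graph_algebra =
  fixes V :: "'v set" and Ed :: "'v set set" and r :: "'v rel" and E :: "complex set monoid"
    and vs :: "'v list"
  assumes graph: "simple_graph V Ed" and lin: "linear_order_on V r"
    and set_vs: "set vs = V" and elim: "elimination_list Ed vs"
begin

abbreviation "\<A> \<equiv> abelian_arrangement V Ed r E"
abbreviation "B \<equiv> gens Ed vs"
abbreviation "T \<equiv> tensor_algebra B"
abbreviation "squares \<equiv> {v * v | v. v \<in> grade T 1}"
abbreviation "I1 \<equiv> Idl\<^bsub>T\<^esub> squares"
abbreviation "Lam \<equiv> exterior_algebra B"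
abbreviation "rels \<equiv> cycle_relations \<A> \<union> edge_relations \<A>"
abbreviation "I2 \<equiv> Idl\<^bsub>Lam\<^esub> rels"
abbreviation "A \<equiv> arrangement_algebra \<A>"

lemma card: "\<forall>e\<in>Ed. card e = 2" and edges_subset: "\<forall>e\<in>Ed. e \<subseteq> set vs"
  using graph by (auto simp: simple_graph_def set_vs)

lemma arrangement_simps [simp]: "verts \<A> = V" "edges \<A> = Ed" "vorder \<A> = r"
  by (simp_all add: abelian_arrangement_def)

lemma arr_gens: "arr_gens \<A> = B"
  using edges_subset by (auto simp: arr_gens_def gens_def set_vs)

lemma head_tail:
  assumes "(u, w) \<in> r" "u \<noteq> w" shows "edge_head r {u, w} = w" "edge_tail r {u, w} = u"
proof -
  have po: "antisym r" "refl_on V r" "r \<subseteq> V \<times> V"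
    using lin by (auto simp: linear_order_on_def partial_order_on_def preorder_on_def)
  have "u \<in> V" "w \<in> V" using po(3) assms(1) by auto
  then have "(u, u) \<in> r" "(w, w) \<in> r" using po(2) by (auto simp: refl_on_def)
  then show "edge_head r {u, w} = w" "edge_tail r {u, w} = u"
    unfolding edge_head_def edge_tail_def using assms po(1)
    by (intro the_equality; auto simp: antisym_def)+
qed

lemma edge_cases:
  assumes "e \<in> Ed"
  obtains u w where "e = {u, w}" "u \<noteq> w" "(u, w) \<in> r" "u \<in> V" "w \<in> V" "edge_head r e = w" "edge_tail r e = u"
proof -
  obtain a b where ab: "e = {a, b}" "a \<noteq> b" using card assms by (meson card_2_iff)
  have V: "a \<in> V" "b \<in> V" using edges_subset assms ab by (auto simp: set_vs)
  then have "(a, b) \<in> r \<or> (b, a) \<in> r" using lin ab(2) by (auto simp: linear_order_on_def total_on_def)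
  then show ?thesis
  proof
    assume "(a, b) \<in> r"
    then show ?thesis using that[of a b] ab V head_tail[of a b] by simp
  next
    assume "(b, a) \<in> r"
    then show ?thesis using that[of b a] ab V head_tail[of b a] by (simp add: insert_commute)
  qed
qed

lemma rat_T: "rat_algebra T" by (rule rat_algebra_tensor)

lemma letter_T [simp]: "b \<in> B \<Longrightarrow> letter b \<in> carrier T" by simp

lemma T_mult: "p \<in> carrier T \<Longrightarrow> q \<in> carrier T \<Longrightarrow> p * q \<in> carrier T"
  using ring.ring_simprules(5)[OF ring_tensor_algebra, of p B q] by (simp del: tensor_simps(1))

lemma T_add: "p \<in> carrier T \<Longrightarrow> q \<in> carrier T \<Longrightarrow> p + q \<in> carrier T"
  using ring.ring_simprules(1)[OF ring_tensor_algebra, of p B q] by (simp del: tensor_simps(1))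

lemma T_uminus: "p \<in> carrier T \<Longrightarrow> - p \<in> carrier T" by simp

lemma T_one: "1 \<in> carrier T" and T_zero: "0 \<in> carrier T"
  using ring.ring_simprules(6)[OF ring_tensor_algebra, of B] by (simp_all del: tensor_simps(1)) simp

lemma T_minus: "p \<in> carrier T \<Longrightarrow> q \<in> carrier T \<Longrightarrow> p \<ominus>\<^bsub>T\<^esub> q = p - q"
proof -
  assume p: "p \<in> carrier T" "q \<in> carrier T"
  interpret T: ring T by (rule ring_tensor_algebra)
  have "\<ominus>\<^bsub>T\<^esub> q = - q" by (rule T.minus_equality) (use p in \<open>simp_all\<close>)
  then show ?thesis by (simp add: a_minus_def)
qed

lemma squares_subset: "squares \<subseteq> carrier T"
proof -
  have "v \<in> carrier T" if "v \<in> grade T 1" for v using that by auto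
  then show ?thesis using T_mult by blast
qed

lemma ideal_I1: "ideal I1 T"
  by (rule ring.genideal_ideal[OF ring_tensor_algebra squares_subset])

definition h1 where "h1 p = I1 +>\<^bsub>T\<^esub> p"

lemma epi1: "algebra_epi T Lam h1"
  using algebra_epi_quotient[OF rat_T ideal_I1] unfolding exterior_algebra_def h1_def .

lemma rat_Lam: "rat_algebra Lam" by (rule algebra_epi_rat_algebra[OF rat_T epi1])

lemmas h1 = algebra_epiD[OF epi1]

definition edge_word :: "'v set list \<Rightarrow> 'v gen list \<Rightarrow>\<^sub>0 rat" where
  "edge_word es = prod_list (map (\<lambda>e. letter (GenG e)) es)"

lemma edge_word_T: "set es \<subseteq> Ed \<Longrightarrow> edge_word es \<in> carrier T"
proof (induction es)
  case (Cons e es)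
  have "letter (GenG e) \<in> carrier T" using Cons.prems edges_subset by (intro letter_T) (auto simp: gens_def)
  then show ?case using Cons T_mult by (simp add: edge_word_def del: tensor_simps(1))
qed (simp add: edge_word_def T_one del: tensor_simps(1))

lemma gg_eq: "gg \<A> e = h1 (letter (GenG e))" and gx_eq: "gx \<A> v = h1 (letter (GenX v))"
  and gy_eq: "gy \<A> v = h1 (letter (GenY v))"
  by (simp_all add: gg_def gx_def gy_def ext_gen_def arr_gens h1_def)

lemma gg_prod_eq: "set es \<subseteq> Ed \<Longrightarrow> gg_prod \<A> es = h1 (edge_word es)"
proof (induction es)
  case Nil
  then show ?case using h1(4) by (simp add: gg_prod_def edge_word_def arr_gens)
next
  case (Cons e es)
  have e: "letter (GenG e) \<in> carrier T" using Cons.prems edges_subset by (intro letter_T) (auto simp: gens_def)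
  have es: "edge_word es \<in> carrier T" using Cons.prems by (intro edge_word_T) simp
  have "gg_prod \<A> (e # es) = gg \<A> e \<otimes>\<^bsub>Lam\<^esub> gg_prod \<A> es" by (simp add: gg_prod_def arr_gens)
  also have "\<dots> = h1 (letter (GenG e)) \<otimes>\<^bsub>Lam\<^esub> h1 (edge_word es)" using Cons by (simp add: gg_eq)
  also have "\<dots> = h1 (letter (GenG e) * edge_word es)" using h1(2)[OF e es] by simp
  finally show ?case by (simp add: edge_word_def)
qed

text \<open>Finite sums in a quotient are those of the type class of polynomials, followed by the projection.\<close>

lemma T_finsum:
  assumes epi: "algebra_epi T Q h" and S: "finite S" "\<And>i. i \<in> S \<Longrightarrow> p i \<in> carrier T"
  shows "(\<Oplus>\<^bsub>Q\<^esub>i\<in>S. h (p i)) = h (\<Sum>i\<in>S. p i) \<and> (\<Sum>i\<in>S. p i) \<in> carrier T"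
proof -
  note h = algebra_epiD[OF epi]
  interpret Q: ring Q by (rule rat_algebraD(1)[OF algebra_epi_rat_algebra[OF rat_T epi]])
  show ?thesis using S
  proof (induction S rule: finite_induct)
    case empty
    then show ?case using h(5) T_zero by (simp del: tensor_simps(1))
  next
    case (insert i S)
    have c: "p i \<in> carrier T" "(\<Sum>i\<in>S. p i) \<in> carrier T" and
      IH: "(\<Oplus>\<^bsub>Q\<^esub>i\<in>S. h (p i)) = h (\<Sum>i\<in>S. p i)" using insert by auto
    have "(\<Oplus>\<^bsub>Q\<^esub>i\<in>insert i S. h (p i)) = h (p i) \<oplus>\<^bsub>Q\<^esub> (\<Oplus>\<^bsub>Q\<^esub>i\<in>S. h (p i))"
      by (rule Q.finsum_insert) (use insert h(8) in \<open>auto simp del: tensor_simps(1)\<close>)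
    also have "\<dots> = h (p i + (\<Sum>i\<in>S. p i))" unfolding IH using h(3)[OF c] by simp
    finally show ?case using insert.hyps T_add[OF c] by (simp del: tensor_simps(1))
  qed
qed

lemmas h1_finsum = T_finsum[OF epi1]

lemma scalar_sign: "scalar ((- 1) ^ n) = (- 1) ^ n"
proof (induction n)
  case (Suc n)
  then show ?case by (simp add: single_uminus)
qed (simp add: scalar_1)

text \<open>The indices of the given relation start at one, whence the minus sign.\<close>

lemma cycle_relation_eq:
  assumes "set es \<subseteq> Ed"
  shows "(\<Oplus>\<^bsub>arr_ext \<A>\<^esub>j\<in>{1..length es}.
         (-1) ^ j \<odot>\<^bsub>arr_ext \<A>\<^esub> gg_prod \<A> (take (j - 1) es @ drop j es)) =
      h1 (- alt_sum (\<lambda>e. letter (GenG e)) es) \<and> alt_sum (\<lambda>e. letter (GenG e)) es \<in> carrier T"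
proof -
  interpret Q: ring Lam by (rule rat_algebraD(1)[OF rat_Lam])
  let ?p = "\<lambda>j. scalar ((-1) ^ j) * edge_word (take (j - 1) es @ drop j es)"
  have sub: "set (take (j - 1) es @ drop j es) \<subseteq> Ed" for j
    using assms set_take_subset[of "j - 1" es] set_drop_subset[of j es] by auto
  have w: "edge_word (take (j - 1) es @ drop j es) \<in> carrier T" for j by (rule edge_word_T[OF sub])
  have s: "scalar c \<in> carrier T" for c by simp
  have p: "?p j \<in> carrier T" for j by (rule T_mult[OF s w])
  have t: "(-1) ^ j \<odot>\<^bsub>Lam\<^esub> gg_prod \<A> (take (j - 1) es @ drop j es) = h1 (?p j)" for j
    unfolding gg_prod_eq[OF sub] using h1(6)[OF w[of j], of "(-1) ^ j"] by simp
  have "(\<Oplus>\<^bsub>arr_ext \<A>\<^esub>j\<in>{1..length es}.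
         (-1) ^ j \<odot>\<^bsub>arr_ext \<A>\<^esub> gg_prod \<A> (take (j - 1) es @ drop j es)) = (\<Oplus>\<^bsub>Lam\<^esub>j\<in>{1..length es}. h1 (?p j))"
    unfolding arr_gens by (rule Q.finsum_cong') (use t h1(8)[OF p] in auto)
  also have "\<dots> = h1 (\<Sum>j\<in>{1..length es}. ?p j)" using h1_finsum[of "{1..length es}" ?p] p by blast
  finally have 1: "(\<Oplus>\<^bsub>arr_ext \<A>\<^esub>j\<in>{1..length es}.
         (-1) ^ j \<odot>\<^bsub>arr_ext \<A>\<^esub> gg_prod \<A> (take (j - 1) es @ drop j es)) = h1 (\<Sum>j\<in>{1..length es}. ?p j)" .
  have "(\<Sum>j\<in>{1..length es}. ?p j) = (\<Sum>j\<in>Suc ` {..<length es}. ?p j)"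
    by (simp add: image_Suc_lessThan)
  also have "\<dots> = - alt_sum (\<lambda>e. letter (GenG e)) es"
    by (subst sum.reindex) (simp_all add: alt_sum_expand scalar_sign edge_word_def sum_negf)
  finally have 2: "(\<Sum>j\<in>{1..length es}. ?p j) = - alt_sum (\<lambda>e. letter (GenG e)) es" .
  have "- alt_sum (\<lambda>e. letter (GenG e)) es \<in> carrier T"
    using h1_finsum[of "{1..length es}" ?p] p unfolding 2[symmetric] by blast
  from T_uminus[OF this] show ?thesis using 1 unfolding 2 by simp
qed

definition edge_rel :: "('v \<Rightarrow> 'v gen) \<Rightarrow> 'v \<Rightarrow> 'v \<Rightarrow> 'v gen list \<Rightarrow>\<^sub>0 rat" where
  "edge_rel G u w = (letter (G u) - letter (G w)) * letter (GenG {u, w})"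

lemma edge_rel_T: "{u, w} \<in> Ed \<Longrightarrow> edge_rel GenX u w \<in> carrier T" "{u, w} \<in> Ed \<Longrightarrow> edge_rel GenY u w \<in> carrier T"
proof -
  assume e: "{u, w} \<in> Ed"
  then have g: "letter (GenX u) \<in> carrier T" "letter (GenX w) \<in> carrier T" "letter (GenY u) \<in> carrier T"
    "letter (GenY w) \<in> carrier T" "letter (GenG {u, w}) \<in> carrier T"
    using edges_subset by (auto simp: gens_def)
  show "edge_rel GenX u w \<in> carrier T" "edge_rel GenY u w \<in> carrier T"
    unfolding edge_rel_def using T_add[OF g(1) T_uminus[OF g(2)]] T_add[OF g(3) T_uminus[OF g(4)]] g(5)
    by (auto intro!: T_mult simp del: tensor_simps(1))
qed

lemma edge_relations_eq:
  "edge_relations \<A> = (\<Union>e\<in>Ed. {h1 (edge_rel GenX (edge_head r e) (edge_tail r e)),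
     h1 (edge_rel GenY (edge_head r e) (edge_tail r e))})"
proof -
  interpret Q: ring Lam by (rule rat_algebraD(1)[OF rat_Lam])
  have uminus: "\<ominus>\<^bsub>Lam\<^esub> h1 p = h1 (- p)" if "p \<in> carrier T" for p
  proof (rule Q.minus_equality)
    show "h1 (- p) \<oplus>\<^bsub>Lam\<^esub> h1 p = \<zero>\<^bsub>Lam\<^esub>" using h1(3)[OF T_uminus[OF that] that] h1(5) by simp
  qed (use that h1(8) T_uminus in blast)+
  have *: "(h1 (letter (G h)) \<ominus>\<^bsub>Lam\<^esub> h1 (letter (G t))) \<otimes>\<^bsub>Lam\<^esub> h1 (letter (GenG e)) = h1 (edge_rel G h t)"
    if "letter (G h) \<in> carrier T" "letter (G t) \<in> carrier T" "letter (GenG e) \<in> carrier T" "e = {h, t}" for G h t e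
    using h1(3)[OF that(1) T_uminus[OF that(2)]] h1(2)[OF T_add[OF that(1) T_uminus[OF that(2)]] that(3)]
    by (simp add: a_minus_def uminus[OF that(2)] edge_rel_def that(4) del: tensor_simps(1))
  have "{(gx \<A> (edge_head r e) \<ominus>\<^bsub>Lam\<^esub> gx \<A> (edge_tail r e)) \<otimes>\<^bsub>Lam\<^esub> gg \<A> e,
        (gy \<A> (edge_head r e) \<ominus>\<^bsub>Lam\<^esub> gy \<A> (edge_tail r e)) \<otimes>\<^bsub>Lam\<^esub> gg \<A> e} =
      {h1 (edge_rel GenX (edge_head r e) (edge_tail r e)), h1 (edge_rel GenY (edge_head r e) (edge_tail r e))}"
    if e: "e \<in> Ed" for e
  proof -
    obtain u w where uw: "e = {u, w}" "u \<in> V" "w \<in> V" "edge_head r e = w" "edge_tail r e = u"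
      using edge_cases[OF e] by metis
    have "e = {w, u}" using uw(1) by (simp add: insert_commute)
    then have eq: "e = {w, u}" .
    have t: "letter (GenX w) \<in> carrier T" "letter (GenX u) \<in> carrier T" "letter (GenY w) \<in> carrier T"
      "letter (GenY u) \<in> carrier T" "letter (GenG e) \<in> carrier T"
      using uw e edges_subset by (auto simp: gens_def set_vs)
    have "(h1 (letter (GenX w)) \<ominus>\<^bsub>Lam\<^esub> h1 (letter (GenX u))) \<otimes>\<^bsub>Lam\<^esub> h1 (letter (GenG e)) = h1 (edge_rel GenX w u)"
      "(h1 (letter (GenY w)) \<ominus>\<^bsub>Lam\<^esub> h1 (letter (GenY u))) \<otimes>\<^bsub>Lam\<^esub> h1 (letter (GenG e)) = h1 (edge_rel GenY w u)"
      by (rule *[of GenX w u e, OF t(1,2,5) eq], rule *[of GenY w u e, OF t(3,4,5) eq])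
    then show ?thesis unfolding gx_eq gy_eq gg_eq uw(4,5) by (simp only:)
  qed
  then show ?thesis by (simp add: edge_relations_def Let_def arr_gens)
qed

lemma sorted_distinct: "sorted_wrt (edge_less r) es \<Longrightarrow> distinct es"
  by (induction es) (auto simp: edge_less_def)

lemma cycle_set: "graph_cycle Ed cs \<Longrightarrow> cycle_edges cs \<subseteq> Ed \<and> set cs \<subseteq> set vs"
proof -
  assume c: "graph_cycle Ed cs"
  have "x \<in> set vs" if x: "x \<in> set cs" for x
  proof -
    obtain i where "i < length cs" "x = cs ! i" using x by (metis in_set_conv_nth)
    then have "{x, cs ! (Suc i mod length cs)} \<in> Ed" using c by (simp add: graph_cycle_def)
    then show ?thesis using edges_subset by auto
  qed
  then show ?thesis using c by (auto simp: graph_cycle_def cycle_edges_def)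
qed

lemma rels_subset: "rels \<subseteq> carrier Lam"
proof -
  have "cycle_relations \<A> \<subseteq> carrier Lam"
  proof
    fix z assume "z \<in> cycle_relations \<A>"
    then obtain es cs where z: "z = (\<Oplus>\<^bsub>arr_ext \<A>\<^esub>j\<in>{1..length es}.
         (-1) ^ j \<odot>\<^bsub>arr_ext \<A>\<^esub> gg_prod \<A> (take (j - 1) es @ drop j es))"
        and c: "graph_cycle Ed cs" "set es = cycle_edges cs" by (auto simp: cycle_relations_def)
    have "set es \<subseteq> Ed" using cycle_set[OF c(1)] c(2) by simp
    note ce = cycle_relation_eq[OF this]
    show "z \<in> carrier Lam"
      unfolding z conjunct1[OF ce] by (rule h1(8)[OF T_uminus[OF conjunct2[OF ce]]])
  qed
  moreover have "edge_relations \<A> \<subseteq> carrier Lam"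
  proof -
    have "{edge_head r e, edge_tail r e} \<in> Ed" if "e \<in> Ed" for e
      using edge_cases[OF that] that by (metis insert_commute)
    then show ?thesis unfolding edge_relations_eq using h1(8) edge_rel_T by blast
  qed
  ultimately show ?thesis by blast
qed

text \<open>The projection from the tensor algebra to the arrangement algebra, by way of the exterior algebra.\<close>

definition \<phi> where "\<phi> p = I2 +>\<^bsub>Lam\<^esub> h1 p"

lemma ideal_I2: "ideal I2 Lam"
  by (rule ring.genideal_ideal[OF rat_algebraD(1)[OF rat_Lam] rels_subset])

lemma A_eq: "A = quotient_algebra Lam I2"
  by (simp add: arrangement_algebra_def arr_gens)

lemma epi: "algebra_epi T A \<phi>"
proof -
  have "algebra_epi Lam A (\<lambda>x. I2 +>\<^bsub>Lam\<^esub> x)"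
    unfolding A_eq by (rule algebra_epi_quotient[OF rat_Lam ideal_I2])
  from algebra_epi_comp[OF epi1 this] show ?thesis by (simp add: \<phi>_def[abs_def])
qed

lemma rat_A: "rat_algebra A" by (rule algebra_epi_rat_algebra[OF rat_T epi])

lemmas \<phi> = algebra_epiD[OF epi]

lemma \<phi>_rel: assumes "h1 p \<in> rels" shows "\<phi> p = \<zero>\<^bsub>A\<^esub>"
proof -
  interpret Q: ring Lam by (rule rat_algebraD(1)[OF rat_Lam])
  have "h1 p \<in> I2" using Q.genideal_self[OF rels_subset] assms by blast
  then have "I2 +>\<^bsub>Lam\<^esub> h1 p = I2" by (rule Q.a_rcos_zero[OF ideal_I2])
  then show ?thesis unfolding \<phi>_def A_eq by (simp add: quotient_algebra_def FactRing_def)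
qed

lemma \<phi>_square: assumes "v \<in> grade T 1" shows "\<phi> (v * v) = \<zero>\<^bsub>A\<^esub>"
proof -
  interpret T: ring T by (rule ring_tensor_algebra)
  have "v * v \<in> I1" using T.genideal_self[OF squares_subset] assms by blast
  then have "h1 (v * v) = h1 0"
    using T.a_rcos_zero[OF ideal_I1] T.a_rcos_zero[OF ideal_I1 additive_subgroup.zero_closed[OF ideal.axioms(1)[OF ideal_I1]]]
    by (simp add: h1_def)
  then have "\<phi> (v * v) = \<phi> 0" by (simp add: \<phi>_def)
  then show ?thesis using \<phi>(5) by simp
qed

lemma model_rel: "model_relations Ed vs" by (rule elimination_model_relations[OF card elim])

text \<open>All relations of the arrangement algebra act as zero on the model, so the action of the tensor algebra
  factors through it.\<close>

lemma kernel_annihilates: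
  assumes p: "p \<in> carrier T" "\<phi> p = \<zero>\<^bsub>A\<^esub>" shows "p \<in> annihilator Ed vs"
proof -
  interpret T: ring T by (rule ring_tensor_algebra)
  let ?K = "annihilator Ed vs \<inter> carrier T"
  have neg: "- q \<in> ?K" if "q \<in> ?K" for q
    using that annihilator_ideal(3)[of q Ed vs "-1"] T_uminus[of q] by (simp del: tensor_simps(1))
  have K: "ideal ?K T"
  proof (rule idealI[OF ring_tensor_algebra])
    show "subgroup ?K (add_monoid T)"
    proof
      show "?K \<subseteq> carrier (add_monoid T)" by simp
      show "q \<otimes>\<^bsub>add_monoid T\<^esub> q' \<in> ?K" if "q \<in> ?K" "q' \<in> ?K" for q q'
        using that by (auto intro: annihilator_ideal(2) T_add simp del: tensor_simps(1))
      show "\<one>\<^bsub>add_monoid T\<^esub> \<in> ?K" using annihilator_ideal(1) T_zero by (simp del: tensor_simps(1))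
      fix q assume q: "q \<in> ?K"
      have "\<ominus>\<^bsub>T\<^esub> q = - q" by (rule T.minus_equality) (use q in \<open>simp_all\<close>)
      then show "inv\<^bsub>add_monoid T\<^esub> q \<in> ?K" using neg[OF q] by (simp add: a_inv_def del: tensor_simps(1))
    qed
    show "c \<otimes>\<^bsub>T\<^esub> q \<in> ?K" "q \<otimes>\<^bsub>T\<^esub> c \<in> ?K" if "q \<in> ?K" "c \<in> carrier T" for q c
      using that by (auto intro: annihilator_ideal(3,4) T_mult simp del: tensor_simps(1))
  qed
  have "squares \<subseteq> ?K"
  proof
    fix z assume z: "z \<in> squares"
    then obtain v where v: "z = v * v" "v \<in> grade T 1" by blast
    then have "z \<in> annihilator Ed vs"
      using model_relations.degree_one_square_annihilator[OF model_rel, of v] by simp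
    then show "z \<in> ?K" using squares_subset z by blast
  qed
  then have I1K: "I1 \<subseteq> ?K" by (rule T.genideal_minimal[OF K])
  have rel: "q \<in> ?K" if q: "q \<in> carrier T" "h1 q \<in> rels" for q
  proof -
    have *: "q \<in> ?K" if "h1 q = h1 s" "s \<in> ?K" for s
    proof -
      have "q \<ominus>\<^bsub>T\<^esub> s \<in> I1"
        by (rule iffD1[OF ideal.a_rcos_eq_iff[OF ideal_I1 q(1)]]) (use that in \<open>simp_all add: h1_def del: tensor_simps(1)\<close>)
      then have "q - s \<in> ?K" using T_minus[OF q(1), of s] that(2) I1K by (simp del: tensor_simps(1)) blast
      then have "(q - s) + s \<in> annihilator Ed vs" using annihilator_ideal(2) that(2) by blast
      then show ?thesis using q(1) by (simp del: tensor_simps(1))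
    qed
    from q(2) show ?thesis
    proof
      assume "h1 q \<in> cycle_relations \<A>"
      then obtain es cs where z: "h1 q = (\<Oplus>\<^bsub>arr_ext \<A>\<^esub>j\<in>{1..length es}.
         (-1) ^ j \<odot>\<^bsub>arr_ext \<A>\<^esub> gg_prod \<A> (take (j - 1) es @ drop j es))"
        and c: "sorted_wrt (edge_less r) es" "graph_cycle Ed cs" "set es = cycle_edges cs"
        by (auto simp: cycle_relations_def)
      have es: "set es \<subseteq> Ed" using cycle_set[OF c(2)] c(3) by simp
      have "alt_sum (\<lambda>e. letter (GenG e)) es \<in> annihilator Ed vs"
        using cycle_set[OF c(2)] sorted_distinct[OF c(1)]
        by (intro annihilator_cycles[OF card edges_subset elim c(2)]) (use c in auto)
      then have K: "- alt_sum (\<lambda>e. letter (GenG e)) es \<in> ?K" using cycle_relation_eq[OF es] neg by blast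
      show ?thesis by (rule *[OF _ K]) (simp only: z conjunct1[OF cycle_relation_eq[OF es]])
    next
      assume "h1 q \<in> edge_relations \<A>"
      then obtain e where e: "e \<in> Ed" "h1 q = h1 (edge_rel GenX (edge_head r e) (edge_tail r e)) \<or>
          h1 q = h1 (edge_rel GenY (edge_head r e) (edge_tail r e))" unfolding edge_relations_eq by blast
      obtain u w where uw: "e = {u, w}" "u \<in> V" "w \<in> V" "edge_head r e = w" "edge_tail r e = u"
        using edge_cases[OF e(1)] by metis
      have wu: "{w, u} \<in> Ed" using uw(1) e(1) by (simp add: insert_commute)
      have "edge_rel GenX w u \<in> ?K" "edge_rel GenY w u \<in> ?K"
        using model_relations.annihilator_edges[OF model_rel _ _ wu] uw(2,3) set_vs edge_rel_T[OF wu]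
        unfolding edge_rel_def by blast+
      then show ?thesis using e(2) * unfolding uw(4,5) by blast
    qed
  qed
  have "p \<in> ?K"
  proof (rule quotient_quotient_kernel[OF rat_T ideal_I1 _ K I1K])
    show "rels \<subseteq> carrier (quotient_algebra T I1)" using rels_subset by (simp add: exterior_algebra_def)
    show "(Idl\<^bsub>quotient_algebra T I1\<^esub> rels) +>\<^bsub>quotient_algebra T I1\<^esub> (I1 +>\<^bsub>T\<^esub> p) =
        \<zero>\<^bsub>quotient_algebra (quotient_algebra T I1) (Idl\<^bsub>quotient_algebra T I1\<^esub> rels)\<^esub>"
      using p(2) unfolding \<phi>_def h1_def A_eq exterior_algebra_def .
  qed (use rel p(1) in \<open>simp_all add: h1_def del: tensor_simps(1)\<close>)
  then show ?thesis by blast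
qed

end

context graph_algebra
begin

text \<open>The congruence calculus above takes place in the ring of all polynomials, whereas \<open>T\<close> contains only those in
  the letters \<open>B\<close>. This retraction onto \<open>T\<close> discards all other words. It is multiplicative, since a product of
  words lies in \<open>lists B\<close> if and only if both factors do.\<close>

lift_definition restrict_words :: "('v gen list \<Rightarrow>\<^sub>0 rat) \<Rightarrow> 'v gen list \<Rightarrow>\<^sub>0 rat" is
  "\<lambda>p w. p w when w \<in> lists B"
  by (auto elim: rev_finite_subset)

lemma restrict_words_T [simp]: "restrict_words p \<in> carrier T"
  by (auto simp: in_keys_iff restrict_words.rep_eq)

lemma restrict_words_id: "p \<in> carrier T \<Longrightarrow> restrict_words p = p"
  by (rule poly_mapping_eqI) (auto simp: restrict_words.rep_eq in_keys_iff when_def)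

lemma restrict_words_add: "restrict_words (p + q) = restrict_words p + restrict_words q"
  by (rule poly_mapping_eqI) (simp add: restrict_words.rep_eq lookup_add when_add_distrib)

lemma restrict_words_single:
  "restrict_words (Poly_Mapping.single w c) = (if w \<in> lists B then Poly_Mapping.single w c else 0)"
  by (rule poly_mapping_eqI) (auto simp: restrict_words.rep_eq lookup_single when_def)

lemma restrict_words_zero [simp]: "restrict_words 0 = 0"
  by (rule poly_mapping_eqI) (simp add: restrict_words.rep_eq)

lemma restrict_words_mult: "restrict_words (p * q) = restrict_words p * restrict_words q"
proof (induction p rule: poly_mapping_single_induct)
  case (single w c)
  show ?case
  proof (induction q rule: poly_mapping_single_induct)
    case (single w' c')
    have "w @ w' \<in> lists B \<longleftrightarrow> w \<in> lists B \<and> w' \<in> lists B" by auto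
    then show ?case by (simp add: mult_single plus_list_def restrict_words_single del: in_lists_conv_set)
  next
    case (add p q)
    then show ?case by (simp add: distrib_left restrict_words_add)
  qed simp
next
  case (add p q)
  then show ?case by (simp add: distrib_right restrict_words_add)
qed simp

text \<open>The kernel of \<open>\<phi>\<close>, enlarged to an ideal of the ring of all polynomials.\<close>

definition J :: "('v gen list \<Rightarrow>\<^sub>0 rat) set" where
  "J = {p. \<phi> (restrict_words p) = \<zero>\<^bsub>A\<^esub>}"

lemma J_iff: "p \<in> carrier T \<Longrightarrow> p \<in> J \<longleftrightarrow> \<phi> p = \<zero>\<^bsub>A\<^esub>"
  by (simp add: J_def restrict_words_id del: tensor_simps(1))

lemma J_ideal:
  "0 \<in> J" "\<lbrakk>p \<in> J; q \<in> J\<rbrakk> \<Longrightarrow> p + q \<in> J" "p \<in> J \<Longrightarrow> c * p \<in> J" "p \<in> J \<Longrightarrow> p * c \<in> J"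
proof -
  interpret A: ring A by (rule rat_algebraD(1)[OF rat_A])
  show "0 \<in> J" using \<phi>(5) by (simp add: J_def)
  show "\<lbrakk>p \<in> J; q \<in> J\<rbrakk> \<Longrightarrow> p + q \<in> J"
    using \<phi>(3)[OF restrict_words_T restrict_words_T, of p q] by (simp add: J_def restrict_words_add)
  show "p \<in> J \<Longrightarrow> c * p \<in> J"
    using \<phi>(2)[OF restrict_words_T restrict_words_T, of c p] \<phi>(8)[OF restrict_words_T, of c]
    by (simp add: J_def restrict_words_mult del: tensor_simps(1))
  show "p \<in> J \<Longrightarrow> p * c \<in> J"
    using \<phi>(2)[OF restrict_words_T restrict_words_T, of p c] \<phi>(8)[OF restrict_words_T, of c]
    by (simp add: J_def restrict_words_mult del: tensor_simps(1))
qed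

lemma J_uminus: "- p \<in> J \<Longrightarrow> p \<in> J"
  using J_ideal(3)[of "- p" "-1"] by simp

lemma J_square: "p \<in> grade T 1 \<Longrightarrow> p * p \<in> J"
proof -
  assume p: "p \<in> grade T 1"
  then have "p \<in> carrier T" by auto
  from J_iff[OF T_mult[OF this this]] show ?thesis using \<phi>_square[OF p] by blast
qed

lemma J_anticommuting: "anticommuting J B letter"
proof
  show sq: "letter a * letter a \<in> J" if "a \<in> B" for a by (rule J_square) (use that in auto)
  show "letter a * letter b + letter b * letter a \<in> J" if ab: "a \<in> B" "b \<in> B" for a b
  proof -
    have "(letter a + letter b) * (letter a + letter b) \<in> J"
      by (rule J_square) (use ab Poly_Mapping.keys_add[of "letter a" "letter b"] in fastforce)
    then have "(letter a + letter b) * (letter a + letter b) + - (letter a * letter a) + - (letter b * letter b) \<in> J"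
      using sq ab J_ideal(3)[of _ "-1"] by (intro J_ideal(2)) auto
    then show ?thesis by (simp add: algebra_simps)
  qed
qed (rule J_ideal; assumption?)+

lemma J_edges: "anticommuting_edges J Ed (\<lambda>e. letter (GenG e))"
proof -
  interpret anticommuting J B letter by (rule J_anticommuting)
  have "GenG e \<in> B" if "e \<in> Ed" for e using that edges_subset by (auto simp: gens_def)
  then show ?thesis by unfold_locales (use K_zero K_add K_left K_right square anticommute in auto)
qed

lemma J_edge_rel:
  assumes "{u, w} \<in> Ed" shows "edge_rel GenX u w \<in> J" "edge_rel GenY u w \<in> J"
proof -
  have uw: "u \<noteq> w" using card assms by fastforce
  obtain a b where ab: "{u, w} = {a, b}" "edge_head r {u, w} = b" "edge_tail r {u, w} = a"
    using edge_cases[OF assms] by metis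
  have ba: "{b, a} \<in> Ed" using assms ab(1) by (simp add: insert_commute)
  have "edge_rel GenX b a \<in> J" "edge_rel GenY b a \<in> J"
  proof -
    have "h1 (edge_rel GenX b a) \<in> rels" "h1 (edge_rel GenY b a) \<in> rels"
      unfolding edge_relations_eq using assms ab(2,3) by blast+
    then show "edge_rel GenX b a \<in> J" "edge_rel GenY b a \<in> J"
      using J_iff[OF edge_rel_T(1)[OF ba]] J_iff[OF edge_rel_T(2)[OF ba]] \<phi>_rel by blast+
  qed
  moreover have "edge_rel G b a = - edge_rel G a b" for G
    by (simp add: edge_rel_def insert_commute algebra_simps)
  ultimately show "edge_rel GenX u w \<in> J" "edge_rel GenY u w \<in> J"
    using ab(1) uw J_uminus by (auto simp: doubleton_eq_iff)
qed

text \<open>For \<open>a < b < c\<close> the edges of the triangle are increasing in this order, since edges are compared by their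
  larger end first.\<close>

lemma J_sorted_triangle:
  assumes ab: "(a, b) \<in> r" "(b, c) \<in> r" "distinct [a, b, c]" and e: "{a, b} \<in> Ed" "{b, c} \<in> Ed" "{a, c} \<in> Ed"
  shows "alt_sum (\<lambda>e. letter (GenG e)) [{a, b}, {a, c}, {b, c}] \<in> J"
proof -
  let ?es = "[{a, b}, {a, c}, {b, c}]"
  have ac: "(a, c) \<in> r" using ab(1,2) lin
    by (auto simp: linear_order_on_def partial_order_on_def preorder_on_def dest: transD)
  have "sorted_wrt (edge_less r) ?es"
    using ab ac by (auto simp: edge_less_def head_tail)
  moreover have "graph_cycle Ed [a, b, c]"
    using ab e by (auto simp: graph_cycle_iff cycle_edge_list_path insert_commute)
  moreover have "set ?es = cycle_edges [a, b, c]"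
    by (auto simp: set_cycle_edge_list[symmetric] cycle_edge_list_path insert_commute)
  ultimately have "(\<Oplus>\<^bsub>arr_ext \<A>\<^esub>j\<in>{1..length ?es}.
         (-1) ^ j \<odot>\<^bsub>arr_ext \<A>\<^esub> gg_prod \<A> (take (j - 1) ?es @ drop j ?es)) \<in> cycle_relations \<A>"
    unfolding cycle_relations_def arrangement_simps by blast
  moreover have es: "set ?es \<subseteq> Ed" using e by auto
  ultimately have rel: "h1 (- alt_sum (\<lambda>e. letter (GenG e)) ?es) \<in> rels"
    unfolding conjunct1[OF cycle_relation_eq[OF es]] by blast
  have "- alt_sum (\<lambda>e. letter (GenG e)) ?es \<in> J"
    using J_iff[OF T_uminus[OF conjunct2[OF cycle_relation_eq[OF es]]]] \<phi>_rel[OF rel] by blast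
  then show ?thesis by (rule J_uminus)
qed

lemma sort_three:
  assumes "u \<in> V" "w \<in> V" "t \<in> V" "distinct [u, w, t]"
  shows "\<exists>a b c. (a, b) \<in> r \<and> (b, c) \<in> r \<and>
    (a, b, c) \<in> {(u, w, t), (u, t, w), (w, u, t), (w, t, u), (t, u, w), (t, w, u)}"
proof -
  have total: "(x, y) \<in> r \<or> (y, x) \<in> r" if "x \<in> V" "y \<in> V" "x \<noteq> y" for x y
    using lin that by (auto simp: linear_order_on_def total_on_def)
  show ?thesis using total[of u w] total[of w t] total[of u t] assms by auto
qed

text \<open>The cyclic form of the triangle relation does not refer to the order of the vertices; it differs from
  the alternating one by an anticommutator.\<close>

lemma J_triangle:
  assumes "u \<in> V" "w \<in> V" "t \<in> V" "distinct [u, w, t]" and e: "{u, w} \<in> Ed" "{w, t} \<in> Ed" "{t, u} \<in> Ed"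
  shows "letter (GenG {u, w}) * letter (GenG {w, t}) + letter (GenG {w, t}) * letter (GenG {t, u})
        + letter (GenG {t, u}) * letter (GenG {u, w}) \<in> J"
proof -
  interpret anticommuting_edges J Ed "\<lambda>e. letter (GenG e)" by (rule J_edges)
  obtain a b c where abc: "(a, b) \<in> r" "(b, c) \<in> r"
    "(a, b, c) \<in> {(u, w, t), (u, t, w), (w, u, t), (w, t, u), (t, u, w), (t, w, u)}"
    using sort_three[OF assms(1-4)] by blast
  have d: "distinct [a, b, c]" using abc(3) assms(4) by auto
  have e': "{a, b} \<in> Ed" "{b, c} \<in> Ed" "{a, c} \<in> Ed" using abc(3) e by (auto simp: insert_commute)
  have "mset [{a, b}, {a, c}, {b, c}] = mset [{u, w}, {w, t}, {t, u}]"
    using abc(3) by (auto simp: insert_commute add_mset_commute)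
  then have "alt_sum (\<lambda>e. letter (GenG e)) [{u, w}, {w, t}, {t, u}] \<in> J"
    by (rule alt_sum_mset) (use e' J_sorted_triangle[OF abc(1,2) d e'] in auto)
  moreover have "letter (GenG {u, w}) * letter (GenG {t, u}) + letter (GenG {t, u}) * letter (GenG {u, w}) \<in> J"
    by (rule anticommute) (use e in auto)
  ultimately have "alt_sum (\<lambda>e. letter (GenG e)) [{u, w}, {w, t}, {t, u}] +
      (letter (GenG {u, w}) * letter (GenG {t, u}) + letter (GenG {t, u}) * letter (GenG {u, w})) \<in> J"
    by (rule K_add)
  then show ?thesis by (simp add: algebra_simps)
qed

lemma J_relations: "relations_ideal J Ed vs"
proof -
  interpret anticommuting J B letter by (rule J_anticommuting)
  show ?thesis
  proof
    show "(letter (GenX u) - letter (GenX w)) * letter (GenG {u, w}) \<in> J"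
      "(letter (GenY u) - letter (GenY w)) * letter (GenG {u, w}) \<in> J" if "{u, w} \<in> Ed" for u w
      using J_edge_rel[OF that] by (simp_all add: edge_rel_def)
  qed (rule J_triangle; simp add: set_vs)
qed

section \<open>Identification with the model and conclusion\<close>

abbreviation "M n \<equiv> homog Ed vs (int n)"

text \<open>The isomorphism of the model with the arrangement algebra. Transported along it, left multiplication by
  a generator becomes the operator of the model.\<close>

definition \<Psi> where "\<Psi> F = \<phi> (normal_form Ed vs F)"

lemma nf_grade: "F \<in> M n \<Longrightarrow> normal_form Ed vs F \<in> grade T n"
  using normal_form_words[of F Ed vs "int n"] by (auto simp: words_def)

lemma grade_T: "p \<in> grade T n \<Longrightarrow> p \<in> carrier T" by auto

lemma \<Psi>_grade: "F \<in> M n \<Longrightarrow> \<Psi> F \<in> grade A n"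
  unfolding \<Psi>_def \<phi>(7) by (rule imageI[OF nf_grade])

lemma J_cong: "p \<in> carrier T \<Longrightarrow> q \<in> carrier T \<Longrightarrow> p - q \<in> J \<Longrightarrow> \<phi> p = \<phi> q"
proof -
  assume pq: "p \<in> carrier T" "q \<in> carrier T" "p - q \<in> J"
  interpret A: ring A by (rule rat_algebraD(1)[OF rat_A])
  have d: "p - q \<in> carrier T" using T_add[OF pq(1) T_uminus[OF pq(2)]] by (simp del: tensor_simps(1))
  have "\<phi> p = \<phi> ((p - q) + q)" by simp
  also have "\<dots> = \<phi> (p - q) \<oplus>\<^bsub>A\<^esub> \<phi> q" using \<phi>(3)[OF d pq(2)] by simp
  also have "\<phi> (p - q) = \<zero>\<^bsub>A\<^esub>" using pq(3) J_iff[OF d] by blast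
  finally show ?thesis using \<phi>(8)[OF pq(2)] by simp
qed

text \<open>Spanning by normally ordered monomials, applied to a homogeneous preimage.\<close>

lemma \<Psi>_onto: assumes "a \<in> grade A n" obtains F where "F \<in> M n" "a = \<Psi> F"
proof -
  interpret relations_ideal J Ed vs by (rule J_relations)
  obtain p where p: "p \<in> grade T n" "a = \<phi> p" using assms unfolding \<phi>(7) by blast
  let ?F = "tact Ed vs p (vac vs)"
  have F: "?F \<in> M n"
    using tact_homog[OF card elim vac_homog, of p "int n"] p(1) by (auto simp: words_def)
  have "normal_form Ed vs ?F - p \<in> J"
    using normal_form_tact[OF card elim, of p] p(1) by (auto simp: equiv_mod_def)
  then have "\<Psi> ?F = \<phi> p"
    unfolding \<Psi>_def by (rule J_cong[OF grade_T[OF nf_grade[OF F]] grade_T[OF p(1)]])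
  then show ?thesis using that F p(2) by simp
qed

lemma \<Psi>_letter:
  assumes a: "a \<in> B" and F: "F \<in> M n"
  shows "\<phi> (letter a) \<otimes>\<^bsub>A\<^esub> \<Psi> F = \<Psi> (act Ed vs a F)"
proof -
  interpret relations_ideal J Ed vs by (rule J_relations)
  have "letter a * normal_form Ed vs F - normal_form Ed vs (act Ed vs a F) \<in> J"
    using letter_normal_form[OF card elim _ a] by (simp add: equiv_mod_def)
  moreover have "act Ed vs a F \<in> M (Suc n)" using act_homog[OF card elim a F] by (simp add: add.commute)
  ultimately have "\<phi> (letter a * normal_form Ed vs F) = \<Psi> (act Ed vs a F)"
    unfolding \<Psi>_def using J_cong T_mult[OF letter_T[OF a] grade_T[OF nf_grade[OF F]]] grade_T[OF nf_grade] by blast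
  then show ?thesis
    unfolding \<Psi>_def using \<phi>(2)[OF letter_T[OF a] grade_T[OF nf_grade[OF F]]] by simp
qed

lemma \<Psi>_sum:
  assumes "finite S" "\<And>n. n \<in> S \<Longrightarrow> F n \<in> M n"
  shows "(\<Oplus>\<^bsub>A\<^esub>n\<in>S. \<Psi> (F n)) = \<Psi> (\<Sum>n\<in>S. F n)"
  unfolding \<Psi>_def normal_form_sum
  using T_finsum[OF epi assms(1), of "\<lambda>n. normal_form Ed vs (F n)"] grade_T[OF nf_grade[OF assms(2)]] by blast

lemma \<Psi>_add: "F \<in> M n \<Longrightarrow> G \<in> M n \<Longrightarrow> \<Psi> (F + G) = \<Psi> F \<oplus>\<^bsub>A\<^esub> \<Psi> G"
  unfolding \<Psi>_def normal_form_add using \<phi>(3)[OF grade_T[OF nf_grade] grade_T[OF nf_grade]] by simp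

lemma \<Psi>_zero: "\<Psi> 0 = \<zero>\<^bsub>A\<^esub>"
  unfolding \<Psi>_def normal_form_zero using \<phi>(5) by simp

lemma \<Psi>_uminus: "F \<in> M n \<Longrightarrow> \<Psi> (- F) = \<ominus>\<^bsub>A\<^esub> \<Psi> F"
proof -
  assume F: "F \<in> M n"
  interpret A: ring A by (rule rat_algebraD(1)[OF rat_A])
  have c: "\<Psi> F \<in> carrier A" "\<Psi> (- F) \<in> carrier A"
    unfolding \<Psi>_def by (rule \<phi>(8)[OF grade_T[OF nf_grade]], rule F homog_uminus[OF F])+
  have "\<Psi> (- F) \<oplus>\<^bsub>A\<^esub> \<Psi> F = \<Psi> (- F + F)" by (rule \<Psi>_add[OF homog_uminus[OF F] F, symmetric])
  also have "\<dots> = \<zero>\<^bsub>A\<^esub>" by (simp only: add.left_inverse \<Psi>_zero)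
  finally show ?thesis using c by (metis A.minus_equality)
qed

text \<open>If the normal form of a sum is zero in the algebra, it acts as zero and hence produces zero from the empty
  monomial, but it also produces the sum itself. Summands of different degree have disjoint supports. This is
  both the independence of normally ordered monomials and the directness of the grading.\<close>

lemma \<Psi>_sum_inject:
  assumes S: "finite S" "\<And>n. n \<in> S \<Longrightarrow> F n \<in> M n" and 0: "\<Psi> (\<Sum>n\<in>S. F n) = \<zero>\<^bsub>A\<^esub>" and n: "n \<in> S"
  shows "F n = 0"
proof -
  have c: "normal_form Ed vs (\<Sum>n\<in>S. F n) \<in> carrier T"
    unfolding normal_form_sum
    using T_finsum[OF epi S(1), of "\<lambda>n. normal_form Ed vs (F n)"] grade_T[OF nf_grade[OF S(2)]] by blast
  have "tact Ed vs (normal_form Ed vs (\<Sum>n\<in>S. F n)) (vac vs) = 0"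
    using kernel_annihilates[OF c] 0 by (simp add: \<Psi>_def annihilator_def)
  moreover have "tact Ed vs (normal_form Ed vs (\<Sum>n\<in>S. F n)) (vac vs) =
      (\<Sum>n\<in>S. tact Ed vs (normal_form Ed vs (F n)) (vac vs))"
    by (simp only: normal_form_sum tact_sum)
  moreover have "\<dots> = (\<Sum>n\<in>S. F n)"
    by (rule sum.cong[OF refl tact_normal_form[OF elim S(2)]])
  ultimately have z: "(\<Sum>n\<in>S. F n) = 0" by (simp only:)
  show ?thesis
  proof
    fix l
    show "F n l = 0 l"
    proof (rule ccontr)
      assume l: "F n l \<noteq> 0 l"
      then have deg: "states_deg l = int n" using S(2)[OF n] by (auto simp: homog_def)
      have "(\<Sum>m\<in>S. F m l) = (\<Sum>m\<in>{n}. F m l)"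
      proof (rule sum.mono_neutral_right)
        show "\<forall>m\<in>S - {n}. F m l = 0" using S(2) deg by (force simp: homog_def)
      qed (use S n in auto)
      then have "F n l = (\<Sum>m\<in>S. F m) l" by (simp add: sum_fun_app)
      then show False using z l by simp
    qed
  qed
qed

lemma \<Psi>_inject: assumes "F \<in> M n" "G \<in> M n" "\<Psi> F = \<Psi> G" shows "F = G"
proof -
  interpret A: ring A by (rule rat_algebraD(1)[OF rat_A])
  have c: "\<Psi> G \<in> carrier A" unfolding \<Psi>_def by (rule \<phi>(8)[OF grade_T[OF nf_grade[OF assms(2)]]])
  have d: "F - G \<in> M n" by (rule homog_diff[OF assms(1,2)])
  have "\<Psi> (F - G) = \<Psi> F \<oplus>\<^bsub>A\<^esub> \<ominus>\<^bsub>A\<^esub> \<Psi> G"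
    using \<Psi>_add[OF assms(1) homog_uminus[OF assms(2)]] \<Psi>_uminus[OF assms(2)] by simp
  also have "\<dots> = \<zero>\<^bsub>A\<^esub>" using c by (simp add: assms(3) A.r_neg)
  finally have "F - G = 0" using \<Psi>_sum_inject[of "{n}" "\<lambda>_. F - G" n] d by simp
  then show ?thesis by simp
qed

text \<open>Decompositions exist because they do in the tensor algebra; they are unique because the model is graded.\<close>

lemma graded_A: "graded_algebra A"
proof -
  interpret A: ring A by (rule rat_algebraD(1)[OF rat_A])
  have g: "grade A n \<subseteq> carrier A" for n unfolding \<phi>(7) \<phi>(1) by (rule image_mono) (use grade_T in blast)
  have gT_add: "p + q \<in> grade T n" if "p \<in> grade T n" "q \<in> grade T n" for p q n
  proof -
    have "Poly_Mapping.keys (p + q) \<subseteq> Poly_Mapping.keys p \<union> Poly_Mapping.keys q" by (rule Poly_Mapping.keys_add)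
    also have "\<dots> \<subseteq> {w \<in> lists B. length w = n}" using that by simp
    finally show ?thesis by simp
  qed
  have gT_mult: "p * q \<in> grade T (m + n)" if pq: "p \<in> grade T m" "q \<in> grade T n" for p q m n
  proof -
    have "w \<in> {w \<in> lists B. length w = m + n}" if w: "w \<in> Poly_Mapping.keys (p * q)" for w
    proof -
      obtain a b where "w = a @ b" "a \<in> Poly_Mapping.keys p" "b \<in> Poly_Mapping.keys q"
        using keys_mult[of p q] w by (auto simp: plus_list_def)
      moreover from this have "a \<in> {w \<in> lists B. length w = m}" "b \<in> {w \<in> lists B. length w = n}"
        using pq by (simp_all add: subset_iff)
      ultimately show ?thesis by simp
    qed
    then show ?thesis by (simp add: subset_iff)
  qed
  have gT_scalar: "scalar c * p \<in> grade T n" if "p \<in> grade T n" for p c n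
    using gT_mult[of "scalar c" 0 p n] that by simp
  have ex: "\<exists>c. (\<forall>n. c n \<in> grade A n) \<and> finite {n. c n \<noteq> \<zero>\<^bsub>A\<^esub>} \<and> a = (\<Oplus>\<^bsub>A\<^esub>n\<in>{n. c n \<noteq> \<zero>\<^bsub>A\<^esub>}. c n)"
    if "a \<in> carrier A" for a
  proof -
    obtain p where p: "p \<in> carrier T" "a = \<phi> p" using \<open>a \<in> carrier A\<close> unfolding \<phi>(1) by blast
    define q where "q n = (\<Sum>w\<in>{w \<in> Poly_Mapping.keys p. length w = n}. Poly_Mapping.single w (Poly_Mapping.lookup p w))" for n
    let ?S = "length ` Poly_Mapping.keys p"
    have q: "q n \<in> grade T n" for n
    proof -
      have "Poly_Mapping.keys (q n) \<subseteq> {w \<in> lists B. length w = n}"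
        unfolding q_def by (rule keys_sum_subset) (use p(1) in auto)
      then show ?thesis by simp
    qed
    have sum: "(\<Sum>n\<in>?S. q n) = p"
    proof -
      have "(\<Sum>n\<in>?S. q n) = (\<Sum>w\<in>Poly_Mapping.keys p. Poly_Mapping.single w (Poly_Mapping.lookup p w))"
        unfolding q_def by (rule sum.group) auto
      also have "\<dots> = p"
        by (rule poly_mapping_eqI) (auto simp: lookup_sum lookup_single when_def in_keys_iff)
      finally show ?thesis .
    qed
    have zero: "\<phi> (q n) = \<zero>\<^bsub>A\<^esub>" if "n \<notin> ?S" for n
    proof -
      have "{w \<in> Poly_Mapping.keys p. length w = n} = {}" using that by auto
      then have "q n = 0" unfolding q_def by (simp only: sum.empty)
      then show ?thesis using \<phi>(5) by simp
    qed
    have sub: "{n. \<phi> (q n) \<noteq> \<zero>\<^bsub>A\<^esub>} \<subseteq> ?S" using zero by blast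
    have "a = (\<Oplus>\<^bsub>A\<^esub>n\<in>?S. \<phi> (q n))"
      using T_finsum[OF epi, of ?S q] grade_T[OF q] sum p(2) by auto
    also have "\<dots> = (\<Oplus>\<^bsub>A\<^esub>n\<in>{n. \<phi> (q n) \<noteq> \<zero>\<^bsub>A\<^esub>}. \<phi> (q n))"
      by (rule A.add.finprod_mono_neutral_cong_right) (use sub \<phi>(8)[OF grade_T[OF q]] in auto)
    finally have "a = (\<Oplus>\<^bsub>A\<^esub>n\<in>{n. \<phi> (q n) \<noteq> \<zero>\<^bsub>A\<^esub>}. \<phi> (q n))" .
    moreover have "finite {n. \<phi> (q n) \<noteq> \<zero>\<^bsub>A\<^esub>}" by (rule finite_subset[OF sub]) simp
    moreover have "\<forall>n. \<phi> (q n) \<in> grade A n" unfolding \<phi>(7) using q by blast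
    ultimately show ?thesis by (intro exI[of _ "\<lambda>n. \<phi> (q n)"] conjI)
  qed
  have unique: "c = c'"
    if c: "\<forall>n. c n \<in> grade A n" "finite {n. c n \<noteq> \<zero>\<^bsub>A\<^esub>}"
      and c': "\<forall>n. c' n \<in> grade A n" "finite {n. c' n \<noteq> \<zero>\<^bsub>A\<^esub>}"
      and eq: "(\<Oplus>\<^bsub>A\<^esub>n\<in>{n. c n \<noteq> \<zero>\<^bsub>A\<^esub>}. c n) = (\<Oplus>\<^bsub>A\<^esub>n\<in>{n. c' n \<noteq> \<zero>\<^bsub>A\<^esub>}. c' n)" for c c'
  proof
    fix n
    let ?S = "insert n ({n. c n \<noteq> \<zero>\<^bsub>A\<^esub>} \<union> {n. c' n \<noteq> \<zero>\<^bsub>A\<^esub>})"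
    have fin: "finite ?S" using c c' by simp
    have "\<forall>n. \<exists>F. F \<in> M n \<and> c n = \<Psi> F" "\<forall>n. \<exists>F. F \<in> M n \<and> c' n = \<Psi> F"
      using c(1) c'(1) \<Psi>_onto by metis+
    then obtain F F' where F: "\<And>n. F n \<in> M n" "\<And>n. c n = \<Psi> (F n)" and F': "\<And>n. F' n \<in> M n" "\<And>n. c' n = \<Psi> (F' n)"
      by metis
    have car: "c n \<in> carrier A" "c' n \<in> carrier A" for n using c(1) c'(1) g by blast+
    have "(\<Oplus>\<^bsub>A\<^esub>n\<in>?S. c n) = (\<Oplus>\<^bsub>A\<^esub>n\<in>{n. c n \<noteq> \<zero>\<^bsub>A\<^esub>}. c n)"
      by (rule A.add.finprod_mono_neutral_cong_right) (use fin car in auto)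
    also have "\<dots> = (\<Oplus>\<^bsub>A\<^esub>n\<in>?S. c' n)"
      unfolding eq by (rule A.add.finprod_mono_neutral_cong_left) (use fin car in auto)
    finally have "\<Psi> (\<Sum>n\<in>?S. F n) = \<Psi> (\<Sum>n\<in>?S. F' n)"
      using \<Psi>_sum[OF fin F(1)] \<Psi>_sum[OF fin F'(1)] by (simp only: F(2) F'(2))
    moreover have cS: "normal_form Ed vs (\<Sum>n\<in>?S. G n) \<in> carrier T" if "\<And>n. G n \<in> M n" for G
      unfolding normal_form_sum
      using T_finsum[OF epi fin, of "\<lambda>n. normal_form Ed vs (G n)"] grade_T[OF nf_grade[OF that]] by blast
    have "\<Psi> (\<Sum>n\<in>?S. F n - F' n) \<oplus>\<^bsub>A\<^esub> \<Psi> (\<Sum>n\<in>?S. F' n) = \<Psi> (\<Sum>n\<in>?S. F n)"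
    proof -
      have d: "F n - F' n \<in> M n" for n by (rule homog_diff[OF F(1) F'(1)])
      have "(\<Sum>n\<in>?S. F n - F' n) + (\<Sum>n\<in>?S. F' n) = (\<Sum>n\<in>?S. F n)"
        by (simp only: sum_subtractf diff_add_cancel)
      then show ?thesis
        unfolding \<Psi>_def using \<phi>(3)[OF cS[OF d] cS[OF F'(1)]] by (simp only: tensor_simps normal_form_add[symmetric])
    qed
    ultimately have "\<Psi> (\<Sum>n\<in>?S. F n - F' n) \<oplus>\<^bsub>A\<^esub> \<Psi> (\<Sum>n\<in>?S. F' n) = \<Psi> (\<Sum>n\<in>?S. F' n)" by (simp only:)
    moreover have "\<Psi> (\<Sum>n\<in>?S. F n - F' n) \<in> carrier A" "\<Psi> (\<Sum>n\<in>?S. F' n) \<in> carrier A"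
      unfolding \<Psi>_def by (rule \<phi>(8)[OF cS], rule homog_diff[OF F(1) F'(1)] F'(1))+
    ultimately have "\<Psi> (\<Sum>n\<in>?S. F n - F' n) = \<zero>\<^bsub>A\<^esub>" by (simp only: A.add.r_cancel_one)
    from \<Psi>_sum_inject[OF fin homog_diff[OF F(1) F'(1)] this] have "F n - F' n = 0" by blast
    then show "c n = c' n" using F(2) F'(2) by simp
  qed
  show ?thesis
    unfolding graded_algebra_def
  proof (intro conjI allI ballI rat_A g)
    show "\<zero>\<^bsub>A\<^esub> \<in> grade A n" for n using \<phi>(5) unfolding \<phi>(7) by (intro image_eqI[of _ _ 0]) auto
    show "a \<oplus>\<^bsub>A\<^esub> b \<in> grade A n" if ab: "a \<in> grade A n" "b \<in> grade A n" for a b n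
    proof -
      obtain p q where pq: "p \<in> grade T n" "q \<in> grade T n" "a = \<phi> p" "b = \<phi> q" using ab unfolding \<phi>(7) by blast
      show ?thesis unfolding \<phi>(7) pq(3,4)
        using \<phi>(3)[OF grade_T[OF pq(1)] grade_T[OF pq(2)]] gT_add[OF pq(1,2)] by (intro image_eqI[of _ _ "p + q"]) simp_all
    qed
    show "c \<odot>\<^bsub>A\<^esub> a \<in> grade A n" if a: "a \<in> grade A n" for a n c
    proof -
      obtain p where p: "p \<in> grade T n" "a = \<phi> p" using a unfolding \<phi>(7) by blast
      show ?thesis unfolding \<phi>(7) p(2)
        using \<phi>(6)[OF grade_T[OF p(1)], of c] gT_scalar[OF p(1), of c] by (intro image_eqI[of _ _ "scalar c * p"]) simp_all
    qed
    show "a \<otimes>\<^bsub>A\<^esub> b \<in> grade A (m + n)" if ab: "a \<in> grade A m" "b \<in> grade A n" for a b m n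
    proof -
      obtain p q where pq: "p \<in> grade T m" "q \<in> grade T n" "a = \<phi> p" "b = \<phi> q" using ab unfolding \<phi>(7) by blast
      show ?thesis unfolding \<phi>(7) pq(3,4)
        using \<phi>(2)[OF grade_T[OF pq(1)] grade_T[OF pq(2)]] gT_mult[OF pq(1,2)] by (intro image_eqI[of _ _ "p * q"]) simp_all
    qed
    show "\<one>\<^bsub>A\<^esub> \<in> grade A 0" using \<phi>(4) unfolding \<phi>(7) by (intro image_eqI[of _ _ 1]) (auto simp: zero_list_def)
    show "\<exists>!c. (\<forall>n. c n \<in> grade A n) \<and> finite {n. c n \<noteq> \<zero>\<^bsub>A\<^esub>} \<and> a = (\<Oplus>\<^bsub>A\<^esub>n\<in>{n. c n \<noteq> \<zero>\<^bsub>A\<^esub>}. c n)"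
      if "a \<in> carrier A" for a
    proof -
      let ?P = "\<lambda>c. (\<forall>n. c n \<in> grade A n) \<and> finite {n. c n \<noteq> \<zero>\<^bsub>A\<^esub>} \<and> a = (\<Oplus>\<^bsub>A\<^esub>n\<in>{n. c n \<noteq> \<zero>\<^bsub>A\<^esub>}. c n)"
      obtain c where c: "?P c" using ex[OF \<open>a \<in> carrier A\<close>] by (elim exE)
      have "c' = c" if "?P c'" for c' using c that by (intro unique) auto
      with c show ?thesis by (rule ex1I)
    qed
  qed
qed

text \<open>The empty monomial is not zero in the model.\<close>

lemma connected_A: "connected_graded_algebra A"
  unfolding connected_graded_algebra_def
proof (intro conjI graded_A)
  interpret A: ring A by (rule rat_algebraD(1)[OF rat_A])
  have vac: "vac vs \<in> M 0" using vac_homog by simp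
  have one: "\<Psi> (vac vs) = \<one>\<^bsub>A\<^esub>" unfolding \<Psi>_def normal_form_vac using \<phi>(4) by simp
  show "\<one>\<^bsub>A\<^esub> \<noteq> \<zero>\<^bsub>A\<^esub>"
  proof
    assume "\<one>\<^bsub>A\<^esub> = \<zero>\<^bsub>A\<^esub>"
    then have "vac vs = 0" using \<Psi>_inject[OF vac homog_zero] one \<Psi>_zero by simp
    then have "vac vs (triv vs) = 0" by simp
    then show False by (simp add: vac_def)
  qed
  have one_T: "(1 :: 'v gen list \<Rightarrow>\<^sub>0 rat) \<in> carrier T" by (rule T_one)
  have sc: "\<phi> (scalar c) = c \<odot>\<^bsub>A\<^esub> \<one>\<^bsub>A\<^esub>" for c
    using \<phi>(6)[OF one_T, of c] \<phi>(4) by simp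
  have "p \<in> grade T 0 \<longleftrightarrow> (\<exists>c. p = scalar c)" for p
  proof
    assume p: "p \<in> grade T 0"
    have "p = scalar (Poly_Mapping.lookup p [])"
      by (rule poly_mapping_eqI) (use p in \<open>auto simp: lookup_single when_def in_keys_iff\<close>)
    then show "\<exists>c. p = scalar c" ..
  qed (auto split: if_splits)
  then have "grade T 0 = range scalar" by blast
  then show "grade A 0 = {q \<odot>\<^bsub>A\<^esub> \<one>\<^bsub>A\<^esub> |q. True}" unfolding \<phi>(7) by (auto simp: sc image_image)
qed

abbreviation "L \<equiv> gen_list Ed vs"

text \<open>The filtration of the model, transported to the algebra. It is easier to verify the conditions there than
  to describe membership in an ideal given by generators.\<close>

definition chain_ideal :: "nat \<Rightarrow> nat \<Rightarrow> ('v gen list \<Rightarrow>\<^sub>0 rat) set set set" where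
  "chain_ideal k n = \<Psi> ` (M n \<inter> filt vs (chain Ed vs k))"

lemma chain_mono: "chain Ed vs k \<subseteq> chain Ed vs (Suc k)"
  unfolding chain_def by (rule set_take_subset_set_take) simp

lemma filt_mono: "P \<subseteq> P' \<Longrightarrow> filt ws P \<subseteq> filt ws P'"
  unfolding filt_def by blast

text \<open>Each condition is the corresponding property of the filtered model, translated by \<open>\<Psi>\<close>.\<close>

lemma koszul_chain_A: "koszul_chain A (\<lambda>k. \<phi> (letter (L ! k))) (length L) chain_ideal"
proof -
  interpret cg: conn_graded A by unfold_locales (rule connected_A)
  have LB: "L ! k \<in> B" if "k < length L" for k using that set_gen_list[OF card elim] nth_mem by metis
  have act: "act Ed vs (L ! k) F \<in> M (Suc n)" if "k < length L" "F \<in> M n" for k F n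
    using act_homog[OF card elim LB[OF that(1)] that(2)] by (simp add: add.commute)
  note step = chain_steps[OF card elim, unfolded chain_step_def]
  have in_iff: "\<Psi> F \<in> chain_ideal k n \<longleftrightarrow> F \<in> filt vs (chain Ed vs k)" if F: "F \<in> M n" for F k n
  proof
    assume "\<Psi> F \<in> chain_ideal k n"
    then obtain G where "G \<in> M n" "G \<in> filt vs (chain Ed vs k)" "\<Psi> F = \<Psi> G" by (auto simp: chain_ideal_def)
    then show "F \<in> filt vs (chain Ed vs k)" using \<Psi>_inject[OF F] by metis
  qed (use F in \<open>auto simp: chain_ideal_def\<close>)
  show ?thesis
  proof
    show "\<phi> (letter (L ! k)) \<in> grade A 1" if "k < length L" for k
      unfolding \<phi>(7) by (rule imageI) (use LB[OF that] in simp)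
    show "chain_ideal k n \<subseteq> grade A n" for k n using \<Psi>_grade by (auto simp: chain_ideal_def)
    show "\<zero>\<^bsub>A\<^esub> \<in> chain_ideal k n" for k n
      unfolding chain_ideal_def by (rule image_eqI[where x = 0]) (simp_all only: \<Psi>_zero homog_zero filt_zero IntI)
    show "a \<oplus>\<^bsub>A\<^esub> b \<in> chain_ideal k n" if ab: "a \<in> chain_ideal k n" "b \<in> chain_ideal k n" for a b k n
    proof -
      obtain F G where FG: "F \<in> M n" "F \<in> filt vs (chain Ed vs k)" "a = \<Psi> F" "G \<in> M n" "G \<in> filt vs (chain Ed vs k)" "b = \<Psi> G"
        using ab by (auto simp: chain_ideal_def)
      have "a \<oplus>\<^bsub>A\<^esub> b = \<Psi> (F + G)" using \<Psi>_add[OF FG(1,4)] FG(3,6) by simp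
      moreover have "F + G \<in> M n" "F + G \<in> filt vs (chain Ed vs k)"
        by (rule homog_add[OF FG(1,4)], rule filt_add[OF FG(2,5)])
      ultimately show ?thesis unfolding chain_ideal_def by blast
    qed
    show "\<ominus>\<^bsub>A\<^esub> a \<in> chain_ideal k n" if a: "a \<in> chain_ideal k n" for a k n
    proof -
      obtain F where F: "F \<in> M n" "F \<in> filt vs (chain Ed vs k)" "a = \<Psi> F"
        using a by (auto simp: chain_ideal_def)
      have "\<ominus>\<^bsub>A\<^esub> a = \<Psi> (- F)" using \<Psi>_uminus[OF F(1)] F(3) by simp
      moreover have "- F \<in> M n" "- F \<in> filt vs (chain Ed vs k)"
        using homog_uminus[OF F(1)] F(2) by (simp_all add: filt_uminus_iff)
      ultimately show ?thesis unfolding chain_ideal_def by blast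
    qed
    show "chain_ideal 0 n = {\<zero>\<^bsub>A\<^esub>}" for n
    proof -
      have "M n \<inter> filt vs (chain Ed vs 0) = {0}" using filt_bot[of _ vs Ed] by auto
      then show ?thesis by (simp only: chain_ideal_def image_insert image_empty \<Psi>_zero)
    qed
    show "chain_ideal (length L) (Suc n) = grade A (Suc n)" for n
    proof
      show "grade A (Suc n) \<subseteq> chain_ideal (length L) (Suc n)"
      proof
        fix a assume "a \<in> grade A (Suc n)"
        then obtain F where F: "F \<in> M (Suc n)" "a = \<Psi> F" by (rule \<Psi>_onto)
        have "F \<in> filt vs (chain Ed vs (length L))" by (rule filt_top[OF card elim F(1)]) simp
        then show "a \<in> chain_ideal (length L) (Suc n)" using F by (auto simp: chain_ideal_def)
      qed
    qed (use \<Psi>_grade in \<open>auto simp: chain_ideal_def\<close>)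
    show "chain_ideal k 0 = {\<zero>\<^bsub>A\<^esub>}" for k
    proof -
      have "M 0 \<inter> filt vs (chain Ed vs k) = {0}" using filt_deg_0[of _ Ed vs] by auto
      then show ?thesis by (simp only: chain_ideal_def image_insert image_empty \<Psi>_zero)
    qed
  next
    fix k n assume k: "k < length L"
    have mult: "\<phi> (letter (L ! k)) \<otimes>\<^bsub>A\<^esub> \<Psi> U = \<Psi> (act Ed vs (L ! k) U)" if "U \<in> M n" for U n
      by (rule \<Psi>_letter[OF LB[OF k] that])
    show "chain_ideal (Suc k) (Suc n) =
        {\<phi> (letter (L ! k)) \<otimes>\<^bsub>A\<^esub> u \<oplus>\<^bsub>A\<^esub> c |u c. u \<in> grade A n \<and> c \<in> chain_ideal k (Suc n)}"
    proof (intro equalityI subsetI)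
      fix a assume "a \<in> chain_ideal (Suc k) (Suc n)"
      then obtain F where F: "F \<in> M (Suc n)" "F \<in> filt vs (chain Ed vs (Suc k))" "a = \<Psi> F"
        by (auto simp: chain_ideal_def)
      have "F \<in> homog Ed vs (int n + 1)" using F(1) by (simp add: add.commute)
      then obtain U where U: "U \<in> M n" "F - act Ed vs (L ! k) U \<in> filt vs (chain Ed vs k)"
        using step[OF k] F(2) by blast
      have d: "F - act Ed vs (L ! k) U \<in> M (Suc n)" by (rule homog_diff[OF F(1) act[OF k U(1)]])
      have "act Ed vs (L ! k) U + (F - act Ed vs (L ! k) U) = F" by (simp only: add_diff_eq add_diff_cancel_left')
      then have "a = \<Psi> (act Ed vs (L ! k) U) \<oplus>\<^bsub>A\<^esub> \<Psi> (F - act Ed vs (L ! k) U)"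
        using \<Psi>_add[OF act[OF k U(1)] d] F(3) by (simp only:)
      then have "a = \<phi> (letter (L ! k)) \<otimes>\<^bsub>A\<^esub> \<Psi> U \<oplus>\<^bsub>A\<^esub> \<Psi> (F - act Ed vs (L ! k) U)"
        by (simp only: mult[OF U(1)])
      moreover have "\<Psi> (F - act Ed vs (L ! k) U) \<in> chain_ideal k (Suc n)" using in_iff[OF d] U(2) by blast
      ultimately show "a \<in> {\<phi> (letter (L ! k)) \<otimes>\<^bsub>A\<^esub> u \<oplus>\<^bsub>A\<^esub> c |u c. u \<in> grade A n \<and> c \<in> chain_ideal k (Suc n)}"
        using \<Psi>_grade[OF U(1)] by blast
    next
      fix a assume "a \<in> {\<phi> (letter (L ! k)) \<otimes>\<^bsub>A\<^esub> u \<oplus>\<^bsub>A\<^esub> c |u c. u \<in> grade A n \<and> c \<in> chain_ideal k (Suc n)}"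
      then obtain u c where uc: "a = \<phi> (letter (L ! k)) \<otimes>\<^bsub>A\<^esub> u \<oplus>\<^bsub>A\<^esub> c" "u \<in> grade A n" "c \<in> chain_ideal k (Suc n)"
        by blast
      obtain U where U: "U \<in> M n" "u = \<Psi> U" using uc(2) by (rule \<Psi>_onto)
      obtain C where C: "C \<in> M (Suc n)" "C \<in> filt vs (chain Ed vs k)" "c = \<Psi> C"
        using uc(3) by (auto simp: chain_ideal_def)
      have "a = \<Psi> (act Ed vs (L ! k) U + C)"
        using \<Psi>_add[OF act[OF k U(1)] C(1)] by (simp only: uc(1) U(2) C(3) mult[OF U(1)])
      moreover have "act Ed vs (L ! k) U + C \<in> M (Suc n)" by (rule homog_add[OF act[OF k U(1)] C(1)])
      moreover have "act Ed vs (L ! k) U + C \<in> filt vs (chain Ed vs (Suc k))"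
        using step[OF k] U(1) C(2) filt_mono[OF chain_mono] by (intro filt_add) blast+
      ultimately show "a \<in> chain_ideal (Suc k) (Suc n)" by (auto simp: chain_ideal_def)
    qed
  next
    fix k assume k: "k < length L"
    obtain q where q: "q \<le> length L" "\<And>n U. U \<in> homog Ed vs n \<Longrightarrow>
        act Ed vs (L ! k) U \<in> filt vs (chain Ed vs k) \<longleftrightarrow> U \<in> filt vs (chain Ed vs q)"
      using step[OF k] by blast
    have "\<phi> (letter (L ! k)) \<otimes>\<^bsub>A\<^esub> u \<in> chain_ideal k (Suc n) \<longleftrightarrow> u \<in> chain_ideal q n" if u: "u \<in> grade A n" for u n
    proof -
      obtain U where U: "U \<in> M n" "u = \<Psi> U" using u by (rule \<Psi>_onto)
      show ?thesis
        unfolding U(2) \<Psi>_letter[OF LB[OF k] U(1)] in_iff[OF act[OF k U(1)]] in_iff[OF U(1)] by (rule q(2)[OF U(1)])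
    qed
    then show "\<exists>q\<le>length L. \<forall>n. \<forall>u\<in>grade A n.
        \<phi> (letter (L ! k)) \<otimes>\<^bsub>A\<^esub> u \<in> chain_ideal k (Suc n) \<longleftrightarrow> u \<in> chain_ideal q n"
      using q(1) by blast
  qed
qed

theorem koszul_A: "koszul A"
  by (rule koszul_chain.koszul[OF koszul_chain_A])

end

theorem theorem3p4p3:
  fixes V :: "'v set" and Ed :: "'v set set" and r :: "'v rel" and E :: "complex set monoid"
    and \<A> :: "'v arrangement"
  assumes "elliptic_curve E"
    and "simple_graph V Ed"
    and "chordal Ed"
    and "perfect_elimination_ordering V Ed r"
    and "\<A> = abelian_arrangement V Ed r E"
  shows "koszul (arrangement_algebra \<A>)"
proof -
  have graph: "finite V" "\<forall>e\<in>Ed. e \<subseteq> V" using assms(2) by (auto simp: simple_graph_def)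
  obtain vs where vs: "set vs = V" "elimination_list Ed vs"
    using perfect_elimination_list[OF graph(1) assms(4) graph(2)] .
  have "graph_algebra V Ed r vs"
    by unfold_locales (use assms(2,4) vs in \<open>simp_all add: perfect_elimination_ordering_def\<close>)
  from graph_algebra.koszul_A[OF this] show ?thesis by (simp add: assms(5))
qed

end
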